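(* Let $V$ be a complete discrete valuation ring of mixed characteristic $p$ with maximal ideal $pV$, with $V/pV$ perfect and $[Q(V):\mathbb Q_p]<\infty$. Let $R=V[[X_1,\dots,X_{n-1}]]$, let $A$ and $B$ be the absolute integral closures of $V$ and $R$ respectively, and let $AR=A\otimes_VR$. Then there exist exact sequences $$0\to H_p^1(B)\to H_p^0(\Omega_{B/V})\to H_p^0(\Omega_{B/A})\to0$$ and $$0\to H_p^1(B)\to H_p^0(\Omega_{B/R})\to H_p^0(\Omega_{B/AR})\to0.$$
   Context: $Q(V)$ is the fraction field of $V$. The absolute integral closure of a domain is its integral closure in an algebraic closure of its fraction field; $A$ is regarded as a subring of $B$. $\Omega$ denotes modules of Kähler differentials (not completed). $H_p^i(-)$ is local cohomology with respect to the ideal $(p)$; thus $H^0_p(M)$ is the $p$-power torsion of $M$ and $H_p^1(B)=B[1/p]/B$. *)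

theory Defs
  imports "HOL-Algebra.Algebra"
begin

section \<open>Complete discrete valuation rings of mixed characteristic\<close>

definition ring_characteristic :: "('a, 'm) ring_scheme \<Rightarrow> nat" where
  "ring_characteristic R =
    (if \<exists>k::nat. 0 < k \<and> [k] \<cdot>\<^bsub>R\<^esub> \<one>\<^bsub>R\<^esub> = \<zero>\<^bsub>R\<^esub>
     then LEAST k::nat. 0 < k \<and> [k] \<cdot>\<^bsub>R\<^esub> \<one>\<^bsub>R\<^esub> = \<zero>\<^bsub>R\<^esub> else 0)"

definition discrete_valuation_ring :: "('a, 'm) ring_scheme \<Rightarrow> bool" where
  "discrete_valuation_ring V \<longleftrightarrow>
    principal_domain V \<and> \<not> field V \<and> (\<exists>!I. maximalideal I V)"

text \<open>
  The map from \<open>R\<close> to the inverse limit of the \<open>R / I^k\<close> is bijective: every compatible system of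
  residue classes, given here by representatives, comes from exactly one element.
\<close>
definition adically_complete :: "('a, 'm) ring_scheme \<Rightarrow> 'a set \<Rightarrow> bool" where
  "adically_complete R I \<longleftrightarrow>
    (\<forall>x. (\<forall>k. x k \<in> carrier R \<and> x (Suc k) \<ominus>\<^bsub>R\<^esub> x k \<in> I [^]\<^bsub>ideals_set R\<^esub> (k::nat)) \<longrightarrow>
      (\<exists>!y. y \<in> carrier R \<and> (\<forall>k. y \<ominus>\<^bsub>R\<^esub> x k \<in> I [^]\<^bsub>ideals_set R\<^esub> k)))"

definition mixed_characteristic :: "('a, 'm) ring_scheme \<Rightarrow> nat \<Rightarrow> bool" where
  "mixed_characteristic V p \<longleftrightarrow> Factorial_Ring.prime p \<and> ring_characteristic V = 0 \<and>
    (\<forall>I. maximalideal I V \<longrightarrow> ring_characteristic (V Quot I) = p)"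

definition perfect_char :: "nat \<Rightarrow> ('a, 'm) ring_scheme \<Rightarrow> bool" where
  "perfect_char p F \<longleftrightarrow> ring_characteristic F = p \<and>
    bij_betw (\<lambda>x. x [^]\<^bsub>F\<^esub> p) (carrier F) (carrier F)"


section \<open>Fraction fields and p-adic numbers\<close>

text \<open>The fraction field of a subring \<open>S\<close> of a field \<open>L\<close>, realized inside \<open>L\<close>.\<close>
definition fractions_in :: "('l, 'm) ring_scheme \<Rightarrow> 'l set \<Rightarrow> 'l set" where
  "fractions_in L S = {x \<otimes>\<^bsub>L\<^esub> inv\<^bsub>L\<^esub> y | x y. x \<in> S \<and> y \<in> S - {\<zero>\<^bsub>L\<^esub>}}"

text \<open>
  The inverse limit of the rings of integers modulo \<open>p^k\<close>, with the residues normalized to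
  \<open>{0..<p^k}\<close>.
\<close>
definition padic_integers :: "nat \<Rightarrow> (nat \<Rightarrow> int) ring" where
  "padic_integers p =
    \<lparr> carrier = {x. \<forall>k. 0 \<le> x k \<and> x k < int p ^ k \<and> x (Suc k) mod int p ^ k = x k},
      monoid.mult = (\<lambda>x y k. x k * y k mod int p ^ k),
      one = (\<lambda>k. 1 mod int p ^ k),
      ring.zero = (\<lambda>k. 0),
      ring.add = (\<lambda>x y k. (x k + y k) mod int p ^ k) \<rparr>"

text \<open>
  The subfield \<open>E\<close> of \<open>L\<close> is a finite extension of the field of \<open>p\<close>-adic numbers, the latter being
  the fraction field of \<open>padic_integers p\<close>, embedded into \<open>E\<close> by \<open>t\<close>.
\<close>
definition finite_over_padics :: "nat \<Rightarrow> ('l, 'm) ring_scheme \<Rightarrow> 'l set \<Rightarrow> bool" where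
  "finite_over_padics p L E \<longleftrightarrow>
    (\<exists>t. t \<in> ring_hom (padic_integers p) L \<and> inj_on t (carrier (padic_integers p)) \<and>
      fractions_in L (t ` carrier (padic_integers p)) \<subseteq> E \<and>
      ring.finite_dimension L (fractions_in L (t ` carrier (padic_integers p))) E)"


section \<open>Power series rings\<close>

text \<open>
  A monomial is a multiset of indices of variables, as in \<^theory>\<open>HOL-Algebra.Indexed_Polynomials\<close>;
  the constants are embedded by \<^const>\<open>ring.indexed_const\<close>.
\<close>
definition power_series_ring :: "('a, 'm) ring_scheme \<Rightarrow> 'i set \<Rightarrow> ('i multiset \<Rightarrow> 'a) ring" where
  "power_series_ring V I =
    \<lparr> carrier = {f. (\<forall>m. f m \<in> carrier V) \<and> (\<forall>m. \<not> set_mset m \<subseteq> I \<longrightarrow> f m = \<zero>\<^bsub>V\<^esub>)},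
      monoid.mult = (\<lambda>f g m. \<Oplus>\<^bsub>V\<^esub>a\<in>{a. a \<subseteq># m}. f a \<otimes>\<^bsub>V\<^esub> g (m - a)),
      one = ring.indexed_const V \<one>\<^bsub>V\<^esub>,
      ring.zero = (\<lambda>m. \<zero>\<^bsub>V\<^esub>),
      ring.add = (\<lambda>f g m. f m \<oplus>\<^bsub>V\<^esub> g m) \<rparr>"


section \<open>Absolute integral closures\<close>

text \<open>The field \<open>L\<close> is, via \<open>i\<close>, an algebraic closure of the fraction field of \<open>D\<close>.\<close>
definition algebraic_closure_of_fractions ::
    "('d, 'm) ring_scheme \<Rightarrow> ('l, 'n) ring_scheme \<Rightarrow> ('d \<Rightarrow> 'l) \<Rightarrow> bool" where
  "algebraic_closure_of_fractions D L i \<longleftrightarrow>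
    i \<in> ring_hom D L \<and> inj_on i (carrier D) \<and>
    algebraic_closure L (fractions_in L (i ` carrier D))"

text \<open>Polynomials are coefficient lists with the leading coefficient first.\<close>
definition integral_closure_in :: "('l, 'm) ring_scheme \<Rightarrow> 'l set \<Rightarrow> 'l set" where
  "integral_closure_in L S =
    {x \<in> carrier L. \<exists>q. polynomial\<^bsub>L\<^esub> S q \<and> q \<noteq> [] \<and> lead_coeff q = \<one>\<^bsub>L\<^esub> \<and>
                        ring.eval L q x = \<zero>\<^bsub>L\<^esub>}"

text \<open>
  This is the absolute integral closure of \<open>D\<close> when
  \<^const>\<open>algebraic_closure_of_fractions\<close> holds for \<open>D\<close>, \<open>L\<close> and \<open>i\<close>.
\<close>
definition absolute_integral_closure ::
    "('d, 'm) ring_scheme \<Rightarrow> ('l, 'n) ring_scheme \<Rightarrow> ('d \<Rightarrow> 'l) \<Rightarrow> ('l, 'n) ring_scheme" where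
  "absolute_integral_closure D L i =
    L\<lparr>carrier := integral_closure_in L (i ` carrier D)\<rparr>"


section \<open>Modules\<close>

text \<open>
  The record type of modules has fields for a multiplication and a unit, which are irrelevant for
  modules and are left unspecified below.
\<close>

definition generated_submodule ::
    "('b, 'm) ring_scheme \<Rightarrow> ('b, 'x, 'n) module_scheme \<Rightarrow> 'x set \<Rightarrow> 'x set" where
  "generated_submodule B M S = \<Inter>{N. submodule N B M \<and> S \<subseteq> N}"

definition quotient_module :: "('b, 'x, 'n) module_scheme \<Rightarrow> 'x set \<Rightarrow> ('b, 'x set) module" where
  "quotient_module M N =
    \<lparr> carrier = a_rcosets\<^bsub>M\<^esub> N,
      monoid.mult = undefined,
      one = undefined,
      ring.zero = N,
      ring.add = set_add M,
      smult = (\<lambda>b Y. \<Union>y\<in>Y. N +>\<^bsub>M\<^esub> (b \<odot>\<^bsub>M\<^esub> y)) \<rparr>"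

definition unit_vector :: "('b, 'm) ring_scheme \<Rightarrow> 's \<Rightarrow> 's \<Rightarrow> 'b" where
  "unit_vector B s = (\<lambda>t. if t = s then \<one>\<^bsub>B\<^esub> else \<zero>\<^bsub>B\<^esub>)"

definition free_module :: "('b, 'm) ring_scheme \<Rightarrow> 's set \<Rightarrow> ('b, 's \<Rightarrow> 'b) module" where
  "free_module B S =
    \<lparr> carrier = {f. (\<forall>s. f s \<in> carrier B) \<and> finite {s. f s \<noteq> \<zero>\<^bsub>B\<^esub>} \<and>
                    (\<forall>s. s \<notin> S \<longrightarrow> f s = \<zero>\<^bsub>B\<^esub>)},
      monoid.mult = undefined,
      one = undefined,
      ring.zero = (\<lambda>s. \<zero>\<^bsub>B\<^esub>),
      ring.add = (\<lambda>f g s. f s \<oplus>\<^bsub>B\<^esub> g s),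
      smult = (\<lambda>b f s. b \<otimes>\<^bsub>B\<^esub> f s) \<rparr>"

definition linear_maps ::
    "('b, 'm) ring_scheme \<Rightarrow> ('b, 'x, 'n) module_scheme \<Rightarrow> ('b, 'y, 'o) module_scheme \<Rightarrow> ('x \<Rightarrow> 'y) set"
  where
  "linear_maps B M N =
    {f \<in> carrier M \<rightarrow> carrier N.
      (\<forall>x\<in>carrier M. \<forall>y\<in>carrier M. f (x \<oplus>\<^bsub>M\<^esub> y) = f x \<oplus>\<^bsub>N\<^esub> f y) \<and>
      (\<forall>b\<in>carrier B. \<forall>x\<in>carrier M. f (b \<odot>\<^bsub>M\<^esub> x) = b \<odot>\<^bsub>N\<^esub> f x)}"

definition short_exact_modules ::
    "('b, 'm) ring_scheme \<Rightarrow> ('b, 'x, 'n) module_scheme \<Rightarrow> ('x \<Rightarrow> 'y) \<Rightarrow>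
     ('b, 'y, 'o) module_scheme \<Rightarrow> ('y \<Rightarrow> 'z) \<Rightarrow> ('b, 'z, 'q) module_scheme \<Rightarrow> bool" where
  "short_exact_modules B M f N g P \<longleftrightarrow>
    module B M \<and> module B N \<and> module B P \<and>
    f \<in> linear_maps B M N \<and> g \<in> linear_maps B N P \<and>
    inj_on f (carrier M) \<and>
    f ` carrier M = {y \<in> carrier N. g y = \<zero>\<^bsub>P\<^esub>} \<and>
    g ` carrier N = carrier P"


section \<open>Local cohomology with respect to \<open>(p)\<close>\<close>

text \<open>The \<open>p\<close>-power torsion of \<open>M\<close>.\<close>
definition H0_p :: "nat \<Rightarrow> ('b, 'x, 'm) module_scheme \<Rightarrow> ('b, 'x, 'm) module_scheme" where
  "H0_p p M = M\<lparr>carrier := {x \<in> carrier M. \<exists>k::nat. [(p ^ k)] \<cdot>\<^bsub>M\<^esub> x = \<zero>\<^bsub>M\<^esub>}\<rparr>"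

text \<open>For a subring \<open>S\<close> of a field \<open>L\<close> of characteristic zero: the \<open>S\<close>-module \<open>S[1/p]\<close>, inside \<open>L\<close>.\<close>
definition invert_p :: "nat \<Rightarrow> ('l, 'm) ring_scheme \<Rightarrow> 'l set \<Rightarrow> ('l, 'l) module" where
  "invert_p p L S =
    \<lparr> carrier = {s \<otimes>\<^bsub>L\<^esub> inv\<^bsub>L\<^esub> ([(p ^ k)] \<cdot>\<^bsub>L\<^esub> \<one>\<^bsub>L\<^esub>) | s (k::nat). s \<in> S},
      monoid.mult = monoid.mult L,
      one = one L,
      ring.zero = ring.zero L,
      ring.add = ring.add L,
      smult = monoid.mult L \<rparr>"

text \<open>\<open>S[1/p]/S\<close>\<close>
definition H1_p :: "nat \<Rightarrow> ('l, 'm) ring_scheme \<Rightarrow> 'l set \<Rightarrow> ('l, 'l set) module" where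
  "H1_p p L S = quotient_module (invert_p p L S) S"


section \<open>Kaehler differentials\<close>

text \<open>
  For a ring homomorphism \<open>u\<close> from \<open>S\<close> to \<open>B\<close>: the free \<open>B\<close>-module on symbols \<open>d b\<close>, \<open>b\<close> in \<open>B\<close>,
  modulo additivity, the Leibniz rule and \<open>d (u s) = 0\<close>.
\<close>

definition kaehler_relations ::
    "('s, 'm) ring_scheme \<Rightarrow> ('s \<Rightarrow> 'b) \<Rightarrow> ('b, 'n) ring_scheme \<Rightarrow> ('b \<Rightarrow> 'b) set" where
  "kaehler_relations S u B =
    (let F = free_module B (carrier B); d = unit_vector B in
      {d (b \<oplus>\<^bsub>B\<^esub> c) \<ominus>\<^bsub>F\<^esub> (d b \<oplus>\<^bsub>F\<^esub> d c) | b c. b \<in> carrier B \<and> c \<in> carrier B} \<union>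
      {d (b \<otimes>\<^bsub>B\<^esub> c) \<ominus>\<^bsub>F\<^esub> (b \<odot>\<^bsub>F\<^esub> d c \<oplus>\<^bsub>F\<^esub> c \<odot>\<^bsub>F\<^esub> d b) | b c. b \<in> carrier B \<and> c \<in> carrier B} \<union>
      {d (u s) | s. s \<in> carrier S})"

definition kaehler_submodule ::
    "('s, 'm) ring_scheme \<Rightarrow> ('s \<Rightarrow> 'b) \<Rightarrow> ('b, 'n) ring_scheme \<Rightarrow> ('b \<Rightarrow> 'b) set" where
  "kaehler_submodule S u B =
    generated_submodule B (free_module B (carrier B)) (kaehler_relations S u B)"

definition kaehler ::
    "('s, 'm) ring_scheme \<Rightarrow> ('s \<Rightarrow> 'b) \<Rightarrow> ('b, 'n) ring_scheme \<Rightarrow> ('b, ('b \<Rightarrow> 'b) set) module" where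
  "kaehler S u B = quotient_module (free_module B (carrier B)) (kaehler_submodule S u B)"

text \<open>
  The canonical map onto the differentials of \<open>B\<close> over \<open>S\<close>, defined on the differentials of \<open>B\<close> over
  any ring whose structure map to \<open>B\<close> factors through \<open>u\<close>; it sends the class of \<open>b d c\<close> to the
  class of \<open>b d c\<close>.
\<close>
definition kaehler_proj ::
    "('s, 'm) ring_scheme \<Rightarrow> ('s \<Rightarrow> 'b) \<Rightarrow> ('b, 'n) ring_scheme \<Rightarrow> ('b \<Rightarrow> 'b) set \<Rightarrow> ('b \<Rightarrow> 'b) set"
  where
  "kaehler_proj S u B Y =
    (\<Union>y\<in>Y. kaehler_submodule S u B +>\<^bsub>free_module B (carrier B)\<^esub> y)"


section \<open>Tensor products of algebras\<close>

definition monoid_algebra ::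
    "('v, 'm) ring_scheme \<Rightarrow> ('g, 'n) monoid_scheme \<Rightarrow> ('g \<Rightarrow> 'v) ring" where
  "monoid_algebra V G =
    \<lparr> carrier = carrier (free_module V (carrier G)),
      monoid.mult = (\<lambda>f g z.
        \<Oplus>\<^bsub>V\<^esub>w\<in>{(x, y). f x \<noteq> \<zero>\<^bsub>V\<^esub> \<and> g y \<noteq> \<zero>\<^bsub>V\<^esub> \<and> x \<otimes>\<^bsub>G\<^esub> y = z}.
          f (fst w) \<otimes>\<^bsub>V\<^esub> g (snd w)),
      one = unit_vector V \<one>\<^bsub>G\<^esub>,
      ring.zero = ring.zero (free_module V (carrier G)),
      ring.add = ring.add (free_module V (carrier G)) \<rparr>"

text \<open>
  The tensor product of the \<open>V\<close>-algebras \<open>A\<close> and \<open>R\<close> with structure maps \<open>i\<close> and \<open>c\<close>: the free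
  \<open>V\<close>-module on the pairs \<open>(a, r)\<close> modulo the bilinear relations. The multiplication is that of the
  monoid algebra of the multiplicative monoid \<open>A \<times> R\<close>. The relations are stable under multiplication
  by pairs, so that the submodule they generate is an ideal.
\<close>

definition tensor_relations ::
    "('v, 'm) ring_scheme \<Rightarrow> ('a, 'n) ring_scheme \<Rightarrow> ('v \<Rightarrow> 'a) \<Rightarrow>
     ('r, 'o) ring_scheme \<Rightarrow> ('v \<Rightarrow> 'r) \<Rightarrow> ('a \<times> 'r \<Rightarrow> 'v) set" where
  "tensor_relations V A i R c =
    (let F = free_module V (carrier A \<times> carrier R); e = unit_vector V in
      {e (a \<oplus>\<^bsub>A\<^esub> a', r) \<ominus>\<^bsub>F\<^esub> (e (a, r) \<oplus>\<^bsub>F\<^esub> e (a', r)) | a a' r.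
        a \<in> carrier A \<and> a' \<in> carrier A \<and> r \<in> carrier R} \<union>
      {e (a, r \<oplus>\<^bsub>R\<^esub> r') \<ominus>\<^bsub>F\<^esub> (e (a, r) \<oplus>\<^bsub>F\<^esub> e (a, r')) | a r r'.
        a \<in> carrier A \<and> r \<in> carrier R \<and> r' \<in> carrier R} \<union>
      {e (i v \<otimes>\<^bsub>A\<^esub> a, r) \<ominus>\<^bsub>F\<^esub> v \<odot>\<^bsub>F\<^esub> e (a, r) | v a r.
        v \<in> carrier V \<and> a \<in> carrier A \<and> r \<in> carrier R} \<union>
      {e (a, c v \<otimes>\<^bsub>R\<^esub> r) \<ominus>\<^bsub>F\<^esub> v \<odot>\<^bsub>F\<^esub> e (a, r) | v a r.
        v \<in> carrier V \<and> a \<in> carrier A \<and> r \<in> carrier R})"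

definition tensor_algebra ::
    "('v, 'm) ring_scheme \<Rightarrow> ('a, 'n) ring_scheme \<Rightarrow> ('v \<Rightarrow> 'a) \<Rightarrow>
     ('r, 'o) ring_scheme \<Rightarrow> ('v \<Rightarrow> 'r) \<Rightarrow> ('a \<times> 'r \<Rightarrow> 'v) set ring" where
  "tensor_algebra V A i R c =
    (let F = monoid_algebra V (A \<times>\<times> R) in F Quot (Idl\<^bsub>F\<^esub> (tensor_relations V A i R c)))"

text \<open>
  The map on the tensor product that sends the class of \<open>(a, r)\<close> to \<open>h a \<otimes> j r\<close>, for algebra
  homomorphisms \<open>h\<close> and \<open>j\<close> to \<open>B\<close>; a scalar \<open>v\<close> acts on \<open>B\<close> through \<open>h (i v)\<close>.
\<close>
definition tensor_lift ::
    "('v, 'm) ring_scheme \<Rightarrow> ('v \<Rightarrow> 'a) \<Rightarrow> ('a \<Rightarrow> 'b) \<Rightarrow> ('r \<Rightarrow> 'b) \<Rightarrow> ('b, 'n) ring_scheme \<Rightarrow>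
     ('a \<times> 'r \<Rightarrow> 'v) set \<Rightarrow> 'b" where
  "tensor_lift V i h j B Y =
    the_elem
      ((\<lambda>f. \<Oplus>\<^bsub>B\<^esub>z\<in>{z. f z \<noteq> \<zero>\<^bsub>V\<^esub>}. h (i (f z)) \<otimes>\<^bsub>B\<^esub> (h (fst z) \<otimes>\<^bsub>B\<^esub> j (snd z))) ` Y)"

end

theory Submission
  imports Defs "HOL.Real" "HOL-Library.Multiset_Order"
begin

text \<open>
  Choose \<open>\<beta> 0 = p\<close> and \<open>\<beta> (k+1) \<in> A\<close> with \<open>\<beta> (k+1)^p + p \<beta> (k+1) = \<beta> k\<close>, and let
  \<open>\<omega> k = (\<Prod>l=1..k. 1 + \<beta> l^(p-1)) d(\<beta> k)\<close>. Then \<open>p \<omega> (k+1) = \<omega> k\<close> and \<open>\<omega> 0 = 0\<close>,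
  so \<open>b / p^k \<mapsto> b \<omega> k\<close> is defined on \<open>B[1/p]/B\<close>. It is injective: if \<open>b \<omega> 1 = 0\<close>, then for every
  real valuation that is nonnegative on \<open>R\<close> localized at \<open>p\<close>, a derivation that does not kill \<open>\<beta> 1\<close>
  (constructed through its graph in the dual numbers) gives \<open>w b \<ge> w p\<close>; hence \<open>b / p\<close> is integral
  over the localization, and then over \<open>R\<close> because \<open>R\<close> is normal and \<open>p\<close> is prime in it. The image is
  the kernel, because \<open>A\<close> is a valuation ring whose finite subextensions have perfect residue field,
  so that their differentials are generated by that of a uniformizer, and the \<open>\<omega> k\<close> exhaust the
  differentials of \<open>A\<close>. All of \<open>B\<close> is divisible by \<open>p\<close>-th roots modulo \<open>p\<close>, which makes the
  torsion \<open>p\<close>-divisible.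
\<close>

text \<open>
  Shorter operators for HOL-Algebra: an explicit structure is a subscript, as in \<open>x **\<^sub>G y\<close>.
\<close>
no_notation map_add (infixl "++" 100)

notation monoid.mult (infixl "**\<index>" 70) and ring.add (infixl "++\<index>" 65)
  and a_minus ("(_ --\<index> _)" [65, 66] 65) and a_inv ("--\<index> _" [81] 80)

abbreviation mult_at ("(_ **\<^sub>_ _)" [70, 1000, 71] 70) where "x **\<^sub>G y \<equiv> x \<otimes>\<^bsub>G\<^esub> y"
abbreviation add_at ("(_ ++\<^sub>_ _)" [65, 1000, 66] 65) where "x ++\<^sub>G y \<equiv> x \<oplus>\<^bsub>G\<^esub> y"
abbreviation minus_at ("(_ --\<^sub>_ _)" [65, 1000, 66] 65) where "x --\<^sub>G y \<equiv> x \<ominus>\<^bsub>G\<^esub> y"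
abbreviation inv_at ("(--\<^sub>_ _)" [1000, 81] 80) where "--\<^sub>G x \<equiv> \<ominus>\<^bsub>G\<^esub> x"
abbreviation smult_at ("(_ \<odot>\<^sub>_ _)" [70, 1000, 71] 70) where "x \<odot>\<^sub>M y \<equiv> x \<odot>\<^bsub>M\<^esub> y"
abbreviation pow_at ("(_ [^]\<^sub>_ _)" [76, 1000, 75] 75) where "x [^]\<^sub>G k \<equiv> x [^]\<^bsub>G\<^esub> k"
abbreviation zero_at ("\<zero>\<^sub>_" [1000] 1000) where "\<zero>\<^sub>G \<equiv> \<zero>\<^bsub>G\<^esub>"
abbreviation one_at ("\<one>\<^sub>_" [1000] 1000) where "\<one>\<^sub>G \<equiv> \<one>\<^bsub>G\<^esub>"
abbreviation iff_ascii (infixr "<->" 25) where "P <-> Q \<equiv> P = (Q::bool)"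

section \<open>Power spans and integrality\<close>

text \<open>The polynomial \<open>T^p + p T\<close> is chosen because its derivative is
  \<open>p (1 + T^(p-1))\<close>: each step of the tower costs exactly one factor \<open>p\<close>,
  and the other factor is collected in \<open>\<omega> k\<close>. The obstacle is injectivity, for
  which a derivation with a genuine denominator at \<open>\<beta> 1\<close> must be produced. The
  localization of \<open>R\<close> at \<open>p\<close> may have an imperfect residue field, and then
  a finite extension need not be generated by a uniformizer. Its fraction field is therefore
  enlarged to a field \<open>F\<close> whose values are still integers but whose residue field is as
  large as possible. Finite extensions of \<open>F\<close> are totally ramified, and a derivation
  extends once a linear equation is solved for the image of a uniformizer. As \<open>F\<close> is
  not complete, expansions in a uniformizer are approximate; this is why derivations take values
  modulo integers and have bounded denominators. A relation between differentials involves finitely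
  many elements of \<open>B\<close>, so one finite extension of \<open>F\<close> suffices. The
  derivation kills all integers of \<open>F\<close>, among them the images of both \<open>V\<close>
  and \<open>R\<close>, so one bound serves both sequences.\<close>

primrec (in ring) pspan :: "'a set => 'a => nat => 'a set" where
 "pspan T z 0 = {\<zero>}"
| "pspan T z (Suc n) = {a ++ c**z[^]n | a c. a : pspan T z n & c : T}"

lemma (in ring) subring_additive_subgroup: "subring S R ==> additive_subgroup S R" by (simp add: additive_subgroup_def subring_def)

context cring
begin

lemma pspan_in_carrier: "T <= carrier R ==> z : carrier R ==> pspan T z n <= carrier R" by (induction n) auto

lemma pspan_mono: "T <= T' ==> pspan T z n <= pspan T' z n"
proof (induction n)
 case (Suc n)
 thus ?case by auto
qed simp

lemma diff_add_cancel: "a : carrier R ==> b : carrier R ==> a ++ (b -- a) = b" by (simp add: a_minus_def a_lcomm[of a b] r_neg)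

context
 fixes T z
 assumes T: "additive_subgroup T R" and z: "z : carrier R"
begin

lemma T_carrier: "c : T ==> c : carrier R" using additive_subgroup.a_subset[OF T] by blast

lemma pspan_closed: "a : pspan T z n ==> a : carrier R" using pspan_in_carrier[OF additive_subgroup.a_subset[OF T] z] by blast

lemma pspan_zero: "\<zero> : pspan T z n"
proof (induction n)
 case (Suc n)
 have "\<zero> = \<zero> ++ \<zero>**z[^]n" using z by simp
 thus ?case using Suc additive_subgroup.zero_closed[OF T] by auto
qed simp

lemma pspan_Suc: "a : pspan T z n ==> a : pspan T z (Suc n)"
proof -
 assume a: "a : pspan T z n"
 have "a = a ++ \<zero>**z[^]n" using z pspan_closed[OF a] by simp
 thus ?thesis using a additive_subgroup.zero_closed[OF T] by auto
qed

lemma pspan_le: "n <= m ==> a : pspan T z n ==> a : pspan T z m" by (induction m rule: dec_induct) (auto dest: pspan_Suc simp del: pspan.simps)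

lemma pspan_add: "a : pspan T z n ==> b : pspan T z n ==> a ++ b : pspan T z n"
proof (induction n arbitrary: a b)
 case (Suc n)
 obtain a' c where a: "a = a' ++ c**z[^]n" "a' : pspan T z n" "c : T" using Suc.prems by auto
 obtain b' d where b: "b = b' ++ d**z[^]n" "b' : pspan T z n" "d : T" using Suc.prems by auto
 have "a ++ b = (a' ++ b') ++ (c ++ d)**z[^]n" using a b z pspan_closed T_carrier by (simp add: a_ac l_distr)
 thus ?case using Suc.IH[OF a(2) b(2)] additive_subgroup.a_closed[OF T a(3) b(3)] by auto
qed simp

lemma pspan_neg: "a : pspan T z n ==> -- a : pspan T z n"
proof (induction n arbitrary: a)
 case (Suc n)
 obtain a' c where a: "a = a' ++ c**z[^]n" "a' : pspan T z n" "c : T" using Suc.prems by auto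
 have "-- a = -- a' ++ (-- c)**z[^]n" using a z pspan_closed T_carrier by (simp add: minus_add l_minus)
 thus ?case using Suc.IH[OF a(2)] additive_subgroup.a_inv_closed[OF T a(3)] by auto
qed simp

lemma pspan_minus: "a : pspan T z n ==> b : pspan T z n ==> a -- b : pspan T z n" by (simp add: a_minus_def pspan_add pspan_neg)

lemma pspan_monom: "c : T ==> i < n ==> c**z[^]i : pspan T z n"
proof -
 assume c: "c : T" and i: "i < n"
 have "c**z[^]i = \<zero> ++ c**z[^]i" using c z T_carrier by simp
 hence "c**z[^]i : pspan T z (Suc i)" using c pspan_zero by auto
 thus ?thesis using i pspan_le[of "Suc i" n] by simp
qed

lemma pspan_shift: "a : pspan T z n ==> z**a : pspan T z (Suc n)"
proof (induction n arbitrary: a)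
 case 0
 thus ?case using z pspan_zero[of "Suc 0"] by simp
next
 case (Suc n)
 obtain a' c where a: "a = a' ++ c**z[^]n" "a' : pspan T z n" "c : T" using Suc.prems by auto
 have "z**a = z**a' ++ c**z[^](Suc n)" using a z pspan_closed T_carrier by (simp add: r_distr m_ac)
 thus ?case using Suc.IH[OF a(2)] a(3) by auto
qed

text \<open>Two coefficient sets are allowed because multiplication can move coefficients into an
  ideal: multiplying by \<open>t\<close> turns a relation over \<open>W\<close> into one with
  coefficients in \<open>t W\<close>.\<close>

lemma pspan_smult:
 assumes "!!c. c : T ==> s**c : T'" and "s : carrier R"
 shows "a : pspan T z n ==> s**a : pspan T' z n"
proof (induction n arbitrary: a)
 case 0
 thus ?case using assms by simp
next
 case (Suc n)
 obtain a' c where a: "a = a' ++ c**z[^]n" "a' : pspan T z n" "c : T" using Suc.prems by auto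
 have "s**a = s**a' ++ (s**c)**z[^]n" using a z assms pspan_closed T_carrier by (simp add: r_distr m_ac)
 thus ?case using Suc.IH[OF a(2)] assms(1)[OF a(3)] by auto
qed

end

lemma pspan_subset:
 assumes E: "additive_subgroup E R" and z: "z : carrier R"
  and m: "!!c i. c : T ==> i < n ==> c**z[^]i : E"
 shows "a : pspan T z n ==> a : E" using m
proof (induction n arbitrary: a)
 case 0
 thus ?case using additive_subgroup.zero_closed[OF E] by simp
next
 case (Suc n)
 obtain a' c where a: "a = a' ++ c**z[^]n" "a' : pspan T z n" "c : T" using Suc.prems by auto
 show ?case unfolding a(1) using additive_subgroup.a_closed[OF E Suc.IH[OF a(2)]] Suc.prems(2) a(3) by simp
qed

text \<open>
  Adjoining to a subring an element that is integral modulo an ideal: \<open>I\<close> absorbs products, and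
  \<open>z [^] e\<close> is a combination of lower powers up to an element of \<open>I\<close>.
\<close>
lemma subring_adjoin:
 assumes S: "subring S R" and I: "additive_subgroup I R" and z: "z : carrier R"
  and SI: "!!s i. s : S ==> i : I ==> s**i : I"
  and zI: "!!i. i : I ==> z**i : I"
  and II: "!!i j. i : I ==> j : I ==> i**j : I"
  and h: "h : pspan S z e" "z[^]e -- h : I" and e: "e >= 1"
 shows "subring {a ++ i | a i. a : pspan S z e & i : I} R" (is "subring ?G R")
proof -
 note Sa = subring_additive_subgroup[OF S]
 have Sc: "S <= carrier R" using subringE(1)[OF S] .
 have Ic: "i : carrier R" if "i : I" for i using additive_subgroup.a_subset[OF I] that by blast
 note pc = pspan_closed[OF Sa z]
 have Gc: "?G <= carrier R" using pc Ic by auto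
 have Gadd: "x ++ y : ?G" if xy: "x : ?G" "y : ?G" for x y
 proof -
  obtain a i where x: "x = a ++ i" "a : pspan S z e" "i : I" using xy(1) by auto
  obtain b j where y: "y = b ++ j" "b : pspan S z e" "j : I" using xy(2) by auto
  have "x ++ y = (a ++ b) ++ (i ++ j)" using x y pc Ic by (simp add: a_ac)
  thus ?thesis using pspan_add[OF Sa z x(2) y(2)] additive_subgroup.a_closed[OF I x(3) y(3)] by blast
 qed
 have Gp: "a : ?G" if "a : pspan S z e" for a
 proof -
  have "a = a ++ \<zero>" using pc[OF that] by simp
  thus ?thesis using that additive_subgroup.zero_closed[OF I] by blast
 qed
 have Gi: "i : ?G" if "i : I" for i
 proof -
  have "i = \<zero> ++ i" using Ic[OF that] by simp
  thus ?thesis using that pspan_zero[OF Sa z] by blast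
 qed
 have Gneg: "-- x : ?G" if xy: "x : ?G" for x
 proof -
  obtain a i where x: "x = a ++ i" "a : pspan S z e" "i : I" using xy(1) by auto
  have "-- x = -- a ++ -- i" using x pc Ic by (simp add: minus_add)
  thus ?thesis using pspan_neg[OF Sa z x(2)] additive_subgroup.a_inv_closed[OF I x(3)] by blast
 qed
 have GS: "s**x : ?G" if s: "s : S" and xx: "x : ?G" for s x
 proof -
  obtain a i where x: "x = a ++ i" "a : pspan S z e" "i : I" using xx by auto
  have "s**x = s**a ++ s**i" using x s pc Ic Sc by (auto simp: r_distr)
  thus ?thesis using pspan_smult[OF Sa z _ _ x(2), of s S] SI[OF s x(3)] s Sc subringE(6)[OF S s] by blast
 qed
 have ze: "s**z[^]e : ?G" if s: "s : S" for s
 proof -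
  have "z[^]e = h ++ (z[^]e -- h)" using z pc[OF h(1)] by (simp add: diff_add_cancel)
  hence "z[^]e : ?G" using h by blast
  thus ?thesis using GS[OF s] by simp
 qed
 \<comment> \<open>Multiplication by \<open>z\<close> raises only the top term to degree
   \<open>e\<close>, and \<open>ze\<close> replaces \<open>z[^]e\<close> by \<open>h\<close> plus an
   element of \<open>I\<close>. This is the only place where the relation for \<open>z[^]e\<close>
   enters.\<close>
 have Gz: "z**x : ?G" if xx: "x : ?G" for x
 proof -
  obtain a i where x: "x = a ++ i" "a : pspan S z e" "i : I" using xx by auto
  have "z**a : pspan S z (Suc e)" using pspan_shift[OF Sa z x(2)] .
  then obtain a' c where a': "z**a = a' ++ c**z[^]e" "a' : pspan S z e" "c : S" by auto
  have "z**x = (a' ++ c**z[^]e) ++ z**i" using x z pc Ic a' by (auto simp: r_distr)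
  thus ?thesis using Gadd[OF Gadd[OF Gp[OF a'(2)] ze[OF a'(3)]] Gi[OF zI[OF x(3)]]] by simp
 qed
 have Gcx: "x : carrier R" if "x : ?G" for x using Gc that by blast
 have Gzk: "z[^]k**x : ?G" if "x : ?G" for x and k :: nat
 proof (induction k)
  case 0
  thus ?case using that Gcx[OF that] by simp
 next
  case (Suc k)
  have "z[^]Suc k**x = z**(z[^]k**x)" using z Gcx[OF that] by (simp add: m_ac)
  thus ?case using Gz[OF Suc] by simp
 qed
 have Iz: "z[^]k**x : I" if "x : I" for x and k :: nat
 proof (induction k)
  case 0
  thus ?case using that Ic by auto
 next
  case (Suc k)
  have "z[^]Suc k**x = z**(z[^]k**x)" using z that Ic by (auto simp: m_ac)
  thus ?case using zI[OF Suc] by simp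
 qed
 have pI: "a**i : I" if "a : pspan S z m" "i : I" for a i m using that(1)
 proof (induction m arbitrary: a)
  case 0
  thus ?case using that Ic additive_subgroup.zero_closed[OF I] by simp
 next
  case (Suc m)
  obtain a' c where a: "a = a' ++ c**z[^]m" "a' : pspan S z m" "c : S" using Suc.prems by auto
  have "a**i = a'**i ++ c**(z[^]m**i)" using a z pc[OF a(2)] that Ic Sc by (auto simp: l_distr m_assoc)
  thus ?case using additive_subgroup.a_closed[OF I Suc.IH[OF a(2)] SI[OF a(3) Iz[OF that(2)]]] by simp
 qed
 have pG: "a**x : ?G" if "a : pspan S z m" "x : ?G" for a x m using that(1)
 proof (induction m arbitrary: a)
  case 0
  have "\<zero> : ?G" using Gi additive_subgroup.zero_closed[OF I] by blast
  thus ?case using Gcx[OF that(2)] 0 by simp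
 next
  case (Suc m)
  obtain a' c where a: "a = a' ++ c**z[^]m" "a' : pspan S z m" "c : S" using Suc.prems by auto
  have "x : carrier R" using that(2) Gc by blast
  hence "a**x = a'**x ++ c**(z[^]m**x)" using a z pc[OF a(2)] that Sc by (auto simp: l_distr m_assoc)
  thus ?case using Gadd[OF Suc.IH[OF a(2)] GS[OF a(3) Gzk[OF that(2)]]] by simp
 qed
 have Gmult: "x**y : ?G" if xy: "x : ?G" "y : ?G" for x y
 proof -
  obtain a i where x: "x = a ++ i" "a : pspan S z e" "i : I" using xy(1) by auto
  obtain b j where y: "y = b ++ j" "b : pspan S z e" "j : I" using xy(2) by auto
  have "x**y = a**y ++ (b**i ++ i**j)" using x y pc[OF x(2)] pc[OF y(2)] Ic[OF x(3)] Ic[OF y(3)] by (simp add: l_distr r_distr m_ac a_ac)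
  moreover have "b**i ++ i**j : I" using additive_subgroup.a_closed[OF I pI[OF y(2) x(3)] II[OF x(3) y(3)]] .
  ultimately show ?thesis using Gadd[OF pG[OF x(2) xy(2)] Gi] by simp
 qed
 have "\<one>**z[^](0::nat) : pspan S z e" using pspan_monom[OF Sa z subringE(3)[OF S], of 0 e] e by simp
 hence "\<one> : ?G" using Gp by simp
 thus ?thesis using subringI[OF Gc] Gneg Gmult Gadd by blast
qed

text \<open>The case of \<open>subring_adjoin\<close> in which the absorbing set consists of
  zero.\<close>

lemma subring_pspan:
 assumes S: "subring S R" and z: "z : carrier R" and h: "z[^]e : pspan S z e" and e: "e >= 1"
 shows "subring (pspan S z e) R"
proof -
 have z0: "additive_subgroup {\<zero>} R" using zeroideal ideal.axioms(1) by blast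
 have "subring {a ++ i | a i. a : pspan S z e & i : {\<zero>}} R" by (rule subring_adjoin[OF S z0 z _ _ _ h _ e])
   (use subringE(1)[OF S] z in \<open>auto simp: a_minus_def r_neg\<close>)
 moreover have "{a ++ i | a i. a : pspan S z e & i : {\<zero>}} = pspan S z e" using pspan_closed[OF subring_additive_subgroup[OF S] z] by force
 ultimately show ?thesis by simp
qed

lemma eval_in_pspan:
 assumes S: "additive_subgroup S R" and z: "z : carrier R"
 shows "set cs <= S ==> eval cs z : pspan S z (length cs)"
proof (induction cs)
 case (Cons c cs)
 have "eval cs z : carrier R" using Cons pspan_closed[OF S z] by auto
 hence "eval (c # cs) z = eval cs z ++ c**z[^](length cs)" using Cons additive_subgroup.a_subset[OF S] z by (auto simp: a_comm)
 thus ?case using Cons by auto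
qed simp

lemma pspan_eval:
 assumes S: "additive_subgroup S R" and z: "z : carrier R"
 shows "a : pspan S z n ==> EX cs. set cs <= S & length cs = n & eval cs z = a"
proof (induction n arbitrary: a)
 case 0
 thus ?case by (intro exI[of _ "[]"]) simp
next
 case (Suc n)
 obtain a' c where a: "a = a' ++ c**z[^]n" "a' : pspan S z n" "c : S" using Suc.prems by auto
 obtain cs where cs: "set cs <= S" "length cs = n" "eval cs z = a'" using Suc.IH[OF a(2)] by blast
 have "eval (c # cs) z = a" using cs a additive_subgroup.a_subset[OF S] z pspan_closed[OF S z a(2)] by (auto simp: a_comm)
 thus ?case using cs a by (intro exI[of _ "c # cs"]) auto
qed

text \<open>Spans of powers avoid a polynomial ring over \<open>S\<close>, so that \<open>S\<close>
  may be any set. The exponent \<open>n = 0\<close> would make one equal to zero and never occurs in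
  a nonzero ring.\<close>

definition integral_over :: "'a set => 'a => bool" where
 "integral_over S x <-> (EX n. x[^]n : pspan S x n)"

lemma integral_over_mono: "integral_over S x ==> S <= T ==> integral_over T x" unfolding integral_over_def using pspan_mono by blast

lemma integral_over_eval:
 assumes S: "additive_subgroup S R" and x: "x : carrier R"
 shows "integral_over S x <-> (EX cs. set cs <= S & eval (\<one> # cs) x = \<zero>)"
proof
 assume "integral_over S x"
 then obtain n where n: "x[^]n : pspan S x n" unfolding integral_over_def by blast
 obtain cs where cs: "set cs <= S" "length cs = n" "eval cs x = -- (x[^]n)" using pspan_eval[OF S x pspan_neg[OF S x n]] by blast
 have "eval (\<one> # cs) x = \<zero>" using cs x by (simp add: r_neg)
 thus "EX cs. set cs <= S & eval (\<one> # cs) x = \<zero>" using cs by blast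
next
 assume "EX cs. set cs <= S & eval (\<one> # cs) x = \<zero>"
 then obtain cs where cs: "set cs <= S" "eval (\<one> # cs) x = \<zero>" by blast
 have e: "eval cs x : pspan S x (length cs)" using eval_in_pspan[OF S x cs(1)] .
 have "x[^]length cs ++ eval cs x = \<zero>" using cs x by simp
 hence "x[^]length cs = -- eval cs x" using x pspan_closed[OF S x e] by (simp add: minus_equality)
 thus "integral_over S x" unfolding integral_over_def using pspan_neg[OF S x e] by metis
qed

end

lemma (in field) integral_closure_in_eq:
 assumes S: "subring S R"
 shows "integral_closure_in R S = {x : carrier R. integral_over S x}"
proof -
 note Sa = subring_additive_subgroup[OF S]
 have "(EX q. polynomial S q & q ~= [] & lead_coeff q = \<one> & eval q x = \<zero>) <->
   (EX cs. set cs <= S & eval (\<one> # cs) x = \<zero>)" (is "?L = ?R") for x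
 proof
  assume ?L
  then obtain q where q: "polynomial S q" "q ~= []" "lead_coeff q = \<one>" "eval q x = \<zero>" by blast
  thus ?R by (cases q) (auto simp: polynomial_def)
 next
  assume ?R
  then obtain cs where "set cs <= S" "eval (\<one> # cs) x = \<zero>" by blast
  thus ?L using subringE(3)[OF S] by (intro exI[of _ "\<one> # cs"]) (auto simp: polynomial_def)
 qed
 thus ?thesis unfolding integral_closure_in_def by (simp only: integral_over_eval[OF Sa] cong: conj_cong)
qed

text \<open>The minimal polynomial \<open>Irr K x\<close> is monic; conversely a monic relation is a
  nonzero polynomial.\<close>

lemma (in field) algebraic_iff_integral:
 assumes K: "subfield K R" and x: "x : carrier R"
 shows "(algebraic over K) x <-> integral_over K x"
proof
 note Ka = subring_additive_subgroup[OF subfieldE(1)[OF K]]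
 assume a: "(algebraic over K) x"
 note I = IrrE[OF K x a]
 obtain cs where cs: "Irr K x = \<one> # cs" using I(3,4) pirreducibleE(1)[OF subfieldE(1)[OF K] I(1,2)] by (cases "Irr K x") auto
 have "polynomial K (Irr K x)" using I(1) univ_poly_carrier by blast
 hence "set cs <= K" using cs by (simp add: polynomial_def)
 thus "integral_over K x" using integral_over_eval[OF Ka x] I(4) I(3) cs by metis
next
 note Ka = subring_additive_subgroup[OF subfieldE(1)[OF K]]
 assume "integral_over K x"
 then obtain cs where cs: "set cs <= K" "eval (\<one> # cs) x = \<zero>" using integral_over_eval[OF Ka x] by blast
 have "\<one> # cs : carrier (K[X])" using cs subringE(3)[OF subfieldE(1)[OF K]] by (auto simp: univ_poly_carrier[symmetric] polynomial_def)
 thus "(algebraic over K) x" using algebraicI[of "\<one> # cs" K x] cs by simp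
qed

section \<open>Valuation rings\<close>

context field
begin

text \<open>Reversal of polynomials, used to turn relations for \<open>inv x\<close> into relations
  for \<open>x\<close>. The span on the left has \<open>n\<close> coefficients, hence degree at most
  \<open>n - 1\<close>, which \<open>x[^]m\<close> has to clear.\<close>

lemma pspan_reverse:
 assumes T: "additive_subgroup T R" and x: "x : carrier R" "x ~= \<zero>"
 shows "a : pspan T (inv x) n ==> n <= Suc m ==> x[^]m**a : pspan T x (Suc m)"
proof (induction n arbitrary: a)
 case 0
 thus ?case using pspan_zero[OF T x(1), of "Suc m"] x(1) by simp
next
 case (Suc n)
 have ix: "inv x : carrier R" using x field_Units by auto
 obtain a' c where a: "a = a' ++ c**inv x[^]n" "a' : pspan T (inv x) n" "c : T" using Suc.prems by auto
 have cc: "c : carrier R" "a' : carrier R" using T_carrier[OF T x(1) a(3)] pspan_closed[OF T ix a(2)] by auto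
 have n: "n <= m" using Suc.prems by simp
 have "x[^]m = x[^](m - n)**x[^]n" using n x by (simp add: nat_pow_mult)
 moreover have "x[^]n**inv x[^]n = \<one>" using x ix field_Units by (simp add: pow_mult_distrib[OF m_comm, symmetric] nat_pow_one)
 ultimately have "x[^]m**(c**inv x[^]n) = c**x[^](m - n)" using x ix cc by (smt (verit) m_assoc m_comm nat_pow_closed r_one m_closed)
 hence "x[^]m**a = x[^]m**a' ++ c**x[^](m - n)" using a(1) cc x ix by (simp add: r_distr)
 moreover have "c**x[^](m - n) : pspan T x (Suc m)" by (rule pspan_monom[OF T x(1) a(3)]) simp
 ultimately show ?case using pspan_add[OF T x(1) Suc.IH[OF a(2)]] n by simp
qed

text \<open>The recursion of \<open>pspan\<close> peels off the top coefficient; a relation can be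
  solved for a power of the inverse only after the constant coefficient has been split off.\<close>

lemma pspan_low:
 assumes T: "additive_subgroup T R" and z: "z : carrier R"
 shows "a : pspan T z (Suc n) ==> EX c a'. c : T & a' : pspan T z n & a = c ++ z**a'"
proof (induction n arbitrary: a)
 case 0
 then obtain c where "c : T" "a = \<zero> ++ c**z[^](0::nat)" by auto
 thus ?case using z T_carrier[OF T z] by (intro exI[of _ c] exI[of _ \<zero>]) auto
next
 case (Suc n)
 obtain a' c where a: "a = a' ++ c**z[^](Suc n)" "a' : pspan T z (Suc n)" "c : T" using Suc.prems pspan.simps(2)[of T z "Suc n"] by auto
 obtain d b where d: "d : T" "b : pspan T z n" "a' = d ++ z**b" using Suc.IH[OF a(2)] by blast
 have cc: "b : carrier R" "c : carrier R" "d : carrier R" using pspan_closed[OF T z d(2)] T_carrier[OF T z] a d by auto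
 have "a = d ++ z**(b ++ c**z[^]n)" using a(1) d(3) z cc by (simp add: r_distr a_assoc m_ac)
 moreover have "b ++ c**z[^]n : pspan T z (Suc n)" using d a by auto
 ultimately show ?case using d(1) by blast
qed

lemma simple_extension_pspan:
 assumes S: "subring S R" and z: "z : carrier R"
 shows "a : simple_extension S z ==> EX n. a : pspan S z n"
proof (induction rule: simple_extension.induct)
 case zero
 thus ?case by (intro exI[of _ 0]) simp
next
 case (lin a c)
 note Sa = subring_additive_subgroup[OF S]
 obtain n where n: "a : pspan S z n" using lin by blast
 have "a**z : pspan S z (Suc n)" using pspan_shift[OF Sa z n] z pspan_closed[OF Sa z n] by (simp add: m_comm)
 moreover have "c**z[^](0::nat) : pspan S z (Suc n)" by (rule pspan_monom[OF Sa z lin(2)]) simp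
 moreover have "c : carrier R" using lin(2) subringE(1)[OF S] by blast
 ultimately have "a**z ++ c : pspan S z (Suc n)" using pspan_add[OF Sa z, of "a**z" "Suc n" c] by (simp del: pspan.simps)
 thus ?case by blast
qed

lemma pspan_in_subring:
 assumes S: "subring S R" and T: "T <= S" and z: "z : S"
 shows "a : pspan T z n ==> a : S"
proof (rule pspan_subset[OF subring_additive_subgroup[OF S]])
 show "z : carrier R" using z subringE(1)[OF S] by blast
 fix c i assume "c : T"
 moreover have "z[^]i : S" for i :: nat by (induction i) (use subringE(3,6)[OF S] z in auto)
 ultimately show "c**z[^]i : S" for i :: nat using subringE(6)[OF S] T by blast
qed

lemma subring_Union_chain:
 assumes "C ~= {}" "subset.chain A C" "!!S. S : A ==> subring S R"
 shows "subring (\<Union>C) R"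
proof -
 have C: "!!S. S : C ==> subring S R" "!!S T. S : C ==> T : C ==> S <= T \<or> T <= S" using assms unfolding subset.chain_def by blast+
 have two: "EX S:C. x : S & y : S" if "x : \<Union>C" "y : \<Union>C" for x y using that C(2) by blast
 show ?thesis
 proof (rule subringI)
  show "\<Union>C <= carrier R" using subringE(1)[OF C(1)] by blast
  show "\<one> : \<Union>C" using assms(1) subringE(3)[OF C(1)] by blast
  show "-- h : \<Union>C" if "h : \<Union>C" for h using that subringE(5)[OF C(1)] by blast
  show "h1**h2 : \<Union>C" "h1 ++ h2 : \<Union>C" if "h1 : \<Union>C" "h2 : \<Union>C" for h1 h2 using two[OF that] subringE(6,7)[OF C(1)] by blast+
 qed
qed

definition valuation_ring :: "'a set => bool" where
 "valuation_ring W <-> subring W R & (ALL z:carrier R. z ~: W --> inv z : W)"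

lemma inv_facts: "x : carrier R ==> x ~= \<zero> ==> inv x : carrier R & inv x ~= \<zero> & x**inv x = \<one> & inv x**x = \<one> & inv (inv x) = x"
 using field_Units Units_inv_Units[of x] by (auto intro: inv_equality)

text \<open>
  Chevalley's extension argument: a maximal subring in which \<open>t = inv x\<close> is not invertible is a
  valuation ring.
\<close>
lemma exists_valuation_ring:
 assumes S: "subring S R" and x: "x : carrier R" and ni: "~ integral_over S x"
 shows "EX W. valuation_ring W & S <= W & x ~: W"
proof -
 note Sa = subring_additive_subgroup[OF S]
 have x0: "x ~= \<zero>"
 proof
  assume "x = \<zero>"
  hence "x[^](1::nat) = \<zero>" by simp
  hence "x[^](1::nat) : pspan S x 1" using pspan_zero[OF Sa x, of 1] by metis
  thus False using ni unfolding integral_over_def by blast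
 qed
 define t where "t = inv x"
 have t: "t : carrier R" "t ~= \<zero>" "t**x = \<one>" "x**t = \<one>" using inv_facts[OF x x0] by (auto simp: t_def)
 define A where "A = {W. subring W R & simple_extension S t <= W & (ALL s:W. t**s ~= \<one>)}"
 have S1: "subring (simple_extension S t) R" using simple_extension_is_subring[OF S t(1)] .
 \<comment> \<open>An inverse of \<open>t\<close> in the ring generated by \<open>t\<close> would be
   \<open>x\<close> itself, written as a polynomial in \<open>inv x\<close>; reversing it makes
   \<open>x\<close> integral.\<close>
 have "t**s ~= \<one>" if s: "s : simple_extension S t" for s
 proof
  assume e: "t**s = \<one>"
  have sc: "s : carrier R" using s subringE(1)[OF S1] by blast
  have "s = x" using e t sc x by (metis inv_char m_comm t_def comm_inv_char inv_facts x0)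
  obtain n where n: "s : pspan S (inv x) n" using simple_extension_pspan[OF S t(1) s] t_def by blast
  have "x[^]n**s : pspan S x (Suc n)" using pspan_reverse[OF Sa x x0 n] by simp
  hence "x[^]Suc n : pspan S x (Suc n)" using `s = x` by simp
  thus False using ni unfolding integral_over_def by blast
 qed
 hence "simple_extension S t : A" using S1 by (simp add: A_def)
 hence Ane: "A ~= {}" by blast
 have "EX M:A. ALL Y:A. M <= Y --> Y = M"
 proof (rule subset_Zorn_nonempty[OF Ane])
  fix C assume C: "C ~= {}" "subset.chain A C"
  have "subring (\<Union>C) R" by (rule subring_Union_chain[OF C]) (simp add: A_def)
  moreover have "C <= A" using C(2) by (simp add: subset.chain_def)
  ultimately show "\<Union>C \<in> A" using C(1) unfolding A_def by blast
 qed
 then obtain W where W: "W : A" and max: "!!Y. Y : A ==> W <= Y ==> Y = W" by blast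
 have Ws: "subring W R" and SW: "simple_extension S t <= W" and tW: "!!s. s : W ==> t**s ~= \<one>" using W by (auto simp: A_def)
 note Wa = subring_additive_subgroup[OF Ws]
 have Wc: "s : carrier R" if "s : W" for s using that subringE(1)[OF Ws] by blast
 have tinW: "t : W" using simple_extension_mem[OF S t(1)] SW by blast
 \<comment> \<open>By maximality of \<open>W\<close>, adjoining any element from outside makes
   \<open>t\<close> invertible.\<close>
 have ext: "EX n s. s : pspan W z n & t**s = \<one>" if z: "z : carrier R" "z ~: W" for z
 proof -
  have "W <= simple_extension W z" using simple_extension_incl[OF subringE(1)[OF Ws] z(1)] .
  moreover have "simple_extension W z ~= W" using simple_extension_mem[OF Ws z(1)] z(2) by blast
  ultimately have "simple_extension W z ~: A" using max by blast
  then obtain s where "s : simple_extension W z" "t**s = \<one>" using simple_extension_is_subring[OF Ws z(1)] `W <= simple_extension W z` SW by (auto simp: A_def)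
  thus ?thesis using simple_extension_pspan[OF Ws z(1)] by blast
 qed
 define T where "T = {t**s | s. s : W}"
 have T: "additive_subgroup T R"
 proof -
  have "ideal (PIdl\<^bsub>R\<lparr>carrier := W\<rparr>\<^esub> t) (R\<lparr>carrier := W\<rparr>)"
   using cring.cgenideal_ideal[OF domain.axioms(1)[OF subring_is_domain[OF Ws]]] tinW by simp
  moreover have "PIdl\<^bsub>R\<lparr>carrier := W\<rparr>\<^esub> t = T" unfolding cgenideal_def T_def using Wc t(1) by (auto, metis m_comm, metis m_comm)
  ultimately have "subgroup T (add_monoid (R\<lparr>carrier := W\<rparr>))" by (simp add: ideal_def additive_subgroup_def)
  hence "subgroup T (add_monoid R)" using group.incl_subgroup[OF add.is_group, of W T] Wa by (simp add: additive_subgroup_def)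
  thus ?thesis by (simp add: additive_subgroup_def)
 qed
 have TW: "T <= W" using tinW subringE(6)[OF Ws] by (auto simp: T_def)
 have WT: "s**c : T" if sc: "s : W" "c : T" for s c
 proof -
  obtain r where r: "c = t**r" "r : W" using sc by (auto simp: T_def)
  have "s**c = t**(s**r)" using r sc Wc t(1) by (simp add: m_lcomm)
  thus ?thesis using r sc subringE(6)[OF Ws] by (auto simp: T_def)
 qed
 have T1: "\<one> ~: T" unfolding T_def using tW by fastforce
 \<comment> \<open>The ideal \<open>t W\<close> lies in the Jacobson radical of \<open>W\<close>: if
   \<open>u = \<one> -- b\<close> were no unit, adjoining \<open>inv u\<close> would make
   \<open>t\<close> invertible. This puts \<open>u[^]n\<close> into \<open>t W\<close>, although it
   is congruent to one.\<close>
 have unit: "EX v:W. v**(\<one> -- b) = \<one>" if b: "b : T" for b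
 proof -
  define u where "u = \<one> -- b"
  have bW: "b : W" and bc: "b : carrier R" using b TW Wc by auto
  have uW: "u : W" using bW subringE(3,5,7)[OF Ws] by (simp add: u_def a_minus_def)
  have uc: "u : carrier R" using uW Wc by simp
  have u0: "u ~= \<zero>" using b T1 bc by (auto simp: u_def)
  have iu: "inv u : carrier R" "inv u**u = \<one>" "u**inv u = \<one>" "inv u ~= \<zero>" using inv_facts[OF uc u0] by auto
  have "inv u : W"
  proof (rule ccontr)
   assume "inv u ~: W"
   then obtain n s where s: "s : pspan W (inv u) n" "t**s = \<one>" using ext[OF iu(1)] by blast
   have sc: "s : carrier R" using pspan_closed[OF Wa iu(1) s(1)] .
   have us: "u[^]n**s : W" using pspan_in_subring[OF Ws order_refl uW pspan_reverse[OF Wa uc u0 s(1), of n]] by simp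
   have "u[^]n = t**(u[^]n**s)" using s(2) uc sc t(1) by (metis m_lcomm nat_pow_closed r_one)
   hence "u[^]n : T" using us by (auto simp: T_def)
   moreover have "\<one> -- u[^]k : T" for k :: nat
   proof (induction k)
   case 0
   thus ?case using additive_subgroup.zero_closed[OF T] by (simp add: a_minus_def r_neg)
   next
   case (Suc k)
   have ukW: "u[^]k : W" using uW subringE(3,6)[OF Ws] by (induction k) auto
   have "\<one> -- u[^]Suc k = (\<one> -- u[^]k) ++ u[^]k**b" using bc uc unfolding u_def by (simp add: a_minus_def r_distr r_minus minus_add a_ac r_neg)
   thus ?case using additive_subgroup.a_closed[OF T Suc WT[OF ukW b]] by simp
   qed
   moreover have "\<one> = (\<one> -- u[^]n) ++ u[^]n" using uc by (simp add: a_minus_def a_assoc l_neg)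
   ultimately show False using T1 additive_subgroup.a_closed[OF T] by metis
  qed
  thus ?thesis using iu u_def by auto
 qed
 \<comment> \<open>The indices \<open>n\<close> and \<open>m\<close> count coefficients. In the
   shorter relation, the one for \<open>inv z\<close>, the factor \<open>\<one> -- b\<close> is a
   unit, so after reversal it expresses \<open>z[^](n - 1)\<close> by lower powers; this removes the
   top term of the longer relation.\<close>
 have step: "\<one> : pspan T z (n - 1)"
  if z: "z : carrier R" "z ~= \<zero>" and n: "\<one> : pspan T z n" and m: "\<one> : pspan T (inv z) m" and mn: "m <= n" for z m n
 proof -
  have zi: "inv z : carrier R" "z**inv z = \<one>" using inv_facts[OF z] by auto
  have k1: "EX M. k = Suc (Suc M)" if y: "\<one> : pspan T y k" "y : carrier R" for y k
  proof -
   have "k ~= 0" using y by (cases k) auto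
   moreover have "k ~= 1"
   proof
   assume "k = 1"
   then obtain c where "c : T" "\<one> = \<zero> ++ c**y[^](0::nat)" using y(1) by auto
   hence "\<one> = c" using y(2) TW Wc by auto
   thus False using T1 `c : T` by simp
   qed
   ultimately show ?thesis by (metis One_nat_def not0_implies_Suc)
  qed
  obtain M where M: "m = Suc (Suc M)" using k1[OF m zi(1)] by blast
  obtain N where N: "n = Suc (Suc N)" using k1[OF n z(1)] by blast
  obtain b a' where b: "b : T" "a' : pspan T (inv z) (Suc M)" "\<one> = b ++ inv z**a'" using pspan_low[OF T zi(1), of \<one> "Suc M"] m M by blast
  have cc: "b : carrier R" "a' : carrier R" using b TW Wc pspan_closed[OF T zi(1) b(2)] by auto
  obtain v where v: "v : W" "v**(\<one> -- b) = \<one>" using unit[OF b(1)] by blast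
  have "\<one> -- b = inv z**a'" using b(3) cc zi by (metis a_minus_def add.inv_solve_right' add.m_comm one_closed m_closed)
  hence "\<one> = inv z**(v**a')" using v(2) Wc[OF v(1)] cc zi by (simp add: m_lcomm)
  hence "z = z**(inv z**(v**a'))" using z by (metis r_one)
  also have "\<dots> = v**a'" using z zi Wc[OF v(1)] cc by (simp add: m_assoc[symmetric])
  finally have zv: "z = v**a'" .
  have va: "v**a' : pspan T (inv z) (Suc M)" by (rule pspan_smult[OF T zi(1) _ _ b(2)]) (use v(1) Wc WT in auto)
  have "z[^]N**(v**a') : pspan T z (Suc N)" using pspan_reverse[OF T z va, of N] mn M N by simp
  hence zN: "z[^]Suc N : pspan T z (Suc N)" using zv by simp
  obtain a c where a: "\<one> = a ++ c**z[^]Suc N" "a : pspan T z (Suc N)" "c : T" using n N pspan.simps(2)[of T z "Suc N"] by blast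
  have "c**z[^]Suc N : pspan T z (Suc N)" by (rule pspan_smult[OF T z(1) _ _ zN]) (use a(3) TW Wc WT in auto)
  thus ?thesis using pspan_add[OF T z(1) a(2)] a(1) N by simp
 qed
 \<comment> \<open>If neither \<open>z\<close> nor \<open>inv z\<close> were in \<open>W\<close>,
   both would satisfy relations with coefficients in \<open>t W\<close>; the longer of two shortest
   ones could still be shortened.\<close>
 have fin: "inv z : W" if z: "z : carrier R" "z ~: W" for z
 proof (rule ccontr)
  assume nW: "inv z ~: W"
  have z0: "z ~= \<zero>" using z(2) subringE(2)[OF Ws] by blast
  have zi: "inv z : carrier R" "inv z ~= \<zero>" "inv (inv z) = z" using inv_facts[OF z(1) z0] by auto
  have ex: "EX n. \<one> : pspan T y n" if y: "y : carrier R" "y ~: W" for y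
  proof -
   obtain n s where s: "s : pspan W y n" "t**s = \<one>" using ext[OF y] by blast
   have "t**s : pspan T y n" by (rule pspan_smult[OF Wa y(1) _ t(1) s(1)]) (auto simp: T_def)
   thus ?thesis using s(2) by auto
  qed
  define n where "n = (LEAST n. \<one> : pspan T z n)"
  define m where "m = (LEAST m. \<one> : pspan T (inv z) m)"
  have n: "\<one> : pspan T z n" unfolding n_def by (rule LeastI_ex[OF ex[OF z]])
  have m: "\<one> : pspan T (inv z) m" unfolding m_def by (rule LeastI_ex[OF ex[OF zi(1) nW]])
  have n0: "n ~= 0" "m ~= 0" using n m by (metis one_not_zero pspan.simps(1) singletonD)+
  show False
  proof (cases "m <= n")
   case True
   thus False using step[OF z(1) z0 n m] n0 not_less_Least[of "n - 1" "%n. \<one> : pspan T z n"] n_def by simp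
  next
   case False
   thus False using step[OF zi(1,2) m, unfolded zi(3), OF n] n0
   not_less_Least[of "m - 1" "%m. \<one> : pspan T (inv z) m"] m_def by simp
  qed
 qed
 have "x ~: W" using tW[of x] t by auto
 moreover have "S <= W" using simple_extension_incl[OF subringE(1)[OF S] t(1)] SW by blast
 ultimately show ?thesis unfolding valuation_ring_def using Ws fin by blast
qed

text \<open>Dividing an integral equation of degree \<open>n\<close> by \<open>x[^](n - 1)\<close>
  presents \<open>x\<close> as a polynomial in \<open>inv x\<close>, which lies in \<open>W\<close>
  whenever \<open>x\<close> does not.\<close>

lemma valuation_ring_integrally_closed:
 assumes W: "valuation_ring W" and x: "x : carrier R" and i: "integral_over W x"
 shows "x : W"
proof (rule ccontr)
 assume nW: "x ~: W"
 have Ws: "subring W R" and ixW: "inv x : W" using W nW x by (auto simp: valuation_ring_def)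
 have x0: "x ~= \<zero>" using nW subringE(2)[OF Ws] by blast
 have xi: "inv x : carrier R" "inv x ~= \<zero>" "inv (inv x) = x" "inv x**x = \<one>" using inv_facts[OF x x0] by auto
 obtain n where n: "x[^]n : pspan W x n" using i unfolding integral_over_def by blast
 have "n ~= 0" using n by (cases n) auto
 then obtain m where m: "n = Suc m" by (cases n) auto
 have "inv x[^]m**x[^]n : pspan W (inv x) (Suc m)" using pspan_reverse[OF subring_additive_subgroup[OF Ws] xi(1,2), of "x[^]n" n m] n xi(3) m by simp
 hence "inv x[^]m**x[^]n : W" using pspan_in_subring[OF Ws order_refl ixW] by blast
 moreover have "inv x[^]m**x[^]n = x"
 proof -
  have "inv x[^]m**x[^]m = \<one>" using x xi by (simp add: pow_mult_distrib[OF m_comm, symmetric] nat_pow_one)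
  thus ?thesis using m x xi by (simp add: m_assoc[symmetric])
 qed
 ultimately show False using nW by simp
qed

lemma integral_over_iff_valuation_rings:
 assumes S: "subring S R" and x: "x : carrier R"
 shows "integral_over S x <-> (ALL W. valuation_ring W --> S <= W --> x : W)"
 using exists_valuation_ring[OF S x] valuation_ring_integrally_closed x integral_over_mono by meson

text \<open>The integral closure is an intersection of valuation rings. This takes the place of the
  determinant argument for sums and products of integral elements.\<close>

lemma subring_integral_closure:
 assumes S: "subring S R"
 shows "subring {x : carrier R. integral_over S x} R"
proof -
 have "{x : carrier R. integral_over S x} = \<Inter>{W. valuation_ring W & S <= W}"
 proof -
  have "valuation_ring (carrier R)" unfolding valuation_ring_def using carrier_is_subring by blast
  hence "\<Inter>{W. valuation_ring W & S <= W} <= carrier R" using subringE(1)[OF S] by blast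
  thus ?thesis using integral_over_iff_valuation_rings[OF S] by blast
 qed
 moreover have "valuation_ring (carrier R)" unfolding valuation_ring_def using carrier_is_subring by blast
 hence "subring (\<Inter>{W. valuation_ring W & S <= W}) R" using subringE(1)[OF S] by (intro subring_Inter) (auto simp: valuation_ring_def)
 ultimately show ?thesis by simp
qed

lemma integral_over_subset:
 assumes "subring S R" "x : S"
 shows "integral_over S x" using integral_over_iff_valuation_rings[OF assms(1)] assms subringE(1)[OF assms(1)] by blast

end

section \<open>Real valuations\<close>

lemma (in cring) pow_prod: "x : carrier R ==> y : carrier R ==> (x**y)[^](n::nat) = x[^]n**y[^]n" by (simp add: nat_pow_distrib)

text \<open>The summands are kept apart so that the values of any two of them can be
  compared.\<close>

primrec (in ring) eval_terms :: "'a list => 'a => 'a list" where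
 "eval_terms [] x = []"
| "eval_terms (c # cs) x = c**x[^]length cs # eval_terms cs x"

context field
begin

lemma eval_terms_sum: "eval cs x = foldr (\<oplus>) (eval_terms cs x) \<zero>" by (induction cs) auto

lemma length_eval_terms [simp]: "length (eval_terms cs x) = length cs" by (induction cs) auto

lemma eval_terms_nth: "i < length cs ==> eval_terms cs x ! i = cs ! i**x[^](length cs - 1 - i)" by (induction cs arbitrary: i) (auto simp: nth_Cons' )

lemma eval_terms_carrier: "set cs <= carrier R ==> x : carrier R ==> set (eval_terms cs x) <= carrier R" by (induction cs) auto

lemma nonzero_mult: "x : carrier R ==> y : carrier R ==> x ~= \<zero> ==> y ~= \<zero> ==> x**y ~= \<zero>" using integral by blast

lemma nonzero_pow: "x : carrier R ==> x ~= \<zero> ==> x[^](n::nat) ~= \<zero>" by (induction n) (auto dest: integral)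

lemma inv_mult: "x : carrier R ==> y : carrier R ==> x ~= \<zero> ==> y ~= \<zero> ==> inv (x**y) = inv x**inv y"
proof -
 assume x: "x : carrier R" "y : carrier R" "x ~= \<zero>" "y ~= \<zero>"
 note ix = inv_facts[OF x(1,3)] and iy = inv_facts[OF x(2,4)]
 have "(x**y)**(inv x**inv y) = (x**inv x)**(y**inv y)" using x ix[THEN conjunct1] iy[THEN conjunct1] by (simp only: m_ac m_closed)
 thus ?thesis using ix iy x by (intro comm_inv_char) auto
qed

text \<open>Equality of values with respect to \<open>W\<close>, expressed by a unit of
  \<open>W\<close> because no value group is available at this stage.\<close>

definition assoc_in :: "'a set => 'a => 'a => bool" where
 "assoc_in W x y <-> (EX u:W. u ~= \<zero> & inv u : W & x = u**y)"

context
 fixes W assumes W: "valuation_ring W"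
begin

lemma vr_subring: "subring W R" using W by (simp add: valuation_ring_def)
lemma vr_c: "u : W ==> u : carrier R" using subringE(1)[OF vr_subring] by blast
lemma vr_pow: "u : W ==> u[^](n::nat) : W" by (induction n) (use subringE(3,6)[OF vr_subring] in auto)

text \<open>If \<open>x\<close> were outside, \<open>inv x\<close> would be in \<open>W\<close>, and
  \<open>x\<close> is \<open>inv x[^](n - 1)\<close> times \<open>x[^]n\<close>.\<close>

lemma vr_pow_iff: "x : carrier R ==> n >= 1 ==> x[^](n::nat) : W ==> x : W"
proof (rule ccontr)
 assume x: "x : carrier R" "n >= 1" "x[^]n : W" "x ~: W"
 have ix: "inv x : W" using W x by (simp add: valuation_ring_def)
 have x0: "x ~= \<zero>" using x subringE(2)[OF vr_subring] by blast
 have "inv x[^](n - 1)**x[^]n : W" using x vr_pow[OF ix] subringE(6)[OF vr_subring] by blast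
 moreover have "x[^]n = x[^](n - 1)**x" using x(2) by (metis Suc_diff_1 Suc_le_eq One_nat_def nat_pow_Suc)
 moreover have "inv x[^](n - 1)**(x[^](n - 1)**x) = x" using x inv_facts[OF x(1) x0] by (simp add: m_assoc[symmetric] pow_prod[symmetric])
 ultimately show False using x by simp
qed

lemma assoc_refl: "x : carrier R ==> assoc_in W x x" unfolding assoc_in_def using subringE(3)[OF vr_subring] by (intro bexI[of _ \<one>]) auto

lemma assoc_sym: "x : carrier R ==> y : carrier R ==> assoc_in W x y ==> assoc_in W y x"
proof -
 assume x: "x : carrier R" and y: "y : carrier R" and a: "assoc_in W x y"
 then obtain u where u: "u : W" "u ~= \<zero>" "inv u : W" "x = u**y" by (auto simp: assoc_in_def)
 note iu = inv_facts[OF vr_c[OF u(1)] u(2)]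
 have "y = inv u**x" using u(4) iu y vr_c[OF u(1)] by (simp add: m_assoc[symmetric])
 thus ?thesis unfolding assoc_in_def using u iu by auto
qed

lemma assoc_trans: "z : carrier R ==> assoc_in W x y ==> assoc_in W y z ==> assoc_in W x z"
proof -
 assume z: "z : carrier R" and a: "assoc_in W x y" "assoc_in W y z"
 obtain u where u: "u : W" "u ~= \<zero>" "inv u : W" "x = u**y" using a by (auto simp: assoc_in_def)
 obtain v where v: "v : W" "v ~= \<zero>" "inv v : W" "y = v**z" using a by (auto simp: assoc_in_def)
 have "x = (u**v)**z" using u v z vr_c by (simp add: m_assoc)
 moreover have "inv (u**v) : W" using inv_mult u v vr_c subringE(6)[OF vr_subring] by simp
 moreover have "u**v : W" "u**v ~= \<zero>" using u v subringE(6)[OF vr_subring] nonzero_mult[OF vr_c vr_c] by auto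
 ultimately show ?thesis unfolding assoc_in_def by blast
qed

lemma assoc_mult:
 assumes "x' : carrier R" "y' : carrier R" and a: "assoc_in W x x'" "assoc_in W y y'"
 shows "assoc_in W (x**y) (x'**y')"
proof -
 obtain u where u: "u : W" "u ~= \<zero>" "inv u : W" "x = u**x'" using a by (auto simp: assoc_in_def)
 obtain v where v: "v : W" "v ~= \<zero>" "inv v : W" "y = v**y'" using a by (auto simp: assoc_in_def)
 have "x**y = (u**v)**(x'**y')" using u v assms vr_c by (simp add: m_ac)
 moreover have "inv (u**v) : W" using inv_mult u v vr_c subringE(6)[OF vr_subring] by simp
 moreover have "u**v : W" "u**v ~= \<zero>" using u v subringE(6)[OF vr_subring] nonzero_mult[OF vr_c vr_c] by auto
 ultimately show ?thesis unfolding assoc_in_def by blast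
qed

lemma assoc_pow: "x' : carrier R ==> assoc_in W x x' ==> assoc_in W (x[^](n::nat)) (x'[^]n)"
proof (induction n)
 case 0
 thus ?case using assoc_refl by simp
next
 case (Suc n)
 thus ?case using assoc_mult by simp
qed

lemma assoc_cancel:
 assumes c: "x : carrier R" "y : carrier R" "z : carrier R" "z ~= \<zero>" and a: "assoc_in W (x**z) (y**z)"
 shows "assoc_in W x y"
proof -
 obtain u where u: "u : W" "u ~= \<zero>" "inv u : W" "x**z = u**(y**z)" using a by (auto simp: assoc_in_def)
 have "x**z = (u**y)**z" using u(4) c vr_c[OF u(1)] by (simp add: m_assoc)
 hence "x = u**y" using m_rcancel[OF c(4,3)] c vr_c[OF u(1)] by blast
 thus ?thesis using u by (auto simp: assoc_in_def)
qed

text \<open>A valuation ring is local: if \<open>inv v\<close> were outside \<open>W\<close>, where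
  \<open>v = \<one> ++ a\<close>, then so would be \<open>a**inv v\<close>. Its inverse
  \<open>inv a ++ \<one>\<close> would then lie in \<open>W\<close>, and \<open>a\<close> would be a
  unit.\<close>

lemma unit_add:
 assumes a: "a : W" and na: "~ (a ~= \<zero> & inv a : W)"
 shows "\<one> ++ a ~= \<zero> & \<one> ++ a : W & inv (\<one> ++ a) : W"
proof -
 have ac: "a : carrier R" using vr_c a .
 define v where "v = \<one> ++ a"
 have v: "v : W" "v : carrier R" using a subringE(3,7)[OF vr_subring] vr_c by (auto simp: v_def)
 have mone: "inv (-- \<one>) = -- \<one>" using comm_inv_char[of "-- \<one>" "-- \<one>"] by (simp add: l_minus)
 have v0: "v ~= \<zero>"
 proof
  assume "v = \<zero>"
  hence "a = -- \<one>" using ac unfolding v_def by (metis a_comm minus_equality minus_minus one_closed)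
  thus False using na mone subringE(3,5)[OF vr_subring] by auto
 qed
 have "inv v : W"
 proof (rule ccontr)
  assume nv: "inv v ~: W"
  show False
  proof (cases "a = \<zero>")
   case True
   thus False using nv subringE(3)[OF vr_subring] by (simp add: v_def)
  next
   case False
   hence "inv a ~: W" using na by simp
   define b where "b = a**inv v"
   note iv = inv_facts[OF v(2) v0] and ia = inv_facts[OF ac False]
   have "inv v = \<one> -- b"
   proof -
   have "\<one> = inv v ++ b" using iv ac unfolding b_def v_def by (metis l_distr l_one m_comm one_closed v_def)
   thus ?thesis using iv ac unfolding b_def by (metis a_minus_def add.inv_solve_right m_closed one_closed)
   qed
   moreover have bc: "b : carrier R" "b ~= \<zero>" using iv ac False by (auto simp: b_def integral_iff)
   ultimately have "b ~: W" using nv subringE(3,5,7)[OF vr_subring] by (auto simp: a_minus_def)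
   hence "inv b : W" using W bc by (simp add: valuation_ring_def)
   moreover have "inv b = inv a**v" using inv_mult[of a "inv v"] ac iv False by (simp add: b_def)
   moreover have "inv a**v = inv a ++ \<one>" using ia ac by (simp add: v_def r_distr)
   ultimately have "(inv a ++ \<one>) -- \<one> : W" using subringE(3,5,7)[OF vr_subring] by (metis a_minus_def)
   moreover have "(inv a ++ \<one>) -- \<one> = inv a" using ia by (simp add: a_minus_def a_assoc r_neg)
   ultimately show False using `inv a ~: W` by simp
  qed
 qed
 thus ?thesis using v v0 by (simp add: v_def)
qed

text \<open>Dividing by the summand of smaller value leaves one plus a non-unit, which is a unit; so
  the sum keeps the value of that summand.\<close>

lemma assoc_add:
 assumes c: "x : carrier R" "y : carrier R" and n: "x ~= \<zero>" "y ~= \<zero>" "~ assoc_in W x y"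
 shows "x ++ y ~= \<zero> & (assoc_in W (x ++ y) x \<or> assoc_in W (x ++ y) y)"
proof -
 have main: "a ++ b ~= \<zero> & assoc_in W (a ++ b) b"
  if ab: "a : carrier R" "b : carrier R" "a ~= \<zero>" "b ~= \<zero>" "~ assoc_in W a b" "a**inv b : W" for a b
 proof -
  note ib = inv_facts[OF ab(2,4)]
  define q where "q = a**inv b"
  have q: "q : carrier R" "q ~= \<zero>" "a = q**b" using ab ib by (auto simp: q_def m_assoc integral_iff)
  have "inv q ~: W" using ab(5,6) q unfolding assoc_in_def q_def by blast
  hence u: "\<one> ++ q ~= \<zero>" "\<one> ++ q : W" "inv (\<one> ++ q) : W" using unit_add[of q] ab(6) q_def by auto
  have "a ++ b = (\<one> ++ q)**b" using q ab by (simp add: l_distr a_comm)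
  thus ?thesis using u ab q nonzero_mult[of "\<one> ++ q" b] unfolding assoc_in_def by auto
 qed
 show ?thesis
 proof (cases "x**inv y : W")
  case True
  thus ?thesis using main[OF c n] by blast
 next
  case False
  note iy = inv_facts[OF c(2) n(2)] and ix = inv_facts[OF c(1) n(1)]
  have "inv (x**inv y) : W" using False W c iy by (simp add: valuation_ring_def)
  moreover have "inv (x**inv y) = y**inv x" using inv_mult[of x "inv y"] c iy ix n by (simp add: m_comm)
  ultimately show ?thesis using main[of y x] c n assoc_sym[OF c(2,1)] a_comm[OF c] by auto
 qed
qed

text \<open>The purpose is that a vanishing sum with a nonzero term has two terms of equal value.
  The induction needs the other outcomes as well: all terms vanish, or the sum has the value of one
  of them.\<close>

lemma sum_zero_assoc:
 assumes "set xs <= carrier R"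
 shows "(EX i j. i < j & j < length xs & xs ! i ~= \<zero> & xs ! j ~= \<zero> & assoc_in W (xs ! i) (xs ! j)) \<or>
  (set xs <= {\<zero>} & foldr (\<oplus>) xs \<zero> = \<zero>) \<or>
  (foldr (\<oplus>) xs \<zero> ~= \<zero> & (EX x:set xs. x ~= \<zero> & assoc_in W (foldr (\<oplus>) xs \<zero>) x))" using assms
proof (induction xs)
 case (Cons x xs)
 let ?s = "foldr (\<oplus>) xs \<zero>"
 have sc: "?s : carrier R" using Cons.prems by (induction xs) auto
 have xc: "x : carrier R" "set xs <= carrier R" using Cons.prems by auto
 from Cons.IH[OF xc(2)] consider
   (1) i j where "i < j" "j < length xs" "xs ! i ~= \<zero>" "xs ! j ~= \<zero>" "assoc_in W (xs ! i) (xs ! j)"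
  | (2) "set xs <= {\<zero>}" "?s = \<zero>"
  | (3) y where "?s ~= \<zero>" "y : set xs" "y ~= \<zero>" "assoc_in W ?s y" by blast
 thus ?case
 proof cases
  case 1
  thus ?thesis by (intro disjI1 exI[of _ "Suc i"] exI[of _ "Suc j"]) auto
 next
  case 2
  thus ?thesis using xc assoc_refl by (cases "x = \<zero>") auto
 next
  case 3
  have yc: "y : carrier R" using 3 xc by auto
  show ?thesis
  proof (cases "x = \<zero>")
   case True
   thus ?thesis using 3 sc by auto
  next
   case False
   show ?thesis
   proof (cases "assoc_in W x ?s")
   case True
   have "assoc_in W x y" using assoc_trans[OF yc True 3(4)] .
   moreover obtain j where "j < length xs" "xs ! j = y" using 3(2) by (auto simp: in_set_conv_nth)
   ultimately show ?thesis using False 3 by (intro disjI1 exI[of _ 0] exI[of _ "Suc j"]) auto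
   next
   case nas: False
   show ?thesis using assoc_add[OF xc(1) sc False 3(1) nas] assoc_trans[OF yc _ 3(4)] False 3(2,3) by auto
   qed
  qed
 qed
qed simp

end

end

text \<open>The number \<open>w \<zero>\<close> is arbitrary, so zero is treated separately
  throughout. The ultrametric inequality is not an axiom: it follows because the elements of
  nonnegative value form a ring.\<close>

locale valued_field = field R for R (structure) +
 fixes w :: "'a => real"
 assumes w_mult: "[|x : carrier R; y : carrier R; x ~= \<zero>; y ~= \<zero>|] ==> w (x**y) = w x + w y"
  and w_ring: "valuation_ring {x : carrier R. x = \<zero> \<or> w x >= 0}"

text \<open>Numerator and denominator are units times powers of \<open>q\<close>. The value of the
  fraction is the difference \<open>b - a\<close>, kept as a pair of naturals to avoid negative
  exponents.\<close>

lemma (in field) fractions_in_nonzero: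
 assumes P: "subring P R" and f: "!!x. x : P ==> x ~= \<zero> ==> EX n::nat. EX u:P. u ~= \<zero> & inv u : P & x = q[^]n**u"
  and q: "q : P" "q ~= \<zero>" and W: "valuation_ring W" "P <= W" and z: "z : fractions_in R P" "z ~= \<zero>"
 shows "EX (a::nat) (b::nat). assoc_in W (z**q[^]a) (q[^]b)"
proof -
 have Pc: "P <= carrier R" using subringE(1)[OF P] .
 obtain x y where xy: "z = x**inv y" "x : P" "y : P" "y ~= \<zero>" using z(1) by (auto simp: fractions_in_def)
 have yc: "y : carrier R" "x : carrier R" using xy Pc by auto
 have "x ~= \<zero>" using xy z(2) inv_facts[OF yc(1) xy(4)] by auto
 then obtain n :: nat and u where u: "u : P" "u ~= \<zero>" "inv u : P" "x = q[^]n**u" using f[OF xy(2)] by blast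
 obtain m :: nat and v where v: "v : P" "v ~= \<zero>" "inv v : P" "y = q[^](m::nat)**v" using f[OF xy(3,4)] by blast
 note iv = inv_facts[of v] and iy = inv_facts[OF yc(1) xy(4)]
 have c: "u : carrier R" "v : carrier R" "q : carrier R" using u v q Pc by auto
 have "q[^]m = y**inv v" using v c iv by (simp add: m_assoc)
 hence "z**q[^]m = x**(inv y**y)**inv v" using xy(1) yc iy[THEN conjunct1] c iv v(2) by (simp add: m_assoc)
 also have "\<dots> = x**inv v" using yc iy by simp
 also have "\<dots> = (u**inv v)**q[^]n" using u(4) c iv v(2) by (simp add: m_ac)
 finally have "z**q[^]m = (u**inv v)**q[^]n" .
 moreover have "assoc_in W ((u**inv v)**q[^]n) (q[^]n)"
 proof -
  have "inv (u**inv v) = inv u**v" using inv_mult[of u "inv v"] c u v iv by simp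
  moreover have "u**inv v ~= \<zero>" using c iv u v by (simp add: integral_iff)
  ultimately show ?thesis unfolding assoc_in_def using u v W(2) subringE(6)[OF P] by (metis subsetD)
 qed
 ultimately have "assoc_in W (z**q[^]m) (q[^]n)" by simp
 thus ?thesis by blast
qed

text \<open>
  \<open>P\<close> is a discrete valuation ring with uniformizer \<open>q\<close>. Over its fraction field every element
  satisfies an algebraic relation, two terms of which must have the same value; this makes the value
  group of any valuation ring over \<open>P\<close> a subgroup of the rationals.
\<close>
lemma (in field) exists_valuation:
 assumes P: "subring P R" and q: "q : P" "q ~= \<zero>"
  and f: "!!x. x : P ==> x ~= \<zero> ==> EX n::nat. EX u:P. u ~= \<zero> & inv u : P & x = q[^]n**u"
  and alg: "!!x. x : carrier R ==> integral_over (fractions_in R P) x"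
  and Q: "subfield (fractions_in R P) R"
  and y: "y : carrier R" "~ integral_over P y"
 shows "EX w. valued_field R w & w q = 1 & (ALL x:P. x ~= \<zero> --> w x >= 0) & y ~= \<zero> & w y < 0"
proof -
 let ?Q = "fractions_in R P"
 obtain W where W: "valuation_ring W" and PW: "P <= W" and yW: "y ~: W" using exists_valuation_ring[OF P y] by blast
 note Ws = vr_subring[OF W] and Wc = vr_c[OF W]
 have qc: "q : carrier R" and qW: "q : W" using q PW Wc by auto
 have Qf: "EX (a::nat) (b::nat). assoc_in W (z**q[^]a) (q[^]b)" if "z : ?Q" "z ~= \<zero>" for z using fractions_in_nonzero[OF P f q W PW that] .
 \<comment> \<open>If \<open>q\<close> were invertible in \<open>W\<close>, the whole fraction field
   would lie in \<open>W\<close>, and with it everything algebraic over that field, in particular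
   \<open>y\<close>.\<close>
 have nu: "inv q ~: W"
 proof
  assume iq: "inv q : W"
  have "?Q <= W"
  proof
   fix z assume z: "z : ?Q"
   show "z : W"
   proof (cases "z = \<zero>")
   case False
   have zc: "z : carrier R" using z subfieldE(3)[OF Q] by blast
   obtain a b :: nat where "assoc_in W (z**q[^]a) (q[^]b)" using Qf[OF z False] by blast
   then obtain u where "u : W" "z**q[^]a = u**q[^]b" by (auto simp: assoc_in_def)
   hence "(z**q[^]a)**inv q[^]a : W" using vr_pow[OF W iq, of a] vr_pow[OF W qW, of b] subringE(6)[OF Ws] by simp
   moreover have "(z**q[^]a)**inv q[^]a = z" using zc qc inv_facts[OF qc q(2)] by (simp add: m_assoc pow_prod[symmetric])
   ultimately show ?thesis by simp
   qed (use subringE(2)[OF Ws] in simp)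
  qed
  hence "y : W" using valuation_ring_integrally_closed[OF W y(1)] integral_over_mono[OF alg[OF y(1)]] by blast
  thus False using yW by simp
 qed
 have qpow: "k = l" if "assoc_in W (q[^]k) (q[^]l)" for k l :: nat
 proof -
  have False if a: "assoc_in W (q[^]k) (q[^]l)" and kl: "k < l" for k l :: nat
  proof -
   obtain u where u: "u : W" "q[^]k = u**q[^]l" using a by (auto simp: assoc_in_def)
   have "l = Suc (l - Suc k) + k" using kl by simp
   hence "q[^]l = q[^](l - Suc k)**q**q[^]k" using qc by (metis nat_pow_Suc nat_pow_mult)
   hence "\<one>**q[^]k = (u**q[^](l - Suc k)**q)**q[^]k" using u(2) qc Wc[OF u(1)] by (simp add: m_assoc)
   hence "\<one> = (u**q[^](l - Suc k))**q" using m_rcancel[of "q[^]k" \<one>] nonzero_pow[OF qc q(2)] qc Wc[OF u(1)] by simp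
   hence "inv q = u**q[^](l - Suc k)" using qc Wc[OF u(1)] by (metis comm_inv_char m_closed m_comm nat_pow_closed)
   thus False using nu u(1) vr_pow[OF W qW] subringE(6)[OF Ws] by simp
  qed
  moreover have "assoc_in W (q[^]l) (q[^]k)" using assoc_sym[OF W _ _ that] qc by simp
  ultimately show ?thesis using that by (meson nat_neq_iff)
 qed
 \<comment> \<open>The value of \<open>x\<close> is the rational \<open>(b - a) / n\<close> for
   which \<open>x[^]n\<close> has the value of \<open>q\<close> to the power \<open>b - a\<close>.
   The exponent \<open>n\<close> is there because values of algebraic elements need not be
   integral.\<close>
 define V where "V x v <-> (EX (n::nat) (a::nat) (b::nat). n >= 1 & assoc_in W (x[^]n**q[^]a) (q[^]b) & v * real n = real b - real a)"
  for x and v :: real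
 have Vex: "EX v. V x v" if x: "x : carrier R" "x ~= \<zero>" for x
 proof -
  note Qa = subring_additive_subgroup[OF subfieldE(1)[OF Q]]
  obtain cs where cs: "set cs <= ?Q" "eval (\<one> # cs) x = \<zero>" using alg[OF x(1)] integral_over_eval[OF Qa x(1)] by blast
  let ?cs = "\<one> # cs"
  have csQ: "set ?cs <= ?Q" using cs subringE(3)[OF subfieldE(1)[OF Q]] by simp
  hence csc: "set ?cs <= carrier R" using subfieldE(3)[OF Q] by blast
  have "\<one>**x[^]length cs : set (eval_terms ?cs x)" by simp
  hence nz: "~ set (eval_terms ?cs x) <= {\<zero>}" using nonzero_pow[OF x] x by (metis l_one nat_pow_closed singletonD subsetD)
  have "foldr (\<oplus>) (eval_terms ?cs x) \<zero> = \<zero>" using cs(2) unfolding eval_terms_sum .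
  \<comment> \<open>The terms of a vanishing sum cannot all have different values. Cancelling
    \<open>x[^]l\<close> from two terms of equal value leaves \<open>c**x[^]k\<close> and
    \<open>d\<close>, so the value of \<open>x\<close> is a \<open>k\<close>-th part of a value on
    the fraction field.\<close>
  then obtain i j where ij: "i < j" "j < length ?cs" "eval_terms ?cs x ! i ~= \<zero>" "eval_terms ?cs x ! j ~= \<zero>"
   "assoc_in W (eval_terms ?cs x ! i) (eval_terms ?cs x ! j)" using sum_zero_assoc[OF W eval_terms_carrier[OF csc x(1)]] nz unfolding length_eval_terms by blast
  define c where "c = ?cs ! i"
  define d where "d = ?cs ! j"
  define k where "k = j - i"
  define l where "l = length ?cs - 1 - j"
  have kl: "length ?cs - 1 - i = k + l" "k >= 1" using ij by (auto simp: k_def l_def)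
  have t: "eval_terms ?cs x ! i = c**x[^](k + l)" "eval_terms ?cs x ! j = d**x[^]l"
   using eval_terms_nth[of i ?cs x] eval_terms_nth[of j ?cs x] ij kl by (auto simp: c_def d_def l_def)
  have cd: "c : ?Q" "d : ?Q" using subsetD[OF csQ nth_mem[of i]] subsetD[OF csQ nth_mem[of j]] ij(1,2) unfolding c_def d_def by linarith+
  have cdc: "c : carrier R" "d : carrier R" using cd subfieldE(3)[OF Q] by auto
  have cd0: "c ~= \<zero>" "d ~= \<zero>" using ij t cdc x by auto
  have "assoc_in W ((c**x[^]k)**x[^]l) (d**x[^]l)" using ij(5) t cdc x by (simp add: m_assoc nat_pow_mult)
  hence a1: "assoc_in W (c**x[^]k) d" using assoc_cancel[OF W _ cdc(2) _ nonzero_pow[OF x]] cdc x by simp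
  obtain a b :: nat where ab: "assoc_in W (c**q[^]a) (q[^]b)" using Qf[OF cd(1) cd0(1)] by blast
  obtain a' b' :: nat where ab': "assoc_in W (d**q[^]a') (q[^]b')" using Qf[OF cd(2) cd0(2)] by blast
  have "assoc_in W ((c**x[^]k)**q[^]a') (q[^]b')" using assoc_trans[OF W _ assoc_mult[OF W _ _ a1 assoc_refl[OF W]] ab'] cdc qc by simp
  hence "assoc_in W (((c**x[^]k)**q[^]a')**q[^]a) (q[^]b'**q[^]a)" using assoc_mult[OF W _ _ _ assoc_refl[OF W]] qc by simp
  moreover have "((c**x[^]k)**q[^]a')**q[^]a = (x[^]k**q[^]a')**(c**q[^]a)" using cdc qc x by (simp add: m_ac)
  moreover have "assoc_in W ((x[^]k**q[^]a')**q[^]b) ((x[^]k**q[^]a')**(c**q[^]a))" using assoc_mult[OF W _ _ assoc_refl[OF W] assoc_sym[OF W _ _ ab]] cdc qc x by simp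
  ultimately have "assoc_in W ((x[^]k**q[^]a')**q[^]b) (q[^]b'**q[^]a)" using assoc_trans[OF W] qc by simp
  hence "assoc_in W (x[^]k**q[^](a' + b)) (q[^](b' + a))" using qc x by (simp add: m_assoc nat_pow_mult)
  hence "V x ((real (b' + a) - real (a' + b)) / real k)" unfolding V_def using kl by (intro exI[of _ k] exI[of _ "a' + b"] exI[of _ "b' + a"]) auto
  thus ?thesis by blast
 qed
 have raise: "assoc_in W (x[^](n * m)**q[^](a * m)) (q[^](b * m))"
  if "assoc_in W (x[^]n**q[^]a) (q[^]b)" "x : carrier R" for x and n a b m :: nat using assoc_pow[OF W _ that(1), of m] that(2) qc by (simp add: pow_prod nat_pow_pow)
 have Vun: "v = v'" if x: "x : carrier R" "x ~= \<zero>" and V: "V x v" "V x v'" for x v v'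
 proof -
  obtain n a b :: nat where 1: "n >= 1" "assoc_in W (x[^]n**q[^]a) (q[^]b)" "v * real n = real b - real a" using V(1) unfolding V_def by blast
  obtain m c d :: nat where 2: "m >= 1" "assoc_in W (x[^]m**q[^]c) (q[^]d)" "v' * real m = real d - real c" using V(2) unfolding V_def by blast
  let ?x = "x[^](n * m)"
  have 3: "assoc_in W (?x**q[^](a * m)) (q[^](b * m))" using raise[OF 1(2) x(1)] .
  have 4: "assoc_in W (?x**q[^](c * n)) (q[^](d * n))" using raise[OF 2(2) x(1), of n] by (simp add: mult.commute)
  have 5: "assoc_in W ((?x**q[^](a * m))**q[^](c * n)) (q[^](b * m)**q[^](c * n))" using assoc_mult[OF W _ _ 3 assoc_refl[OF W]] qc by simp
  have 6: "assoc_in W ((?x**q[^](c * n))**q[^](a * m)) (q[^](d * n)**q[^](a * m))" using assoc_mult[OF W _ _ 4 assoc_refl[OF W]] qc by simp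
  have 7: "(?x**q[^](c * n))**q[^](a * m) = (?x**q[^](a * m))**q[^](c * n)" using qc x by (simp add: m_ac)
  have "assoc_in W (q[^](b * m)**q[^](c * n)) (q[^](d * n)**q[^](a * m))" using assoc_trans[OF W _ assoc_sym[OF W _ _ 5] 6[unfolded 7]] qc x by simp
  hence "b * m + c * n = d * n + a * m" using qpow[of "b * m + c * n" "d * n + a * m"] qc by (simp add: nat_pow_mult)
  hence "real b * m + real c * n = real d * n + real a * m" by (metis of_nat_add of_nat_mult)
  hence "(real b - real a) * m = (real d - real c) * n" by (simp add: algebra_simps)
  hence "v * n * m = v' * m * n" using 1 2 by simp
  thus ?thesis using 1(1) 2(1) by simp
 qed
 define w where "w x = (THE v. V x v)" for x
 have wI: "w x = v" if "V x v" "x : carrier R" "x ~= \<zero>" for x v unfolding w_def using that Vun by blast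
 have wV: "V x (w x)" if "x : carrier R" "x ~= \<zero>" for x using Vex[OF that] wI[OF _ that] by metis
 have wmult: "w (x**y) = w x + w y" if x: "x : carrier R" "y : carrier R" "x ~= \<zero>" "y ~= \<zero>" for x y
 proof (rule wI)
  obtain n a b :: nat where 1: "n >= 1" "assoc_in W (x[^]n**q[^]a) (q[^]b)" "w x * real n = real b - real a" using wV[OF x(1,3)] unfolding V_def by blast
  obtain m c d :: nat where 2: "m >= 1" "assoc_in W (y[^]m**q[^]c) (q[^]d)" "w y * real m = real d - real c" using wV[OF x(2,4)] unfolding V_def by blast
  have 3: "assoc_in W (x[^](n * m)**q[^](a * m)) (q[^](b * m))" using raise[OF 1(2) x(1)] .
  have 4: "assoc_in W (y[^](n * m)**q[^](c * n)) (q[^](d * n))" using raise[OF 2(2) x(2), of n] by (simp add: mult.commute)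
  have "(x[^](n * m)**q[^](a * m))**(y[^](n * m)**q[^](c * n)) =
   (x**y)[^](n * m)**q[^](a * m + c * n)" using x qc by (simp add: pow_prod nat_pow_mult[symmetric] m_ac)
  hence "assoc_in W ((x**y)[^](n * m)**q[^](a * m + c * n)) (q[^](b * m + d * n))" using assoc_mult[OF W _ _ 3 4] qc by (simp add: nat_pow_mult)
  moreover have "(w x + w y) * real (n * m) = real (b * m + d * n) - real (a * m + c * n)"
  proof -
   have "(w x + w y) * real (n * m) = (w x * real n) * m + (w y * real m) * n" by (simp add: algebra_simps)
   also have "\<dots> = (real b - real a) * m + (real d - real c) * n" unfolding 1(3) 2(3) ..
   finally show ?thesis by (simp add: algebra_simps)
  qed
  moreover have "n * m >= 1" using 1(1) 2(1) by (metis One_nat_def Suc_le_eq nat_0_less_mult_iff)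
  ultimately show "V (x**y) (w x + w y)" unfolding V_def by blast
 qed (use x nonzero_mult in auto)
 have w0: "w x >= 0 <-> x : W" if x: "x : carrier R" "x ~= \<zero>" for x
 proof -
  obtain n a b :: nat where 1: "n >= 1" "assoc_in W (x[^]n**q[^]a) (q[^]b)" "w x * real n = real b - real a" using wV[OF x] unfolding V_def by blast
  obtain u where u: "u : W" "u ~= \<zero>" "inv u : W" "x[^]n**q[^]a = u**q[^]b" using 1(2) by (auto simp: assoc_in_def)
  have "w x = (real b - real a) / real n" using 1(1,3) by (simp add: field_simps)
  hence sgn: "w x >= 0 <-> a <= b" using 1(1) by (simp add: zero_le_divide_iff)
  show ?thesis
  proof
   assume "w x >= 0"
   hence ab: "a <= b" using sgn by simp
   hence "q[^]b = q[^](b - a)**q[^]a" using qc by (simp add: nat_pow_mult)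
   hence "x[^]n**q[^]a = (u**q[^](b - a))**q[^]a" using u(4) qc Wc[OF u(1)] by (simp add: m_assoc)
   hence "x[^]n = u**q[^](b - a)" using m_rcancel[of "q[^]a" "x[^]n"] nonzero_pow[OF qc q(2)] qc x Wc[OF u(1)] by simp
   hence "x[^]n : W" using u(1) vr_pow[OF W qW] subringE(6)[OF Ws] by simp
   thus "x : W" using vr_pow_iff[OF W x(1) 1(1)] by blast
  next
   assume xW: "x : W"
   show "w x >= 0"
   proof (rule ccontr)
   assume "~ w x >= 0"
   hence ab: "b < a" using sgn by simp
   hence "a = Suc (a - Suc b) + b" by simp
   hence "q[^]a = q[^](a - Suc b)**q**q[^]b" using qc by (metis nat_pow_Suc nat_pow_mult)
   hence "(x[^]n**q[^](a - Suc b)**q)**q[^]b = u**q[^]b" using u(4) qc x by (simp add: m_assoc)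
   hence e: "x[^]n**q[^](a - Suc b)**q = u" using m_rcancel[of "q[^]b" _ u] nonzero_pow[OF qc q(2)] qc x Wc[OF u(1)] by simp
   have iu: "inv u : carrier R" "inv u**u = \<one>" using inv_facts[OF Wc[OF u(1)] u(2)] by auto
   have "(inv u**(x[^]n**q[^](a - Suc b)))**q = \<one>" using e iu x qc by (simp add: m_assoc)
   hence "inv q = inv u**(x[^]n**q[^](a - Suc b))" using x qc iu by (metis comm_inv_char m_closed m_comm nat_pow_closed)
   thus False using nu u(3) vr_pow[OF W qW] vr_pow[OF W xW] subringE(6)[OF Ws] by simp
   qed
  qed
 qed
 have Weq: "{x : carrier R. x = \<zero> \<or> w x >= 0} = W" using w0 Wc subringE(2)[OF Ws] by auto
 have "valued_field R w" by unfold_locales (use wmult Weq W in auto)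
 moreover have "w q = 1"
 proof (rule wI[OF _ qc q(2)])
  have "assoc_in W (q[^](1::nat)**q[^](0::nat)) (q[^](1::nat))" using assoc_refl[OF W] qc by simp
  thus "V q 1" unfolding V_def by (intro exI[of _ "1::nat"] exI[of _ "0::nat"]) simp
 qed
 moreover have "ALL x:P. x ~= \<zero> --> w x >= 0" using w0 PW Wc by blast
 moreover have "y ~= \<zero>" using yW subringE(2)[OF Ws] by blast
 ultimately show ?thesis using w0[OF y(1)] yW by force
qed

section \<open>Coefficient lists: division by linear factors and splitting over an algebraically
  closed field\<close>

context cring
begin

lemma add_diff_cancel_right: "[|a : carrier R; b : carrier R; c : carrier R|] ==> (a ++ c) -- (b ++ c) = a -- b" by algebra

lemma add_diff_cancel_left: "[|a : carrier R; b : carrier R|] ==> (a ++ b) -- a = b" by algebra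

lemma mult_diff_telescope: "[|a : carrier R; b : carrier R; x : carrier R; r : carrier R|] ==>
  a**x -- b**r = (a -- b)**x ++ b**(x -- r)" by algebra

lemma diff_mult_add: "[|a : carrier R; b : carrier R; c : carrier R; s : carrier R; t : carrier R|] ==>
  (c**a ++ s) -- (c**b ++ t) = c**(a -- b) ++ (s -- t)" by algebra

end

context field
begin

lemma eval_closed: "set cs <= carrier R ==> x : carrier R ==> eval cs x : carrier R" by (induction cs) auto

lemma eval_snoc: "set cs <= carrier R ==> c : carrier R ==> x : carrier R ==> eval (cs @ [c]) x = eval cs x**x ++ c" by (rule eval_append_aux)

lemma eval_in_subring: "subring T R ==> set cs <= T ==> x : T ==> eval cs x : T"
 using eval_in_pspan[OF subring_additive_subgroup] pspan_in_subring[OF _ order_refl] subringE(1) by (meson subsetD)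

text \<open>Horner division by \<open>x -- r\<close> of the polynomial with coefficients
  \<open>cs\<close> followed by a constant. The constant cancels in the difference, which explains
  the factors \<open>x\<close> and \<open>r\<close>. The last clause runs the division backwards to
  recover the coefficients from the quotient and \<open>r\<close>.\<close>

lemma eval_quotient:
 assumes r: "r : carrier R"
 shows "set cs <= carrier R ==> EX ds. set ds <= carrier R & length ds = length cs & (cs ~= [] --> hd ds = hd cs) &
  (ALL x:carrier R. eval cs x**x -- eval cs r**r = (x -- r)**eval ds x) &
  (ALL T. subring T R --> r : T --> set ds <= T --> set cs <= T)"
proof (induction cs rule: rev_induct)
 case Nil
 thus ?case using r by (intro exI[of _ "[]"]) (auto simp: a_minus_def)
next
 case (snoc c cs)
 have cs: "set cs <= carrier R" "c : carrier R" using snoc.prems by auto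
 obtain ds where ds: "set ds <= carrier R" "length ds = length cs" "cs ~= [] --> hd ds = hd cs"
  "!!x. x : carrier R ==> eval cs x**x -- eval cs r**r = (x -- r)**eval ds x"
  "!!T. subring T R ==> r : T ==> set ds <= T ==> set cs <= T" using snoc.IH[OF cs(1)] by blast
 let ?q = "cs @ [c]" and ?v = "eval (cs @ [c]) r"
 have v: "?v : carrier R" using eval_closed[OF snoc.prems r] .
 have "eval ?q x**x -- ?v**r = (x -- r)**eval (ds @ [?v]) x" if x: "x : carrier R" for x
 proof -
  have e: "eval cs x : carrier R" "eval cs r : carrier R" "eval ds x : carrier R" "eval ?q x : carrier R" using eval_closed cs ds(1) x r snoc.prems by auto
  have "eval ?q x -- ?v = (eval cs x**x ++ c) -- (eval cs r**r ++ c)" using eval_snoc cs x r by simp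
  also have "\<dots> = eval cs x**x -- eval cs r**r" using e cs x r by (simp add: add_diff_cancel_right)
  finally have d: "eval ?q x -- ?v = (x -- r)**eval ds x" using ds(4)[OF x] by simp
  have "eval ?q x**x -- ?v**r = (eval ?q x -- ?v)**x ++ ?v**(x -- r)" by (rule mult_diff_telescope[OF e(4) v x r])
  also have "\<dots> = (x -- r)**(eval ds x**x ++ ?v)" unfolding d using e v x r by (simp add: r_distr m_ac)
  also have "\<dots> = (x -- r)**eval (ds @ [?v]) x" using eval_snoc[OF ds(1) v x] by simp
  finally show ?thesis .
 qed
 moreover have "set ?q <= T" if T: "subring T R" "r : T" "set (ds @ [?v]) <= T" for T
 proof -
  have csT: "set cs <= T" using ds(5)[OF T(1,2)] T(3) by simp
  have "eval cs r**r : T" using eval_in_subring[OF T(1) csT T(2)] T(2) subringE(6)[OF T(1)] by blast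
  moreover have "?v = eval cs r**r ++ c" using eval_snoc[OF cs r] .
  hence "c = ?v -- eval cs r**r" using add_diff_cancel_left[of "eval cs r**r" c] cs r eval_closed[OF cs(1) r] by simp
  ultimately have "c : T" using T(1,3) subringE(5,7)[OF T(1)] by (metis a_minus_def list.set_intros(1) set_append subsetD UnI2)
  thus ?thesis using csT by simp
 qed
 moreover have "set (ds @ [?v]) <= carrier R" "length (ds @ [?v]) = length ?q" using ds v by auto
 moreover have "hd (ds @ [?v]) = hd ?q" using ds(2,3) cs r by (cases "cs = []") (auto simp: hd_append)
 ultimately show ?case by blast
qed

definition linprod :: "'a list => 'a => 'a" where
 "linprod rs x = foldr (%r a. (x -- r)**a) rs \<one>"

text \<open>Roots are split off one at a time. The last clause, that the coefficients lie in every
  subring containing the roots, replaces the formulas by elementary symmetric functions.\<close>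

lemma monic_roots:
 assumes ac: "algebraically_closed R"
 shows "set cs <= carrier R ==> EX rs. set rs <= carrier R & (ALL r:set rs. eval (\<one> # cs) r = \<zero>) &
  (ALL x:carrier R. eval (\<one> # cs) x = linprod rs x) &
  (ALL T. subring T R --> set rs <= T --> set cs <= T)"
proof (induction "length cs" arbitrary: cs)
 case 0
 thus ?case by (intro exI[of _ "[]"]) (auto simp: linprod_def)
next
 case (Suc n)
 let ?P = "\<one> # cs"
 have Pc: "?P : carrier (poly_ring R)" using Suc.prems by (auto simp: univ_poly_carrier[symmetric] polynomial_def)
 have "splitted ?P" using algebraically_closed.roots_over_carrier[OF ac Pc] .
 hence "size (roots ?P) = Suc n" using Suc.hyps(2) by (simp add: splitted_def)
 then obtain r where "r :# roots ?P" by (metis multiset_nonemptyE size_empty nat.distinct(1))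
 hence r: "r : carrier R" "eval ?P r = \<zero>" using roots_mem_iff_is_root[OF Pc] by (auto simp: is_root_def)
 define ps where "ps = \<one> # butlast cs"
 define c where "c = last cs"
 have csn: "cs ~= []" using Suc.hyps(2) by auto
 have P: "?P = ps @ [c]" using csn by (simp add: ps_def c_def)
 have ps: "set ps <= carrier R" "c : carrier R" using Suc.prems csn in_set_butlastD[of _ cs] by (auto simp: ps_def c_def)
 have psn: "ps ~= []" "hd ps = \<one>" "length ps = Suc n" using Suc.hyps(2) by (auto simp: ps_def)
 obtain ds where ds: "set ds <= carrier R" "length ds = length ps" "ps ~= [] --> hd ds = hd ps"
  "ALL x:carrier R. eval ps x**x -- eval ps r**r = (x -- r)**eval ds x"
  "ALL T. subring T R --> r : T --> set ds <= T --> set ps <= T" using eval_quotient[OF r(1) ps(1)] by (elim exE conjE)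
 obtain es where es: "ds = \<one> # es" "n = length es" using ds(2,3) psn by (cases ds) auto
 have esc: "set es <= carrier R" using ds(1) es by simp
 obtain rs where rs: "set rs <= carrier R" "ALL r:set rs. eval (\<one> # es) r = \<zero>"
  "ALL x:carrier R. eval (\<one> # es) x = linprod rs x"
  "ALL T. subring T R --> set rs <= T --> set es <= T" using Suc.hyps(1)[OF es(2) esc] by (elim exE conjE)
 have ev: "eval ?P x = (x -- r)**eval (\<one> # es) x" if x: "x : carrier R" for x
 proof -
  have e: "eval ps x : carrier R" "eval ps r : carrier R" using eval_closed ps x r by auto
  have "eval ?P x = eval ?P x -- eval ?P r" using r(2) eval_closed[of ?P x] Suc.prems x by (simp add: a_minus_def)
  also have "\<dots> = eval ps x**x -- eval ps r**r" unfolding P eval_snoc[OF ps x] eval_snoc[OF ps r(1)] using e ps x r by (simp add: add_diff_cancel_right)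
  finally show ?thesis using bspec[OF ds(4) x] es by simp
 qed
 have "set cs <= T" if T: "subring T R" "set (r # rs) <= T" for T
 proof -
  have "set es <= T" using rs(4) T by simp
  hence psT: "set ps <= T" using ds(5) T es subringE(3)[OF T(1)] by simp
  have "eval ps r**r : T" using eval_in_subring[OF T(1) psT] T(2) subringE(6)[OF T(1)] by auto
  moreover have "eval ps r**r ++ c = \<zero>" using r(2) eval_snoc[OF ps r(1)] P by simp
  hence "c = -- (eval ps r**r)" using ps r eval_closed[OF ps(1) r(1)] by (metis m_closed minus_equality a_comm minus_minus)
  ultimately have "c : T" using subringE(5)[OF T(1)] by simp
  hence "set ?P <= T" unfolding P using psT by simp
  thus ?thesis by simp
 qed
 moreover have "set (r # rs) <= carrier R" using rs(1) r by simp
 moreover have "eval ?P z = \<zero>" if z: "z : set (r # rs)" for z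
 proof (cases "z = r")
  case True
  thus ?thesis using r by simp
 next
  case False
  hence "z : set rs" "z : carrier R" using z rs(1) by auto
  thus ?thesis using ev[of z] rs(2) r(1) minus_closed[of z r] by (simp del: eval.simps)
 qed
 moreover have "eval ?P x = linprod (r # rs) x" if x: "x : carrier R" for x using ev[OF x] rs(3) x by (simp add: linprod_def del: eval.simps)
 ultimately show ?case by blast
qed

text \<open>More powers of \<open>y\<close> than the dimension are linearly dependent. The explicit
  length bounds the exponents that occur when two terms of the relation are compared.\<close>

lemma dimension_eval:
 assumes K: "subfield K R" and d: "dimension D K E" and y: "!!i. y[^](i::nat) : E" "y : carrier R"
 shows "EX cs. set cs <= K & length cs = Suc D & ~ set cs <= {\<zero>} & eval cs y = \<zero>"
proof -
 let ?U = "exp_base y (Suc D)"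
 have "~ independent K ?U" using independent_length_le_dimension[OF K d, of ?U] y by (auto simp: exp_base_def)
 then obtain Ks where Ks: "length Ks = length ?U" "combine Ks ?U = \<zero>" "set Ks <= K" "set Ks ~= {\<zero>}"
  using dependent_imp_non_trivial_combine[OF K] exp_base_closed[OF y(2)] by metis
 have l: "length Ks = Suc D" using Ks(1) by (simp add: exp_base_def)
 have "eval Ks y = \<zero>" using combine_eq_eval[of Ks y] Ks(2) l by simp
 moreover have "~ set Ks <= {\<zero>}" using Ks(4) l by (cases Ks) auto
 ultimately show ?thesis using Ks(3) l by blast
qed

end

section \<open>Balls, residues and normalized polynomials in a valued field\<close>

context valued_field
begin

definition vge :: "real => 'a set" where "vge r = {x : carrier R. x = \<zero> \<or> w x >= r}"
definition vgt :: "real => 'a set" where "vgt r = {x : carrier R. x = \<zero> \<or> w x > r}"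

lemma vge0_ring: "valuation_ring (vge 0)" using w_ring by (simp add: vge_def)
lemmas vge0_subring = vr_subring[OF vge0_ring]

lemma vge_carrier: "x : vge r ==> x : carrier R" by (simp add: vge_def)
lemma vgt_carrier: "x : vgt r ==> x : carrier R" by (simp add: vgt_def)
lemma vge_zero [simp]: "\<zero> : vge r" by (simp add: vge_def)
lemma vgt_zero [simp]: "\<zero> : vgt r" by (simp add: vgt_def)
lemma vge_mono: "x : vge r ==> s <= r ==> x : vge s" by (auto simp: vge_def)
lemma vgt_vge: "x : vgt r ==> x : vge r" by (auto simp: vge_def vgt_def)
lemma vge_vgt: "x : vge r ==> s < r ==> x : vgt s" by (auto simp: vge_def vgt_def)

lemma w_one [simp]: "w \<one> = 0" using w_mult[of \<one> \<one>] by simp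

lemma w_inv: "x : carrier R ==> x ~= \<zero> ==> w (inv x) = - w x" using w_mult[of x "inv x"] inv_facts[of x] by simp

lemma w_pow: "x : carrier R ==> x ~= \<zero> ==> w (x[^](n::nat)) = n * w x" by (induction n) (simp_all add: w_mult nonzero_pow algebra_simps)

lemma w_neg: "x : carrier R ==> x ~= \<zero> ==> w (-- x) = w x"
proof -
 assume x: "x : carrier R" "x ~= \<zero>"
 have "-- \<one> ~= \<zero>" by (simp add: add.inv_eq_1_iff)
 moreover have "(-- \<one>)**(-- \<one>) = \<one>" by (simp add: l_minus)
 ultimately have "w (-- \<one>) = 0" using w_mult[of "-- \<one>" "-- \<one>"] by simp
 moreover have "-- x = (-- \<one>)**x" using x by (simp add: l_minus)
 ultimately show ?thesis using w_mult[of "-- \<one>" x] x `-- \<one> ~= \<zero>` by simp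
qed

lemma vge_mult: "x : vge r ==> y : vge s ==> x**y : vge (r + s)" by (cases "x = \<zero> \<or> y = \<zero>") (auto simp: vge_def w_mult)

lemma vgt_mult: "x : vge r ==> y : vgt s ==> x**y : vgt (r + s)" by (cases "x = \<zero> \<or> y = \<zero>") (auto simp: vge_def vgt_def w_mult)

lemma vge0_mult: "x : vge 0 ==> y : vge r ==> x**y : vge r" using vge_mult[of x 0 y r] by simp

lemma vge_neg: "x : vge r ==> -- x : vge r" by (cases "x = \<zero>") (auto simp: vge_def w_neg)

lemma vge_add_le:
 assumes x: "x : carrier R" "x ~= \<zero>" and y: "y : vge (w x)" shows "x ++ y : vge (w x)"
proof -
 have yc: "y : carrier R" using y vge_carrier by blast
 note ix = inv_facts[OF x]
 have "inv x : vge (- w x)" using ix w_inv[OF x] by (simp add: vge_def)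
 hence "inv x**y : vge 0" using vge_mult[OF _ y] by fastforce
 hence 1: "\<one> ++ inv x**y : vge 0" using subringE(3,7)[OF vge0_subring] by simp
 have "x ++ y = (\<one> ++ inv x**y)**x" using ix x yc by (simp add: l_distr m_comm[of "inv x**y" x] m_assoc[symmetric])
 thus ?thesis using vge_mult[OF 1, of x "w x"] x by (simp add: vge_def)
qed

lemma vge_add: "x : vge r ==> y : vge r ==> x ++ y : vge r"
proof -
 assume xy: "x : vge r" "y : vge r"
 show ?thesis
 proof (cases "x = \<zero> \<or> y = \<zero>")
  case True
  thus ?thesis using xy vge_carrier by auto
 next
  case False
  have c: "x : carrier R" "y : carrier R" "w x >= r" "w y >= r" using xy False by (auto simp: vge_def)
  show ?thesis
  proof (cases "w x <= w y")
   case True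
   thus ?thesis using vge_add_le[of x y] vge_mono c False by (simp add: vge_def)
  next
   case F: False
   thus ?thesis using vge_add_le[of y x] vge_mono c False by (simp add: vge_def a_comm)
  qed
 qed
qed

lemma vgt_eq: "x : vgt r <-> (EX s>r. x : vge s)"
proof
 assume "x : vgt r"
 thus "EX s>r. x : vge s" by (cases "x = \<zero>") (auto simp: vgt_def vge_def intro: exI[of _ "r + 1"])
qed (auto intro: vge_vgt)

lemma vgt_add: "x : vgt r ==> y : vgt r ==> x ++ y : vgt r"
proof -
 assume "x : vgt r" "y : vgt r"
 then obtain s t where "s > r" "t > r" "x : vge s" "y : vge t" unfolding vgt_eq by blast
 thus ?thesis unfolding vgt_eq using vge_add[of x "min s t" y] vge_mono by (intro exI[of _ "min s t"]) auto
qed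

lemma vgt_neg: "x : vgt r ==> -- x : vgt r" unfolding vgt_eq using vge_neg by blast

lemma vge_additive_subgroup: "additive_subgroup (vge r) R" unfolding additive_subgroup_def
proof (rule add.subgroupI)
 show "vge r ~= {}" using vge_zero by blast
qed (use vge_carrier vge_neg vge_add in \<open>auto simp: a_inv_def[symmetric]\<close>)

lemma vge_minus: "x : vge r ==> y : vge r ==> x -- y : vge r" by (simp add: a_minus_def vge_add vge_neg)

lemma vgt_minus: "x : vgt r ==> y : vgt r ==> x -- y : vgt r" by (simp add: a_minus_def vgt_add vgt_neg)

lemma w_add_less:
 assumes x: "x : carrier R" "x ~= \<zero>" and y: "y : vgt (w x)"
 shows "x ++ y ~= \<zero>" "w (x ++ y) = w x"
proof -
 have yc: "y : carrier R" using y vgt_carrier by blast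
 have e: "(x ++ y) -- y = x" using x yc by (simp add: a_minus_def a_assoc r_neg)
 have n: "x ~: vgt (w x)" using x by (simp add: vgt_def)
 have "x ++ y ~: vgt (w x)" using vgt_minus[OF _ y, of "x ++ y"] e n by auto
 moreover have "x ++ y : vge (w x)" using vge_add[OF _ vgt_vge[OF y], of x] x by (simp add: vge_def)
 ultimately show "x ++ y ~= \<zero>" "w (x ++ y) = w x" using x yc by (auto simp: vge_def vgt_def)
qed

lemma vge0_pow: "x : vge 0 ==> x[^](n::nat) : vge 0" by (rule vr_pow[OF vge0_ring])

lemma assoc_w: "x : carrier R ==> y : carrier R ==> y ~= \<zero> ==> assoc_in (vge 0) x y ==> w x = w y"
proof -
 assume c: "x : carrier R" "y : carrier R" "y ~= \<zero>" "assoc_in (vge 0) x y"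
 then obtain u where u: "u : vge 0" "u ~= \<zero>" "inv u : vge 0" "x = u**y" by (auto simp: assoc_in_def)
 have uc: "u : carrier R" using u vge_carrier by blast
 have "inv u ~= \<zero>" using inv_facts[OF uc u(2)] by blast
 hence "w u = 0" using u w_inv[OF uc u(2)] by (simp add: vge_def)
 thus ?thesis using u c uc w_mult by simp
qed

text \<open>Newton polygon argument: two terms of the relation have equal value, and
  \<open>n\<close> is the difference of their exponents. The bound on \<open>n\<close> later gives a
  common denominator for all values.\<close>

lemma eval_equal_values:
 assumes cs: "set cs <= carrier R" "~ set cs <= {\<zero>}" and y: "y : carrier R" "y ~= \<zero>" and e: "eval cs y = \<zero>"
 shows "EX c:set cs. EX d:set cs. EX n::nat. c ~= \<zero> & d ~= \<zero> & 1 <= n & n < length cs & n * w y = w c - w d"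
proof -
 let ?t = "eval_terms cs y"
 have tn: "?t ! i = cs ! i**y[^](length cs - 1 - i)" if "i < length cs" for i using eval_terms_nth[OF that] .
 obtain k where k: "k < length cs" "cs ! k ~= \<zero>" using cs(2) by (metis in_set_conv_nth singletonI subsetI)
 have csn: "cs ! i : carrier R" if "i < length cs" for i using cs(1) that by auto
 have "?t ! k ~= \<zero>" using tn[OF k(1)] nonzero_mult[OF csn[OF k(1)] _ k(2) nonzero_pow[OF y]] y by simp
 moreover have "?t ! k : set ?t" using nth_mem[of k ?t] k(1) by simp
 ultimately have "~ set ?t <= {\<zero>}" by blast
 then obtain i j where ij: "i < j" "j < length cs" "?t ! i ~= \<zero>" "?t ! j ~= \<zero>" "assoc_in (vge 0) (?t ! i) (?t ! j)"
  using sum_zero_assoc[OF vge0_ring eval_terms_carrier[OF cs(1) y(1)]] e[unfolded eval_terms_sum] unfolding length_eval_terms by blast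
 have il: "i < length cs" using ij by simp
 have c0: "cs ! i ~= \<zero>" "cs ! j ~= \<zero>" using ij(3,4) tn[OF il] tn[OF ij(2)] y by auto
 note ci = csn[OF il] and cj = csn[OF ij(2)]
 have "w (?t ! i) = w (?t ! j)" using assoc_w[OF _ _ ij(4,5)] tn il ij(2) ci cj y by simp
 hence "w (cs ! i) + (length cs - 1 - i) * w y = w (cs ! j) + (length cs - 1 - j) * w y"
  using tn[OF il] tn[OF ij(2)] w_mult[OF ci _ c0(1) nonzero_pow[OF y]] w_mult[OF cj _ c0(2) nonzero_pow[OF y]] w_pow[OF y] y by simp
 moreover have "real (length cs - 1 - i) = real (length cs - 1 - j) + real (j - i)" using ij by simp
 ultimately have "real (j - i) * w y = w (cs ! j) - w (cs ! i)" by (simp add: distrib_right)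
 thus ?thesis using c0 ij il by (intro bexI[of _ "cs ! j"] bexI[of _ "cs ! i"] exI[of _ "j - i"]) auto
qed

lemma list_min_value:
 "~ set cs <= {\<zero>} ==> EX c:set cs. c ~= \<zero> & (ALL d:set cs. d = \<zero> \<or> w d >= w c)"
proof (induction cs)
 case (Cons c cs)
 show ?case
 proof (cases "set cs <= {\<zero>}")
  case True
  thus ?thesis using Cons.prems by auto
 next
  case False
  then obtain d where d: "d : set cs" "d ~= \<zero>" "ALL b:set cs. b = \<zero> \<or> w b >= w d" using Cons.IH by blast
  show ?thesis
  proof (cases "c = \<zero> \<or> w d <= w c")
   case True
   thus ?thesis using d by auto
  next
   case False
   thus ?thesis using d by (intro bexI[of _ c]) force+
  qed
 qed
qed simp

lemma eval_scale: "set cs <= carrier R ==> x : carrier R ==> c : carrier R ==> eval (map (%d. d**c) cs) x = eval cs x**c"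
proof (induction cs)
 case (Cons d cs)
 thus ?case using eval_closed[of cs x] by (simp add: l_distr r_distr m_ac)
qed simp

text \<open>Division by a coefficient of least value: afterwards the polynomial is integral and does
  not vanish modulo the maximal ideal.\<close>

lemma normalize_list:
 assumes F: "subfield F R" and cs: "set cs <= F" "~ set cs <= {\<zero>}"
 shows "EX c:set cs. c ~= \<zero> & set (map (%d. d**inv c) cs) <= F \<inter> vge 0 & \<one> : set (map (%d. d**inv c) cs)"
proof -
 obtain c where c: "c : set cs" "c ~= \<zero>" "!!d. d : set cs ==> d = \<zero> \<or> w d >= w c" using list_min_value[OF cs(2)] by blast
 have Fc: "d : carrier R" if "d : F" for d using subfieldE(3)[OF F] that by blast
 have cc: "c : carrier R" "c : F" using c cs(1) Fc by auto
 note ic = inv_facts[OF cc(1) c(2)]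
 have icF: "inv c : F" using subfield_m_inv(1)[OF F] cc c by blast
 have "d**inv c : F \<inter> vge 0" if d: "d : set cs" for d
 proof (cases "d = \<zero>")
  case True
  thus ?thesis using ic subringE(2)[OF subfieldE(1)[OF F]] by simp
 next
  case False
  have dF: "d : F" "d : carrier R" using d cs(1) Fc by auto
  have "w (d**inv c) = w d - w c" using w_mult[of d "inv c"] dF ic False w_inv[OF cc(1) c(2)] by simp
  thus ?thesis using c(3)[OF d] False dF ic icF subringE(6)[OF subfieldE(1)[OF F]] by (simp add: vge_def)
 qed
 moreover have "\<one> = c**inv c" using ic by simp
 ultimately show ?thesis using c by (intro bexI[of _ c]) auto
qed

text \<open>Passage to the residue field: leading coefficients of positive value drop out and the
  first one of value zero is inverted. Hence the degree \<open>e\<close> can be smaller than that of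
  the given polynomial.\<close>

lemma eval_residue_monic:
 assumes F: "subfield F R" and x: "x : vge 0"
 shows "set cs <= F \<inter> vge 0 ==> EX c:set cs. c ~= \<zero> & w c = 0 ==> eval cs x : vgt 0 ==>
  EX e<length cs. EX a:pspan (F \<inter> vge 0) x e. x[^]e -- a : vgt 0"
proof (induction cs)
 case (Cons c cs)
 let ?O = "F \<inter> vge 0"
 have O: "subring ?O R" using subring_inter[OF subfieldE(1)[OF F] vge0_subring] .
 note Oa = subring_additive_subgroup[OF O]
 have xc: "x : carrier R" using x vge_carrier by blast
 have cc: "c : carrier R" "c : F" "c : vge 0" "set cs <= ?O" "set cs <= carrier R" using Cons.prems(1) vge_carrier by auto
 have e: "eval cs x : carrier R" using eval_closed[OF cc(5) xc] .
 have ev: "eval (c # cs) x = c**x[^]length cs ++ eval cs x" by simp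
 show ?case
 proof (cases "c ~= \<zero> & w c = 0")
  case True
  have ic: "inv c : carrier R" "inv c**c = \<one>" "inv c ~= \<zero>" using inv_facts[OF cc(1)] True by auto
  have icO: "inv c : ?O" using subfield_m_inv(1)[OF F] cc True w_inv[of c] ic by (simp add: vge_def)
  define a where "a = -- (inv c**eval cs x)"
  have "inv c**eval cs x : pspan ?O x (length cs)" by (rule pspan_smult[OF Oa xc _ ic(1) eval_in_pspan[OF Oa xc cc(4)]]) (use icO subringE(6)[OF O] in blast)
  hence aP: "a : pspan ?O x (length cs)" unfolding a_def using pspan_neg[OF Oa xc] by blast
  have "inv c**eval (c # cs) x = x[^]length cs -- a" unfolding ev a_def using ic e xc cc by (simp add: r_distr m_assoc[symmetric] a_minus_def)
  moreover have "inv c**eval (c # cs) x : vgt 0" using vgt_mult[of "inv c" 0, OF _ Cons.prems(3)] icO by simp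
  ultimately show ?thesis using aP by (intro exI[of _ "length cs"]) auto
 next
  case False
  have "c : vgt 0" using cc(3) False by (auto simp: vge_def vgt_def)
  hence "x[^]length cs**c : vgt 0" using vgt_mult[of "x[^]length cs" 0] vge0_pow[OF x] by simp
  hence "eval (c # cs) x -- c**x[^]length cs : vgt 0" using vgt_minus[OF Cons.prems(3)] cc xc by (simp add: m_comm)
  moreover have "eval (c # cs) x -- c**x[^]length cs = eval cs x" unfolding ev using cc xc e by (simp add: add_diff_cancel_left)
  ultimately have "eval cs x : vgt 0" by simp
  moreover have "EX c:set cs. c ~= \<zero> & w c = 0" using Cons.prems(2) False by auto
  ultimately show ?thesis using Cons.IH[OF cc(4)] by (auto intro: less_SucI)
 qed
qed simp

lemma eval_congruent:
 assumes x: "x : vge 0" "y : vge 0" and d: "x -- y : vgt 0"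
 shows "set cs <= vge 0 ==> eval cs x -- eval cs y : vgt 0"
proof (induction cs)
 case Nil
 thus ?case by (simp add: a_minus_def)
next
 case (Cons c cs)
 have c: "x : carrier R" "y : carrier R" "c : carrier R" "set cs <= carrier R" "c : vge 0" using x Cons.prems vge_carrier by auto
 have e: "eval cs x : carrier R" "eval cs y : carrier R" using eval_closed c by auto
 have "x[^]n -- y[^]n : vgt 0" for n :: nat
 proof (induction n)
  case 0
  thus ?case by (simp add: a_minus_def r_neg)
 next
  case (Suc n)
  have "x[^]Suc n -- y[^]Suc n = x**(x[^]n -- y[^]n) ++ y[^]n**(x -- y)" using mult_diff_telescope[of "x[^]n" "y[^]n" x y] c by (simp add: m_comm)
  thus ?case using vgt_add[OF vgt_mult[OF x(1) Suc] vgt_mult[OF vge0_pow[OF x(2)] d]] by simp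
 qed
 hence 1: "c**(x[^]length cs -- y[^]length cs) : vgt 0" using vgt_mult[OF c(5)] by fastforce
 have "eval (c # cs) x -- eval (c # cs) y = c**(x[^]length cs -- y[^]length cs) ++ (eval cs x -- eval cs y)" using diff_mult_add c e by simp
 thus ?case using vgt_add[OF 1 Cons.IH] Cons.prems by simp
qed

lemma linprod_residue:
 assumes x: "x : vge 0"
 shows "set rs <= vge 0 ==> linprod rs x : vgt 0 ==> EX r:set rs. x -- r : vgt 0"
proof (induction rs)
 case Nil
 thus ?case by (simp add: linprod_def vgt_def)
next
 case (Cons r rs)
 have lp: "linprod (r # rs) x = (x -- r)**linprod rs x" by (simp add: linprod_def)
 have c: "x : carrier R" "r : carrier R" using x Cons.prems vge_carrier by auto
 have lc: "linprod rs x : carrier R" using Cons.prems(1) c(1) by (induction rs) (auto simp: linprod_def vge_carrier minus_closed)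
 show ?case
 proof (cases "x -- r : vgt 0")
  case False
  have "x -- r : vge 0" using vge_minus[OF x] Cons.prems by simp
  hence d: "x -- r ~= \<zero>" "w (x -- r) = 0" using False by (auto simp: vge_def vgt_def)
  have "linprod rs x : vgt 0"
  proof (cases "linprod rs x = \<zero>")
   case F: False
   have "(x -- r)**linprod rs x ~= \<zero>" using nonzero_mult[OF _ lc d(1) F] c by simp
   thus ?thesis using Cons.prems(2) lp w_mult[OF _ lc d(1) F] c d lc by (simp add: vgt_def)
  qed simp
  thus ?thesis using Cons.IH Cons.prems by auto
 qed auto
qed

text \<open>
  A subfield that is maximal among those with integral values has full residue field: a missing
  residue class could be lifted to a root of a lift of its minimal polynomial.
\<close>
lemma exists_full_residue_field:
 assumes ac: "algebraically_closed R" and F0: "subfield F0 R"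
  and alg: "!!x. x : carrier R ==> integral_over F0 x"
  and int0: "!!x. x : F0 ==> x ~= \<zero> ==> w x : \<int>"
 shows "EX F. subfield F R & F0 <= F & (ALL x:F. x ~= \<zero> --> w x : \<int>) &
  (ALL x:vge 0. EX s:F \<inter> vge 0. x -- s : vgt 0)"
proof -
 define A where "A = {F. subfield F R & F0 <= F & (ALL x:F. x ~= \<zero> --> w x : \<int>)}"
 have "EX M:A. ALL Y:A. M <= Y --> Y = M"
 proof (rule subset_Zorn_nonempty)
  show "A ~= {}" using F0 int0 by (auto simp: A_def)
  fix C assume C: "C ~= {}" "subset.chain A C"
  have CA: "C <= A" using C(2) by (simp add: subset.chain_def)
  have "subring (\<Union>C) R" by (rule subring_Union_chain[OF C]) (simp add: A_def subfieldE)
  moreover have "inv k : \<Union>C" if "k : \<Union>C - {\<zero>}" for k using that CA subfield_m_inv(1) unfolding A_def by blast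
  ultimately have "subfield (\<Union>C) R" by (rule subfieldI')
  thus "\<Union>C \<in> A" using CA C(1) unfolding A_def by blast
 qed
 then obtain F where FA: "F : A" and max: "!!Y. Y : A ==> F <= Y ==> Y = F" by blast
 have F: "subfield F R" "F0 <= F" and int: "!!x. x : F ==> x ~= \<zero> ==> w x : \<int>" using FA by (auto simp: A_def)
 let ?O = "F \<inter> vge 0"
 have O: "subring ?O R" using subring_inter[OF subfieldE(1)[OF F(1)] vge0_subring] .
 note Oa = subring_additive_subgroup[OF O] and Fa = subring_additive_subgroup[OF subfieldE(1)[OF F(1)]]
 have "EX s:?O. x -- s : vgt 0" if x: "x : vge 0" for x
 proof (rule ccontr)
  assume no: "~ (EX s:?O. x -- s : vgt 0)"
  have xc: "x : carrier R" using x vge_carrier by blast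
  \<comment> \<open>The residue of \<open>x\<close> satisfies a monic equation of degree
    \<open>e\<close> over the residue field of \<open>F\<close>; the least such \<open>e\<close> is
    the degree of its minimal polynomial.\<close>
  define Q where "Q e <-> (EX a:pspan ?O x e. x[^]e -- a : vgt 0)" for e
  obtain cs where cs: "set cs <= F" "eval (\<one> # cs) x = \<zero>" using integral_over_eval[OF Fa xc] integral_over_mono[OF alg[OF xc] F(2)] by blast
  have cs1: "set (\<one> # cs) <= F" "~ set (\<one> # cs) <= {\<zero>}" "set (\<one> # cs) <= carrier R"
   using cs subringE(3)[OF subfieldE(1)[OF F(1)]] subfieldE(3)[OF F(1)] by auto
  obtain c where c: "c : set (\<one> # cs)" "c ~= \<zero>" "set (map (%d. d**inv c) (\<one> # cs)) <= ?O"
   "\<one> : set (map (%d. d**inv c) (\<one> # cs))" using normalize_list[OF F(1) cs1(1,2)] by blast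
  have "c : carrier R" using c(1) cs1(3) by blast
  hence "eval (map (%d. d**inv c) (\<one> # cs)) x = \<zero>" using eval_scale[OF cs1(3) xc, of "inv c"] cs(2) inv_facts[of c] c(2) by simp
  hence "EX e. Q e" unfolding Q_def using eval_residue_monic[OF F(1) x c(3)] c(4) by (metis vgt_zero w_one one_not_zero)
  hence Qe: "Q (LEAST e. Q e)" by (rule LeastI_ex)
  define e where "e = (LEAST e. Q e)"
  obtain a where a: "a : pspan ?O x e" "x[^]e -- a : vgt 0" using Qe[folded e_def] unfolding Q_def by blast
  have "e ~= 0"
  proof
   assume "e = 0"
   hence "\<one> : vgt 0" using a by (simp add: a_minus_def)
   thus False by (simp add: vgt_def)
  qed
  obtain ds where ds: "set ds <= ?O" "length ds = e" "eval ds x = -- a" using pspan_eval[OF Oa xc pspan_neg[OF Oa xc a(1)]] by blast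
  have dsc: "set ds <= carrier R" "set ds <= vge 0" "set ds <= F" using ds(1) vge_carrier by auto
  have g: "eval (\<one> # ds) x : vgt 0" using a(2) ds xc by (simp add: a_minus_def)
  obtain rs where rs: "set rs <= carrier R" "ALL r:set rs. eval (\<one> # ds) r = \<zero>"
   "ALL y:carrier R. eval (\<one> # ds) y = linprod rs y" using monic_roots[OF ac dsc(1)] by (elim exE conjE)
  have "set rs <= vge 0"
  proof
   fix r assume r: "r : set rs"
   hence rc: "r : carrier R" using rs(1) by blast
   have "eval (\<one> # ds) r = \<zero>" using rs(2) r by blast
   hence "integral_over (vge 0) r" using integral_over_eval[OF vge_additive_subgroup[of 0] rc] dsc(2) by blast
   thus "r : vge 0" using valuation_ring_integrally_closed[OF vge0_ring rc] by blast
  qed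
  \<comment> \<open>Modulo the maximal ideal the product of the factors \<open>x -- r\<close>
    vanishes, so one root \<open>z\<close> of the lifted polynomial has the residue of
    \<open>x\<close>.\<close>
  then obtain z where z: "z : set rs" "x -- z : vgt 0" "z : vge 0" using linprod_residue[OF x, of rs] g bspec[OF rs(3) xc] by (auto simp del: eval.simps)
  have zc: "z : carrier R" using z vge_carrier by blast
  have gz: "eval (\<one> # ds) z = \<zero>" using rs(2) z(1) by blast
  have zF: "z ~: F" using no z by blast
  let ?E = "simple_extension F z"
  have iz: "integral_over F z" using integral_over_eval[OF Fa zc] dsc(3) gz by blast
  have E: "subfield ?E R" using simple_extension_is_subfield[OF F(1) zc] algebraic_iff_integral[OF F(1) zc] iz by blast
  have FE: "F <= ?E" using simple_extension_incl[OF subfieldE(3)[OF F(1)] zc] .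
  have "z[^]e = -- eval ds z" using gz ds(2) zc eval_closed[OF dsc(1) zc] by (simp add: minus_equality)
  hence ze: "z[^]e : pspan F z e" using pspan_neg[OF Fa zc eval_in_pspan[OF Fa zc dsc(3)]] ds(2) by simp
  have pE: "subring (pspan F z e) R" using subring_pspan[OF subfieldE(1)[OF F(1)] zc ze] `e ~= 0` by simp
  have "?E <= pspan F z e"
  proof (rule simple_extension_subring_incl[OF pE])
   show "F <= pspan F z e"
   proof
   fix c assume c: "c : F"
   hence "c**z[^](0::nat) : pspan F z e" using `e ~= 0` by (intro pspan_monom[OF Fa zc]) auto
   thus "c : pspan F z e" using c subfieldE(3)[OF F(1)] by auto
   qed
   show "z : pspan F z e"
   proof (cases "e = 1")
   case True
   thus ?thesis using ze zc by simp
   next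
   case False
   hence "\<one>**z[^](1::nat) : pspan F z e" using `e ~= 0` subringE(3)[OF subfieldE(1)[OF F(1)]] by (intro pspan_monom[OF Fa zc]) auto
   thus ?thesis using zc by simp
   qed
  qed
  \<comment> \<open>After normalization the polynomial \<open>bs\<close> of length \<open>e\<close>
    cannot vanish at the residue of \<open>x\<close>, by minimality of \<open>e\<close>. Hence
    \<open>w y\<close> is the value of the normalizing coefficient, which lies in
    \<open>F\<close>.\<close>
  have "w y : \<int>" if y: "y : ?E" "y ~= \<zero>" for y
  proof -
   have yc: "y : carrier R" using y subfieldE(3)[OF E] by blast
   obtain bs where bs: "set bs <= F" "length bs = e" "eval bs z = y" using pspan_eval[OF Fa zc] y(1) `?E <= pspan F z e` by blast
   have bsc: "set bs <= carrier R" using bs(1) subfieldE(3)[OF F(1)] by blast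
   have "~ set bs <= {\<zero>}"
   proof
   assume "set bs <= {\<zero>}"
   hence "eval bs z = \<zero>" using zc by (induction bs) auto
   thus False using bs(3) y(2) by simp
   qed
   then obtain c where c: "c : set bs" "c ~= \<zero>" "set (map (%d. d**inv c) bs) <= ?O"
   "\<one> : set (map (%d. d**inv c) bs)" using normalize_list[OF F(1) bs(1)] by blast
   have cc: "c : carrier R" using c(1) bsc by blast
   note ic = inv_facts[OF cc c(2)]
   let ?b = "map (%d. d**inv c) bs"
   have bO: "set ?b <= vge 0" using c(3) by blast
   have ez: "eval ?b z = y**inv c" using eval_scale[OF bsc zc, of "inv c"] ic bs(3) by simp
   have "y**inv c : vge 0" using eval_in_subring[OF vge0_subring bO z(3)] ez by simp
   moreover have "y**inv c ~: vgt 0"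
   proof
   assume "y**inv c : vgt 0"
   hence "eval ?b z : vgt 0" using ez by simp
   moreover have "eval ?b x -- eval ?b z : vgt 0" using eval_congruent[OF x z(3,2) bO] .
   ultimately have "eval ?b z ++ (eval ?b x -- eval ?b z) : vgt 0" using vgt_add by blast
   moreover have "eval ?b z ++ (eval ?b x -- eval ?b z) = eval ?b x" using diff_add_cancel[of "eval ?b z" "eval ?b x"] eval_closed[of ?b] bO xc zc vge_carrier by blast
   ultimately have "eval ?b x : vgt 0" by simp
   then obtain k where "k < e" "Q k" unfolding Q_def using eval_residue_monic[OF F(1) x c(3)] c(4) bs(2) by (metis length_map one_not_zero w_one)
   thus False using not_less_Least[of k Q] e_def by blast
   qed
   ultimately have "w (y**inv c) = 0" by (auto simp: vge_def vgt_def)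
   hence "w y = w c" using w_mult[of y "inv c"] yc y(2) ic w_inv[OF cc c(2)] by simp
   thus ?thesis using int[of c] c bs(1) by auto
  qed
  hence "?E : A" using E FE F(2) by (auto simp: A_def)
  hence "?E = F" using max FE by blast
  thus False using zF simple_extension_mem[OF subfieldE(1)[OF F(1)] zc] by blast
 qed
 thus ?thesis using F int by blast
qed

end

section \<open>Dual numbers and approximate derivations\<close>

text \<open>The dual numbers: \<open>(x, y)\<close> stands for \<open>x\<close> plus
  \<open>y\<close> times an element of square zero. The graph of a derivation is a subring, so
  extending a derivation becomes adjoining an element to a ring.\<close>

definition (in ring) dual :: "('a \<times> 'a) ring" where
 "dual = \<lparr> carrier = carrier R \<times> carrier R,
  monoid.mult = (%x y. (fst x**fst y, fst x**snd y ++ fst y**snd x)),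
  one = (\<one>, \<zero>), ring.zero = (\<zero>, \<zero>),
  ring.add = (%x y. (fst x ++ fst y, snd x ++ snd y)) \<rparr>"

lemma (in ring) dual_simps [simp]:
 "carrier dual = carrier R \<times> carrier R"
 "(x, y) **\<^sub>dual (x', y') = (x**x', x**y' ++ x'**y)"
 "\<one>\<^sub>dual = (\<one>, \<zero>)" "\<zero>\<^sub>dual = (\<zero>, \<zero>)"
 "(x, y) ++\<^sub>dual (x', y') = (x ++ x', y ++ y')" by (simp_all add: dual_def)

lemma (in cring) dual_cring: "cring dual"
proof (rule cringI)
 show "abelian_group dual"
 proof (rule abelian_groupI)
  fix x assume "x : carrier dual"
  thus "EX y:carrier dual. y ++\<^sub>dual x = \<zero>\<^sub>dual" by (cases x) (auto intro!: bexI[of _ "(-- fst x, -- snd x)"] simp: l_neg)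
 qed (auto simp: a_ac)
 show "comm_monoid dual" by (rule comm_monoidI) (auto simp: m_ac r_distr a_ac)
qed (auto simp: l_distr r_distr a_ac)

context field
begin

interpretation D: cring dual by (rule dual_cring)

lemma dual_inv: "x : carrier R ==> y : carrier R ==> --\<^sub>dual (x, y) = (-- x, -- y)" by (rule D.minus_equality) (auto simp: l_neg)

lemma dual_minus: "x : carrier R ==> y : carrier R ==> x' : carrier R ==> y' : carrier R ==>
  (x, y) --\<^sub>dual (x', y') = (x -- x', y -- y')" by (simp add: a_minus_def dual_inv)

definition natf :: "nat => 'a" where "natf n = [n] \<cdot> \<one>"

lemma natf_simps [simp]: "natf 0 = \<zero>" "natf (Suc n) = natf n ++ \<one>" by (simp_all add: natf_def)

lemma natf_closed [simp]: "natf n : carrier R" by (simp add: natf_def)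

lemma natf_subring: "subring S R ==> natf n : S"
proof (induction n)
 case (Suc n)
 thus ?case using subringE(7)[OF _ Suc.IH subringE(3)] by simp
qed (simp add: subringE(2))

text \<open>The derivative of \<open>T^j\<close> at \<open>x\<close>; for \<open>j = 0\<close> the
  factor \<open>natf 0\<close> makes the truncated exponent harmless.\<close>

definition dpow :: "'a => nat => 'a" where "dpow x j = natf j**x[^](j - 1)"

lemma dpow_closed [simp]: "x : carrier R ==> dpow x j : carrier R" by (simp add: dpow_def)

lemma dpow_Suc: "x : carrier R ==> dpow x (Suc j) = dpow x j**x ++ x[^]j" by (cases j) (auto simp: dpow_def l_distr m_assoc)

lemma dual_pow:
 assumes c: "x : carrier R" "m : carrier R"
 shows "(x, m) [^]\<^sub>dual (j::nat) = (x[^]j, dpow x j**m)"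
proof (induction j)
 case 0
 thus ?case using c by (simp add: dpow_def)
next
 case (Suc j)
 have "x[^]j**m ++ x**(dpow x j**m) = dpow x (Suc j)**m" unfolding dpow_Suc[OF c(1)] using c by (simp add: l_distr r_distr m_ac a_ac)
 thus ?case using Suc by simp
qed

lemma dual_pspan_fst:
 assumes G: "fst ` G <= T" and c: "x : carrier R" "m : carrier R"
 shows "g : D.pspan G (x, m) j ==> fst g : pspan T x j"
proof (induction j arbitrary: g)
 case (Suc j)
 then obtain a h where g: "g = a ++\<^sub>dual h **\<^sub>dual (x, m) [^]\<^sub>dual j" "a : D.pspan G (x, m) j" "h : G" by auto
 have "fst g = fst a ++ fst h**x[^]j" unfolding g(1) dual_pow[OF c] by (cases a; cases h) simp
 thus ?case using Suc.IH[OF g(2)] g(3) G by auto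
qed simp

end

section \<open>Uniformizers, totally ramified extensions and the extension of derivations\<close>

context valued_field
begin

interpretation D: cring dual by (rule dual_cring)

lemma subfield_value_multiples:
 assumes E: "subfield E R" and x: "x : E" "x ~= \<zero>"
 shows "EX z:E. z ~= \<zero> & w z = of_int k * w x"
proof -
 have Ec: "x : carrier R" using x subfieldE(3)[OF E] by blast
 have p: "y[^](n::nat) : E" if "y : E" for y n by (induction n) (use that subringE(3,6)[OF subfieldE(1)[OF E]] in auto)
 have ix: "inv x : E" "inv x ~= \<zero>" "inv x : carrier R" using subfield_m_inv(1)[OF E] x inv_facts[OF Ec x(2)] by auto
 show ?thesis
 proof (cases "k >= 0")
  case True
  thus ?thesis using p[OF x(1), of "nat k"] w_pow[OF Ec x(2), of "nat k"] nonzero_pow[OF Ec x(2), of "nat k"]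
   by (intro bexI[of _ "x[^]nat k"]) (simp_all only: of_nat_nat simp_thms not_False_eq_True)
 next
  case False
  hence "real (nat (- k)) = - of_int k" by simp
  thus ?thesis using p[OF ix(1), of "nat (- k)"] w_pow[OF ix(3,2), of "nat (- k)"] nonzero_pow[OF ix(3,2), of "nat (- k)"] w_inv[OF Ec x(2)]
   by (intro bexI[of _ "inv x[^]nat (- k)"]) (simp_all only: minus_mult_minus simp_thms not_False_eq_True)
 qed
qed

lemma pow_in_subfield: "subfield E R ==> x : E ==> x[^](n::nat) : E" by (induction n) (use subringE(3,6)[OF subfieldE(1)] in auto)

text \<open>The values on \<open>E\<close> are multiples of \<open>gam / fact D\<close>, hence
  discrete, and the least positive one generates them by division with remainder. The element
  \<open>t\<close> shows that positive values occur.\<close>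

lemma exists_uniformizer:
 assumes K: "subfield K R" and E: "subfield E R" and dim: "dimension D K E"
  and g: "gam > 0" "!!x. x : K ==> x ~= \<zero> ==> EX k::int. w x = of_int k * gam"
  and t: "t : E" "t ~= \<zero>" "w t = gam"
 shows "EX un:E. un ~= \<zero> & w un > 0 & (ALL x:E. x ~= \<zero> --> (EX k::int. w x = of_int k * w un))"
proof -
 \<comment> \<open>Every value on \<open>E\<close> has the form \<open>(k - l) gam / n\<close> with
   \<open>1 <= n <= D\<close>, and each such \<open>n\<close> divides \<open>fact D\<close>.\<close>
 define de where "de = gam / fact D"
 have d0: "de > 0" using g(1) by (simp add: de_def)
 have Es: "subring E R" using subfieldE(1)[OF E] .
 have Ec: "x : carrier R" if "x : E" for x using that subfieldE(3)[OF E] by blast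
 have Kc: "x : carrier R" if "x : K" for x using that subfieldE(3)[OF K] by blast
 have mul: "EX k::int. w x = of_int k * de" if x: "x : E" "x ~= \<zero>" for x
 proof -
  have "x[^](i::nat) : E" for i by (induction i) (use x subringE(3,6)[OF Es] in auto)
  then obtain cs where cs: "set cs <= K" "length cs = Suc D" "~ set cs <= {\<zero>}" "eval cs x = \<zero>" using dimension_eval[OF K dim _ Ec[OF x(1)]] by blast
  have csc: "set cs <= carrier R" using cs(1) Kc by blast
  obtain c d n where n: "c : set cs" "d : set cs" "c ~= \<zero>" "d ~= \<zero>" "1 <= n" "n < length cs" "real n * w x = w c - w d"
   using eval_equal_values[OF csc cs(3) Ec[OF x(1)] x(2) cs(4)] by blast
  obtain k where k: "w c = of_int k * gam" using g(2)[of c] n cs(1) by blast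
  obtain l where l: "w d = of_int l * gam" using g(2)[of d] n cs(1) by blast
  have "n dvd fact D" using n cs(2) by (intro dvd_fact) auto
  then obtain q :: nat where q: "fact D = n * q" by blast
  have rq: "(fact D :: real) = real n * real q" using q by (metis of_nat_fact of_nat_mult)
  have n0: "real n > 0" using n(5) by simp
  have "w x = (of_int k - of_int l) * gam / real n" using n(7) k l n0 by (simp add: field_simps)
  also have "\<dots> = of_int ((k - l) * int q) * de"
  proof -
   have "real q > 0" using rq fact_gt_zero[of D, where 'a = real] n0 by (simp add: zero_less_mult_iff)
   thus ?thesis unfolding de_def rq using n0 by simp
  qed
  finally show ?thesis by blast
 qed
 define S where "S k <-> k > 0 & (EX x:E. x ~= \<zero> & w x = real k * de)" for k :: nat
 have "S (fact D)" unfolding S_def using t d0 by (auto simp: de_def intro!: bexI[of _ t])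
 hence "S (LEAST k. S k)" by (rule LeastI)
 define k0 where "k0 = (LEAST k. S k)"
 obtain un where p: "un : E" "un ~= \<zero>" "w un = real k0 * de" "k0 > 0" using `S (LEAST k. S k)` unfolding k0_def[symmetric] unfolding S_def by blast
 have "EX k::int. w x = of_int k * w un" if x: "x : E" "x ~= \<zero>" for x
 proof -
  obtain k where k: "w x = of_int k * de" using mul[OF x] by blast
  define q r where "q = k div int k0" and "r = k mod int k0"
  have kr: "k = q * int k0 + r" "0 <= r" "r < int k0" using p(4) by (auto simp: q_def r_def)
  obtain z where z: "z : E" "z ~= \<zero>" "w z = of_int (- q) * w un" using subfield_value_multiples[OF E p(1,2)] by blast
  have y: "x**z : E" "x**z ~= \<zero>" using x z subringE(6)[OF Es] nonzero_mult[OF Ec Ec] by auto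
  have "w (x**z) = of_int r * de" using w_mult[OF Ec[OF x(1)] Ec[OF z(1)] x(2) z(2)] k z(3) p(3) kr(1) by (simp add: algebra_simps)
  hence "w (x**z) = real (nat r) * de" using kr by simp
  moreover have "~ S (nat r)" using kr not_less_Least[of "nat r" S] by (simp add: k0_def[symmetric])
  ultimately have "r = 0" using y kr(2) unfolding S_def by fastforce
  thus ?thesis using k kr(1) p(3) by (intro exI[of _ q]) simp
 qed
 thus ?thesis using p d0 by (intro bexI[of _ un]) auto
qed

context
 fixes F1 un and e :: nat and gam :: real
 assumes F1: "subfield F1 R" and pi: "un : carrier R" "un ~= \<zero>" and e: "e >= 1" "real e * w un = gam" and gam: "gam > 0"
  and val1: "!!x. x : F1 ==> x ~= \<zero> ==> EX k::int. w x = of_int k * gam"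
begin

lemma F1c: "x : F1 ==> x : carrier R" using subfieldE(3)[OF F1] by blast

lemma pi_pos: "w un > 0" using e gam by (metis of_nat_0_le_iff zero_less_mult_iff linorder_not_le)

text \<open>The value of \<open>un\<close> is \<open>gam / e\<close>, so its multiples by numbers
  below \<open>e\<close> are distinct modulo the value group of \<open>F1\<close>.\<close>

lemma values_distinct:
 assumes "of_int k * gam + real i * w un = of_int l * gam + real j * w un" "i < e" "j < e"
 shows "i = j"
proof -
 have "(of_int k * real e + real i) * w un = (of_int l * real e + real j) * w un" using assms(1) unfolding e(2)[symmetric] by (simp add: algebra_simps)
 hence "of_int k * real e + real i = of_int l * real e + real j" using pi_pos by simp
 hence "of_int (k * int e + int i) = (of_int (l * int e + int j) :: real)" by simp
 hence 1: "k * int e + int i = l * int e + int j" by (simp only: of_int_eq_iff)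
 have "int i = (k * int e + int i) mod int e" using assms by simp
 also have "\<dots> = int j" unfolding 1 using assms by simp
 finally show ?thesis by simp
qed

text \<open>The nonzero terms of such a combination have pairwise different values, so one of them
  determines the value of the sum.\<close>

lemma pspan_value: "a : pspan F1 un j ==> j <= e ==> a = \<zero> \<or> (EX k::int. EX i<j. w a = of_int k * gam + real i * w un)"
proof (induction j arbitrary: a)
 case (Suc j)
 note Fa = subring_additive_subgroup[OF subfieldE(1)[OF F1]]
 obtain a' c where a: "a = a' ++ c**un[^]j" "a' : pspan F1 un j" "c : F1" using Suc.prems by auto
 have ac: "a' : carrier R" "c : carrier R" using pspan_closed[OF Fa pi(1) a(2)] F1c a(3) by auto
 have IH: "a' = \<zero> \<or> (EX k::int. EX i<j. w a' = of_int k * gam + real i * w un)" using Suc.IH[OF a(2)] Suc.prems by simp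
 show ?case
 proof (cases "c = \<zero>")
  case True
  hence "a = a'" using a ac pi by simp
  thus ?thesis using IH less_SucI by blast
 next
  case False
  obtain l where l: "w c = of_int l * gam" using val1[OF a(3) False] by blast
  have t: "c**un[^]j ~= \<zero>" "w (c**un[^]j) = of_int l * gam + real j * w un"
   using nonzero_mult[OF ac(2) _ False nonzero_pow[OF pi]] w_mult[OF ac(2) _ False nonzero_pow[OF pi]] w_pow[OF pi] l pi(1) by auto
  have tc: "c**un[^]j : carrier R" using ac pi by simp
  show ?thesis
  proof (cases "a' = \<zero>")
   case True
   hence "a = c**un[^]j" using a tc by simp
   thus ?thesis using t by blast
  next
   case a'0: False
   then obtain k i where k: "i < j" "w a' = of_int k * gam + real i * w un" using IH by blast
   have "w a' ~= w (c**un[^]j)"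
   proof
   assume "w a' = w (c**un[^]j)"
   hence "i = j" using values_distinct[of k i l j] k t Suc.prems(2) by simp
   thus False using k(1) by simp
   qed
   then consider "w a' < w (c**un[^]j)" | "w (c**un[^]j) < w a'" by linarith
   thus ?thesis
   proof cases
   case 1
   hence "w a = w a'" using w_add_less[OF ac(1) a'0, of "c**un[^]j"] a(1) tc by (simp add: vgt_def)
   thus ?thesis using k less_SucI by metis
   next
   case 2
   hence "w a = w (c**un[^]j)" using w_add_less[OF tc t(1), of a'] a(1) ac tc by (simp add: vgt_def a_comm)
   thus ?thesis using t by auto
   qed
  qed
 qed
qed simp

text \<open>The top term and the rest have different values and cannot cancel, so a lower bound for
  the sum is one for both.\<close>

lemma pspan_top_value:
 assumes a: "a : pspan F1 un j" "j < e" "c : F1" and r: "a ++ c**un[^]j : vge r"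
 shows "a : vge r & c**un[^]j : vge r"
proof -
 note Fa = subring_additive_subgroup[OF subfieldE(1)[OF F1]]
 have ac: "a : carrier R" "c : carrier R" using pspan_closed[OF Fa pi(1) a(1)] F1c a(3) by auto
 let ?t = "c**un[^]j"
 have tc: "?t : carrier R" using ac pi by simp
 show ?thesis
 proof (cases "a = \<zero> \<or> c = \<zero>")
  case True
  thus ?thesis using r ac tc pi by auto
 next
  case False
  obtain l where l: "w c = of_int l * gam" using val1[OF a(3)] False by blast
  have t: "?t ~= \<zero>" "w ?t = of_int l * gam + real j * w un"
   using nonzero_mult[OF ac(2) _ _ nonzero_pow[OF pi]] w_mult[OF ac(2) _ _ nonzero_pow[OF pi]] w_pow[OF pi] l pi(1) False by auto
  obtain k i where k: "i < j" "w a = of_int k * gam + real i * w un" using pspan_value[OF a(1)] a(2) False by auto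
  have "w a ~= w ?t"
  proof
   assume "w a = w ?t"
   hence "i = j" using values_distinct[of k i l j] k t a(2) by simp
   thus False using k(1) by simp
  qed
  then consider "w a < w ?t" | "w ?t < w a" by linarith
  thus ?thesis
  proof cases
   case 1
   hence "w (a ++ ?t) = w a" "a ++ ?t ~= \<zero>" using w_add_less[OF ac(1), of ?t] tc False by (auto simp: vgt_def)
   thus ?thesis using r 1 ac tc by (auto simp: vge_def)
  next
   case 2
   hence "w (a ++ ?t) = w ?t" "a ++ ?t ~= \<zero>" using w_add_less[OF tc t(1), of a] ac tc by (auto simp: vgt_def a_comm)
   thus ?thesis using r 2 ac tc by (auto simp: vge_def)
  qed
 qed
qed

context
 fixes F2 og
 assumes F2: "subfield F2 R" "F1 <= F2" "un : F2" and om: "og : F1" "og ~= \<zero>" "w og = gam"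
  and val2: "!!x. x : F2 ==> x ~= \<zero> ==> EX k::int. w x = of_int k * w un"
  and res: "!!x. x : F2 \<inter> vge 0 ==> EX s:F1 \<inter> vge 0. x -- s : vgt 0"
begin

lemma F2c: "x : F2 ==> x : carrier R" using subfieldE(3)[OF F2(1)] by blast

text \<open>Residues of \<open>F2\<close> are already represented in \<open>F1\<close>, so the
  leading part of a remainder is removed by an element of \<open>F1\<close> times a power of
  \<open>un\<close> below \<open>e\<close>. Without completeness this only gives approximations of
  prescribed accuracy.\<close>

lemma uniformizer_expansion:
 assumes x: "x : F2 \<inter> vge 0"
 shows "EX a:pspan (F1 \<inter> vge 0) un e. x -- a : vge (real J * w un)"
proof (induction J)
 let ?O = "F1 \<inter> vge 0"
 have O: "subring ?O R" using subring_inter[OF subfieldE(1)[OF F1] vge0_subring] .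
 note Oa = subring_additive_subgroup[OF O]
 {
  case 0
  have "x -- \<zero> = x" using x vge_carrier by (auto simp: a_minus_def)
  thus ?case using pspan_zero[OF Oa pi(1)] x by (intro bexI[of _ \<zero>]) auto
 next
  case (Suc J)
  then obtain a where a: "a : pspan ?O un e" "x -- a : vge (real J * w un)" by blast
  have ac: "a : carrier R" using pspan_closed[OF Oa pi(1) a(1)] .
  have xc: "x : carrier R" using x F2c by blast
  have aF: "a : F2" using pspan_in_subring[OF subfieldE(1)[OF F2(1)] _ F2(3) a(1)] F2(2) by blast
  define y where "y = x -- a"
  have y: "y : F2" "y : carrier R" using x aF F2c subringE(5,7)[OF subfieldE(1)[OF F2(1)]] xc ac by (auto simp: y_def a_minus_def)
  show ?case
  proof (cases "y = \<zero> \<or> w y ~= real J * w un")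
   case True
   have "y : vge (real (Suc J) * w un)"
   proof (cases "y = \<zero>")
   case False
   obtain k :: int where k: "w y = of_int k * w un" using val2[OF y(1) False] by blast
   have "w y >= real J * w un" using a(2) False by (simp add: y_def[symmetric] vge_def)
   hence "of_int k >= (of_int (int J) :: real)" using k pi_pos by simp
   moreover have "of_int k ~= (of_int (int J) :: real)" using True False k by auto
   ultimately have "k >= int (Suc J)" by (simp only: of_int_le_iff of_int_eq_iff)
   hence "of_int k >= real (Suc J)" by linarith
   thus ?thesis using k y(2) pi_pos by (simp add: vge_def)
   qed simp
   thus ?thesis using a(1) y_def by blast
  next
   case False
   \<comment> \<open>The element \<open>t\<close> has the value of \<open>un[^]J\<close> but
     contains fewer than \<open>e\<close> factors \<open>un\<close>: the others are grouped into
     powers of \<open>og\<close>, which lies in \<open>F1\<close> and has the value of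
     \<open>un[^]e\<close>.\<close>
   define q r where "q = J div e" and "r = J mod e"
   have J: "J = q * e + r" "r < e" using e(1) by (auto simp: q_def r_def)
   define t where "t = og[^]q**un[^]r"
   have oc: "og : carrier R" using om F1c by blast
   have t: "t : carrier R" "t ~= \<zero>" "w t = real J * w un" using oc pi om(2) nonzero_mult[OF _ _ nonzero_pow[OF oc om(2)] nonzero_pow[OF pi]]
   w_mult[OF _ _ nonzero_pow[OF oc om(2)] nonzero_pow[OF pi]] w_pow[OF oc om(2)] w_pow[OF pi] om(3) J(1) e(2) by (auto simp: t_def algebra_simps)
   have tF: "t : F2" using pow_in_subfield[OF F2(1)] F2 om(1) subringE(6)[OF subfieldE(1)[OF F2(1)]] by (auto simp: t_def)
   note it = inv_facts[OF t(1,2)]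
   have itF: "inv t : F2" using subfield_m_inv(1)[OF F2(1)] tF t(2) by blast
   have "w (y**inv t) = 0" using w_mult[of y "inv t"] y(2) it False t(3) w_inv[OF t(1,2)] by simp
   hence "y**inv t : F2 \<inter> vge 0" using y it itF subringE(6)[OF subfieldE(1)[OF F2(1)]] by (simp add: vge_def)
   then obtain s where s: "s : ?O" "y**inv t -- s : vgt 0" using res by blast
   have sc: "s : carrier R" using s F1c by blast
   have "t : vge (real J * w un)" using t by (simp add: vge_def)
   hence "t**(y**inv t -- s) : vgt (real J * w un)" using vgt_mult[OF _ s(2)] by fastforce
   moreover have "t**(y**inv t -- s) = y -- s**t"
   proof -
   have "t**(y**inv t -- s) = y**(t**inv t) -- s**t" using t(1) y(2) it[THEN conjunct1] sc by algebra
   thus ?thesis using it y by simp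
   qed
   ultimately have d: "y -- s**t : vgt (real J * w un)" by simp
   have sF: "s**t : F2" using s(1) F2(2) tF subringE(6)[OF subfieldE(1)[OF F2(1)]] by blast
   have dF: "y -- s**t : F2" using y(1) sF subringE(5,7)[OF subfieldE(1)[OF F2(1)]] by (simp add: a_minus_def)
   have d2: "y -- s**t : vge (real (Suc J) * w un)"
   proof (cases "y -- s**t = \<zero>")
   case ne: False
   obtain k :: int where k: "w (y -- s**t) = of_int k * w un" using val2[OF dF ne] by blast
   hence "of_int k > (of_int (int J) :: real)" using d ne pi_pos by (simp add: vgt_def)
   hence "k >= int (Suc J)" by (simp only: of_int_less_iff)
   hence "of_int k >= real (Suc J)" by linarith
   thus ?thesis using k F2c[OF dF] pi_pos by (simp add: vge_def)
   qed simp
   have "og : vge 0" using om oc gam by (simp add: vge_def)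
   hence "s**og[^]q : ?O" using s(1) pow_in_subfield[OF F1 om(1)] vge0_pow subringE(6)[OF O] by blast
   hence "(s**og[^]q)**un[^]r : pspan ?O un e" using pspan_monom[OF Oa pi(1) _ J(2)] by blast
   moreover have "(s**og[^]q)**un[^]r = s**t" using sc oc pi by (simp add: t_def m_assoc)
   ultimately have "a ++ s**t : pspan ?O un e" using pspan_add[OF Oa pi(1) a(1)] by simp
   moreover have "x -- (a ++ s**t) = y -- s**t"
   proof -
   have "x -- (a ++ b) = (x -- a) -- b" if "b : carrier R" for b using that xc ac by algebra
   thus ?thesis using sc t(1) by (simp add: y_def)
   qed
   ultimately show ?thesis using d2 by (intro bexI[of _ "a ++ s**t"]) auto
  qed
 }
qed

end

end

text \<open>
  The graph of a derivation from the integers of \<open>F\<close> to \<open>R / vge 0\<close>, as a subring of the dual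
  numbers.
\<close>
definition der_graph :: "real => 'a set => ('a \<times> 'a) set => bool" where
 "der_graph N F G <-> subring G dual & (ALL x y. (x, y) : G --> x : F \<inter> vge 0 & y : vge (- N)) &
  (ALL x:F \<inter> vge 0. EX y. (x, y) : G) & (ALL y. (\<zero>, y) : G <-> y : vge 0)"

text \<open>The graph is enlarged by \<open>(un, m)\<close>, where \<open>m\<close> is to be the
  image of \<open>un\<close>. Hypothesis \<open>H\<close> says that the equation for
  \<open>un[^]e\<close> and its derivative hold up to errors that the graph tolerates; the values of
  the powers of \<open>un\<close> then prevent new elements over zero.\<close>

lemma der_graph_extend:
 fixes N :: nat and e :: nat
 assumes F1: "subfield F1 R" and pi: "un : carrier R" "un ~= \<zero>" and e: "e >= 1" "real e * w un = gam" and gam: "gam > 0"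
  and val1: "!!x. x : F1 ==> x ~= \<zero> ==> EX k::int. w x = of_int k * gam"
  and F2: "subfield F2 R" "F1 <= F2" "un : F2" and om: "og : F1" "og ~= \<zero>" "w og = gam"
  and val2: "!!x. x : F2 ==> x ~= \<zero> ==> EX k::int. w x = of_int k * w un"
  and res: "!!x. x : F2 \<inter> vge 0 ==> EX s:F1 \<inter> vge 0. x -- s : vgt 0"
  and G: "der_graph N1 F1 G" and q: "(q, \<zero>) : G" "q ~= \<zero>" "w q = 1"
  and m: "m : vge (- real N)" "0 <= N1" "N1 <= real N"
  and H: "(a, b) : D.pspan G (un, m) e" "un[^]e -- a : vge (real N)" "dpow un e**m -- b : vge 0"
 shows "EX G2. der_graph N F2 G2 & G <= G2 & (e >= 2 --> (un, m) : G2)"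
proof -
 have Gs: "subring G dual" and G1: "!!x y. (x, y) : G ==> x : F1 \<inter> vge 0 & y : vge (- N1)"
  and G2: "!!x. x : F1 \<inter> vge 0 ==> EX y. (x, y) : G" and G0: "!!y. (\<zero>, y) : G <-> y : vge 0" using G unfolding der_graph_def by blast+
 have F1cc: "x : carrier R" if "x : F1" for x using that subfieldE(3)[OF F1] by blast
 let ?O = "F1 \<inter> vge 0"
 define z where "z = (un, m)"
 have mc: "m : carrier R" using m vge_carrier by blast
 have z: "z : carrier dual" using pi mc by (simp add: z_def)
 note Ga = D.subring_additive_subgroup[OF Gs] and F1a = subring_additive_subgroup[OF subfieldE(1)[OF F1]]
 note pp = pi_pos[OF F1 pi e gam val1]
 have piv: "un : vge 0" using pi pp by (simp add: vge_def)
 \<comment> \<open>Multiples of \<open>q[^]N\<close> have integral derivative because denominators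
   are at most \<open>q[^]N\<close> and \<open>q\<close> is a constant. This set absorbs all errors
   of approximation.\<close>
 define I where "I = vge (real N) \<times> vge 0"
 have Ia: "additive_subgroup I dual" unfolding additive_subgroup_def
 proof (rule D.add.subgroupI)
  show "I <= carrier dual" using vge_carrier by (auto simp: I_def)
  show "I ~= {}" using vge_zero[of "real N"] vge_zero[of 0] unfolding I_def by blast
  fix x assume x: "x : I"
  thus "--\<^sub>dual x : I" using dual_inv vge_neg vge_carrier by (cases x) (auto simp: I_def)
  fix y assume "y : I"
  thus "x ++\<^sub>dual y : I" using x vge_add by (cases x; cases y) (auto simp: I_def)
 qed
 have bI: "(x, y) **\<^sub>dual i : I" if xyi: "x : vge 0" "y : vge (- real N)" "i : I" for x y i
 proof -
  obtain u v where i: "i = (u, v)" "u : vge (real N)" "v : vge 0" using xyi(3) by (auto simp: I_def)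
  have "u**y : vge 0" using vge_mult[OF i(2) xyi(2)] by simp
  thus ?thesis using vge0_mult[OF xyi(1)] vge_add i by (auto simp: I_def)
 qed
 have GI: "g **\<^sub>dual i : I" if "g : G" "i : I" for g i
  using bI[of "fst g" "snd g" i] G1[of "fst g" "snd g"] vge_mono[of "snd g" "- N1" "- real N"] m(3) that by auto
 have zI: "z **\<^sub>dual i : I" if "i : I" for i using bI[OF piv m(1) that] by (simp add: z_def)
 have Nv: "x : vge 0" if "x : vge (real N)" for x using that vge_mono[of x "real N" 0] by simp
 have Nv2: "x : vge (- real N)" if "x : vge 0" for x using that vge_mono[of x 0 "- real N"] by simp
 have II: "i **\<^sub>dual j : I" if "i : I" "j : I" for i j using bI[of "fst i" "snd i" j] that Nv Nv2 by (auto simp: I_def)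
 have Hc: "(a, b) : carrier dual" using D.pspan_closed[OF Ga z H(1)[folded z_def]] .
 have hI: "z [^]\<^sub>dual e --\<^sub>dual (a, b) : I" using H(2,3) Hc pi mc dual_pow[OF pi(1) mc] dual_minus by (simp add: z_def I_def)
 let ?G = "{g ++\<^sub>dual i | g i. g : D.pspan G z e & i : I}"
 have sub: "subring ?G dual" by (rule D.subring_adjoin[OF Gs Ia z GI zI II _ hI e(1)]) (use H(1) in \<open>simp_all add: z_def\<close>)
 have pfst: "fst g : pspan ?O un j" if "g : D.pspan G z j" for g j using dual_pspan_fst[of G ?O un m g j] that G1 pi mc unfolding z_def by fastforce
 have psnd: "snd g : vge (- real N) & fst g : vge 0" if g: "g : D.pspan G z j" for g j
 proof -
  let ?B = "vge 0 \<times> vge (- real N)"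
  have "additive_subgroup ?B dual" unfolding additive_subgroup_def
  proof (rule D.add.subgroupI)
   show "?B <= carrier dual" using vge_carrier by auto
   show "?B ~= {}" using vge_zero[of "- real N"] vge_zero[of 0] by blast
   fix x assume x: "x : ?B"
   thus "--\<^sub>dual x : ?B" using dual_inv vge_neg vge_carrier by (cases x) auto
   fix y assume "y : ?B"
   thus "x ++\<^sub>dual y : ?B" using x vge_add by (cases x; cases y) auto
  qed
  moreover have "c **\<^sub>dual z [^]\<^sub>dual i : ?B" if c: "c : G" for c and i :: nat
  proof -
   obtain c1 c2 where cc: "c = (c1, c2)" by (cases c)
   have c12: "c1 : vge 0" "c2 : vge (- real N)" using G1[of c1 c2] c cc vge_mono[of c2 "- N1" "- real N"] m(3) by auto
   have "dpow un i : vge 0" unfolding dpow_def using natf_subring[OF vge0_subring] vge0_pow[OF piv] vge0_mult by blast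
   hence "dpow un i**m : vge (- real N)" using vge0_mult m(1) by blast
   hence "c1**(dpow un i**m) : vge (- real N)" "un[^]i**c2 : vge (- real N)" "c1**un[^]i : vge 0" using c12 vge0_mult vge0_pow[OF piv] by auto
   thus ?thesis using vge_add unfolding cc z_def dual_pow[OF pi(1) mc] by simp
  qed
  ultimately have "g : ?B" using D.pspan_subset[OF _ z _ g, of ?B] by blast
  thus ?thesis by auto
 qed
 obtain Nk :: int where Nk: "1 = of_int Nk * gam" using val1[of q] q(2,3) G1[OF q(1)] by auto
 have rN: "real N = of_int (int N * Nk) * gam" using Nk by (simp add: mult.assoc)
 have qc: "q : carrier R" "q : F1" "q : vge 0" using G1[OF q(1)] F1cc by auto
 have qN: "(q[^]N, \<zero>) : G"
 proof -
  have "(q, \<zero>) [^]\<^sub>dual k : G" for k :: nat by (induction k) (use q(1) subringE(3,6)[OF Gs] in auto)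
  thus ?thesis using dual_pow[OF qc(1), of \<zero> N] qc by (metis dpow_closed r_null zero_closed)
 qed
 \<comment> \<open>Write \<open>x\<close> as \<open>q[^]N**x'\<close>. The image of
   \<open>x'\<close> has denominator at most \<open>q[^]N\<close>, and \<open>q[^]N\<close> has
   derivative zero, so the product rule gives an integral image.\<close>
 have small: "y : vge 0" if g: "(x, y) : G" and x: "x : vge (real N)" for x y
 proof (cases "x = \<zero>")
  case True
  thus ?thesis using G0 g by blast
 next
  case False
  have xF: "x : F1" "x : carrier R" using G1[OF g] F1cc by auto
  have q0: "q[^]N ~= \<zero>" "q[^]N : carrier R" "q[^]N : F1" using nonzero_pow[OF qc(1) q(2)] qc pow_in_subfield[OF F1 qc(2)] by auto
  note iq = inv_facts[OF q0(2,1)]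
  have wq: "w (q[^]N) = real N" using w_pow[OF qc(1) q(2)] q(3) by simp
  define x' where "x' = x**inv (q[^]N)"
  have "inv (q[^]N) : vge (- real N)" using iq w_inv[OF q0(2,1)] wq by (simp add: vge_def)
  hence "x' : vge 0" unfolding x'_def using vge_mult[OF x] by fastforce
  moreover have "x' : F1" unfolding x'_def using xF subfield_m_inv(1)[OF F1] q0 subringE(6)[OF subfieldE(1)[OF F1]] by blast
  ultimately obtain y' where y': "(x', y') : G" using G2 by blast
  have x'c: "x' : carrier R" "y' : carrier R" "y : carrier R" "y' : vge (- N1)" using G1[OF y'] G1[OF g] vge_carrier by blast+
  have "q[^]N**x' = x" using xF iq q0 by (simp add: x'_def m_lcomm)
  hence "(x, q[^]N**y') : G" using subringE(6)[OF Gs qN y'] x'c q0 by simp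
  hence "(x, y) --\<^sub>dual (x, q[^]N**y') : G" using g subringE(5,7)[OF Gs] by (simp add: a_minus_def)
  hence "(\<zero>, y -- q[^]N**y') : G" using dual_minus xF x'c q0 by (simp add: a_minus_def r_neg)
  hence "y -- q[^]N**y' : vge 0" using G0 by blast
  moreover have "q[^]N : vge (real N)" using q0 wq by (simp add: vge_def)
  hence "q[^]N**y' : vge 0" using vge_mult[OF _ x'c(4)] vge_mono m(3) by fastforce
  ultimately have "q[^]N**y' ++ (y -- q[^]N**y') : vge 0" using vge_add by blast
  thus ?thesis using diff_add_cancel[of "q[^]N**y'" y] x'c q0 by simp
 qed
 have ker: "snd g : vge 0" if "g : D.pspan G z j" "j <= e" "fst g : vge (real N)" for g j using that
 proof (induction j arbitrary: g)
  case (Suc j)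
  obtain a' c where g: "g = a' ++\<^sub>dual c **\<^sub>dual z [^]\<^sub>dual j" "a' : D.pspan G z j" "c : G" using Suc.prems by auto
  obtain c1 c2 where cc: "c = (c1, c2)" by (cases c)
  obtain a1 a2 where aa: "a' = (a1, a2)" by (cases a')
  have c1: "c1 : F1" "c1 : carrier R" "c2 : carrier R" using G1[of c1 c2] g(3) cc F1cc vge_carrier by auto
  have gx: "g = (a1 ++ c1**un[^]j, a2 ++ (c1**(dpow un j**m) ++ un[^]j**c2))" unfolding g(1) cc aa z_def dual_pow[OF pi(1) mc] by simp
  have "a1 : pspan F1 un j" using pfst[OF g(2)] aa pspan_mono[of ?O F1 un j] by auto
  hence t: "a1 : vge (real N)" "c1**un[^]j : vge (real N)" using pspan_top_value[OF F1 pi e gam val1 _ _ c1(1), of a1 j "real N"] Suc.prems gx by auto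
  have a2: "a2 : vge 0" using Suc.IH[OF g(2)] Suc.prems t aa by simp
  \<comment> \<open>The values of \<open>c1\<close> and the number \<open>N\<close> are multiples of
    \<open>gam\<close>, whereas \<open>un[^]j\<close> contributes less than \<open>gam\<close>. So
    \<open>c1\<close> alone has value at least \<open>N\<close>.\<close>
  have c1N: "c1 : vge (real N)"
  proof (cases "c1 = \<zero>")
   case False
   obtain k :: int where k: "w c1 = of_int k * gam" using val1[OF c1(1) False] by blast
   have "c1**un[^]j ~= \<zero>" using nonzero_mult[OF c1(2) _ False nonzero_pow[OF pi]] pi by simp
   hence "real N <= w c1 + real j * w un" using t(2) w_mult[OF c1(2) _ False nonzero_pow[OF pi]] w_pow[OF pi] pi by (simp add: vge_def)
   also have "\<dots> < w c1 + real e * w un" using Suc.prems pp by simp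
   finally have "real N < of_int (k + 1) * gam" using k e(2) by (simp add: algebra_simps)
   hence "of_int (int N * Nk) * gam < of_int (k + 1) * gam" unfolding rN .
   hence "int N * Nk < k + 1" using gam by (simp only: mult_less_cancel_right_pos of_int_less_iff)
   hence "int N * Nk <= k" by simp
   hence "of_int (int N * Nk) * gam <= of_int k * gam" using gam by (simp only: mult_le_cancel_right_pos of_int_le_iff)
   thus ?thesis using k Nk c1(2) by (simp add: vge_def mult.assoc)
  qed simp
  hence c2: "c2 : vge 0" using small[of c1 c2] g(3) cc by blast
  have "dpow un j : vge 0" unfolding dpow_def using natf_subring[OF vge0_subring] vge0_pow[OF piv] vge0_mult by blast
  hence "dpow un j**m : vge (- real N)" using vge0_mult m(1) by blast
  hence "c1**(dpow un j**m) : vge 0" using vge_mult[OF c1N] by fastforce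
  thus ?case unfolding gx using a2 vge_add vge0_mult[OF vge0_pow[OF piv] c2] by simp
 qed simp
 \<comment> \<open>The errors in \<open>I\<close> have first coordinates outside \<open>F2\<close>
   as well; the intersection removes them.\<close>
 define G' where "G' = ?G \<inter> (F2 \<times> carrier R)"
 have F2d: "subring (F2 \<times> carrier R) dual"
 proof (rule D.subringI)
  note s = subringE[OF subfieldE(1)[OF F2(1)]]
  have F2c: "x : carrier R" if "x : F2" for x using s(1) that by blast
  show "F2 \<times> carrier R <= carrier dual" using s(1) by auto
  show "\<one>\<^sub>dual : F2 \<times> carrier R" using s(3) by simp
  show "--\<^sub>dual h : F2 \<times> carrier R" if "h : F2 \<times> carrier R" for h using that s(5) dual_inv F2c by (cases h) auto
  show "h1 **\<^sub>dual h2 : F2 \<times> carrier R" "h1 ++\<^sub>dual h2 : F2 \<times> carrier R" if "h1 : F2 \<times> carrier R" "h2 : F2 \<times> carrier R" for h1 h2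
   using that s(6,7) F2c by (cases h1; cases h2; auto)+
 qed
 have G's: "subring G' dual" unfolding G'_def using D.subring_inter[OF sub F2d] .
 have G'1: "x : F2 \<inter> vge 0 & y : vge (- real N)" if "(x, y) : G'" for x y
 proof -
  obtain g i where gi: "(x, y) = g ++\<^sub>dual i" "g : D.pspan G z e" "i : I" "x : F2" using `(x, y) : G'` by (auto simp: G'_def)
  obtain g1 g2 where gg: "g = (g1, g2)" by (cases g)
  obtain i1 i2 where ii: "i = (i1, i2)" by (cases i)
  have "x = g1 ++ i1" "y = g2 ++ i2" using gi(1) gg ii by auto
  thus ?thesis using psnd[OF gi(2)] gi(3,4) gg ii vge_add Nv Nv2 by (auto simp: I_def)
 qed
 have lift: "EX y. (x, y) : D.pspan G z j" if "x : pspan ?O un j" for x j using that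
 proof (induction j arbitrary: x)
  case (Suc j)
  obtain x' c where x: "x = x' ++ c**un[^]j" "x' : pspan ?O un j" "c : ?O" using Suc.prems by auto
  obtain y where y: "(x', y) : D.pspan G z j" using Suc.IH[OF x(2)] by blast
  obtain d where d: "(c, d) : G" using G2[OF x(3)] by blast
  have "(x', y) ++\<^sub>dual (c, d) **\<^sub>dual z [^]\<^sub>dual j : D.pspan G z (Suc j)" using y d by auto
  moreover have "(x', y) ++\<^sub>dual (c, d) **\<^sub>dual z [^]\<^sub>dual j = (x, y ++ (c**(dpow un j**m) ++ un[^]j**d))"
   unfolding z_def dual_pow[OF pi(1) mc] x(1) by simp
  ultimately show ?case by metis
 qed auto
 have G'2: "EX y. (x, y) : G'" if x: "x : F2 \<inter> vge 0" for x
 proof -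
  obtain J :: nat where J: "real J * w un >= real N" using pp reals_Archimedean3 by (metis less_le)
  obtain c where c: "c : pspan ?O un e" "x -- c : vge (real J * w un)" using uniformizer_expansion[OF F1 pi e gam val1 F2 om val2 res x] by blast
  obtain y where y: "(c, y) : D.pspan G z e" using lift[OF c(1)] by blast
  have yc: "c : carrier R" "y : carrier R" using D.pspan_closed[OF Ga z y] by auto
  have xc: "x : carrier R" using x vge_carrier by blast
  have "(x -- c, \<zero>) : I" using vge_mono[OF c(2) J] by (simp add: I_def)
  moreover have "(x, y) = (c, y) ++\<^sub>dual (x -- c, \<zero>)" using yc xc diff_add_cancel by simp
  ultimately show ?thesis unfolding G'_def using x y yc by blast
 qed
 have G'0: "(\<zero>, y) : G' <-> y : vge 0" for y
 proof
  assume "(\<zero>, y) : G'"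
  then obtain g i where gi: "(\<zero>, y) = g ++\<^sub>dual i" "g : D.pspan G z e" "i : I" by (auto simp: G'_def)
  obtain g1 g2 where gg: "g = (g1, g2)" by (cases g)
  obtain i1 i2 where ii: "i = (i1, i2)" by (cases i)
  have e0: "\<zero> = g1 ++ i1" "y = g2 ++ i2" using gi(1) gg ii by auto
  have i: "i1 : vge (real N)" "i2 : vge 0" using gi(3) ii by (auto simp: I_def)
  have "g1 : carrier R" using D.pspan_closed[OF Ga z gi(2)] gg by simp
  hence "g1 = -- i1" using e0(1) vge_carrier[OF i(1)] by (metis minus_equality)
  hence "g1 : vge (real N)" using vge_neg[OF i(1)] by simp
  thus "y : vge 0" using ker[OF gi(2)] gg e0(2) i(2) vge_add by simp
 next
  assume y: "y : vge 0"
  have "\<zero>\<^sub>dual : D.pspan G z e" using D.pspan_zero[OF Ga z] .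
  moreover have "(\<zero>, y) : I" using y by (simp add: I_def)
  moreover have "(\<zero>, y) = \<zero>\<^sub>dual ++\<^sub>dual (\<zero>, y)" using vge_carrier[OF y] by simp
  ultimately have "(\<zero>, y) : ?G" by blast
  thus "(\<zero>, y) : G'" unfolding G'_def using vge_carrier[OF y] subringE(2)[OF subfieldE(1)[OF F2(1)]] by simp
 qed
 have pG: "g : ?G" if "g : D.pspan G z e" for g
 proof -
  have "g = g ++\<^sub>dual \<zero>\<^sub>dual" using D.pspan_closed[OF Ga z that] by (metis D.r_zero)
  moreover have "\<zero>\<^sub>dual : I" by (simp add: I_def)
  ultimately show ?thesis using that by blast
 qed
 have "G <= G'"
 proof
  fix g assume g: "g : G"
  have gc: "g : carrier dual" using subringE(1)[OF Gs] g by blast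
  have g0: "g **\<^sub>dual z [^]\<^sub>dual (0::nat) : D.pspan G z e" using e(1) by (intro D.pspan_monom[OF Ga z g]) simp
  have g1: "g **\<^sub>dual z [^]\<^sub>dual (0::nat) = g" unfolding D.nat_pow_0 by (rule D.r_one[OF gc])
  have "g : ?G" by (rule pG[OF g0[unfolded g1]])
  thus "g : G'" unfolding G'_def using G1[of "fst g" "snd g"] g F2(2) gc by (cases g) auto
 qed
 \<comment> \<open>For \<open>e = 1\<close> the span contains only elements of \<open>G\<close>, so
   \<open>un\<close> itself is available only from \<open>e = 2\<close> on.\<close>
 moreover have "(un, m) : G'" if "e >= 2"
 proof -
  have g0: "\<one>\<^sub>dual **\<^sub>dual z [^]\<^sub>dual (1::nat) : D.pspan G z e" by (rule D.pspan_monom[OF Ga z subringE(3)[OF Gs]]) (use that in simp)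
  have g1: "\<one>\<^sub>dual **\<^sub>dual z [^]\<^sub>dual (1::nat) = z" unfolding D.nat_pow_eone[OF z] by (rule D.l_one[OF z])
  have "z : ?G" by (rule pG[OF g0[unfolded g1]])
  thus ?thesis unfolding G'_def z_def using F2(3) mc by simp
 qed
 ultimately show ?thesis unfolding der_graph_def using G's G'1 G'2 G'0 by (intro exI[of _ G']) blast
qed

end

context valued_field
begin

interpretation D: cring dual by (rule dual_cring)

text \<open>The image of a combination of powers of \<open>un\<close> depends affinely on the image
  \<open>m\<close> of \<open>un\<close>: \<open>t\<close> comes from the derivatives of the
  coefficients, \<open>u\<close> from the formal derivative of the polynomial. This turns the
  extension problem into a linear equation for \<open>m\<close>.\<close>

lemma dual_pspan_lift:
 assumes F1: "subfield F1 R" and pi: "un : carrier R" "un : vge 0" and G: "der_graph N1 F1 G"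
 shows "a : pspan (F1 \<inter> vge 0) un j ==> EX t u. t : vge (- N1) & u : pspan F1 un (j - 1) &
  (ALL m:carrier R. (a, t ++ u**m) : D.pspan G (un, m) j)"
proof (induction j arbitrary: a)
 case 0
 thus ?case by (intro exI[of _ \<zero>]) simp
next
 case (Suc j)
 note F1s = subfieldE(1)[OF F1]
 note Fa = subring_additive_subgroup[OF F1s]
 obtain a' c where a: "a = a' ++ c**un[^]j" "a' : pspan (F1 \<inter> vge 0) un j" "c : F1 \<inter> vge 0" using Suc.prems by auto
 obtain t u where tu: "t : vge (- N1)" "u : pspan F1 un (j - 1)"
  "ALL m:carrier R. (a', t ++ u**m) : D.pspan G (un, m) j" using Suc.IH[OF a(2)] by blast
 obtain y where y: "(c, y) : G" using G a(3) unfolding der_graph_def by blast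
 have yv: "y : vge (- N1)" using G y unfolding der_graph_def by blast
 have c: "c : carrier R" "y : carrier R" "t : carrier R" "u : carrier R" using a(3) yv tu(1) vge_carrier pspan_closed[OF Fa pi(1) tu(2)] by auto
 let ?t = "t ++ un[^]j**y" and ?u = "u ++ c**dpow un j"
 have "?t : vge (- N1)" using vge_add[OF tu(1) vge0_mult[OF vge0_pow[OF pi(2)] yv]] .
 moreover have "?u : pspan F1 un j"
 proof (cases j)
  case 0
  thus ?thesis using tu(2) c pi by (simp add: dpow_def)
 next
  case (Suc i)
  have "c**natf j : F1" using a(3) natf_subring[OF F1s] subringE(6)[OF F1s] by blast
  hence "(c**natf j)**un[^]i : pspan F1 un j" using Suc by (intro pspan_monom[OF Fa pi(1)]) auto
  moreover have "(c**natf j)**un[^]i = c**dpow un j" using c pi Suc by (simp add: dpow_def m_assoc del: natf_simps)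
  moreover have "u : pspan F1 un j" using pspan_le[OF Fa pi(1) _ tu(2)] by simp
  ultimately show ?thesis using pspan_add[OF Fa pi(1)] by simp
 qed
 moreover have "(a, ?t ++ ?u**m) : D.pspan G (un, m) (Suc j)" if m: "m : carrier R" for m
 proof -
  have "(a', t ++ u**m) ++\<^sub>dual (c, y) **\<^sub>dual (un, m) [^]\<^sub>dual j : D.pspan G (un, m) (Suc j)" using bspec[OF tu(3) m] y by auto
  moreover have "(a', t ++ u**m) ++\<^sub>dual (c, y) **\<^sub>dual (un, m) [^]\<^sub>dual j = (a, ?t ++ ?u**m)"
   unfolding dual_pow[OF pi(1) m] a(1) using c m pi dpow_closed[OF pi(1), of j] by (simp add: l_distr m_assoc a_ac)
  ultimately show ?thesis by metis
 qed
 ultimately show ?case by (metis diff_Suc_1)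
qed

text \<open>Differentiating the approximate equation \<open>un^e = a\<close> gives
  \<open>v m = t\<close>. In \<open>v\<close> the term \<open>natf e**un[^](e - 1)\<close> cannot
  cancel against lower powers of \<open>un\<close>, so \<open>v\<close> is nonzero and
  \<open>m\<close> exists, with a denominator controlled by the value of that term.\<close>

lemma der_graph_solve:
 fixes e :: nat
 assumes F1: "subfield F1 R" and pi: "un : carrier R" "un ~= \<zero>" and e: "e >= 1" "real e * w un = gam" and gam: "gam > 0"
  and val1: "!!x. x : F1 ==> x ~= \<zero> ==> EX k::int. w x = of_int k * gam"
  and F2: "subfield F2 R" "F1 <= F2" "un : F2" and om: "og : F1" "og ~= \<zero>" "w og = gam"
  and val2: "!!x. x : F2 ==> x ~= \<zero> ==> EX k::int. w x = of_int k * w un"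
  and res: "!!x. x : F2 \<inter> vge 0 ==> EX s:F1 \<inter> vge 0. x -- s : vgt 0"
  and G: "der_graph N1 F1 G" "0 <= N1" and q: "(q, \<zero>) : G" "q ~= \<zero>" "w q = 1"
  and ne: "natf e ~= \<zero>"
 shows "EX N G2. der_graph N F2 G2 & G <= G2"
proof -
 let ?O = "F1 \<inter> vge 0"
 have O: "subring ?O R" using subring_inter[OF subfieldE(1)[OF F1] vge0_subring] .
 note F1s = subfieldE(1)[OF F1]
 note Fa = subring_additive_subgroup[OF F1s]
 have pp: "w un > 0" using pi_pos[OF F1 pi e gam val1] .
 have piv: "un : vge 0" using pi pp by (simp add: vge_def)
 have d: "dpow un e : carrier R" "dpow un e ~= \<zero>" using nonzero_mult[OF _ _ ne nonzero_pow[OF pi]] pi by (auto simp: dpow_def)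
 obtain N :: nat where N: "real N >= N1 + \<bar>w (dpow un e)\<bar>" using real_arch_simple by blast
 have oneF: "un[^]e : F2 \<inter> vge 0" using pow_in_subfield[OF F2(1,3)] vge0_pow[OF piv] by blast
 obtain J :: nat where J: "real J * w un >= real N" using pp reals_Archimedean3 by (metis less_le)
 obtain a where a: "a : pspan ?O un e" "un[^]e -- a : vge (real J * w un)" using uniformizer_expansion[OF F1 pi e gam val1 F2 om val2 res oneF] by blast
 obtain t u where tu: "t : vge (- N1)" "u : pspan F1 un (e - 1)"
  "ALL m:carrier R. (a, t ++ u**m) : D.pspan G (un, m) e" using dual_pspan_lift[OF F1 pi(1) piv G(1) a(1)] by blast
 have c: "t : carrier R" "u : carrier R" using tu(1) vge_carrier pspan_closed[OF Fa pi(1) tu(2)] by auto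
 \<comment> \<open>The derivative at \<open>un\<close> of the polynomial that expresses
   \<open>un[^]e\<close> minus its expansion; it is the coefficient of \<open>m\<close> in the
   equation to be solved.\<close>
 define v where "v = dpow un e -- u"
 have vc: "v : carrier R" using d c by (simp add: v_def)
 have v: "dpow un e : vge r" if "v : vge r" for r
 proof -
  have "v = -- u ++ natf e**un[^](e - 1)" using c pi by (simp add: v_def dpow_def a_minus_def a_comm)
  hence "-- u ++ natf e**un[^](e - 1) : vge r" using that by simp
  thus ?thesis using pspan_top_value[OF F1 pi e gam val1 pspan_neg[OF Fa pi(1) tu(2)] _ natf_subring[OF F1s]] e(1) by (simp add: dpow_def)
 qed
 have v0: "v ~= \<zero>"
 proof
  assume "v = \<zero>"
  hence "dpow un e : vge (w (dpow un e) + 1)" using v by simp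
  thus False using d by (simp add: vge_def)
 qed
 have "v : vge (w v)" using vc by (simp add: vge_def)
 hence wv: "w v <= w (dpow un e)" using v d by (auto simp: vge_def)
 note iv = inv_facts[OF vc v0]
 define m where "m = inv v**t"
 have "inv v : vge (- w v)" using iv w_inv[OF vc v0] by (simp add: vge_def)
 hence "m : vge (- w v + - N1)" unfolding m_def using vge_mult tu(1) by blast
 moreover have "- real N <= - w v + - N1" using wv N by linarith
 ultimately have m: "m : vge (- real N)" by (rule vge_mono)
 have mc: "m : carrier R" using m vge_carrier by blast
 have "v**m = t" using iv vc c by (simp add: m_def m_assoc[symmetric])
 have "dpow un e**m -- (t ++ u**m) = v**m -- t"
 proof -
  have "x**m -- (t ++ u**m) = (x -- u)**m -- t" if "x : carrier R" for x using that c mc by algebra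
  thus ?thesis using d by (simp add: v_def)
 qed
 hence z: "dpow un e**m -- (t ++ u**m) : vge 0" using `v**m = t` c by (simp add: a_minus_def r_neg)
 have N1: "N1 <= real N" using N by linarith
 show ?thesis using der_graph_extend[OF F1 pi e gam val1 F2 om val2 res G(1) q m G(2) N1 bspec[OF tu(3) mc] vge_mono[OF a(2) J] z] by blast
qed

lemma pspan_subring_contains:
 assumes F: "subring F R" and z: "z : carrier R" "z[^]e : pspan F z e" "e >= 1"
 shows "simple_extension F z <= pspan F z e"
proof (rule simple_extension_subring_incl[OF subring_pspan[OF F z]])
 note Fa = subring_additive_subgroup[OF F]
 show "F <= pspan F z e"
 proof
  fix c assume c: "c : F"
  hence "c**z[^](0::nat) : pspan F z e" using z(3) by (intro pspan_monom[OF Fa z(1)]) auto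
  thus "c : pspan F z e" using c subringE(1)[OF F] by auto
 qed
 show "z : pspan F z e"
 proof (cases "e = 1")
  case True
  thus ?thesis using z by simp
 next
  case False
  hence "\<one>**z[^](1::nat) : pspan F z e" using z(3) subringE(3)[OF F] by (intro pspan_monom[OF Fa z(1)]) auto
  thus ?thesis using z(1) by simp
 qed
qed

text \<open>
  The polynomial \<open>T^p + p T - p\<close> is Eisenstein over \<open>F\<close>, and the derivation sends its root
  \<open>bt\<close> to the inverse of the value of the derivative of that polynomial at \<open>bt\<close>.
\<close>
lemma exists_derivation:
 assumes F: "subfield F R" and int: "!!x. x : F ==> x ~= \<zero> ==> w x : \<int>"
  and res: "!!x. x : vge 0 ==> EX s:F \<inter> vge 0. x -- s : vgt 0"
  and alg: "!!x. x : carrier R ==> integral_over F x"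
  and p: "p >= 2" "w (natf p) = 1" and char: "!!n. n >= 1 ==> natf n ~= \<zero>"
  and bt: "bt : carrier R" "bt[^]p = natf p -- natf p**bt" and Y: "finite Y" "Y <= carrier R"
 shows "EX F2 N G m. subfield F2 R & F <= F2 & Y <= F2 & der_graph N F2 G & (F \<inter> vge 0) \<times> vge 0 <= G &
  (bt, m) : G & natf p**(\<one> ++ bt[^](p - 1))**m = \<one>"
proof -
 define q where "q = natf p"
 have Fs: "subring F R" using subfieldE(1)[OF F] .
 note Fa = subring_additive_subgroup[OF Fs]
 have q: "q : F" "q : carrier R" "q ~= \<zero>" "w q = 1" using natf_subring[OF Fs] char[of p] p by (auto simp: q_def)
 have qv: "q : vge 1" "q : vge 0" using q by (auto simp: vge_def)
 have b: "bt[^]p = q -- q**bt" using bt(2) by (simp add: q_def)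
 have b0: "bt ~= \<zero>"
 proof
  assume "bt = \<zero>"
  hence "q = \<zero>" using b q p(1) nat_pow_zero[of p] by (simp add: a_minus_def)
  thus False using q by simp
 qed
 have eb: "q -- q**bt = q**(\<one> -- bt)"
 proof -
  have "q**(\<one> -- bt) = q**\<one> -- q**bt" using q(2) bt(1) by algebra
  thus ?thesis using q by simp
 qed
 have wp: "w (bt[^]p) = real p * w bt" using w_pow[OF bt(1) b0] .
 have bp0: "bt[^]p ~= \<zero>" using nonzero_pow[OF bt(1) b0] .
 \<comment> \<open>For \<open>w bt <= 0\<close> the equation would give
   \<open>1 + w bt <= p w bt\<close>, while \<open>p w bt <= w bt\<close>. Positivity makes
   \<open>\<one> -- bt\<close> a unit, so that \<open>w bt = 1 / p\<close>.\<close>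
 have bv: "bt : vgt 0"
 proof (rule ccontr)
  assume n: "bt ~: vgt 0"
  hence wb: "w bt <= 0" using bt(1) by (simp add: vgt_def)
  have "\<one> : vge (w bt)" "bt : vge (w bt)" using wb bt(1) by (auto simp: vge_def)
  hence "q**(\<one> -- bt) : vge (1 + w bt)" using vge_mult[OF qv(1)] vge_minus by blast
  hence "1 + w bt <= real p * w bt" using b eb bp0 wp by (simp add: vge_def)
  moreover have "real p * w bt <= w bt" using wb p(1) mult_right_mono_neg[of 1 "real p" "w bt"] by simp
  ultimately show False by simp
 qed
 have "-- bt : vgt (w \<one>)" using vgt_neg[OF bv] by simp
 hence ub: "\<one> -- bt ~= \<zero>" "w (\<one> -- bt) = 0" using w_add_less[of \<one> "-- bt"] by (auto simp: a_minus_def)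
 have pb: "real p * w bt = 1" using wp b eb w_mult[of q "\<one> -- bt"] q ub bt(1) by simp
 have wb0: "w bt > 0" using bv b0 by (simp add: vgt_def)
 have bv0: "bt : vge 0" using vgt_vge[OF bv] .
 let ?F1 = "simple_extension F bt"
 have F1: "subfield ?F1 R" using simple_extension_is_subfield[OF F bt(1)] algebraic_iff_integral[OF F bt(1)] alg[OF bt(1)] by blast
 have F1s: "subring ?F1 R" using subfieldE(1)[OF F1] .
 have FF1: "F <= ?F1" and bF1: "bt : ?F1" using simple_extension_incl[OF subfieldE(3)[OF F] bt(1)] simple_extension_mem[OF Fs bt(1)] by auto
 have val: "EX k::int. w x = of_int k * 1" if "x : F" "x ~= \<zero>" for x using int[OF that] by (auto elim: Ints_cases)
 have bpin: "bt[^]p : pspan F bt p"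
 proof -
  have "q**bt[^](0::nat) : pspan F bt p" "q**bt[^](1::nat) : pspan F bt p" by (rule pspan_monom[OF Fa bt(1) q(1)], use p(1) in linarith)+
  hence "q**bt[^](0::nat) -- q**bt[^](1::nat) : pspan F bt p" using pspan_minus[OF Fa bt(1)] by blast
  thus ?thesis using b q bt(1) by simp
 qed
 have F1p: "?F1 <= pspan F bt p" using pspan_subring_contains[OF Fs bt(1) bpin] p(1) by simp
 have p1: "p >= 1" using p(1) by simp
 have val1: "EX k::int. w x = of_int k * w bt" if x: "x : ?F1" "x ~= \<zero>" for x
 proof -
  obtain k :: int and i where k: "w x = of_int k * 1 + real i * w bt" using pspan_value[OF F bt(1) b0 p1 pb zero_less_one val, of x p] F1p x by auto
  hence "w x = of_int (k * int p + int i) * w bt" using pb by (simp add: algebra_simps)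
  thus ?thesis by blast
 qed
 define G0 where "G0 = (F \<inter> vge 0) \<times> vge 0"
 have O: "subring (F \<inter> vge 0) R" using subring_inter[OF Fs vge0_subring] .
 have G0s: "subring G0 dual"
 proof (rule D.subringI)
  note sO = subringE[OF O] and sW = subringE[OF vge0_subring]
  have Oc: "x : carrier R" if "x : vge 0" for x using vge_carrier that by blast
  show "G0 <= carrier dual" using Oc by (auto simp: G0_def)
  show "\<one>\<^sub>dual : G0" using sO(3) sW(2) by (simp add: G0_def)
  show "--\<^sub>dual h : G0" if "h : G0" for h using that sO(5) sW(5) dual_inv Oc by (cases h) (auto simp: G0_def)
  show "h1 **\<^sub>dual h2 : G0" "h1 ++\<^sub>dual h2 : G0" if "h1 : G0" "h2 : G0" for h1 h2 using that sO(6,7) sW(6,7) by (cases h1; cases h2; auto simp: G0_def)+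
 qed
 have G0: "der_graph 0 F G0" unfolding der_graph_def using G0s subringE(2)[OF Fs] by (auto simp: G0_def intro: exI[of _ \<zero>])
 \<comment> \<open>The derivative of \<open>T^p + q T\<close> at \<open>bt\<close>. Its value is
   exactly one, so its inverse \<open>m\<close> has one factor \<open>q\<close> in the denominator
   and the extension works with \<open>N = 1\<close>.\<close>
 define v where "v = dpow bt p ++ q"
 have "bt[^](p - 1) : vgt 0"
 proof -
  have "p - 1 = Suc (p - 2)" using p(1) by simp
  thus ?thesis using vgt_mult[OF vge0_pow[OF bv0, of "p - 2"] bv] by simp
 qed
 hence "bt[^](p - 1) : vgt (w \<one>)" by simp
 hence u1: "\<one> ++ bt[^](p - 1) ~= \<zero>" "w (\<one> ++ bt[^](p - 1)) = 0" using w_add_less[of \<one> "bt[^](p - 1)"] by auto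
 have v1: "v = q**(\<one> ++ bt[^](p - 1))" unfolding v_def dpow_def q_def[symmetric] using q bt(1) by (simp add: r_distr a_comm)
 have v: "v : carrier R" "v ~= \<zero>" "w v = 1" unfolding v1 using nonzero_mult[of q "\<one> ++ bt[^](p - 1)"] w_mult[of q "\<one> ++ bt[^](p - 1)"] u1 q bt(1) by auto
 define m where "m = inv v"
 have m: "m : carrier R" "m ~= \<zero>" "w m = -1" "v**m = \<one>" using inv_facts[OF v(1,2)] w_inv[OF v(1,2)] v(3) by (auto simp: m_def)
 have mv: "m : vge (- real 1)" using m by (simp add: vge_def)
 \<comment> \<open>The right side of \<open>bt^p = q - q bt\<close> together with its derivative, as
   an element of the span over the zero derivation.\<close>
 have H: "(q -- q**bt, -- (q**m)) : D.pspan G0 (bt, m) p"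
 proof -
  note G0a = D.subring_additive_subgroup[OF G0s]
  have bm: "(bt, m) : carrier dual" using bt(1) m by simp
  have g: "(q, \<zero>) : G0" using q qv by (simp add: G0_def)
  have h0: "(q, \<zero>) **\<^sub>dual (bt, m) [^]\<^sub>dual (0::nat) : D.pspan G0 (bt, m) p" by (rule D.pspan_monom[OF G0a bm g]) (use p(1) in simp)
  have h1: "(q, \<zero>) **\<^sub>dual (bt, m) [^]\<^sub>dual (1::nat) : D.pspan G0 (bt, m) p" by (rule D.pspan_monom[OF G0a bm g]) (use p(1) in simp)
  have "(q, \<zero>) **\<^sub>dual (bt, m) [^]\<^sub>dual (0::nat) --\<^sub>dual (q, \<zero>) **\<^sub>dual (bt, m) [^]\<^sub>dual (1::nat) =
   (q -- q**bt, -- (q**m))" unfolding D.nat_pow_eone[OF bm] D.nat_pow_0 using q bt(1) m by (simp add: dual_inv a_minus_def)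
  thus ?thesis using D.pspan_minus[OF G0a bm h0 h1] by simp
 qed
 have z1: "bt[^]p -- (q -- q**bt) : vge (real 1)" using b q bt(1) by (simp add: a_minus_def r_neg)
 have z2: "dpow bt p**m -- -- (q**m) : vge 0"
 proof -
  have "dpow bt p**m -- -- (q**m) = v**m" using q m bt(1) by (simp add: v_def l_distr a_minus_def)
  thus ?thesis using m(4) subringE(3)[OF vge0_subring] by simp
 qed
 have res1: "EX s:F \<inter> vge 0. x -- s : vgt 0" if "x : ?F1 \<inter> vge 0" for x using res that by blast
 have "EX G1. der_graph (real 1) ?F1 G1 & G0 <= G1 & (p >= 2 --> (bt, m) : G1)"
  by (rule der_graph_extend[OF F bt(1) b0 p1 pb zero_less_one val F1 FF1 bF1 q(1,3,4) val1 res1 G0 _ q(3,4) mv _ _ H z1 z2])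
   (use q qv in \<open>auto simp: G0_def\<close>)
 then obtain G1 where G1: "der_graph 1 ?F1 G1" "G0 <= G1" "(bt, m) : G1" using p(1) by auto
 \<comment> \<open>The elements of \<open>Y\<close> are adjoined in one finite extension of
   \<open>?F1\<close>. Its ramification index is nonzero in \<open>R\<close> by \<open>char\<close>,
   as solving for the image of a uniformizer requires.\<close>
 obtain xs where xs: "set xs = Y" using Y(1) finite_list by blast
 let ?F2 = "finite_extension ?F1 xs"
 have alg1: "(algebraic over ?F1) x" if "x : set xs" for x using algebraic_iff_integral[OF F1] integral_over_mono[OF alg FF1] that xs Y(2) by blast
 have xsc: "set xs <= carrier R" using xs Y by simp
 have F2: "subfield ?F2 R" using finite_extension_is_subfield[OF F1 xsc alg1] by blast
 have F12: "?F1 <= ?F2" using finite_extension_incl[OF subfieldE(3)[OF F1] xsc] .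
 have YF2: "Y <= ?F2" using finite_extension_mem[OF F1s xsc] xs by simp
 obtain D where D: "dimension D ?F1 ?F2" using finite_extension_finite_dimension(1)[OF F1 xsc alg1] by (auto simp: finite_dimension_def)
 obtain un where pi: "un : ?F2" "un ~= \<zero>" "w un > 0" "!!x. x : ?F2 ==> x ~= \<zero> ==> EX k::int. w x = of_int k * w un"
  using exists_uniformizer[OF F1 F2 D wb0 val1 subsetD[OF F12 bF1] b0 refl] by blast
 obtain k :: int where k: "w bt = of_int k * w un" using pi(4)[OF subsetD[OF F12 bF1] b0] by blast
 have "k > 0" using k wb0 pi(3) by (simp add: zero_less_mult_iff)
 hence e: "nat k >= 1" "real (nat k) * w un = w bt" using k by auto
 have pic: "un : carrier R" using pi(1) subfieldE(3)[OF F2] by blast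
 have q0G: "(q, \<zero>) : G1" using G1(2) q qv by (auto simp: G0_def)
 have res2: "EX s:?F1 \<inter> vge 0. x -- s : vgt 0" if "x : ?F2 \<inter> vge 0" for x using res[of x] that FF1 by blast
 have "EX N G2. der_graph N ?F2 G2 & G1 <= G2"
  by (rule der_graph_solve[OF F1 pic pi(2) e wb0 val1 F2 F12 pi(1) bF1 b0 refl pi(4) res2 G1(1) _ q0G q(3,4) char[OF e(1)]]) simp_all
 then obtain N G2 where G2: "der_graph N ?F2 G2" "G1 <= G2" by blast
 have "natf p**(\<one> ++ bt[^](p - 1))**m = \<one>" using m(4) unfolding v1 q_def .
 thus ?thesis using F2 YF2 G2 G1 FF1 F12 unfolding G0_def by (intro exI[of _ ?F2] exI[of _ N] exI[of _ G2] exI[of _ m]) blast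
qed

end

section \<open>Quotient modules and torsion\<close>

context module
begin

lemma add_pow_smult: "x : carrier M ==> [(n::nat)] \<cdot>\<^bsub>M\<^esub> x = ([n] \<cdot>\<^bsub>R\<^esub> \<one>) \<odot>\<^sub>M x"
proof (induction n)
 case 0
 thus ?case by simp
next
 case (Suc n)
 thus ?case by (simp add: smult_l_distr)
qed

lemma smult_minus_distr: "a : carrier R ==> x : carrier M ==> y : carrier M ==>
  a \<odot>\<^sub>M (x --\<^sub>M y) = a \<odot>\<^sub>M x --\<^sub>M a \<odot>\<^sub>M y" by (simp add: a_minus_def smult_r_distr smult_r_minus)

context
 fixes N assumes N: "submodule N R M"
begin

lemma sub_abelian: "abelian_subgroup N M" using N abelian_subgroupI3[of N M] M.abelian_group_axioms by (simp add: submodule_def additive_subgroup_def)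

lemma N_sub: "N <= carrier M" using submoduleE(1)[OF N] .

lemma N_zero: "\<zero>\<^sub>M : N" using submoduleE(2,4)[OF N] N_sub R.zero_closed smult_l_null by (metis ex_in_conv subsetD)

lemma coset_mem: "x : carrier M ==> y : N +>\<^bsub>M\<^esub> x <-> y : carrier M & y --\<^sub>M x : N"
proof -
 assume x: "x : carrier M"
 have "y : N +>\<^bsub>M\<^esub> x <-> (EX n:N. y = n ++\<^sub>M x)" by (auto simp: a_r_coset_def')
 also have "\<dots> <-> y : carrier M & y --\<^sub>M x : N"
 proof
  assume "EX n:N. y = n ++\<^sub>M x"
  then obtain n where n: "n : N" "y = n ++\<^sub>M x" by blast
  hence "n : carrier M" using N_sub by blast
  thus "y : carrier M & y --\<^sub>M x : N" using n x by (simp add: a_minus_def M.a_assoc M.r_neg)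
 next
  assume y: "y : carrier M & y --\<^sub>M x : N"
  hence "y = (y --\<^sub>M x) ++\<^sub>M x" using x by (simp add: a_minus_def M.a_assoc M.l_neg)
  thus "EX n:N. y = n ++\<^sub>M x" using y by blast
 qed
 finally show ?thesis .
qed

lemma coset_eq_iff: "x : carrier M ==> y : carrier M ==> N +>\<^bsub>M\<^esub> x = N +>\<^bsub>M\<^esub> y <-> x --\<^sub>M y : N"
proof
 assume xy: "x : carrier M" "y : carrier M"
 {
  assume "N +>\<^bsub>M\<^esub> x = N +>\<^bsub>M\<^esub> y"
  moreover have "x : N +>\<^bsub>M\<^esub> x" using abelian_subgroup.a_rcos_self[OF sub_abelian xy(1)] .
  ultimately show "x --\<^sub>M y : N" using coset_mem[OF xy(2)] by blast
 next
  assume "x --\<^sub>M y : N"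
  hence "x : N +>\<^bsub>M\<^esub> y" using coset_mem[OF xy(2)] xy by blast
  thus "N +>\<^bsub>M\<^esub> x = N +>\<^bsub>M\<^esub> y" using M.a_repr_independence[OF _ xy(2)] N by (auto simp: submodule_def)
 }
qed

lemma quotient_carrier: "carrier (quotient_module M N) = (%x. N +>\<^bsub>M\<^esub> x) ` carrier M" by (auto simp: quotient_module_def A_RCOSETS_def' )

lemma quotient_closed: "x : carrier M ==> N +>\<^bsub>M\<^esub> x : carrier (quotient_module M N)" using quotient_carrier by blast

lemma quotient_zero: "\<zero>\<^bsub>quotient_module M N\<^esub> = N +>\<^bsub>M\<^esub> \<zero>\<^sub>M"
 using M.a_coset_add_zero[OF N_sub] by (simp add: quotient_module_def)

lemma quotient_add: "x : carrier M ==> y : carrier M ==>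
  (N +>\<^bsub>M\<^esub> x) ++\<^bsub>quotient_module M N\<^esub> (N +>\<^bsub>M\<^esub> y) = N +>\<^bsub>M\<^esub> (x ++\<^sub>M y)"
 using abelian_subgroup.a_rcos_sum[OF sub_abelian] by (simp add: quotient_module_def)

lemma quotient_smult:
 assumes b: "b : carrier R" and x: "x : carrier M"
 shows "b \<odot>\<^bsub>quotient_module M N\<^esub> (N +>\<^bsub>M\<^esub> x) = N +>\<^bsub>M\<^esub> (b \<odot>\<^sub>M x)"
proof -
 have "N +>\<^bsub>M\<^esub> (b \<odot>\<^sub>M y) = N +>\<^bsub>M\<^esub> (b \<odot>\<^sub>M x)" if "y : N +>\<^bsub>M\<^esub> x" for y
 proof -
  have y: "y : carrier M" "y --\<^sub>M x : N" using coset_mem[OF x] that by auto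
  have "b \<odot>\<^sub>M y --\<^sub>M b \<odot>\<^sub>M x : N" using submoduleE(4)[OF N b y(2)] smult_minus_distr[OF b y(1) x] by simp
  thus ?thesis using coset_eq_iff b x y by simp
 qed
 moreover have "x : N +>\<^bsub>M\<^esub> x" using abelian_subgroup.a_rcos_self[OF sub_abelian x] .
 ultimately have "(\<Union>y\<in>N +>\<^bsub>M\<^esub> x. N +>\<^bsub>M\<^esub> (b \<odot>\<^sub>M y)) = N +>\<^bsub>M\<^esub> (b \<odot>\<^sub>M x)" by blast
 thus ?thesis by (simp add: quotient_module_def)
qed

lemma quotient_is_module: "module R (quotient_module M N)"
proof (rule moduleI)
 let ?Q = "quotient_module M N"
 have ex: "EX x. x : carrier M & c = N +>\<^bsub>M\<^esub> x" if "c : carrier ?Q" for c using that quotient_carrier by auto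
 show "cring R" by (rule R.cring_axioms)
 show "abelian_group ?Q"
 proof (rule abelian_groupI)
  show "\<zero>\<^sub>?Q : carrier ?Q" unfolding quotient_zero using quotient_closed by simp
  fix a assume "a : carrier ?Q"
  then obtain x where x: "x : carrier M" "a = N +>\<^bsub>M\<^esub> x" using ex by blast
  show "\<zero>\<^sub>?Q ++\<^sub>?Q a = a" unfolding quotient_zero x(2) using quotient_add[OF M.zero_closed x(1)] x(1) by simp
  show "EX b:carrier ?Q. b ++\<^sub>?Q a = \<zero>\<^sub>?Q" unfolding quotient_zero x(2) using quotient_add[of "--\<^sub>M x" x] quotient_closed x(1) M.l_neg
   by (intro bexI[of _ "N +>\<^bsub>M\<^esub> (--\<^sub>M x)"]) auto
  fix b assume "b : carrier ?Q"
  then obtain y where y: "y : carrier M" "b = N +>\<^bsub>M\<^esub> y" using ex by blast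
  show "a ++\<^sub>?Q b : carrier ?Q" unfolding x(2) y(2) using quotient_add quotient_closed x y by simp
  show "a ++\<^sub>?Q b = b ++\<^sub>?Q a" unfolding x(2) y(2) using quotient_add x y M.a_comm by simp
  fix c assume "c : carrier ?Q"
  then obtain z where z: "z : carrier M" "c = N +>\<^bsub>M\<^esub> z" using ex by blast
  show "a ++\<^sub>?Q b ++\<^sub>?Q c = a ++\<^sub>?Q (b ++\<^sub>?Q c)" unfolding x(2) y(2) z(2) using quotient_add x y z M.a_assoc by simp
 qed
 show "\<one> \<odot>\<^sub>?Q x = x" if x: "x : carrier ?Q" for x
 proof -
  obtain u where u: "u : carrier M" "x = N +>\<^bsub>M\<^esub> u" using ex[OF x] by blast
  show ?thesis unfolding u(2) using quotient_smult u by simp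
 qed
 fix a x assume a: "a : carrier R" and "x : carrier ?Q"
 then obtain u where u: "u : carrier M" "x = N +>\<^bsub>M\<^esub> u" using ex by blast
 show "a \<odot>\<^sub>?Q x : carrier ?Q" unfolding u(2) using quotient_smult quotient_closed a u by simp
 {
  fix b assume b: "b : carrier R"
  show "(a ++ b) \<odot>\<^sub>?Q x = a \<odot>\<^sub>?Q x ++\<^sub>?Q b \<odot>\<^sub>?Q x" unfolding u(2) using quotient_smult quotient_add a b u smult_l_distr by simp
  show "(a**b) \<odot>\<^sub>?Q x = a \<odot>\<^sub>?Q (b \<odot>\<^sub>?Q x)" unfolding u(2) using quotient_smult a b u smult_assoc1 by simp
 }
 fix y assume "y : carrier ?Q"
 then obtain v where v: "v : carrier M" "y = N +>\<^bsub>M\<^esub> v" using ex by blast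
 show "a \<odot>\<^sub>?Q (x ++\<^sub>?Q y) = a \<odot>\<^sub>?Q x ++\<^sub>?Q a \<odot>\<^sub>?Q y"
  unfolding u(2) v(2) using quotient_smult quotient_add a u v smult_r_distr by simp
qed

end

lemma H0_p_submodule:
 fixes p :: nat
 shows "submodule {x : carrier M. EX k::nat. [(p ^ k)] \<cdot>\<^bsub>M\<^esub> x = \<zero>\<^sub>M} R M"
proof (rule submoduleI)
 let ?T = "{x : carrier M. EX k::nat. [(p ^ k)] \<cdot>\<^bsub>M\<^esub> x = \<zero>\<^sub>M}"
 have up: "[(p ^ (k + l))] \<cdot>\<^bsub>M\<^esub> x = \<zero>\<^sub>M" if "x : carrier M" "[(p ^ k)] \<cdot>\<^bsub>M\<^esub> x = \<zero>\<^sub>M" for x and k l :: nat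
 proof -
  have "[(p ^ (k + l))] \<cdot>\<^bsub>M\<^esub> x = [(p ^ l)] \<cdot>\<^bsub>M\<^esub> ([(p ^ k)] \<cdot>\<^bsub>M\<^esub> x)"
   using M.add.nat_pow_pow[OF that(1), of "p ^ l" "p ^ k"] by (simp add: power_add)
  thus ?thesis using that(2) M.add.nat_pow_one by simp
 qed
 show "?T <= carrier M" by blast
 show "\<zero>\<^sub>M : ?T" using M.add.nat_pow_one by auto
 show "--\<^sub>M a : ?T" if "a : ?T" for a using that M.add.nat_pow_inv[of a] by auto
 show "a ++\<^sub>M b : ?T" if ab: "a : ?T" "b : ?T" for a b
 proof -
  obtain k l :: nat where kl: "[(p ^ k)] \<cdot>\<^bsub>M\<^esub> a = \<zero>\<^sub>M" "[(p ^ l)] \<cdot>\<^bsub>M\<^esub> b = \<zero>\<^sub>M" using ab by blast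
  have "[(p ^ (k + l))] \<cdot>\<^bsub>M\<^esub> (a ++\<^sub>M b) = \<zero>\<^sub>M"
   using up[OF _ kl(1), of l] up[OF _ kl(2), of k] ab M.add.nat_pow_distrib[of a b "p ^ (k + l)"] by (simp add: add.commute)
  thus ?thesis using ab by blast
 qed
 show "a \<odot>\<^sub>M x : ?T" if ax: "a : carrier R" "x : ?T" for a x
 proof -
  obtain k :: nat where k: "[(p ^ k)] \<cdot>\<^bsub>M\<^esub> x = \<zero>\<^sub>M" using ax by blast
  have "[(p ^ k)] \<cdot>\<^bsub>M\<^esub> (a \<odot>\<^sub>M x) = a \<odot>\<^sub>M ([(p ^ k)] \<cdot>\<^bsub>M\<^esub> x)"
   using ax add_pow_smult smult_assoc1[symmetric] by (simp add: m_comm)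
  thus ?thesis using ax k by auto
 qed
qed

lemma H0_p_module: "module R (H0_p p M)" unfolding H0_p_def using submodule.submodule_is_module[OF H0_p_submodule] module_axioms by blast

lemma generated_submodule_is_submodule:
 assumes "S <= carrier M"
 shows "submodule (generated_submodule R M S) R M" "S <= generated_submodule R M S"
proof -
 have c: "submodule (carrier M) R M" using carrier_is_submodule .
 let ?A = "{N. submodule N R M & S <= N}"
 show "submodule (generated_submodule R M S) R M" unfolding generated_submodule_def
 proof (rule submoduleI)
  show "\<Inter>?A <= carrier M" using c assms by blast
  show "\<zero>\<^sub>M : \<Inter>?A" using N_zero by blast
 qed (use submoduleE(3-5) in blast)+
 show "S <= generated_submodule R M S" unfolding generated_submodule_def by blast
qed

lemma generated_submodule_minimal: "submodule N R M ==> S <= N ==> generated_submodule R M S <= N" unfolding generated_submodule_def by blast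

end

section \<open>An exact sequence with first term \<open>B[1/p]/B\<close>\<close>

context field
begin

lemma natf_subfield_eq: "natf (p ^ k) = natf p[^](k::nat)"
proof (induction k)
 case (Suc k)
 have m: "natf (a * b) = natf a**natf b" for a b by (induction b) (simp_all add: r_distr natf_def add.nat_pow_mult[symmetric] a_comm)
 show ?case using Suc m[of "p ^ k" p] by (simp add: mult.commute)
qed simp

context
 fixes S p assumes S: "subring S R" and p0: "natf p ~= \<zero>"
begin

abbreviation "pinv k == inv (natf p[^](k::nat))"

lemma S_cring: "cring (R\<lparr>carrier := S\<rparr>)" using subring_is_domain[OF S] by (simp add: domain_def)

lemma pinv: "pinv k : carrier R" "pinv k**natf p[^]k = \<one>" "natf p[^]k**pinv k = \<one>" using inv_facts[OF _ nonzero_pow[OF natf_closed p0], of k] by auto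

lemma invert_p_carrier: "carrier (invert_p p R S) = {s**pinv k | s k. s : S}" by (simp add: invert_p_def natf_def[symmetric] natf_subfield_eq)

lemma Sc: "s : S ==> s : carrier R" using subringE(1)[OF S] by blast

lemma np: "natf p[^](k::nat) : S" by (metis S natf_subfield_eq natf_subring)

lemma fraction_eq:
 assumes "s : S" shows "s**pinv k = (s**natf p[^]l)**pinv (k + l)"
proof -
 have c: "s : carrier R" using Sc assms .
 have "(s**natf p[^]l)**pinv (k + l)**(natf p[^]k**natf p[^]l) = s**natf p[^]l**(pinv (k + l)**natf p[^](k + l))"
  using c pinv(1)[of "k + l"] by (simp add: m_assoc nat_pow_mult)
 also have "\<dots> = s**natf p[^]l" using pinv(2)[of "k + l"] c by simp
 also have "\<dots> = s**(pinv k**natf p[^]k)**natf p[^]l" using pinv(2)[of k] c by simp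
 also have "\<dots> = (s**pinv k)**(natf p[^]k**natf p[^]l)" using c pinv(1)[of k] by (simp add: m_assoc)
 finally have e: "(s**natf p[^]l)**pinv (k + l)**(natf p[^]k**natf p[^]l) = (s**pinv k)**(natf p[^]k**natf p[^]l)" .
 have "natf p[^]k**natf p[^]l ~= \<zero>" using nonzero_mult nonzero_pow[OF natf_closed p0] by simp
 thus ?thesis using m_rcancel[of "natf p[^]k**natf p[^]l"] e c pinv(1) by simp
qed

lemma common_fraction:
 assumes "x : carrier (invert_p p R S)" "y : carrier (invert_p p R S)"
 shows "EX s:S. EX t:S. EX k. x = s**pinv k & y = t**pinv k"
proof -
 obtain s k where s: "s : S" "x = s**pinv k" using assms(1) unfolding invert_p_carrier by blast
 obtain t l where t: "t : S" "y = t**pinv l" using assms(2) unfolding invert_p_carrier by blast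
 have "x = (s**natf p[^]l)**pinv (k + l)" using fraction_eq[OF s(1), of k l] s(2) by simp
 moreover have "y = (t**natf p[^]k)**pinv (k + l)" using fraction_eq[OF t(1), of l k] t(2) by (simp add: add.commute)
 ultimately show ?thesis using s(1) t(1) np subringE(6)[OF S] by blast
qed

lemma invert_p_module: "module (R\<lparr>carrier := S\<rparr>) (invert_p p R S)"
proof (rule moduleI)
 let ?M = "invert_p p R S"
 have simps: "ring.add ?M = ring.add R" "ring.zero ?M = \<zero>" "smult ?M = (\<otimes>)" by (simp_all add: invert_p_def)
 have Mc: "x : carrier R" if "x : carrier ?M" for x using that Sc pinv(1) unfolding invert_p_carrier by auto
 have add: "x ++ y : carrier ?M" if xy: "x : carrier ?M" "y : carrier ?M" for x y
 proof -
  obtain s t k where st: "s : S" "t : S" "x = s**pinv k" "y = t**pinv k" using common_fraction[OF xy] by blast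
  have "x ++ y = (s ++ t)**pinv k" using st Sc pinv(1)[of k] by (simp add: l_distr)
  thus ?thesis unfolding invert_p_carrier using st subringE(7)[OF S] by blast
 qed
 show "cring (R\<lparr>carrier := S\<rparr>)" by (rule S_cring)
 have neg: "-- x : carrier ?M" if "x : carrier ?M" for x
 proof -
  obtain s k where s: "s : S" "x = s**pinv k" using `x : carrier ?M` unfolding invert_p_carrier by blast
  have "-- x = (-- s)**pinv k" using s Sc pinv(1) by (simp add: l_minus)
  thus ?thesis unfolding invert_p_carrier using s(1) subringE(5)[OF S] by blast
 qed
 have z: "\<zero> : carrier ?M"
 proof -
  have "\<zero> = \<zero>**pinv 0" using pinv(1) by simp
  thus ?thesis unfolding invert_p_carrier using subringE(2)[OF S] by blast
 qed
 show "abelian_group ?M"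
 proof (rule abelian_groupI)
  show "EX y:carrier ?M. y ++\<^sub>?M x = \<zero>\<^sub>?M" if "x : carrier ?M" for x using neg[OF that] Mc[OF that] l_neg unfolding simps by blast
 qed (use add z Mc in \<open>auto simp: simps a_ac\<close>)
 show "a \<odot>\<^sub>?M x : carrier ?M" if ax: "a : carrier (R\<lparr>carrier := S\<rparr>)" "x : carrier ?M" for a x
 proof -
  obtain s k where s: "s : S" "x = s**pinv k" using ax(2) unfolding invert_p_carrier by blast
  have "a**x = (a**s)**pinv k" using s Sc ax pinv(1) by (simp add: m_assoc)
  thus ?thesis unfolding invert_p_carrier simps using s ax subringE(6)[OF S] by auto
 qed
qed (use subringE(1)[OF S] pinv(1) in \<open>auto simp: invert_p_def natf_def[symmetric] natf_subfield_eq l_distr r_distr m_assoc subset_iff\<close>)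

lemma S_submodule: "submodule S (R\<lparr>carrier := S\<rparr>) (invert_p p R S)"
proof -
 interpret M: module "R\<lparr>carrier := S\<rparr>" "invert_p p R S" by (rule invert_p_module)
 have simps: "ring.add (invert_p p R S) = ring.add R" "ring.zero (invert_p p R S) = \<zero>" "smult (invert_p p R S) = (\<otimes>)" by (simp_all add: invert_p_def)
 have S_in: "S <= carrier (invert_p p R S)"
 proof
  fix s assume s: "s : S"
  have "s = s**pinv 0" using Sc[OF s] by simp
  thus "s : carrier (invert_p p R S)" unfolding invert_p_carrier using s by blast
 qed
 show ?thesis
 proof (rule M.submoduleI[OF S_in])
  fix a assume a: "a : S"
  have "-- a : S" using subringE(5)[OF S a] .
  hence "--\<^bsub>invert_p p R S\<^esub> a = -- a" using a S_in Sc[OF a] by (intro M.minus_equality) (auto simp: simps l_neg)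
  thus "--\<^bsub>invert_p p R S\<^esub> a : S" using `-- a : S` by simp
 qed (use subringE[OF S] in \<open>auto simp: simps\<close>)
qed

lemma invert_p_minus: "x : carrier (invert_p p R S) ==> y : carrier (invert_p p R S) ==> x --\<^bsub>invert_p p R S\<^esub> y = x -- y"
proof -
 interpret M: module "R\<lparr>carrier := S\<rparr>" "invert_p p R S" by (rule invert_p_module)
 assume xy: "x : carrier (invert_p p R S)" "y : carrier (invert_p p R S)"
 have c: "z : carrier R" if "z : carrier (invert_p p R S)" for z using that Sc pinv(1) unfolding invert_p_carrier by auto
 have simps: "ring.add (invert_p p R S) = ring.add R" "ring.zero (invert_p p R S) = \<zero>" by (simp_all add: invert_p_def)
 have "--\<^bsub>invert_p p R S\<^esub> y = -- y"
  using M.l_neg[OF xy(2)] c[OF xy(2)] c[OF M.a_inv_closed[OF xy(2)]] minus_equality[of "--\<^bsub>invert_p p R S\<^esub> y" y] by (simp add: simps)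
 thus ?thesis by (simp add: a_minus_def simps)
qed

lemma torsion_pow:
 assumes N: "module (R\<lparr>carrier := S\<rparr>) N"
  and w: "!!k. og k : carrier N" "!!k. natf p \<odot>\<^sub>N og (Suc k) = og k"
 shows "natf p[^](l::nat) \<odot>\<^sub>N og (k + l) = og k"
proof (induction l)
 interpret N: module "R\<lparr>carrier := S\<rparr>" N by (rule N)
 {
  case 0
  thus ?case using N.smult_one[OF w(1)] by simp
 next
  case (Suc l)
  have "natf p[^]Suc l \<odot>\<^sub>N og (k + Suc l) = natf p[^]l \<odot>\<^sub>N (natf p \<odot>\<^sub>N og (Suc (k + l)))"
   using N.smult_assoc1[of "natf p[^]l" "natf p" "og (Suc (k + l))"] np natf_subring[OF S] w(1) by simp
  thus ?case using w(2) Suc by simp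
 }
qed

lemma torsion_raise:
 assumes N: "module (R\<lparr>carrier := S\<rparr>) N"
  and w: "!!k. og k : carrier N" "!!k. natf p \<odot>\<^sub>N og (Suc k) = og k" and s: "s : S"
 shows "s \<odot>\<^sub>N og k = (s**natf p[^](l::nat)) \<odot>\<^sub>N og (k + l)"
proof -
 interpret N: module "R\<lparr>carrier := S\<rparr>" N by (rule N)
 show ?thesis using N.smult_assoc1[of s "natf p[^]l" "og (k + l)"] np w(1) s torsion_pow[where og = og, OF N w] by simp
qed

text \<open>The map sends the class of \<open>s / p^k\<close> to \<open>s \<odot> og k\<close>.\<close>
lemma short_exact_torsion:
 fixes N :: "('a, 'x, 'm) module_scheme" and P :: "('a, 'y, 'n) module_scheme" and og :: "nat => 'x"
 assumes N: "module (R\<lparr>carrier := S\<rparr>) N" and P: "module (R\<lparr>carrier := S\<rparr>) P"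
  and g: "g : linear_maps (R\<lparr>carrier := S\<rparr>) N P" "g ` carrier N = carrier P"
  and w: "!!k. og k : carrier N" "og 0 = \<zero>\<^sub>N" "!!k. natf p \<odot>\<^sub>N og (Suc k) = og k"
  and inj1: "!!b. b : S ==> b \<odot>\<^sub>N og 1 = \<zero>\<^sub>N ==> EX c:S. b = natf p**c"
  and ker: "{y : carrier N. g y = \<zero>\<^sub>P} = {b \<odot>\<^sub>N og k | b k. b : S}"
 shows "EX f. short_exact_modules (R\<lparr>carrier := S\<rparr>) (H1_p p R S) f (H0_p p N) g (H0_p p P)"
proof -
 let ?B = "R\<lparr>carrier := S\<rparr>" and ?I = "invert_p p R S"
 interpret N: module ?B N by (rule N)
 interpret P: module ?B P by (rule P)
 interpret I: module ?B ?I by (rule invert_p_module)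
 note Q = I.quotient_is_module[OF S_submodule]
 have H1: "H1_p p R S = quotient_module ?I S" by (simp add: H1_p_def)
 interpret Q: module ?B "H1_p p R S" unfolding H1 by (rule Q)
 have pS: "natf p : S" using natf_subring[OF S] .
 note wpow = torsion_pow[where og = og, OF N w(1,3)] and wsm = torsion_raise[where og = og, OF N w(1,3)]
 \<comment> \<open>If \<open>b\<close> kills \<open>og (Suc k)\<close>, it also kills
   \<open>og k\<close> and is by induction \<open>natf p[^]k**c\<close>. Then \<open>c\<close> kills
   \<open>og 1\<close>, and \<open>inj1\<close> yields one more factor.\<close>
 have inj: "EX c:S. b = natf p[^]k**c" if "b : S" "b \<odot>\<^sub>N og k = \<zero>\<^sub>N" for b k using that
 proof (induction k arbitrary: b)
  case 0
  thus ?case using Sc by auto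
 next
  case (Suc k)
  have "(natf p**b) \<odot>\<^sub>N og (Suc k) = \<zero>\<^sub>N" using N.smult_assoc1[of "natf p" b "og (Suc k)"] pS Suc.prems w(1) by simp
  moreover have "(natf p**b) \<odot>\<^sub>N og (Suc k) = b \<odot>\<^sub>N og k" using N.smult_assoc1[of b "natf p" "og (Suc k)"] pS Suc.prems w(1,3) Sc m_comm by simp
  ultimately obtain c where c: "c : S" "b = natf p[^]k**c" using Suc.IH[OF Suc.prems(1)] by auto
  have "(c**natf p[^]k) \<odot>\<^sub>N og (1 + k) = \<zero>\<^sub>N" using Suc.prems c Sc m_comm by simp
  hence "c \<odot>\<^sub>N og 1 = \<zero>\<^sub>N" using wsm[OF c(1), of 1 k] by simp
  then obtain d where "d : S" "c = natf p**d" using inj1[OF c(1)] by blast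
  thus ?case using c Sc by (intro bexI[of _ d]) (simp_all add: m_assoc)
 qed
 have key: "s \<odot>\<^sub>N og k = t \<odot>\<^sub>N og l <-> s**pinv k -- t**pinv l : S" if st: "s : S" "t : S" for s t k l
 proof -
  define d where "d = s**natf p[^]l -- t**natf p[^]k"
  have c: "s : carrier R" "t : carrier R" using st Sc by auto
  have dS: "d : S" using st np subringE(5,6,7)[OF S] by (simp add: d_def a_minus_def)
  have s1: "s**natf p[^]l : S" "t**natf p[^]k : S" using st np subringE(6)[OF S] by auto
  have m: "--\<^sub>?B (t**natf p[^]k) = -- (t**natf p[^]k)"
  proof -
   have "-- (t**natf p[^]k) : S" using subringE(5)[OF S s1(2)] .
   thus ?thesis using N.R.minus_equality[of "-- (t**natf p[^]k)" "t**natf p[^]k"] s1(2) Sc[OF s1(2)] by (simp add: l_neg)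
  qed
  have "d \<odot>\<^sub>N og (k + l) = (s**natf p[^]l) \<odot>\<^sub>N og (k + l) --\<^sub>N (t**natf p[^]k) \<odot>\<^sub>N og (k + l)"
   using N.smult_l_distr[of "s**natf p[^]l" "-- (t**natf p[^]k)" "og (k + l)"] s1 subringE(5)[OF S s1(2)] w(1)
   N.smult_l_minus[of "t**natf p[^]k" "og (k + l)"] m by (simp add: d_def a_minus_def)
  hence d1: "d \<odot>\<^sub>N og (k + l) = s \<odot>\<^sub>N og k --\<^sub>N t \<odot>\<^sub>N og l"
   using wsm[OF st(1), of k l] wsm[OF st(2), of l k] by (simp add: add.commute)
  have d2: "s**pinv k -- t**pinv l = d**pinv (k + l)" using fraction_eq[OF st(1), of k l] fraction_eq[OF st(2), of l k] c pinv(1)[of "k + l"]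
   by (simp add: d_def add.commute a_minus_def l_distr l_minus)
  have nc: "s \<odot>\<^sub>N og k : carrier N" "t \<odot>\<^sub>N og l : carrier N" using st w(1) by auto
  have "s \<odot>\<^sub>N og k = t \<odot>\<^sub>N og l <-> d \<odot>\<^sub>N og (k + l) = \<zero>\<^sub>N"
   unfolding d1 using nc by (metis N.M.r_neg a_minus_def N.M.minus_equality N.M.minus_minus N.M.a_inv_closed)
  also have "\<dots> <-> d**pinv (k + l) : S"
  proof
   assume "d \<odot>\<^sub>N og (k + l) = \<zero>\<^sub>N"
   then obtain e where e: "e : S" "d = natf p[^](k + l)**e" using inj[OF dS] by blast
   hence "d**pinv (k + l) = e" using Sc pinv[of "k + l"] by (simp add: m_comm[of _ e] m_assoc)
   thus "d**pinv (k + l) : S" using e by simp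
  next
   assume e: "d**pinv (k + l) : S"
   have "d = (d**pinv (k + l))**natf p[^](k + l)" using Sc[OF dS] pinv[of "k + l"] by (simp add: m_assoc)
   hence "d \<odot>\<^sub>N og (0 + (k + l)) = (d**pinv (k + l)) \<odot>\<^sub>N og 0" using wsm[OF e, of 0 "k + l"] by simp
   thus "d \<odot>\<^sub>N og (k + l) = \<zero>\<^sub>N" using w(2) e by simp
  qed
  finally show ?thesis using d2 by simp
 qed
 define cl where "cl x = S +>\<^bsub>?I\<^esub> x" for x
 have Hc: "EX s:S. EX k. y = cl (s**pinv k)" if "y : carrier (H1_p p R S)" for y
  using that unfolding H1 I.quotient_carrier[OF S_submodule] cl_def invert_p_carrier by blast
 have frI: "s**pinv k : carrier ?I" if "s : S" for s k using that unfolding invert_p_carrier by blast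
 have cleq: "cl (s**pinv k) = cl (t**pinv l) <-> s \<odot>\<^sub>N og k = t \<odot>\<^sub>N og l" if "s : S" "t : S" for s t k l
  unfolding cl_def using I.coset_eq_iff[OF S_submodule frI[OF that(1)] frI[OF that(2)]] key[OF that] invert_p_minus[OF frI frI] that by simp
 \<comment> \<open>The value does not depend on the fraction chosen, and \<open>f\<close> is
   injective: these are the two directions of \<open>cleq\<close>.\<close>
 define f where "f y = (THE z. EX s:S. EX k. y = cl (s**pinv k) & z = s \<odot>\<^sub>N og k)" for y
 have f: "f (cl (s**pinv k)) = s \<odot>\<^sub>N og k" if "s : S" for s k unfolding f_def
 proof (rule the_equality)
  show "EX t:S. EX l. cl (s**pinv k) = cl (t**pinv l) & s \<odot>\<^sub>N og k = t \<odot>\<^sub>N og l" using that by blast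
  fix z assume "EX t:S. EX l. cl (s**pinv k) = cl (t**pinv l) & z = t \<odot>\<^sub>N og l"
  thus "z = s \<odot>\<^sub>N og k" using cleq[OF that] by metis
 qed
 have tors: "s \<odot>\<^sub>N og k : carrier (H0_p p N)" if "s : S" for s k
 proof -
  have c: "s \<odot>\<^sub>N og k : carrier N" using w(1) that by simp
  have e: "[(p ^ k)] \<cdot>\<^bsub>?B\<^esub> \<one> = natf p[^]k"
  proof -
   have "[n] \<cdot>\<^bsub>?B\<^esub> \<one> = natf n" for n :: nat by (induction n) (simp_all add: add_pow_def nat_pow_def)
   thus ?thesis using natf_subfield_eq by simp
  qed
  have "natf p[^]k \<odot>\<^sub>N (s \<odot>\<^sub>N og k) = s \<odot>\<^sub>N (natf p[^]k \<odot>\<^sub>N og (0 + k))"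
   using N.smult_assoc1[of "natf p[^]k" s "og k"] N.smult_assoc1[of s "natf p[^]k" "og k"] np w(1) that Sc m_comm by simp
  also have "\<dots> = \<zero>\<^sub>N" unfolding wpow using w(2) that by simp
  finally have "[(p ^ k)] \<cdot>\<^bsub>N\<^esub> (s \<odot>\<^sub>N og k) = \<zero>\<^sub>N" using N.add_pow_smult[OF c, of "p ^ k"] e by simp
  thus ?thesis using c by (auto simp: H0_p_def)
 qed
 have H0: "ring.add (H0_p p N) = ring.add N" "smult (H0_p p N) = smult N" "ring.zero (H0_p p P) = ring.zero P"
  "ring.add (H0_p p P) = ring.add P" "smult (H0_p p P) = smult P" by (simp_all add: H0_p_def)
 have cl_add: "cl x ++\<^bsub>H1_p p R S\<^esub> cl y = cl (x ++ y)" if "x : carrier ?I" "y : carrier ?I" for x y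
  unfolding cl_def H1 I.quotient_add[OF S_submodule that] by (simp add: invert_p_def)
 have cl_sm: "b \<odot>\<^bsub>H1_p p R S\<^esub> cl x = cl (b**x)" if "b : S" "x : carrier ?I" for b x
  unfolding cl_def H1 using I.quotient_smult[OF S_submodule _ that(2), of b] that(1) by (simp add: invert_p_def)
 have flin: "f : linear_maps ?B (H1_p p R S) (H0_p p N)" unfolding linear_maps_def H0
 proof (intro CollectI conjI ballI)
  show "f : carrier (H1_p p R S) \<rightarrow> carrier (H0_p p N)" using Hc f tors by fastforce
  fix x y assume "x : carrier (H1_p p R S)" and "y : carrier (H1_p p R S)"
  then obtain s k t l where st: "s : S" "x = cl (s**pinv k)" "t : S" "y = cl (t**pinv l)" using Hc by metis
  have c: "s : carrier R" "t : carrier R" using st Sc by auto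
  have s1: "s**natf p[^]l : S" "t**natf p[^]k : S" using st np subringE(6)[OF S] by auto
  have "s**pinv k ++ t**pinv l = (s**natf p[^]l ++ t**natf p[^]k)**pinv (k + l)"
   using fraction_eq[OF st(1), of k l] fraction_eq[OF st(3), of l k] c pinv(1)[of "k + l"] by (simp add: add.commute l_distr)
  hence "f (x ++\<^bsub>H1_p p R S\<^esub> y) = (s**natf p[^]l ++ t**natf p[^]k) \<odot>\<^sub>N og (k + l)"
   unfolding st(2,4) cl_add[OF frI[OF st(1)] frI[OF st(3)]] using f s1 subringE(7)[OF S] by simp
  also have "\<dots> = (s**natf p[^]l) \<odot>\<^sub>N og (k + l) ++\<^sub>N (t**natf p[^]k) \<odot>\<^sub>N og (k + l)"
   using N.smult_l_distr[of "s**natf p[^]l" "t**natf p[^]k" "og (k + l)"] s1 w(1) by simp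
  also have "\<dots> = f x ++\<^sub>N f y" unfolding st(2,4) f[OF st(1)] f[OF st(3)] using wsm[OF st(1), of k l] wsm[OF st(3), of l k] by (simp add: add.commute)
  finally show "f (x ++\<^bsub>H1_p p R S\<^esub> y) = f x ++\<^sub>N f y" .
 next
  fix b x assume b: "b : carrier ?B" and "x : carrier (H1_p p R S)"
  then obtain s k where s: "s : S" "x = cl (s**pinv k)" using Hc by metis
  have "b**(s**pinv k) = (b**s)**pinv k" using b s Sc pinv(1) by (simp add: m_assoc)
  thus "f (b \<odot>\<^bsub>H1_p p R S\<^esub> x) = b \<odot>\<^sub>N f x"
   unfolding s(2) f[OF s(1)] using cl_sm[OF _ frI[OF s(1)], of b] b f[of "b**s" k] s(1) subringE(6)[OF S] N.smult_assoc1[of b s "og k"] w(1) by simp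
 qed
 have glin: "g : linear_maps ?B (H0_p p N) (H0_p p P)"
 proof -
  have gs: "g (b \<odot>\<^sub>N x) = b \<odot>\<^sub>P g x" "g x : carrier P" if "b : S" "x : carrier N" for b x using g(1) that unfolding linear_maps_def by auto
  have g0: "g \<zero>\<^sub>N = \<zero>\<^sub>P" using gs[of \<zero> "\<zero>\<^sub>N"] subringE(2)[OF S] N.smult_l_null[of "\<zero>\<^sub>N"] P.smult_l_null[of "g \<zero>\<^sub>N"] by simp
  have "g x : carrier (H0_p p P)" if "x : carrier (H0_p p N)" for x
  proof -
   obtain k :: nat where k: "[(p ^ k)] \<cdot>\<^bsub>N\<^esub> x = \<zero>\<^sub>N" and xc: "x : carrier N" using `x : carrier (H0_p p N)` by (auto simp: H0_p_def)
   have "[(p ^ k)] \<cdot>\<^bsub>P\<^esub> g x = g ([(p ^ k)] \<cdot>\<^bsub>N\<^esub> x)"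
   using N.add_pow_smult[OF xc, of "p ^ k"] P.add_pow_smult[OF gs(2)[OF _ xc], of \<one> "p ^ k"] gs(1)[OF _ xc] subringE(3)[OF S]
   cring.cring_simprules(6)[OF S_cring] N.R.add.nat_pow_closed[of \<one> "p ^ k"] by simp
   thus ?thesis using k g0 gs(2)[OF subringE(3)[OF S] xc] by (auto simp: H0_p_def)
  qed
  thus ?thesis using g(1) unfolding linear_maps_def H0 by (auto simp: H0_p_def)
 qed
 have finj: "inj_on f (carrier (H1_p p R S))"
 proof (rule inj_onI)
  fix x y assume "x : carrier (H1_p p R S)" "y : carrier (H1_p p R S)" and e: "f x = f y"
  then obtain s k t l where st: "s : S" "x = cl (s**pinv k)" "t : S" "y = cl (t**pinv l)" using Hc by metis
  thus "x = y" using e f cleq by simp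
 qed
 have fim: "f ` carrier (H1_p p R S) = {b \<odot>\<^sub>N og k | b k. b : S}"
 proof
  show "f ` carrier (H1_p p R S) <= {b \<odot>\<^sub>N og k | b k. b : S}" using Hc f by fastforce
  show "{b \<odot>\<^sub>N og k | b k. b : S} <= f ` carrier (H1_p p R S)"
  proof
   fix y assume "y : {b \<odot>\<^sub>N og k | b k. b : S}"
   then obtain b k where b: "b : S" "y = b \<odot>\<^sub>N og k" by blast
   have "cl (b**pinv k) : carrier (H1_p p R S)" unfolding H1 cl_def using I.quotient_closed[OF S_submodule frI[OF b(1)]] .
   thus "y : f ` carrier (H1_p p R S)" using f[OF b(1)] b(2) by (metis image_eqI)
  qed
 qed
 have ker0: "{y : carrier (H0_p p N). g y = \<zero>\<^bsub>H0_p p P\<^esub>} = {b \<odot>\<^sub>N og k | b k. b : S}"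
 proof -
  have "carrier (H0_p p N) <= carrier N" by (auto simp: H0_p_def)
  thus ?thesis using ker tors unfolding H0 by blast
 qed
 \<comment> \<open>The kernel of \<open>g\<close> consists of multiples of the \<open>og k\<close>
   and is itself torsion. Hence every lift of a torsion element is torsion.\<close>
 have "g ` carrier (H0_p p N) = carrier (H0_p p P)"
 proof
  show "g ` carrier (H0_p p N) <= carrier (H0_p p P)" using glin by (auto simp: linear_maps_def)
  show "carrier (H0_p p P) <= g ` carrier (H0_p p N)"
  proof
   fix z assume z: "z : carrier (H0_p p P)"
   then obtain k :: nat where k: "[(p ^ k)] \<cdot>\<^bsub>P\<^esub> z = \<zero>\<^sub>P" "z : carrier P" by (auto simp: H0_p_def)
   obtain y where y: "y : carrier N" "z = g y" using k(2) g(2) by auto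
   have one: "[(p ^ k)] \<cdot>\<^bsub>?B\<^esub> \<one>\<^sub>?B : carrier ?B" by (rule N.R.add.nat_pow_closed[OF N.R.one_closed])
   have "g ([(p ^ k)] \<cdot>\<^bsub>N\<^esub> y) = [(p ^ k)] \<cdot>\<^bsub>P\<^esub> z"
   unfolding N.add_pow_smult[OF y(1)] P.add_pow_smult[OF k(2)] using g(1) one y unfolding linear_maps_def by blast
   hence "[(p ^ k)] \<cdot>\<^bsub>N\<^esub> y : {y : carrier N. g y = \<zero>\<^sub>P}" using k(1) y(1) by simp
   hence "[(p ^ k)] \<cdot>\<^bsub>N\<^esub> y : carrier (H0_p p N)" using ker tors by auto
   then obtain l :: nat where l: "[(p ^ l)] \<cdot>\<^bsub>N\<^esub> ([(p ^ k)] \<cdot>\<^bsub>N\<^esub> y) = \<zero>\<^sub>N" by (auto simp: H0_p_def)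
   have "[(p ^ (k + l))] \<cdot>\<^bsub>N\<^esub> y = \<zero>\<^sub>N" using l N.M.add.nat_pow_pow[OF y(1), of "p ^ l" "p ^ k"] by (simp add: power_add)
   hence "y : carrier (H0_p p N)" using y(1) by (auto simp: H0_p_def)
   thus "z : g ` carrier (H0_p p N)" using y(2) by blast
  qed
 qed
 thus ?thesis unfolding short_exact_modules_def using Q.module_axioms N.H0_p_module P.H0_p_module flin glin finj fim ker0 by (intro exI[of _ f]) simp
qed

end

end

section \<open>Kaehler differentials\<close>

context cring
begin

lemma free_module_simps:
 "\<zero>\<^bsub>free_module R S\<^esub> = (%s. \<zero>)"
 "f ++\<^bsub>free_module R S\<^esub> g = (%s. f s ++ g s)"
 "b \<odot>\<^bsub>free_module R S\<^esub> f = (%s. b**f s)" by (simp_all add: free_module_def)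

lemma free_module_carrier: "f : carrier (free_module R S) <->
  (ALL s. f s : carrier R) & finite {s. f s ~= \<zero>} & (ALL s. s ~: S --> f s = \<zero>)" by (simp add: free_module_def)

lemma free_module_module: "module R (free_module R S)"
proof (rule moduleI)
 let ?F = "free_module R S"
 have add: "(%s. f s ++ g s) : carrier ?F" if "f : carrier ?F" "g : carrier ?F" for f g
 proof -
  have "finite ({s. f s ~= \<zero>} \<union> {s. g s ~= \<zero>})" using that free_module_carrier by blast
  hence "finite {s. f s ++ g s ~= \<zero>}" by (rule rev_finite_subset) auto
  thus ?thesis using that by (auto simp: free_module_carrier)
 qed
 have sm: "(%s. b**f s) : carrier ?F" if "b : carrier R" "f : carrier ?F" for b f
 proof -
  have "finite {s. f s ~= \<zero>}" using that free_module_carrier by blast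
  hence "finite {s. b**f s ~= \<zero>}" by (rule rev_finite_subset) (use that in auto)
  thus ?thesis using that by (auto simp: free_module_carrier)
 qed
 show "cring R" by (rule is_cring)
 show "abelian_group ?F"
 proof (rule abelian_groupI)
  show "EX y:carrier ?F. y ++\<^sub>?F x = \<zero>\<^sub>?F" if x: "x : carrier ?F" for x unfolding free_module_simps
  proof (rule bexI)
   show "(%s. (-- \<one>)**x s) : carrier ?F" using sm[of "-- \<one>"] x by simp
   show "(%s. (-- \<one>)**x s ++ x s) = (%s. \<zero>)" using x by (auto simp: free_module_carrier l_minus l_neg)
  qed
 qed (use add in \<open>auto simp: free_module_simps free_module_carrier a_ac intro!: ext\<close>)
qed (auto simp: free_module_simps free_module_carrier l_distr r_distr m_assoc intro!: ext elim!: rev_finite_subset)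

lemma free_module_minus:
 assumes f: "f : carrier (free_module R S)" "g : carrier (free_module R S)"
 shows "f --\<^bsub>free_module R S\<^esub> g = (%s. f s -- g s)"
proof -
 interpret F: module R "free_module R S" by (rule free_module_module)
 let ?h = "(-- \<one>) \<odot>\<^bsub>free_module R S\<^esub> g"
 have "?h : carrier (free_module R S)" using F.smult_closed f by simp
 moreover have "?h = (%s. -- g s)" using f by (auto simp: free_module_simps free_module_carrier l_minus)
 moreover have "?h = --\<^bsub>free_module R S\<^esub> g" using F.smult_l_minus[of \<one> g] F.smult_one[OF f(2)] f by simp
 ultimately have "--\<^bsub>free_module R S\<^esub> g = (%s. -- g s)" by simp
 thus ?thesis unfolding a_minus_def by (simp add: free_module_simps)
qed

lemma unit_vector_closed: "s : S ==> unit_vector R s : carrier (free_module R S)" by (auto simp: free_module_carrier unit_vector_def)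

end

locale kaehler_data = B?: cring B for S :: "('s, 'm) ring_scheme" and u :: "'s => 'b" and B :: "('b, 'n) ring_scheme" (structure) +
 assumes u_closed: "s : carrier S ==> u s : carrier B"
begin

abbreviation "F == free_module B (carrier B)"
abbreviation "N == kaehler_submodule S u B"
abbreviation "\<Omega> == kaehler S u B"
abbreviation "unitv == unit_vector B"

sublocale F: module B "free_module B (carrier B)" by (rule free_module_module)

lemma unitv_closed: "b : carrier B ==> unitv b : carrier F" by (rule unit_vector_closed)

lemma relations_closed: "kaehler_relations S u B <= carrier F" unfolding kaehler_relations_def Let_def
 using unitv_closed u_closed by (auto intro!: F.minus_closed F.add.m_closed F.smult_closed)

lemma N_submodule: "submodule N B F" unfolding kaehler_submodule_def by (rule F.generated_submodule_is_submodule[OF relations_closed])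

lemma relations_N: "kaehler_relations S u B <= N" unfolding kaehler_submodule_def by (rule F.generated_submodule_is_submodule[OF relations_closed])

lemma N_minimal: "submodule T B F ==> kaehler_relations S u B <= T ==> N <= T" unfolding kaehler_submodule_def by (rule F.generated_submodule_minimal)

lemma kaehler_module: "module B \<Omega>" unfolding kaehler_def by (rule F.quotient_is_module[OF N_submodule])

definition cls :: "('b => 'b) => ('b => 'b) set" where "cls x = N +>\<^bsub>F\<^esub> x"

lemma cls_closed: "x : carrier F ==> cls x : carrier \<Omega>" unfolding cls_def kaehler_def by (rule F.quotient_closed[OF N_submodule])

lemma cls_surj: "y : carrier \<Omega> ==> EX x:carrier F. y = cls x" unfolding cls_def kaehler_def F.quotient_carrier[OF N_submodule] by blast

lemma cls_add: "x : carrier F ==> y : carrier F ==> cls (x ++\<^sub>F y) = cls x ++\<^sub>\<Omega> cls y"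
 unfolding cls_def kaehler_def by (simp add: F.quotient_add[OF N_submodule])

lemma cls_smult: "b : carrier B ==> x : carrier F ==> cls (b \<odot>\<^sub>F x) = b \<odot>\<^sub>\<Omega> cls x"
 unfolding cls_def kaehler_def by (simp add: F.quotient_smult[OF N_submodule])

lemma cls_eq: "x : carrier F ==> y : carrier F ==> cls x = cls y <-> x --\<^sub>F y : N" unfolding cls_def by (rule F.coset_eq_iff[OF N_submodule])

lemma cls_zero: "cls \<zero>\<^sub>F = \<zero>\<^sub>\<Omega>" unfolding cls_def kaehler_def by (simp add: F.quotient_zero[OF N_submodule])

lemma cls_eq_zero: "x : carrier F ==> cls x = \<zero>\<^sub>\<Omega> <-> x : N"
proof -
 assume x: "x : carrier F"
 have "--\<^sub>F \<zero>\<^sub>F = \<zero>\<^sub>F" by (rule F.M.minus_equality) (simp_all add: F.M.zero_closed)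
 hence "x --\<^sub>F \<zero>\<^sub>F = x" using x F.M.r_zero unfolding a_minus_def by simp
 thus ?thesis using cls_eq[OF x F.M.zero_closed] cls_zero by simp
qed

definition diff :: "'b => ('b => 'b) set" where "diff b = cls (unitv b)"

lemma diff_closed: "b : carrier B ==> diff b : carrier \<Omega>" unfolding diff_def using cls_closed unitv_closed by blast

lemma diff_add: "b : carrier B ==> c : carrier B ==> diff (b ++ c) = diff b ++\<^sub>\<Omega> diff c"
proof -
 assume bc: "b : carrier B" "c : carrier B"
 have "unitv (b ++ c) --\<^sub>F (unitv b ++\<^sub>F unitv c) : N" using relations_N bc unfolding kaehler_relations_def Let_def by blast
 thus ?thesis unfolding diff_def using cls_eq[of "unitv (b ++ c)" "unitv b ++\<^sub>F unitv c"] cls_add[of "unitv b" "unitv c"] unitv_closed bc F.M.a_closed by simp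
qed

lemma diff_mult: "b : carrier B ==> c : carrier B ==> diff (b**c) = b \<odot>\<^sub>\<Omega> diff c ++\<^sub>\<Omega> c \<odot>\<^sub>\<Omega> diff b"
proof -
 assume bc: "b : carrier B" "c : carrier B"
 have "unitv (b**c) --\<^sub>F (b \<odot>\<^sub>F unitv c ++\<^sub>F c \<odot>\<^sub>F unitv b) : N" using relations_N bc unfolding kaehler_relations_def Let_def by blast
 thus ?thesis unfolding diff_def using cls_eq[of "unitv (b**c)" "b \<odot>\<^sub>F unitv c ++\<^sub>F c \<odot>\<^sub>F unitv b"]
   cls_add[of "b \<odot>\<^sub>F unitv c" "c \<odot>\<^sub>F unitv b"] cls_smult unitv_closed bc F.M.a_closed F.smult_closed by simp
qed

lemma N_base_mono:
 assumes "kaehler_data S' u' B" "!!s'. s' : carrier S' ==> unitv (u' s') : N"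
 shows "kaehler_submodule S' u' B <= N"
proof (rule kaehler_data.N_minimal[OF assms(1) N_submodule])
 show "kaehler_relations S' u' B <= N" using relations_N assms(2) unfolding kaehler_relations_def Let_def by blast
qed

end

text \<open>Since one relation submodule is contained in the other, the union over a coset is a
  single coset.\<close>

lemma (in kaehler_data) kaehler_proj_cls:
 assumes T: "kaehler_data S' u' B" and le: "N <= kaehler_submodule S' u' B" and x: "x : carrier F"
 shows "kaehler_proj S' u' B (cls x) = kaehler_data.cls S' u' B x"
proof -
 interpret T: kaehler_data S' u' B by (rule T)
 have "T.N +>\<^bsub>F\<^esub> y = T.N +>\<^bsub>F\<^esub> x" if "y : cls x" for y
 proof -
  have "y : carrier F" "y --\<^sub>F x : N" using that F.coset_mem[OF N_submodule x] unfolding cls_def by auto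
  thus ?thesis using F.coset_eq_iff[OF T.N_submodule _ x] le by blast
 qed
 moreover have "x : cls x" unfolding cls_def using abelian_subgroup.a_rcos_self[OF F.sub_abelian[OF N_submodule] x] .
 ultimately show ?thesis unfolding kaehler_proj_def T.cls_def by blast
qed

text \<open>The kernel of the projection is generated by the differentials of the larger base. By
  \<open>sp\<close> these are multiples of the \<open>og k\<close>, and by \<open>b0\<close> all
  \<open>og k\<close> are in the kernel.\<close>

lemma (in field) kaehler_short_exact:
 assumes S: "subring S R" and p0: "natf p ~= \<zero>"
  and K: "kaehler_data T u (R\<lparr>carrier := S\<rparr>)" and K': "kaehler_data T' u' (R\<lparr>carrier := S\<rparr>)"
  and le: "kaehler_submodule T u (R\<lparr>carrier := S\<rparr>) <= kaehler_submodule T' u' (R\<lparr>carrier := S\<rparr>)"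
  and ga: "!!k. ga k : S" "!!k. bt k : S"
  and w: "!!k. og k = ga k \<odot>\<^bsub>kaehler T u (R\<lparr>carrier := S\<rparr>)\<^esub> kaehler_data.diff T u (R\<lparr>carrier := S\<rparr>) (bt k)"
  and w0: "og 0 = \<zero>\<^bsub>kaehler T u (R\<lparr>carrier := S\<rparr>)\<^esub>" and ws: "!!k. natf p \<odot>\<^bsub>kaehler T u (R\<lparr>carrier := S\<rparr>)\<^esub> og (Suc k) = og k"
  and inj1: "!!b. b : S ==> b \<odot>\<^bsub>kaehler T u (R\<lparr>carrier := S\<rparr>)\<^esub> og 1 = \<zero>\<^bsub>kaehler T u (R\<lparr>carrier := S\<rparr>)\<^esub> ==> EX c:S. b = natf p**c"
  and sp: "!!t. t : carrier T' ==> EX b:S. EX k. kaehler_data.diff T u (R\<lparr>carrier := S\<rparr>) (u' t) = b \<odot>\<^bsub>kaehler T u (R\<lparr>carrier := S\<rparr>)\<^esub> og k"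
  and b0: "!!k. unit_vector (R\<lparr>carrier := S\<rparr>) (bt k) : kaehler_submodule T' u' (R\<lparr>carrier := S\<rparr>)"
 shows "EX f. short_exact_modules (R\<lparr>carrier := S\<rparr>) (H1_p p R S) f
  (H0_p p (kaehler T u (R\<lparr>carrier := S\<rparr>))) (kaehler_proj T' u' (R\<lparr>carrier := S\<rparr>)) (H0_p p (kaehler T' u' (R\<lparr>carrier := S\<rparr>)))"
proof -
 let ?B = "R\<lparr>carrier := S\<rparr>"
 interpret K: kaehler_data T u ?B by (rule K)
 interpret K': kaehler_data T' u' ?B by (rule K')
 interpret O: module ?B K.\<Omega> by (rule K.kaehler_module)
 interpret O': module ?B K'.\<Omega> by (rule K'.kaehler_module)
 let ?g = "kaehler_proj T' u' ?B"
 have g: "?g (K.cls x) = K'.cls x" if "x : carrier K.F" for x using K.kaehler_proj_cls[OF K' le that] .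
 have Sc: "s : carrier R" if "s : S" for s using subringE(1)[OF S] that by blast
 have wc: "og k : carrier K.\<Omega>" for k unfolding w using O.smult_closed ga K.diff_closed by simp
 define Im where "Im = {b \<odot>\<^sub>K.\<Omega> og k | b k. b : S}"
 have glin: "?g : linear_maps ?B K.\<Omega> K'.\<Omega>" unfolding linear_maps_def
 proof (intro CollectI conjI ballI)
  show "?g : carrier K.\<Omega> \<rightarrow> carrier K'.\<Omega>" using K.cls_surj g K'.cls_closed by fastforce
  fix x y assume "x : carrier K.\<Omega>" "y : carrier K.\<Omega>"
  then obtain a b where "a : carrier K.F" "b : carrier K.F" "x = K.cls a" "y = K.cls b" using K.cls_surj by metis
  thus "?g (x ++\<^sub>K.\<Omega> y) = ?g x ++\<^sub>K'.\<Omega> ?g y" using g K.cls_add[symmetric] K'.cls_add K.F.M.a_closed by simp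
 next
  fix b x assume "b : carrier ?B" "x : carrier K.\<Omega>"
  then obtain a where "b : carrier ?B" "a : carrier K.F" "x = K.cls a" using K.cls_surj by metis
  thus "?g (b \<odot>\<^sub>K.\<Omega> x) = b \<odot>\<^sub>K'.\<Omega> ?g x" using g K.cls_smult[symmetric] K'.cls_smult K.F.smult_closed by simp
 qed
 have gsurj: "?g ` carrier K.\<Omega> = carrier K'.\<Omega>"
 proof
  show "?g ` carrier K.\<Omega> <= carrier K'.\<Omega>" using glin by (auto simp: linear_maps_def)
  show "carrier K'.\<Omega> <= ?g ` carrier K.\<Omega>"
  proof
   fix y assume "y : carrier K'.\<Omega>"
   then obtain x where "x : carrier K.F" "y = K'.cls x" using K'.cls_surj by blast
   thus "y : ?g ` carrier K.\<Omega>" using g K.cls_closed by (metis image_eqI)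
  qed
 qed
 have zIm: "\<zero>\<^sub>K.\<Omega> : Im" unfolding Im_def using O.smult_l_null[OF wc[of 0]] subringE(2)[OF S] by (intro CollectI exI[of _ \<zero>] exI[of _ 0]) simp
 \<comment> \<open>The preimage of \<open>Im\<close> is a submodule, because multiples of
   \<open>og k\<close> and \<open>og l\<close> can both be written as multiples of
   \<open>og (k + l)\<close>. It then suffices to check generating relations.\<close>
 let ?T = "{x : carrier K.F. K.cls x : Im}"
 have T: "submodule ?T ?B K.F"
 proof (rule K.F.submoduleI)
  show "?T <= carrier K.F" by blast
  show "\<zero>\<^sub>K.F : ?T" using zIm K.cls_zero K.F.M.zero_closed by simp
  have sm: "a \<odot>\<^sub>K.F x : ?T" if ax: "a : carrier ?B" "x : ?T" for a x
  proof -
   obtain b k where b: "b : S" "K.cls x = b \<odot>\<^sub>K.\<Omega> og k" using ax by (auto simp: Im_def)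
   have "K.cls (a \<odot>\<^sub>K.F x) = (a**b) \<odot>\<^sub>K.\<Omega> og k" using K.cls_smult[OF ax(1)] ax b O.smult_assoc1[of a b "og k"] wc by simp
   thus ?thesis using ax b subringE(6)[OF S] K.F.smult_closed unfolding Im_def by auto
  qed
  thus "a \<odot>\<^sub>K.F x : ?T" if "a : carrier ?B" "x : ?T" for a x using that by blast
  show "--\<^sub>K.F a : ?T" if a: "a : ?T" for a
  proof -
   have "(--\<^sub>?B \<one>\<^sub>?B) \<odot>\<^sub>K.F a = --\<^sub>K.F a" using K.F.smult_l_minus[OF K.B.one_closed, of a] K.F.smult_one[of a] a by simp
   moreover have "(--\<^sub>?B \<one>\<^sub>?B) \<odot>\<^sub>K.F a : ?T" by (rule sm[OF K.B.a_inv_closed[OF K.B.one_closed] a])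
   ultimately show ?thesis by simp
  qed
  show "a ++\<^sub>K.F b : ?T" if ab: "a : ?T" "b : ?T" for a b
  proof -
   obtain c k where c: "c : S" "K.cls a = c \<odot>\<^sub>K.\<Omega> og k" using ab by (auto simp: Im_def)
   obtain d l where d: "d : S" "K.cls b = d \<odot>\<^sub>K.\<Omega> og l" using ab by (auto simp: Im_def)
   have pS: "c**natf p[^]l : S" "d**natf p[^]k : S" using c d np[OF S p0] subringE(6)[OF S] by auto
   have "K.cls (a ++\<^sub>K.F b) = (c**natf p[^]l) \<odot>\<^sub>K.\<Omega> og (k + l) ++\<^sub>K.\<Omega> (d**natf p[^]k) \<odot>\<^sub>K.\<Omega> og (k + l)"
   using K.cls_add ab c(2) d(2) torsion_raise[where og = og, OF S p0 O.module_axioms wc ws c(1), of k l]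
   torsion_raise[where og = og, OF S p0 O.module_axioms wc ws d(1), of l k] by (simp add: add.commute)
   also have "\<dots> = (c**natf p[^]l ++ d**natf p[^]k) \<odot>\<^sub>K.\<Omega> og (k + l)"
   using O.smult_l_distr[of "c**natf p[^]l" "d**natf p[^]k" "og (k + l)"] pS wc by simp
   finally have "K.cls (a ++\<^sub>K.F b) : Im" using pS subringE(7)[OF S] unfolding Im_def by blast
   moreover have "a ++\<^sub>K.F b : carrier K.F" using ab K.F.M.a_closed by blast
   ultimately show ?thesis by blast
  qed
 qed
 have N'T: "K'.N <= ?T"
 proof (rule K'.N_minimal[OF T])
  have 1: "x : ?T" if "x : K.N" for x
  proof -
   have "x : carrier K.F" using that K.F.N_sub[OF K.N_submodule] by blast
   moreover have "K.cls x = \<zero>\<^sub>K.\<Omega>" using K.cls_eq_zero calculation that by blast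
   ultimately show ?thesis using zIm by simp
  qed
  have 2: "K.unitv (u' t) : ?T" if "t : carrier T'" for t
  proof -
   have "K.cls (K.unitv (u' t)) : Im" using sp[OF that] unfolding Im_def K.diff_def by blast
   thus ?thesis using K'.u_closed[OF that] K.unitv_closed by blast
  qed
  show "kaehler_relations T' u' ?B <= ?T" using 1 2 K.relations_N unfolding kaehler_relations_def Let_def by blast
 qed
 have ker: "{y : carrier K.\<Omega>. ?g y = \<zero>\<^sub>K'.\<Omega>} = Im"
 proof
  show "{y : carrier K.\<Omega>. ?g y = \<zero>\<^sub>K'.\<Omega>} <= Im"
  proof
   fix y assume y: "y : {y : carrier K.\<Omega>. ?g y = \<zero>\<^sub>K'.\<Omega>}"
   then obtain x where x: "x : carrier K.F" "y = K.cls x" using K.cls_surj by blast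
   hence "x : K'.N" using y g K'.cls_eq_zero by simp
   thus "y : Im" using N'T x by blast
  qed
  show "Im <= {y : carrier K.\<Omega>. ?g y = \<zero>\<^sub>K'.\<Omega>}"
  proof
   fix y assume "y : Im"
   then obtain b k where b: "b : S" "y = b \<odot>\<^sub>K.\<Omega> og k" by (auto simp: Im_def)
   let ?x = "b \<odot>\<^sub>K.F (ga k \<odot>\<^sub>K.F K.unitv (bt k))"
   have uc: "K.unitv (bt k) : carrier K.F" using K.unitv_closed ga(2) by simp
   have xc: "?x : carrier K.F" using K.F.smult_closed uc b ga by simp
   have "y = K.cls ?x" using b K.cls_smult uc K.F.smult_closed ga unfolding w K.diff_def by simp
   moreover have "?x : K'.N" using submodule.smult_closed[OF K'.N_submodule] b0[of k] b ga by simp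
   ultimately show "y : {y : carrier K.\<Omega>. ?g y = \<zero>\<^sub>K'.\<Omega>}" using xc g K'.cls_eq_zero K.cls_closed by simp
  qed
 qed
 show ?thesis by (rule short_exact_torsion[OF S p0 K.kaehler_module K'.kaehler_module glin gsurj wc w0 ws inj1 ker[unfolded Im_def]])
qed

section \<open>Detecting nonzero differentials\<close>

context field
begin

definition pairing :: "('a => 'a) => ('a => 'a) => 'a" where
 "pairing f de = (\<Oplus>s\<in>{s. f s ~= \<zero>}. f s**de s)"

definition approx_der :: "'a set => 'a set => 'a set => ('a => 'a) => bool" where
 "approx_der W Z C de <-> (ALL x. de x : carrier R) & (ALL x:C. ALL y:C. de (x ++ y) -- (de x ++ de y) : W) &
  (ALL x:C. ALL y:C. de (x**y) -- (x**de y ++ y**de x) : W) & (ALL z:Z \<inter> C. de z : W)"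

lemma pairing_superset:
 assumes "finite T" "{s. f s ~= \<zero>} <= T" "!!s. f s : carrier R" "!!s. de s : carrier R"
 shows "pairing f de = (\<Oplus>s\<in>T. f s**de s)" unfolding pairing_def by (rule add.finprod_mono_neutral_cong_left) (use assms in auto)

lemma pairing_add:
 assumes f: "!!s. f s : carrier R" "finite {s. f s ~= \<zero>}" and g: "!!s. g s : carrier R" "finite {s. g s ~= \<zero>}"
  and d: "!!s. de s : carrier R"
 shows "pairing (%s. f s ++ g s) de = pairing f de ++ pairing g de"
proof -
 let ?T = "{s. f s ~= \<zero>} \<union> {s. g s ~= \<zero>}"
 have "pairing (%s. f s ++ g s) de = (\<Oplus>s\<in>?T. (f s ++ g s)**de s)" by (rule pairing_superset) (use assms in auto)
 also have "\<dots> = (\<Oplus>s\<in>?T. f s**de s ++ g s**de s)" using assms by (simp add: l_distr)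
 also have "\<dots> = (\<Oplus>s\<in>?T. f s**de s) ++ (\<Oplus>s\<in>?T. g s**de s)" by (rule add.finprod_multf) (use assms in auto)
 also have "(\<Oplus>s\<in>?T. f s**de s) = pairing f de" by (rule pairing_superset[symmetric]) (use assms in auto)
 also have "(\<Oplus>s\<in>?T. g s**de s) = pairing g de" by (rule pairing_superset[symmetric]) (use assms in auto)
 finally show ?thesis .
qed

lemma pairing_smult:
 assumes f: "!!s. f s : carrier R" "finite {s. f s ~= \<zero>}" and b: "b : carrier R" and d: "!!s. de s : carrier R"
 shows "pairing (%s. b**f s) de = b**pairing f de"
proof -
 let ?T = "{s. f s ~= \<zero>}"
 have "pairing (%s. b**f s) de = (\<Oplus>s\<in>?T. (b**f s)**de s)" by (rule pairing_superset) (use assms in auto)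
 also have "\<dots> = (\<Oplus>s\<in>?T. b**(f s**de s))" using assms by (simp add: m_assoc)
 also have "\<dots> = b**(\<Oplus>s\<in>?T. f s**de s)" by (rule finsum_rdistr[symmetric]) (use assms in auto)
 finally show ?thesis by (simp add: pairing_def)
qed

lemma pairing_closed: "(!!s. f s : carrier R) ==> (!!s. de s : carrier R) ==> pairing f de : carrier R" unfolding pairing_def by (rule finsum_closed) auto

lemma pairing_unit: "(!!s. de s : carrier R) ==> pairing (unit_vector R b) de = de b"
proof -
 assume d: "!!s. de s : carrier R"
 have "pairing (unit_vector R b) de = (\<Oplus>s\<in>{b}. unit_vector R b s**de s)" by (rule pairing_superset) (use d in \<open>auto simp: unit_vector_def\<close>)
 also have "\<dots> = de b" using d by (simp add: unit_vector_def)
 finally show ?thesis .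
qed

text \<open>A relation involves finitely many symbols, so it pairs into \<open>W\<close> with every
  derivation defined on those. Formally, the elements that admit such a finite \<open>Y\<close> form
  a submodule containing the generating relations.\<close>

lemma kaehler_pairing:
 assumes S: "subring S R" and W: "subring W R" and SW: "S <= W" and K: "kaehler_data T u (R\<lparr>carrier := S\<rparr>)"
  and f: "f : kaehler_submodule T u (R\<lparr>carrier := S\<rparr>)"
 shows "EX Y. finite Y & Y <= S & (ALL C de. approx_der W (u ` carrier T) C de --> Y <= C --> pairing f de : W)"
proof -
 let ?B = "R\<lparr>carrier := S\<rparr>"
 interpret K: kaehler_data T u ?B by (rule K)
 define P where "P f Y <-> finite Y & Y <= S & (ALL C de. approx_der W (u ` carrier T) C de --> Y <= C --> pairing f de : W)" for f Y
 let ?N = "{f : carrier K.F. EX Y. P f Y}"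
 note Wr = subringE[OF W] and Sr = subringE[OF S]
 have Fc: "f s : carrier R" "f s : S" "finite {s. f s ~= \<zero>}" if "f : carrier K.F" for f s using that K.B.free_module_carrier[of f S] Sr(1) by auto
 have dc: "de s : carrier R" if "approx_der W Z C de" for Z C de s using that by (simp add: approx_der_def)
 have Smone: "--\<^sub>?B \<one>\<^sub>?B = -- \<one>" using K.B.minus_equality[of "-- \<one>" \<one>] Sr(3,5) by (simp add: l_neg)
 have sm: "a \<odot>\<^sub>K.F x : ?N" if ax: "a : carrier ?B" "x : ?N" for a x
 proof -
  obtain Y where Y: "P x Y" using ax by blast
  have "pairing (a \<odot>\<^sub>K.F x) de : W" if d: "approx_der W (u ` carrier T) C de" "Y <= C" for C de
  proof -
   have "pairing x de : W" using Y d unfolding P_def by blast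
   moreover have "pairing (a \<odot>\<^sub>K.F x) de = a**pairing x de" using pairing_smult[of x a de] Fc ax dc[OF d(1)] Sr(1) by (auto simp: K.B.free_module_simps)
   ultimately show ?thesis using ax SW Wr(6) by auto
  qed
  thus ?thesis using Y ax K.F.smult_closed unfolding P_def by blast
 qed
 have ad: "a ++\<^sub>K.F b : ?N" if ab: "a : ?N" "b : ?N" for a b
 proof -
  obtain Y Z where Y: "P a Y" "P b Z" using ab by blast
  have "pairing (a ++\<^sub>K.F b) de : W" if d: "approx_der W (u ` carrier T) C de" "Y \<union> Z <= C" for C de
  proof -
   have "pairing a de : W" "pairing b de : W" using Y d unfolding P_def by blast+
   moreover have "pairing (a ++\<^sub>K.F b) de = pairing a de ++ pairing b de" using pairing_add[of a b de] Fc ab dc[OF d(1)] by (auto simp: K.B.free_module_simps)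
   ultimately show ?thesis using Wr(7) by simp
  qed
  hence "P (a ++\<^sub>K.F b) (Y \<union> Z)" using Y unfolding P_def by blast
  thus ?thesis using ab K.F.M.a_closed by blast
 qed
 have neg: "--\<^sub>K.F a = (--\<^sub>?B \<one>\<^sub>?B) \<odot>\<^sub>K.F a" if "a : carrier K.F" for a
  using K.F.smult_l_minus[OF K.B.one_closed, of a] K.F.smult_one[of a] that by simp
 have N: "submodule ?N ?B K.F"
 proof (rule K.F.submoduleI)
  show "?N <= carrier K.F" by blast
  have "pairing (%s. \<zero>) de = \<zero>" for de by (simp add: pairing_def)
  hence "P \<zero>\<^sub>K.F {}" unfolding P_def using Wr(2) by (simp add: K.B.free_module_simps)
  thus "\<zero>\<^sub>K.F : ?N" by blast
  show "--\<^sub>K.F a : ?N" if "a : ?N" for a using sm[OF K.B.a_inv_closed[OF K.B.one_closed] that] neg[of a] that by simp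
 qed (use sm ad in blast)+
 have uB: "unit_vector ?B b = unit_vector R b" for b by (auto simp: unit_vector_def)
 have uF: "unit_vector R b : carrier K.F" if "b : S" for b using K.B.unit_vector_closed[of b S] that uB[of b] by simp
 have pm: "pairing (a --\<^sub>K.F b) de = pairing a de -- pairing b de"
  if ab: "a : carrier K.F" "b : carrier K.F" "!!s. de s : carrier R" for a b de
 proof -
  have nb: "--\<^sub>K.F b : carrier K.F" using ab(2) by (rule K.F.M.a_inv_closed)
  have "pairing (--\<^sub>K.F b) de = -- pairing b de" unfolding neg[OF ab(2)] Smone using pairing_smult[of b "-- \<one>" de] Fc[OF ab(2)] ab(3) pairing_closed[of b de]
   by (simp add: K.B.free_module_simps l_minus)
  moreover have "pairing (a ++\<^sub>K.F --\<^sub>K.F b) de = pairing a de ++ pairing (--\<^sub>K.F b) de"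
   using pairing_add[of a "--\<^sub>K.F b" de] Fc ab nb by (auto simp: K.B.free_module_simps)
  ultimately show ?thesis by (simp add: a_minus_def)
 qed
 have pa: "pairing (a ++\<^sub>K.F b) de = pairing a de ++ pairing b de"
  if ab: "a : carrier K.F" "b : carrier K.F" "!!s. de s : carrier R" for a b de using pairing_add[of a b de] Fc ab by (auto simp: K.B.free_module_simps)
 have ps: "pairing (c \<odot>\<^sub>K.F a) de = c**pairing a de"
  if ab: "a : carrier K.F" "c : S" "!!s. de s : carrier R" for a c de using pairing_smult[of a c de] Fc ab Sr(1) by (auto simp: K.B.free_module_simps)
 have "kaehler_relations T u ?B <= ?N"
 proof
  fix r assume r: "r : kaehler_relations T u ?B"
  hence rc: "r : carrier K.F" using K.relations_closed by blast
  from r consider (1) b c where "b : S" "c : S" "r = unit_vector R (b ++ c) --\<^sub>K.F (unit_vector R b ++\<^sub>K.F unit_vector R c)"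
   | (2) b c where "b : S" "c : S" "r = unit_vector R (b**c) --\<^sub>K.F (b \<odot>\<^sub>K.F unit_vector R c ++\<^sub>K.F c \<odot>\<^sub>K.F unit_vector R b)"
   | (3) t where "t : carrier T" "r = unit_vector R (u t)" unfolding kaehler_relations_def Let_def uB by auto
  hence "EX Y. P r Y"
  proof cases
   case 1
   have "pairing r de = de (b ++ c) -- (de b ++ de c)" if "!!s. de s : carrier R" for de unfolding 1(3) using pm pa uF 1 Sr(7) that pairing_unit K.F.M.a_closed by simp
   hence "P r {b, c}" unfolding P_def using 1 by (auto simp: approx_der_def)
   thus ?thesis by blast
  next
   case 2
   have "pairing r de = de (b**c) -- (b**de c ++ c**de b)" if "!!s. de s : carrier R" for de
   unfolding 2(3) using pm pa ps uF 2 Sr(6) that pairing_unit K.F.M.a_closed K.F.smult_closed by simp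
   hence "P r {b, c}" unfolding P_def using 2 by (auto simp: approx_der_def)
   thus ?thesis by blast
  next
   case 3
   have "u t : S" using K.u_closed[OF 3(1)] by simp
   hence "P r {u t}" unfolding P_def 3(2) using pairing_unit 3(1) by (auto simp: approx_der_def)
   thus ?thesis by blast
  qed
  thus "r : ?N" using rc by blast
 qed
 hence "f : ?N" using K.N_minimal[OF N] f by blast
 thus ?thesis unfolding P_def by blast
qed

end

context valued_field
begin

interpretation D: cring dual by (rule dual_cring)

text \<open>Pairing \<open>rel\<close> with the derivation shows that
  \<open>b (1 + bt^(p-1)) m\<close> is integral, where \<open>m\<close> is the image of
  \<open>bt\<close>; by the choice of \<open>m\<close> this product is \<open>b / p\<close>.\<close>

lemma kaehler_torsion_bound:
 assumes F: "subfield F R" and int: "!!x. x : F ==> x ~= \<zero> ==> w x : \<int>"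
  and res: "!!x. x : vge 0 ==> EX s:F \<inter> vge 0. x -- s : vgt 0"
  and alg: "!!x. x : carrier R ==> integral_over F x"
  and p: "p >= 2" "w (natf p) = 1" and char: "!!n. n >= 1 ==> natf n ~= \<zero>"
  and bt: "bt : S" "bt[^]p = natf p -- natf p**bt"
  and S: "subring S R" "S <= vge 0" and K: "kaehler_data T u (R\<lparr>carrier := S\<rparr>)" and uF: "u ` carrier T <= F"
  and b: "b : S"
  and rel: "(%s. (b**(\<one> ++ bt[^](p - 1)))**unit_vector R bt s) : kaehler_submodule T u (R\<lparr>carrier := S\<rparr>)"
 shows "b**inv (natf p) : vge 0"
proof -
 obtain Y where Y: "finite Y" "Y <= S"
  "!!C de. approx_der (vge 0) (u ` carrier T) C de ==> Y <= C ==>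
   pairing (%s. (b**(\<one> ++ bt[^](p - 1)))**unit_vector R bt s) de : vge 0" using kaehler_pairing[OF S(1) vge0_subring S(2) K rel] by blast
 have Sc: "x : carrier R" if "x : S" for x using that subringE(1)[OF S(1)] by blast
 obtain F2 N G m where G: "subfield F2 R" "F <= F2" "Y <= F2" "der_graph N F2 G" "(F \<inter> vge 0) \<times> vge 0 <= G"
  "(bt, m) : G" "natf p**(\<one> ++ bt[^](p - 1))**m = \<one>" using exists_derivation[OF F int res alg p char Sc[OF bt(1)] bt(2) Y(1)] Y(2) subringE(1)[OF S(1)] by blast
 have Gs: "subring G dual" and G1: "!!x y. (x, y) : G ==> x : F2 \<inter> vge 0 & y : vge (- N)"
  and G2: "!!x. x : F2 \<inter> vge 0 ==> EX y. (x, y) : G" and G0: "!!y. (\<zero>, y) : G <-> y : vge 0" using G(4) unfolding der_graph_def by blast+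
 define C where "C = F2 \<inter> vge 0"
 \<comment> \<open>The graph determines the image of an element up to \<open>vge 0\<close> only, so
   one image is chosen; outside \<open>C\<close> the value zero makes \<open>de\<close>
   total.\<close>
 define de where "de x = (if x : C then SOME y. (x, y) : G else \<zero>)" for x
 have dG: "(x, de x) : G" if "x : C" for x using that someI_ex[OF G2] unfolding de_def C_def by simp
 have Cc: "x : carrier R" if "x : C" for x using that vge_carrier by (auto simp: C_def)
 have dc: "de x : carrier R" for x using dG[of x] G1[of x "de x"] vge_carrier by (cases "x : C") (auto simp: de_def)
 have uniq: "y -- z : vge 0" if yz: "(x, y) : G" "(x, z) : G" for x y z
 proof -
  have c: "x : carrier R" "y : carrier R" "z : carrier R" using yz G1 vge_carrier by blast+
  have "(x, y) --\<^sub>dual (x, z) : G" using yz subringE(5,7)[OF Gs] by (simp add: a_minus_def)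
  hence "(\<zero>, y -- z) : G" using dual_minus c by (simp add: a_minus_def r_neg)
  thus ?thesis using G0 by blast
 qed
 have Cs: "subring C R" unfolding C_def using subring_inter[OF subfieldE(1)[OF G(1)] vge0_subring] .
 have "approx_der (vge 0) (u ` carrier T) C de" unfolding approx_der_def
 proof (intro conjI allI ballI)
  show "de x : carrier R" for x by (rule dc)
  fix x y assume xy: "x : C" "y : C"
  have "(x, de x) ++\<^sub>dual (y, de y) : G" "(x, de x) **\<^sub>dual (y, de y) : G" using subringE(6,7)[OF Gs] dG xy by auto
  thus "de (x ++ y) -- (de x ++ de y) : vge 0" "de (x**y) -- (x**de y ++ y**de x) : vge 0" using uniq[OF dG] subringE(6,7)[OF Cs xy] by simp_all
 next
  fix z assume z: "z : u ` carrier T \<inter> C"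
  hence "(z, \<zero>) : (F \<inter> vge 0) \<times> vge 0" using uF subringE(2)[OF vge0_subring] by (auto simp: C_def)
  hence "(z, \<zero>) : G" using G(5) by blast
  hence "de z -- \<zero> : vge 0" using uniq[OF dG] z by blast
  thus "de z : vge 0" using dc by (simp add: a_minus_def)
 qed
 moreover have "Y <= C" using G(3) Y(2) S(2) by (auto simp: C_def)
 ultimately have pr: "pairing (%s. (b**(\<one> ++ bt[^](p - 1)))**unit_vector R bt s) de : vge 0" using Y(3) by blast
 define c where "c = b**(\<one> ++ bt[^](p - 1))"
 have bc: "b : carrier R" "bt : carrier R" "c : carrier R" using b bt Sc by (auto simp: c_def)
 have mc: "m : carrier R" using G1[OF G(6)] vge_carrier by blast
 have "finite {s. unit_vector R bt s ~= \<zero>}" by (rule finite_subset[of _ "{bt}"]) (auto simp: unit_vector_def)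
 hence "pairing (%s. c**unit_vector R bt s) de = c**de bt" using pairing_smult[of "unit_vector R bt" c de] pairing_unit[of de bt] dc bc by (auto simp: unit_vector_def)
 hence 1: "c**de bt : vge 0" using pr by (simp add: c_def)
 have bS: "\<one> ++ bt[^](p - 1) : vge 0" using subringE(3,7)[OF vge0_subring] vge0_pow bt(1) S(2) by blast
 hence cW: "c : vge 0" unfolding c_def using b S(2) subringE(6)[OF vge0_subring] by blast
 have "bt : C" using G1[OF G(6)] by (simp add: C_def)
 hence "m -- de bt : vge 0" using uniq[OF G(6) dG] by blast
 hence "c**de bt ++ c**(m -- de bt) : vge 0" using vge_add[OF 1 vge0_mult[OF cW]] by blast
 moreover have "c**de bt ++ c**(m -- de bt) = c**m" using bc(3) mc dc[of bt] by algebra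
 moreover have "c**m = b**inv (natf p)"
 proof -
  have p0: "natf p ~= \<zero>" using char p(1) by simp
  note ip = inv_facts[OF natf_closed p0]
  let ?v = "\<one> ++ bt[^](p - 1)"
  have vc: "?v : carrier R" using bc by simp
  have "natf p**(?v**m) = \<one>" using G(7) vc mc by (simp add: m_assoc)
  hence "inv (natf p) = ?v**m" using vc mc by (intro comm_inv_char) auto
  thus ?thesis unfolding c_def using bc vc mc by (simp add: m_assoc)
 qed
 ultimately show ?thesis by simp
qed

end

section \<open>Power series over a discrete valuation ring\<close>

lemma (in abelian_monoid) finsum_in:
 assumes "finite A" "\<zero> : P" "!!x y. x : P ==> y : P ==> x ++ y : P" "P <= carrier G" "!!a. a : A ==> f a : P"
 shows "finsum G f A : P" using assms(1,5)
proof (induction A rule: finite_induct)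
 case (insert a A)
 hence "f : A \<rightarrow> carrier G" "f a : carrier G" using assms(4) by auto
 thus ?case using insert assms(3) by simp
qed (use assms(2) in simp)

lemma (in abelian_monoid) finsum_split:
 assumes "finite A" "a : A" "!!x. x : A ==> f x : carrier G"
 shows "finsum G f A = f a ++ finsum G f (A - {a})"
proof -
 have "finsum G f (insert a (A - {a})) = f a ++ finsum G f (A - {a})" by (rule finsum_insert) (use assms in auto)
 thus ?thesis using assms(2) by (simp add: insert_absorb)
qed

locale uniformized = domain V for V :: "('v, 'm) ring_scheme" (structure) +
 fixes un :: 'v
 assumes pi_closed: "un : carrier V" and pi_nonzero: "un ~= \<zero>" and pi_nonunit: "un ~: Units V"
  and decompose: "v : carrier V ==> v ~= \<zero> ==> EX u:Units V. EX n::nat. v = u**un[^]n"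
begin

abbreviation "piV == {un**v | v. v : carrier V}"

lemma pi_pow: "un[^](n::nat) : carrier V" "un[^]n ~= \<zero>"
proof -
 show c: "un[^]n : carrier V" for n :: nat using pi_closed by simp
 show "un[^]n ~= \<zero>" by (induction n) (use integral_iff c pi_closed pi_nonzero in \<open>auto simp: one_not_zero\<close>)
qed

lemma unit_iff: "v : carrier V ==> v ~: piV ==> v : Units V"
proof -
 assume v: "v : carrier V" "v ~: piV"
 have "\<zero> = un**\<zero>" using pi_closed by simp
 hence "v ~= \<zero>" using v(2) zero_closed by blast
 then obtain u and n :: nat where u: "u : Units V" "v = u**un[^]n" using decompose v by blast
 have "n = 0"
 proof (cases n)
  case (Suc m)
  hence "v = un**(u**un[^]m)" using u pi_closed Units_closed by (simp add: m_ac)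
  thus ?thesis using v(2) u pi_closed by blast
 qed
 thus ?thesis using u by simp
qed

lemma piV_prime: "a : carrier V ==> b : carrier V ==> a**b : piV ==> a : piV \<or> b : piV"
proof (rule disjCI)
 assume a: "a : carrier V" "b : carrier V" "a**b : piV" "b ~: piV"
 hence u: "b : Units V" using unit_iff by blast
 obtain v where v: "v : carrier V" "a**b = un**v" using a(3) by blast
 have "a = un**(v**inv b)" using v u a(1,2) pi_closed by (metis Units_inv_closed Units_r_inv m_assoc r_one)
 thus "a : piV" using v u by blast
qed

lemma one_notin_piV: "\<one> ~: piV"
proof
 assume "\<one> : piV"
 then obtain v where v: "v : carrier V" "\<one> = un**v" by blast
 hence "un : Units V" using pi_closed m_comm[of un v] unfolding Units_def by auto
 thus False using pi_nonunit by simp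
qed

lemma unit_notin_piV: "u : Units V ==> u ~: piV"
proof
 assume u: "u : Units V" "u : piV"
 then obtain v where v: "v : carrier V" "u = un**v" by blast
 have "\<one> = un**(v**inv u)" using v u(1) pi_closed Units_r_inv[OF u(1)] by (metis Units_inv_closed m_assoc)
 hence "\<one> : piV" using v u(1) by blast
 thus False using one_notin_piV by simp
qed

lemma piV_ideal: "\<zero> : piV" "x : piV ==> y : piV ==> x ++ y : piV" "piV <= carrier V"
 "x : piV ==> c : carrier V ==> x**c : piV" "x : piV ==> c : carrier V ==> c**x : piV"
proof -
 show "\<zero> : piV" using pi_closed by (intro CollectI exI[of _ \<zero>]) simp
 show "x ++ y : piV" if "x : piV" "y : piV"
 proof -
  obtain a b where "a : carrier V" "b : carrier V" "x = un**a" "y = un**b" using `x : piV` `y : piV` by blast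
  hence "x ++ y = un**(a ++ b)" "a ++ b : carrier V" using pi_closed by (simp_all add: r_distr)
  thus ?thesis by blast
 qed
 show "piV <= carrier V" using pi_closed by auto
 show 1: "x**c : piV" if "x : piV" "c : carrier V"
 proof -
  obtain a where "a : carrier V" "x = un**a" using `x : piV` by blast
  hence "x**c = un**(a**c)" "a**c : carrier V" using pi_closed `c : carrier V` by (simp_all add: m_assoc)
  thus ?thesis by blast
 qed
 show "c**x : piV" if "x : piV" "c : carrier V" using 1[OF that] m_comm[of c x] that pi_closed by auto
qed

lemma pi_pow_nonunit: "u : Units V ==> c : carrier V ==> u**un[^](r::nat) ~= c**un[^]Suc r"
proof
 assume u: "u : Units V" "c : carrier V" "u**un[^]r = c**un[^]Suc r"
 hence "u**un[^]r = (un**c)**un[^]r" using pi_closed by (simp add: m_ac)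
 hence "u = un**c" using m_rcancel[OF pi_pow(2,1), of u "un**c" r] u pi_closed Units_closed by blast
 thus False using unit_notin_piV u by blast
qed

text \<open>A fixed \<open>d\<close> cannot compensate a difference between the orders of
  \<open>b\<close> and \<open>a\<close>, because this difference is multiplied by
  \<open>n\<close>.\<close>

lemma completely_integrally_closed:
 assumes c: "a : carrier V" "b : carrier V" "d : carrier V" "b ~= \<zero>" "d ~= \<zero>"
  and e: "!!n::nat. EX e:carrier V. d**a[^]n = e**b[^]n"
 shows "EX v:carrier V. a = b**v"
proof (cases "a = \<zero>")
 case True
 thus ?thesis using c by (intro bexI[of _ \<zero>]) auto
next
 case False
 obtain u and s :: nat where a: "u : Units V" "a = u**un[^]s" using decompose[OF c(1) False] by blast
 obtain u' and t :: nat where b: "u' : Units V" "b = u'**un[^]t" using decompose[OF c(2,4)] by blast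
 obtain u'' and r :: nat where d: "u'' : Units V" "d = u''**un[^]r" using decompose[OF c(3,5)] by blast
 note uc = Units_closed[OF a(1)] Units_closed[OF b(1)] Units_closed[OF d(1)]
 show ?thesis
 proof (cases "t <= s")
  case True
  have "b**(inv u'**u**un[^](s - t)) = (u'**inv u')**(u**(un[^]t**un[^](s - t)))" using b uc pi_closed by (simp add: m_ac del: Units_r_inv Units_l_inv)
  also have "\<dots> = a" using a b uc pi_closed True by (simp add: nat_pow_mult)
  finally show ?thesis using b uc pi_closed by (intro bexI[of _ "inv u'**u**un[^](s - t)"]) auto
 next
  case False
  define k where "k = t - Suc s"
  hence t: "t = s + Suc k" using False by simp
  define w where "w = inv u**u'**un[^]k"
  have wc: "w : carrier V" using a uc pi_closed by (simp add: w_def)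
  have "a**(un**w) = (u**inv u)**(u'**(un[^]s**(un[^]k**un)))" using a uc pi_closed by (simp add: w_def m_ac del: Units_r_inv Units_l_inv)
  also have "\<dots> = b" using a b uc pi_closed t by (simp add: nat_pow_mult[symmetric] m_assoc)
  finally have ba: "b = a**(un**w)" by simp
  \<comment> \<open>The exponent is one more than the order \<open>r\<close> of \<open>d\<close>:
    each factor \<open>b\<close> has a surplus factor \<open>un\<close> over \<open>a\<close>, so
    \<open>d\<close> would be divisible by \<open>un[^]Suc r\<close>.\<close>
  obtain e where e: "e : carrier V" "d**a[^]Suc r = e**b[^]Suc r" using e by blast
  define A where "A = a[^]Suc r"
  define W where "W = w[^]Suc r"
  define Q where "Q = un[^]Suc r"
  have c': "A : carrier V" "W : carrier V" "Q : carrier V" using c wc pi_closed by (simp_all add: A_def W_def Q_def)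
  note eA = e(2)[folded A_def]
  have "b[^]Suc r = A**(Q**W)" unfolding ba A_def W_def Q_def using c wc pi_closed by (simp only: nat_pow_distrib m_closed)
  hence "d**A = (e**W**Q)**A" using eA e(1) c' by (simp add: m_ac)
  moreover have "a[^]n ~= \<zero>" for n :: nat by (induction n) (use integral_iff c(1) `a ~= \<zero>` in auto)
  hence "A ~= \<zero>" unfolding A_def .
  ultimately have "d = e**W**Q" using m_rcancel[of A d "e**W**Q"] c c' e by blast
  moreover have "e**W : carrier V" using e(1) c'(2) by simp
  ultimately have False using pi_pow_nonunit[OF d(1), of "e**W" r] d(2) Q_def by metis
  thus ?thesis ..
 qed
qed

end

text \<open>The same growth argument for exponents, one variable at a time: for \<open>n\<close> one
  larger than the multiplicity in \<open>de\<close>, a deficit in \<open>\<alpha>\<close> could not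
  be compensated.\<close>

lemma multiset_multiples_le:
 fixes de \<alpha> mu :: "'i multiset"
 assumes "!!n. EX \<epsilon>. de + repeat_mset n \<alpha> = \<epsilon> + repeat_mset n mu"
 shows "mu <=# \<alpha>"
proof (rule mset_subset_eqI)
 fix i
 obtain \<epsilon> where "de + repeat_mset (Suc (count de i)) \<alpha> = \<epsilon> + repeat_mset (Suc (count de i)) mu" using assms by blast
 hence e: "count de i + Suc (count de i) * count \<alpha> i = count \<epsilon> i + Suc (count de i) * count mu i" by (metis count_union count_repeat_mset)
 show "count mu i <= count \<alpha> i"
 proof (rule ccontr)
  assume "~ count mu i <= count \<alpha> i"
  hence "Suc (count de i) * Suc (count \<alpha> i) <= Suc (count de i) * count mu i" by (intro mult_le_mono) auto
  thus False using e by simp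
 qed
qed

lemma (in cring) power_series_simps:
 "ring.zero (power_series_ring R I) = (%m. \<zero>)" "f ++\<^bsub>power_series_ring R I\<^esub> g = (%m. f m ++ g m)"
 "\<one>\<^bsub>power_series_ring R I\<^esub> = indexed_const \<one>"
 "(f **\<^bsub>power_series_ring R I\<^esub> g) m = (\<Oplus>a\<in>{a. a <=# m}. f a**g (m - a))" by (simp_all add: power_series_ring_def)

lemma (in cring) power_series_carrier:
 "f : carrier (power_series_ring R I) <-> (ALL m. f m : carrier R) & (ALL m. ~ set_mset m <= I --> f m = \<zero>)" by (simp add: power_series_ring_def)

lemma finite_submultisets: "finite {a. a <=# (m :: 'i multiset)}"
proof (induction m)
 case (add x m)
 have "{a. a <=# add_mset x m} <= {a. a <=# m} \<union> add_mset x ` {a. a <=# m}"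
 proof
  fix a assume a: "a : {a. a <=# add_mset x m}"
  show "a : {a. a <=# m} \<union> add_mset x ` {a. a <=# m}"
  proof (cases "x :# a")
   case True
   then obtain b where "a = add_mset x b" by (metis insert_DiffM)
   thus ?thesis using a by auto
  next
   case False
   have "count a y <= count m y" for y using mset_subset_eq_count[of a "add_mset x m" y] a False by (cases "y = x") (auto simp: not_in_iff)
   thus ?thesis by (simp add: mset_subset_eqI)
  qed
 qed
 thus ?case using add finite_subset by blast
qed simp

context cring
begin

lemma power_series_mult_closed:
 assumes "f : carrier (power_series_ring R I)" "g : carrier (power_series_ring R I)"
 shows "f **\<^bsub>power_series_ring R I\<^esub> g : carrier (power_series_ring R I)" unfolding power_series_carrier power_series_simps
proof (intro conjI allI impI)
 have c: "f m : carrier R" "g m : carrier R" "~ set_mset m <= I ==> f m = \<zero>" "~ set_mset m <= I ==> g m = \<zero>" for m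
  using assms unfolding power_series_carrier by auto
 show "(\<Oplus>a\<in>{a. a <=# m}. f a**g (m - a)) : carrier R" for m by (rule finsum_closed) (use c in auto)
 fix m assume m: "~ set_mset m <= I"
 have "f a**g (m - a) = \<zero>" if "a <=# m" for a
 proof -
  have "a + (m - a) = m" using that by simp
  hence "~ set_mset a <= I \<or> ~ set_mset (m - a) <= I" using m by (metis Un_least set_mset_union)
  thus ?thesis using c(3)[of a] c(4)[of "m - a"] c(1,2) by fastforce
 qed
 hence "(\<Oplus>a\<in>{a. a <=# m}. f a**g (m - a)) = (\<Oplus>a\<in>{a. a <=# m}. \<zero>)" by (intro finsum_cong') auto
 thus "(\<Oplus>a\<in>{a. a <=# m}. f a**g (m - a)) = \<zero>" by simp
qed

lemma power_series_const_mult: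
 assumes "v : carrier R" "f : carrier (power_series_ring R I)"
 shows "indexed_const v **\<^bsub>power_series_ring R I\<^esub> f = (%m. v**f m)"
proof
 fix m
 have c: "f m : carrier R" for m using assms(2) unfolding power_series_carrier by auto
 have "(\<Oplus>a\<in>{a. a <=# m}. indexed_const v a**f (m - a)) = (\<Oplus>a\<in>{a. a <=# m}. if {#} = a then v**f (m - a) else \<zero>)"
  by (rule finsum_cong') (use c assms(1) in \<open>auto simp: indexed_const_def\<close>)
 also have "\<dots> = v**f (m - {#})" by (rule finsum_singleton) (use finite_submultisets c assms(1) in auto)
 finally show "(indexed_const v **\<^bsub>power_series_ring R I\<^esub> f) m = v**f m" by (simp add: power_series_simps)
qed

lemma power_series_const_closed: "v : carrier R ==> indexed_const v : carrier (power_series_ring R I)" by (auto simp: power_series_carrier indexed_const_def)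

text \<open>If a sum of two monomials is at most \<open>mu + \<nu>\<close> and is not formed from
  \<open>mu\<close> and \<open>\<nu>\<close>, one summand is smaller than its counterpart. The ideal
  \<open>P\<close> allows two uses: the multiples of the uniformizer for primality, and zero for
  leading terms.\<close>

lemma power_series_mult_leading:
 fixes f g :: "'i::wellorder multiset => 'a"
 assumes P: "\<zero> : P" "!!x y. x : P ==> y : P ==> x ++ y : P" "P <= carrier R"
   "!!x c. x : P ==> c : carrier R ==> x**c : P" "!!x c. x : P ==> c : carrier R ==> c**x : P"
  and c: "f : carrier (power_series_ring R I)" "g : carrier (power_series_ring R I)"
  and f: "!!m. m < mu ==> f m : P" and g: "!!m. m < \<nu> ==> g m : P"
 shows "EX r:P. (f **\<^bsub>power_series_ring R I\<^esub> g) (mu + \<nu>) = f mu**g \<nu> ++ r"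
  and "!!m. m < mu + \<nu> ==> (f **\<^bsub>power_series_ring R I\<^esub> g) m : P"
proof -
 have c: "f m : carrier R" "g m : carrier R" for m using c unfolding power_series_carrier by auto
 have tm: "f a**g (m - a) : P" if "a <=# m" "m <= mu + \<nu>" "a ~= mu \<or> m < mu + \<nu>" for a m
 proof (cases "a < mu")
  case True
  thus ?thesis using P(4)[OF f c(2)] by blast
 next
  case False
  have "m = a + (m - a)" using that(1) by simp
  hence "a + (m - a) < mu + \<nu> \<or> (mu < a & a + (m - a) <= mu + \<nu>)" using that False by auto
  hence "m - a < \<nu>" using False by (metis add_le_less_mono add_less_le_mono not_less add_mono)
  thus ?thesis using P(5)[OF g c(1)] by blast
 qed
 have "(f **\<^bsub>power_series_ring R I\<^esub> g) (mu + \<nu>) = f mu**g (mu + \<nu> - mu) ++ (\<Oplus>a\<in>{a. a <=# mu + \<nu>} - {mu}. f a**g (mu + \<nu> - a))"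
  unfolding power_series_simps by (rule finsum_split) (use finite_submultisets c in auto)
 moreover have "(\<Oplus>a\<in>{a. a <=# mu + \<nu>} - {mu}. f a**g (mu + \<nu> - a)) : P" by (rule finsum_in[OF _ P(1-3)]) (simp_all add: finite_submultisets tm)
 ultimately show "EX r:P. (f **\<^bsub>power_series_ring R I\<^esub> g) (mu + \<nu>) = f mu**g \<nu> ++ r" by auto
 show "(f **\<^bsub>power_series_ring R I\<^esub> g) m : P" if "m < mu + \<nu>" for m unfolding power_series_simps
  by (rule finsum_in[OF _ P(1-3)]) (use that in \<open>simp_all add: finite_submultisets tm\<close>)
qed

end

text \<open>The power series ring is studied through its image under the injective \<open>j\<close>,
  so that algebraic laws can be taken from the field \<open>L\<close>. The variables are
  well-ordered in order to have a well-ordering of monomials.\<close>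

locale power_series_embedding = uniformized V un + L: field L
 for V :: "('v, 'm) ring_scheme" (structure) and un and L :: "('l, 'n) ring_scheme" +
 fixes I :: "'i::wellorder set" and j :: "('i multiset => 'v) => 'l"
 assumes j_hom: "j : ring_hom (power_series_ring V I) L" and j_inj: "inj_on j (carrier (power_series_ring V I))"
begin

abbreviation "PS == power_series_ring V I"
abbreviation "JR == j ` carrier PS"
abbreviation "pL == j (indexed_const un)"

lemma j_simps: "f : carrier PS ==> j f : carrier L"
 "f : carrier PS ==> g : carrier PS ==> j (f **\<^sub>PS g) = j f **\<^sub>L j g"
 "f : carrier PS ==> g : carrier PS ==> j (%m. f m ++ g m) = j f ++\<^sub>L j g"
 "j (indexed_const \<one>) = \<one>\<^sub>L" using ring_hom_memE[OF j_hom] by (auto simp: power_series_simps)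

lemma ps_coeff: "f : carrier PS ==> f m : carrier V" by (simp add: power_series_carrier)

lemma j_zero: "j (%m. \<zero>) = \<zero>\<^sub>L"
proof -
 have z: "(%m. \<zero>) : carrier PS" by (simp add: power_series_carrier)
 have "j (%m. \<zero>) ++\<^sub>L j (%m. \<zero>) = j (%m. \<zero>)" using j_simps(3)[OF z z] by simp
 thus ?thesis using j_simps(1)[OF z] by (metis L.r_zero L.add.l_cancel L.zero_closed)
qed

lemma j_eq: "f : carrier PS ==> g : carrier PS ==> j f = j g ==> f = g" using j_inj by (auto dest: inj_onD)

lemma j_minus: assumes "f : carrier PS" "g : carrier PS"
 shows "(%m. f m -- g m) : carrier PS" "j (%m. f m -- g m) = j f --\<^sub>L j g"
proof -
 show c: "(%m. f m -- g m) : carrier PS" using assms by (auto simp: power_series_carrier a_minus_def)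
 have "j (%m. (f m -- g m) ++ g m) = j (%m. f m -- g m) ++\<^sub>L j g" by (rule j_simps(3)[OF c assms(2)])
 moreover have "(%m. (f m -- g m) ++ g m) = f" using ps_coeff assms by (auto simp: a_minus_def a_assoc l_neg)
 ultimately have "j f = j (%m. f m -- g m) ++\<^sub>L j g" by simp
 thus "j (%m. f m -- g m) = j f --\<^sub>L j g" using j_simps(1)[OF c] j_simps(1)[OF assms(2)] by (simp add: a_minus_def L.a_assoc L.r_neg)
qed

lemma JR_subring: "subring JR L"
proof (rule L.subringI)
 show "JR <= carrier L" using j_simps(1) by blast
 show "\<one>\<^sub>L : JR" using j_simps(4) power_series_const_closed[OF one_closed] by (metis image_eqI)
 have z: "(%m. \<zero>) : carrier PS" by (simp add: power_series_carrier)
 show "--\<^sub>L h : JR" if h: "h : JR" for h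
 proof -
  obtain f where f: "f : carrier PS" "h = j f" using h by blast
  have "--\<^sub>L h = j (%m. \<zero> -- f m)" using j_minus(2)[OF z f(1)] j_zero f j_simps(1)[OF f(1)] by (simp add: a_minus_def)
  thus ?thesis using j_minus(1)[OF z f(1)] by blast
 qed
 show "h1 **\<^sub>L h2 : JR" if h: "h1 : JR" "h2 : JR" for h1 h2
 proof -
  obtain f g where "f : carrier PS" "h1 = j f" "g : carrier PS" "h2 = j g" using h by blast
  thus ?thesis using j_simps(2)[of f g] power_series_mult_closed[of f I g] by (metis image_eqI)
 qed
 show "h1 ++\<^sub>L h2 : JR" if h: "h1 : JR" "h2 : JR" for h1 h2
 proof -
  obtain f g where fg: "f : carrier PS" "h1 = j f" "g : carrier PS" "h2 = j g" using h by blast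
  hence "(%m. f m ++ g m) : carrier PS" by (auto simp: power_series_carrier)
  from imageI[OF this, of j] show ?thesis using j_simps(3)[OF fg(1,3)] fg(2,4) by simp
 qed
qed

lemma pi_const: "indexed_const un : carrier PS" by (rule power_series_const_closed[OF pi_closed])

lemma varpi: "pL : JR" "pL : carrier L" "pL ~= \<zero>\<^sub>L"
proof -
 show "pL : JR" "pL : carrier L" using pi_const j_simps(1) by auto
 show "pL ~= \<zero>\<^sub>L"
 proof
  assume "pL = \<zero>\<^sub>L"
  hence "indexed_const un = (%m :: 'i multiset. \<zero>)" using j_eq[OF pi_const, of "%m. \<zero>"] j_zero by (simp add: power_series_carrier)
  from fun_cong[OF this, of "{#}"] show False using pi_nonzero by (simp add: indexed_const_def)
 qed
qed

lemma divisible_iff: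
 assumes f: "f : carrier PS"
 shows "(EX x:JR. j f = pL **\<^sub>L x) <-> (ALL m. f m : piV)"
proof
 assume "EX x:JR. j f = pL **\<^sub>L x"
 then obtain g where g: "g : carrier PS" "j f = pL **\<^sub>L j g" by blast
 hence "f = indexed_const un **\<^sub>PS g" using j_eq[OF f power_series_mult_closed[OF pi_const g(1)]] j_simps(2)[OF pi_const g(1)] by simp
 hence "f = (%m. un**g m)" using power_series_const_mult[OF pi_closed g(1)] by simp
 thus "ALL m. f m : piV" using ps_coeff[OF g(1)] by blast
next
 assume a: "ALL m. f m : piV"
 define g where "g m = (if set_mset m <= I then SOME v. v : carrier V & f m = un**v else \<zero>)" for m
 have g: "g m : carrier V & f m = un**g m" if "set_mset m <= I" for m
 proof -
  have "EX v. v : carrier V & f m = un**v" using a by blast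
  from someI_ex[OF this] show ?thesis using that by (simp add: g_def)
 qed
 have g0: "g m = \<zero>" if "~ set_mset m <= I" for m using that by (simp add: g_def)
 have gc: "g : carrier PS" using g g0 zero_closed unfolding power_series_carrier by metis
 have "f = indexed_const un **\<^sub>PS g" unfolding power_series_const_mult[OF pi_closed gc]
 proof
  show "f m = un**g m" for m using g[of m] g0[of m] f pi_closed by (cases "set_mset m <= I") (auto simp: power_series_carrier)
 qed
 thus "EX x:JR. j f = pL **\<^sub>L x" using j_simps(2)[OF pi_const gc] gc by auto
qed

text \<open>Gauss's lemma: for the least monomials whose coefficients are not divisible by
  \<open>un\<close>, the product of these coefficients survives modulo \<open>un\<close>.\<close>

lemma varpi_prime:
 assumes "x : JR" "y : JR" "EX z:JR. x **\<^sub>L y = pL **\<^sub>L z"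
 shows "(EX z:JR. x = pL **\<^sub>L z) \<or> (EX z:JR. y = pL **\<^sub>L z)"
proof (rule ccontr)
 assume n: "~ ?thesis"
 obtain f g where fg: "f : carrier PS" "x = j f" "g : carrier PS" "y = j g" using assms by blast
 have ex: "EX m. f m ~: piV" "EX m. g m ~: piV" using n divisible_iff[OF fg(1)] divisible_iff[OF fg(3)] fg by blast+
 define mu where "mu = (LEAST m. f m ~: piV)"
 define \<nu> where "\<nu> = (LEAST m. g m ~: piV)"
 have m: "f mu ~: piV" "g \<nu> ~: piV" using LeastI_ex[OF ex(1)] LeastI_ex[OF ex(2)] unfolding mu_def \<nu>_def by blast+
 have l: "!!m. m < mu ==> f m : piV" "!!m. m < \<nu> ==> g m : piV" unfolding mu_def \<nu>_def using not_less_Least by blast+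
 obtain r where r: "r : piV" "(f **\<^sub>PS g) (mu + \<nu>) = f mu**g \<nu> ++ r" using power_series_mult_leading(1)[OF piV_ideal fg(1,3) l] by blast
 have "ALL m. (f **\<^sub>PS g) m : piV" using assms(3) divisible_iff[OF power_series_mult_closed[OF fg(1,3)]] j_simps(2)[OF fg(1,3)] fg by simp
 hence "(f **\<^sub>PS g) (mu + \<nu>) ++ (-- \<one>)**r : piV" using piV_ideal(2) piV_ideal(5)[OF r(1), of "-- \<one>"] by blast
 moreover have "(f **\<^sub>PS g) (mu + \<nu>) ++ (-- \<one>)**r = f mu**g \<nu>" using r ps_coeff fg piV_ideal(3) by (auto simp: l_minus a_assoc r_neg subset_iff)
 ultimately show False using piV_prime[of "f mu" "g \<nu>"] m ps_coeff fg by metis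
qed

text \<open>The order \<open>k\<close> of one nonzero coefficient bounds how often \<open>un\<close>
  can be divided out of the series.\<close>

lemma JR_decompose:
 assumes "x : JR" "x ~= \<zero>\<^sub>L"
 shows "EX (n::nat) s. s : JR & x = pL [^]\<^sub>L n **\<^sub>L s & ~ (EX z:JR. s = pL **\<^sub>L z)"
proof -
 obtain f where f: "f : carrier PS" "x = j f" using assms by blast
 have "EX m. f m ~= \<zero>" using assms f j_zero by (metis ext)
 then obtain m u and k :: nat where m: "u : Units V" "f m = u**un[^]k" using decompose ps_coeff[OF f(1)] by metis
 show ?thesis unfolding f(2) using f(1) m(2)
 proof (induction k arbitrary: f)
  case 0
  have "f m ~: piV" using 0 m(1) unit_notin_piV Units_closed by simp
  hence "~ (EX z:JR. j f = pL **\<^sub>L z)" using divisible_iff[OF 0(1)] by blast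
  thus ?case using 0 j_simps(1)[OF 0(1)] by (intro exI[of _ 0] exI[of _ "j f"]) auto
 next
  case (Suc k)
  show ?case
  proof (cases "EX z:JR. j f = pL **\<^sub>L z")
   case False
   thus ?thesis using Suc.prems j_simps(1)[OF Suc.prems(1)] by (intro exI[of _ 0] exI[of _ "j f"]) auto
  next
   case True
   then obtain g where g: "g : carrier PS" "j f = pL **\<^sub>L j g" by blast
   hence "f = indexed_const un **\<^sub>PS g" using j_eq[OF Suc.prems(1) power_series_mult_closed[OF pi_const g(1)]] j_simps(2)[OF pi_const g(1)] by simp
   hence "f m = un**g m" using power_series_const_mult[OF pi_closed g(1)] by simp
   hence "un**g m = un**(u**un[^]k)" using Suc.prems m(1) pi_closed Units_closed by (simp add: m_ac)
   hence "g m = u**un[^]k" using m_lcancel[OF pi_nonzero pi_closed] ps_coeff[OF g(1)] Units_closed[OF m(1)] pi_closed by simp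
   from Suc.IH[OF g(1) this] obtain n :: nat and s where s: "s : JR" "j g = pL [^]\<^sub>L n **\<^sub>L s" "~ (EX z:JR. s = pL **\<^sub>L z)" by blast
   have "j f = pL [^]\<^sub>L Suc n **\<^sub>L s" unfolding g(2) s(2) using varpi(2) subringE(1)[OF JR_subring] s(1) by (auto simp: L.m_ac subset_iff)
   thus ?thesis using s by blast
  qed
 qed
qed

text \<open>For power series the least monomial has to lead. The multiset order is total,
  well-founded and compatible with addition, so leading monomials exist and add up in
  products.\<close>

definition is_lead :: "('i multiset => 'v) => 'i multiset => bool" where
 "is_lead f mu <-> f mu ~= \<zero> & (ALL m<mu. f m = \<zero>)"

lemma is_lead_exists: "f m ~= \<zero> ==> EX mu<=m. is_lead f mu"
proof (intro exI conjI)
 assume m: "f m ~= \<zero>"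
 show "(LEAST m. f m ~= \<zero>) <= m" using m by (rule Least_le)
 show "is_lead f (LEAST m. f m ~= \<zero>)" unfolding is_lead_def using LeastI[of "%m. f m ~= \<zero>", OF m] not_less_Least[of _ "%m. f m ~= \<zero>"] by simp
qed

lemma is_lead_unique: "is_lead f mu ==> is_lead f \<nu> ==> mu = \<nu>" unfolding is_lead_def by (rule linorder_cases[of mu \<nu>]) simp_all

lemma is_lead_mult:
 assumes c: "f : carrier PS" "g : carrier PS" and l: "is_lead f mu" "is_lead g \<nu>"
 shows "is_lead (f **\<^sub>PS g) (mu + \<nu>)" "(f **\<^sub>PS g) (mu + \<nu>) = f mu**g \<nu>"
proof -
 have z: "\<zero> : {\<zero>}" "!!x y. x : {\<zero>} ==> y : {\<zero>} ==> x ++ y : {\<zero>}" "{\<zero>} <= carrier V"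
  "!!x c. x : {\<zero>} ==> c : carrier V ==> x**c : {\<zero>}" "!!x c. x : {\<zero>} ==> c : carrier V ==> c**x : {\<zero>}" by auto
 have fg: "!!m. m < mu ==> f m : {\<zero>}" "!!m. m < \<nu> ==> g m : {\<zero>}" using l by (auto simp: is_lead_def)
 note K = power_series_mult_leading[OF z c fg]
 show e: "(f **\<^sub>PS g) (mu + \<nu>) = f mu**g \<nu>" using K(1) ps_coeff c by auto
 have "f mu**g \<nu> ~= \<zero>" using l integral_iff ps_coeff c by (auto simp: is_lead_def)
 thus "is_lead (f **\<^sub>PS g) (mu + \<nu>)" using e K(2) by (auto simp: is_lead_def)
qed

lemma is_lead_pow:
 assumes c: "f : carrier PS" and l: "is_lead f mu"
 shows "EX g:carrier PS. j g = j f [^]\<^sub>L (n::nat) & is_lead g (repeat_mset n mu) & g (repeat_mset n mu) = f mu[^]n"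
proof (induction n)
 case 0
 have "is_lead (indexed_const \<one>) {#}" using one_not_zero by (auto simp: is_lead_def indexed_const_def less_multiset\<^sub>H\<^sub>O)
 thus ?case using power_series_const_closed[OF one_closed] j_simps(4) by (intro bexI[of _ "indexed_const \<one>"]) (auto simp: indexed_const_def)
next
 case (Suc n)
 then obtain g where g: "g : carrier PS" "j g = j f [^]\<^sub>L n" "is_lead g (repeat_mset n mu)" "g (repeat_mset n mu) = f mu[^]n" by blast
 have e: "repeat_mset n mu + mu = repeat_mset (Suc n) mu" by (simp add: add.commute)
 show ?case using is_lead_mult[OF g(1) c g(3) l] g j_simps(2)[OF g(1) c] power_series_mult_closed[OF g(1) c] unfolding e by (intro bexI[of _ "g **\<^sub>PS f"]) auto
qed

text \<open>The hypotheses amount to identities \<open>d f^n = e b^n\<close> between power series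
  for all \<open>n\<close>. Comparing leading monomials and leading coefficients, both are
  divisible, since \<open>d\<close> stays fixed while \<open>n\<close> grows.\<close>

lemma lead_divisible:
 assumes c: "f : carrier PS" "b : carrier PS" "d : carrier PS"
  and l: "is_lead f \<alpha>" "is_lead b mu" "is_lead d de"
  and x: "x : carrier L" "j f = j b **\<^sub>L x" "!!n::nat. j d **\<^sub>L x [^]\<^sub>L n : JR"
 shows "EX rh. \<alpha> = mu + rh & (EX v:carrier V. f \<alpha> = b mu**v)"
proof -
 have key: "EX \<epsilon>. de + repeat_mset n \<alpha> = \<epsilon> + repeat_mset n mu & (EX e:carrier V. d de**f \<alpha>[^]n = e**b mu[^]n)" for n :: nat
 proof -
  obtain fn where fn: "fn : carrier PS" "j fn = j f [^]\<^sub>L n" "is_lead fn (repeat_mset n \<alpha>)" "fn (repeat_mset n \<alpha>) = f \<alpha>[^]n"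
   using is_lead_pow[OF c(1) l(1)] by blast
  obtain bn where bn: "bn : carrier PS" "j bn = j b [^]\<^sub>L n" "is_lead bn (repeat_mset n mu)" "bn (repeat_mset n mu) = b mu[^]n"
   using is_lead_pow[OF c(2) l(2)] by blast
  obtain e where e: "e : carrier PS" "j d **\<^sub>L x [^]\<^sub>L n = j e" using x(3) by blast
  have "j (d **\<^sub>PS fn) = j (e **\<^sub>PS bn)" using j_simps(1)[OF c(3)] j_simps(1)[OF c(2)] x(1)
   by (simp add: j_simps(2)[OF c(3) fn(1)] j_simps(2)[OF e(1) bn(1)] fn(2) bn(2) x(2) e(2)[symmetric] L.nat_pow_distrib L.m_ac)
  hence eq: "d **\<^sub>PS fn = e **\<^sub>PS bn" using j_eq power_series_mult_closed c fn e bn by blast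
  note D = is_lead_mult[OF c(3) fn(1) l(3) fn(3)]
  have "EX m. e m ~= \<zero>"
  proof (rule ccontr)
   assume "~ ?thesis"
   hence "(e **\<^sub>PS bn) m = (\<Oplus>a\<in>{a. a <=# m}. \<zero>)" for m unfolding power_series_simps by (intro finsum_cong') (use ps_coeff[OF bn(1)] in auto)
   thus False using D(1) eq by (simp add: is_lead_def)
  qed
  then obtain \<epsilon> where \<epsilon>: "is_lead e \<epsilon>" using is_lead_exists by blast
  note E = is_lead_mult[OF e(1) bn(1) \<epsilon> bn(3)]
  have "de + repeat_mset n \<alpha> = \<epsilon> + repeat_mset n mu" using is_lead_unique D(1) E(1) eq by simp
  moreover have "d de**f \<alpha>[^]n = e \<epsilon>**b mu[^]n" using D(2) E(2) fn(4) bn(4) eq calculation by simp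
  ultimately show ?thesis using ps_coeff[OF e(1)] by blast
 qed
 hence "mu <=# \<alpha>" using multiset_multiples_le[of de \<alpha> mu] by blast
 hence "\<alpha> = mu + (\<alpha> - mu)" by simp
 moreover have "EX v:carrier V. f \<alpha> = b mu**v"
  by (rule completely_integrally_closed[of "f \<alpha>" "b mu" "d de"]) (use key ps_coeff c l in \<open>auto simp: is_lead_def\<close>)
 ultimately show ?thesis by blast
qed

text \<open>
  The quotient is constructed coefficient by coefficient: subtracting a partial quotient keeps the
  remainder almost integral, so its leading coefficient remains divisible.
\<close>
lemma JR_completely_integrally_closed:
 assumes x: "x : carrier L" "b : JR" "b ~= \<zero>\<^sub>L" "b **\<^sub>L x : JR"
  and d: "d : JR" "d ~= \<zero>\<^sub>L" "!!n::nat. d **\<^sub>L x [^]\<^sub>L n : JR"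
 shows "x : JR"
proof -
 note J = subringE[OF JR_subring]
 have Jc: "y : carrier L" if "y : JR" for y using J(1) that by blast
 obtain bs where bs: "bs : carrier PS" "b = j bs" using x by blast
 obtain ds where ds: "ds : carrier PS" "d = j ds" using d by blast
 obtain as where as: "as : carrier PS" "b **\<^sub>L x = j as" using x by blast
 have nz: "EX m. g m ~= \<zero>" if "j g ~= \<zero>\<^sub>L" for g using that j_zero by (metis ext)
 obtain mu where mu: "is_lead bs mu" using is_lead_exists nz[of bs] x(3) bs(2) by blast
 obtain de where de: "is_lead ds de" using is_lead_exists nz[of ds] d(2) ds(2) by blast
 \<comment> \<open>Subtracting an element of \<open>JR\<close> keeps \<open>d\<close> as a common
   denominator of all powers. The induction requires the mixed products with powers of
   \<open>x\<close>.\<close>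
 have almost: "d **\<^sub>L (x --\<^sub>L y) [^]\<^sub>L n : JR" if y: "y : JR" for y and n :: nat
 proof -
  have yc: "y : carrier L" "d : carrier L" using Jc y d(1) by auto
  have "d **\<^sub>L (x --\<^sub>L y) [^]\<^sub>L n **\<^sub>L x [^]\<^sub>L (i::nat) : JR" for i
  proof (induction n arbitrary: i)
   case 0
   thus ?case using d(3) yc x(1) by simp
  next
   case (Suc n)
   define z where "z = (x --\<^sub>L y) [^]\<^sub>L n"
   define t where "t = x [^]\<^sub>L i"
   have c: "z : carrier L" "t : carrier L" using x(1) yc by (auto simp: z_def t_def)
   have "d **\<^sub>L z **\<^sub>L (t **\<^sub>L x) : JR" "d **\<^sub>L z **\<^sub>L t : JR" using Suc[of "Suc i"] Suc[of i] by (simp_all add: z_def t_def)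
   hence "d **\<^sub>L z **\<^sub>L (t **\<^sub>L x) ++\<^sub>L --\<^sub>L (y **\<^sub>L (d **\<^sub>L z **\<^sub>L t)) : JR" using J(7)[OF _ J(5)[OF J(6)[OF y]]] by simp
   moreover have "d **\<^sub>L z **\<^sub>L (t **\<^sub>L x) ++\<^sub>L --\<^sub>L (y **\<^sub>L (d **\<^sub>L z **\<^sub>L t)) = d **\<^sub>L (z **\<^sub>L (x --\<^sub>L y)) **\<^sub>L t"
   using c yc x(1) by (simp add: a_minus_def L.r_distr L.l_distr L.r_minus L.l_minus L.m_ac)
   ultimately show ?case by (simp add: z_def t_def)
  qed
  from this[of 0] show ?thesis using yc x(1) by simp
 qed
 \<comment> \<open>Here \<open>tr D q\<close> is the partial quotient with monomials in
   \<open>D\<close>, and \<open>rem D q\<close> is what it leaves of \<open>as\<close>. The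
   condition \<open>P q rh r\<close> makes \<open>r\<close> the coefficient that cancels the
   monomial \<open>mu + rh\<close> in the remainder left by smaller monomials.\<close>
 define tr where "tr D q m = (if m : D then q m else \<zero>)" for D :: "'i multiset set" and q and m
 define rem where "rem D q m = as m -- (bs **\<^sub>PS tr D q) m" for D q m
 define P where "P q rh r <-> r : carrier V & (~ set_mset rh <= I --> r = \<zero>) &
  (set_mset rh <= I --> bs mu**r = rem {..<rh} q (mu + rh))" for q rh r
 have bc: "bs m : carrier V" "as m : carrier V" for m using ps_coeff bs(1) as(1) by auto
 have trc: "tr D q : carrier PS" if "!!y. y : D ==> P q y (q y)" for D q using that unfolding power_series_carrier tr_def P_def by auto
 have bmu: "m < mu ==> bs m = \<zero>" for m using mu by (simp add: is_lead_def)
 have remc: "rem D q : carrier PS" "j (rem D q) = j bs **\<^sub>L (x --\<^sub>L j (tr D q))"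
  if "!!y. y : D ==> P q y (q y)" for D q
 proof -
  note t = trc[of D q, OF that]
  note m = power_series_mult_closed[OF bs(1) t]
  have r: "rem D q = (%m. as m -- (bs **\<^sub>PS tr D q) m)" by (simp add: rem_def fun_eq_iff)
  show "rem D q : carrier PS" unfolding r by (rule j_minus(1)[OF as(1) m])
  have "j (rem D q) = j as --\<^sub>L j (bs **\<^sub>PS tr D q)" unfolding r by (rule j_minus(2)[OF as(1) m])
  thus "j (rem D q) = j bs **\<^sub>L (x --\<^sub>L j (tr D q))"
   using as(2)[symmetric] j_simps(2)[OF bs(1) t] x(1) bs(2) j_simps(1)[OF bs(1)] j_simps(1)[OF t] by (simp add: a_minus_def L.r_distr L.r_minus)
 qed
 \<comment> \<open>As \<open>mu\<close> is the least monomial of \<open>bs\<close>, terms of the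
   quotient beyond \<open>rh\<close> affect only monomials beyond \<open>mu + rh\<close>; a
   cancelled coefficient stays zero.\<close>
 have key: "rem D q (mu + rh) = \<zero>"
  if D: "!!y. y : D ==> P q y (q y)" "ALL y:D. ALL z<y. z : D" "rh : D" "set_mset rh <= I" for D q rh
 proof -
  have D': "!!y. y : {..<rh} ==> P q y (q y)" using D by auto
  note t = ps_coeff[OF trc[of D q, OF D(1)]] and t' = ps_coeff[OF trc[of "{..<rh}" q, OF D']]
  let ?A = "{a. a <=# mu + rh} - {mu}" and ?f = "%q' a. bs a**q' (mu + rh - a)"
  have s: "(bs **\<^sub>PS q') (mu + rh) = bs mu**q' rh ++ finsum V (?f q') ?A" if "!!m. q' m : carrier V" for q'
  proof -
   have "(bs **\<^sub>PS q') (mu + rh) = bs mu**q' (mu + rh - mu) ++ finsum V (?f q') ?A"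
   unfolding power_series_simps by (rule finsum_split) (use finite_submultisets bc that in auto)
   thus ?thesis by simp
  qed
  have "finsum V (?f (tr D q)) ?A = finsum V (?f (tr {..<rh} q)) ?A"
  proof (rule finsum_cong')
   fix a assume a: "a : ?A"
   show "?f (tr D q) a = ?f (tr {..<rh} q) a"
   proof (cases "a < mu")
   case True
   thus ?thesis using bmu t t' by simp
   next
   case False
   hence "mu < a" using a by auto
   moreover have "a + (mu + rh - a) = mu + rh" using a by simp
   ultimately have "mu + rh - a < rh" by (metis add_less_le_mono less_irrefl not_less)
   thus ?thesis using D(2) D(3) by (simp add: tr_def)
   qed
  qed (use bc t' in auto)
  moreover have "tr D q rh = q rh" "tr {..<rh} q rh = \<zero>" using D(3) by (auto simp: tr_def)
  moreover have "bs mu**q rh = rem {..<rh} q (mu + rh)" "q rh : carrier V" using D(1)[OF D(3)] D(4) by (auto simp: P_def)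
  ultimately have e: "(bs **\<^sub>PS tr D q) (mu + rh) = rem {..<rh} q (mu + rh) ++ (bs **\<^sub>PS tr {..<rh} q) (mu + rh)"
   using s[of "tr D q", OF t] s[of "tr {..<rh} q", OF t'] bc ps_coeff[OF power_series_mult_closed[OF bs(1) trc[of "{..<rh}" q, OF D']], of "mu + rh"]
   finsum_closed[of "?f (tr {..<rh} q)" ?A] t' by auto
  have "(bs **\<^sub>PS tr {..<rh} q) (mu + rh) : carrier V" using ps_coeff[OF power_series_mult_closed[OF bs(1) trc[of "{..<rh}" q, OF D']]] .
  hence "(bs **\<^sub>PS tr D q) (mu + rh) = as (mu + rh)" unfolding e rem_def using bc by (simp add: a_minus_def a_assoc l_neg)
  thus ?thesis unfolding rem_def using bc by (simp add: a_minus_def r_neg)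
 qed
 have lead: "EX rh. \<kappa> = mu + rh & set_mset rh <= I & rh ~: D & (EX v:carrier V. rem D q \<kappa> = bs mu**v)"
  if D: "!!y. y : D ==> P q y (q y)" "ALL y:D. ALL z<y. z : D" and l: "is_lead (rem D q) \<kappa>" for D q \<kappa>
 proof -
  have t: "j (tr D q) : JR" using trc[of D q, OF D(1)] by blast
  have xc: "x --\<^sub>L j (tr D q) : carrier L" using x(1) Jc[OF t] by simp
  obtain rh where rh: "\<kappa> = mu + rh" "EX v:carrier V. rem D q \<kappa> = bs mu**v"
   using lead_divisible[OF remc(1)[of D q, OF D(1)] bs(1) ds(1) l mu de xc remc(2)[of D q, OF D(1)]] almost[OF t] ds(2) by blast
  have nz: "rem D q \<kappa> ~= \<zero>" using l by (simp add: is_lead_def)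
  hence "set_mset \<kappa> <= I" using remc(1)[of D q, OF D(1)] unfolding power_series_carrier by blast
  hence "set_mset rh <= I" using rh(1) by simp
  moreover from this have "rh ~: D" using key[of D q rh, OF D] nz rh(1) by blast
  ultimately show ?thesis using rh by blast
 qed
 have "EX q. ALL rh. P q rh (q rh)"
 proof (rule dependent_wf_choice[OF wf_less_multiset])
  fix f g :: "'i multiset => 'v" and rh r assume "!!z. (z, rh) : {(M, N). M < N} ==> f z = g z"
  hence "tr {..<rh} f = tr {..<rh} g" by (auto simp: tr_def)
  thus "P f rh r = P g rh r" by (simp add: P_def rem_def)
 next
  fix rh q assume "!!y. (y, rh) : {(M, N). M < N} ==> P q y (q y)"
  hence D: "!!y. y : {..<rh} ==> P q y (q y)" "ALL y:{..<rh}. ALL z<y. z : {..<rh}" by auto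
  show "EX r. P q rh r"
  proof (cases "set_mset rh <= I & rem {..<rh} q (mu + rh) ~= \<zero>")
   case False
   hence "P q rh \<zero>" using bc by (auto simp: P_def)
   thus ?thesis by blast
  next
   case True
   \<comment> \<open>The leading monomial is some \<open>mu + rh'\<close> with \<open>rh'\<close>
     not treated yet, and it is at most \<open>mu + rh\<close>. Hence \<open>rh'\<close> is
     \<open>rh\<close>, and the required division by \<open>bs mu\<close> is possible.\<close>
   then obtain \<kappa> where l: "\<kappa> <= mu + rh" "is_lead (rem {..<rh} q) \<kappa>" using is_lead_exists by blast
   obtain rh' v where r: "\<kappa> = mu + rh'" "rh' ~: {..<rh}" "v : carrier V" "rem {..<rh} q \<kappa> = bs mu**v" using lead[of "{..<rh}" q \<kappa>, OF D l(2)] by blast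
   hence "rh' = rh" using l(1) by (simp add: not_less)
   hence "P q rh v" using r True by (simp add: P_def)
   thus ?thesis by blast
  qed
 qed
 then obtain q where q: "!!rh. P q rh (q rh)" by blast
 have t: "tr UNIV q : carrier PS" by (rule trc) (use q in auto)
 have "rem UNIV q m = \<zero>" for m
 proof (rule ccontr)
  assume "rem UNIV q m ~= \<zero>"
  then obtain \<kappa> where "is_lead (rem UNIV q) \<kappa>" using is_lead_exists by blast
  thus False using lead[of UNIV q \<kappa>] q by blast
 qed
 hence "rem UNIV q = (%m. \<zero>)" by blast
 hence "b **\<^sub>L (x --\<^sub>L j (tr UNIV q)) = \<zero>\<^sub>L" using remc(2)[of UNIV q] q j_zero bs(2) by simp
 hence "x --\<^sub>L j (tr UNIV q) = \<zero>\<^sub>L" using L.integral_iff Jc[OF x(2)] x(1,3) j_simps(1)[OF t] by simp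
 hence "x = j (tr UNIV q)" using x(1) j_simps(1)[OF t] by (simp add: L.r_right_minus_eq)
 thus ?thesis using t by blast
qed

end

section \<open>Localization at a prime element\<close>

context field
begin

lemma fractions_in_memI: "a : S ==> b : S ==> b ~= \<zero> ==> a**inv b : fractions_in R S" by (auto simp: fractions_in_def)

lemma fraction_add:
 assumes "a : carrier R" "b : carrier R" "c : carrier R" "d : carrier R" "b ~= \<zero>" "d ~= \<zero>"
 shows "a**inv b ++ c**inv d = (a**d ++ c**b)**inv (b**d)"
  "(a**inv b)**(c**inv d) = (a**c)**inv (b**d)"
proof -
 note i = inv_facts[OF assms(2,5)] inv_facts[OF assms(4,6)]
 define b' where "b' = inv b"
 define d' where "d' = inv d"
 have c: "b' : carrier R" "d' : carrier R" "b**b' = \<one>" "d**d' = \<one>" using i by (auto simp: b'_def d'_def)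
 have e: "inv (b**d) = b'**d'" using inv_mult assms by (simp add: b'_def d'_def)
 have "(a**d ++ c**b)**(b'**d') = a**b'**(d**d') ++ c**d'**(b**b')" using c(1,2) assms(1-4) by algebra
 also have "\<dots> = a**b' ++ c**d'" using c assms by simp
 finally show "a**inv b ++ c**inv d = (a**d ++ c**b)**inv (b**d)" unfolding e by (simp add: b'_def d'_def)
 show "(a**inv b)**(c**inv d) = (a**c)**inv (b**d)" unfolding e b'_def[symmetric] d'_def[symmetric] using c(1,2) assms(1-4) by algebra
qed

lemma localization_subring:
 assumes S: "subring S R" and D: "D <= S" "\<one> : D" "\<zero> ~: D" "!!x y. x : D ==> y : D ==> x**y : D"
 shows "subring {a**inv s | a s. a : S & s : D} R" (is "subring ?P R")
proof (rule subringI)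
 note s = subringE[OF S]
 have c: "x : carrier R" if "x : S" for x using s(1) that by blast
 have Dc: "x : carrier R" "x : S" "x ~= \<zero>" if "x : D" for x using c D that by auto
 show "?P <= carrier R" using c Dc inv_facts by fastforce
 show "\<one> : ?P" using D(2) s(3) by (intro CollectI exI[of _ \<one>]) simp
 show "-- h : ?P" if h: "h : ?P" for h
 proof -
  obtain a d where a: "a : S" "d : D" "h = a**inv d" using h by blast
  have "-- h = (-- a)**inv d" using a c Dc inv_facts by (simp add: l_minus)
  thus ?thesis using a s(5) by blast
 qed
 show "h1**h2 : ?P" "h1 ++ h2 : ?P" if h: "h1 : ?P" "h2 : ?P" for h1 h2
 proof -
  obtain a d where a: "a : S" "d : D" "h1 = a**inv d" using h by blast
  obtain b e where b: "b : S" "e : D" "h2 = b**inv e" using h by blast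
  note f = fraction_add[of a d b e, OF c[OF a(1)] Dc(1)[OF a(2)] c[OF b(1)] Dc(1)[OF b(2)] Dc(3)[OF a(2)] Dc(3)[OF b(2)]]
  have "d**e : D" "a**b : S" "a**e ++ b**d : S" using a b D(4) s(6,7) Dc(2) by auto
  thus "h1**h2 : ?P" "h1 ++ h2 : ?P" unfolding a(3) b(3) f by blast+
 qed
qed

lemma fractions_in_subfield:
 assumes S: "subring S R"
 shows "subfield (fractions_in R S) R" "S <= fractions_in R S"
proof -
 note s = subringE[OF S]
 have c: "x : carrier R" if "x : S" for x using s(1) that by blast
 have "fractions_in R S = {a**inv d | a d. a : S & d : S - {\<zero>}}" by (simp add: fractions_in_def)
 moreover have "subring {a**inv d | a d. a : S & d : S - {\<zero>}} R" by (rule localization_subring[OF S]) (use s nonzero_mult c one_not_zero in auto)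
 ultimately have "subring (fractions_in R S) R" by simp
 thus "subfield (fractions_in R S) R"
 proof (rule subfieldI')
  fix k assume k: "k : fractions_in R S - {\<zero>}"
  then obtain a b where ab: "a : S" "b : S" "b ~= \<zero>" "k = a**inv b" by (auto simp: fractions_in_def)
  note ib = inv_facts[OF c[OF ab(2)] ab(3)]
  have a0: "a ~= \<zero>" using k ab ib by auto
  have "inv k = b**inv a" unfolding ab(4) using inv_mult[of a "inv b"] c ab a0 ib inv_facts[of a] m_comm by simp
  thus "inv k : fractions_in R S" using fractions_in_memI ab a0 by simp
 qed
 show "S <= fractions_in R S"
 proof
  fix x assume x: "x : S"
  have "x = x**inv \<one>" using c x by simp
  thus "x : fractions_in R S" using fractions_in_memI[of x S \<one>] x s(3) one_not_zero by simp
 qed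
qed

text \<open>All powers of \<open>x\<close> are combinations of those up to \<open>m\<close>, and
  \<open>b[^]m\<close> clears the denominators of these.\<close>

lemma integral_common_denominator:
 assumes S: "subring S R" and x: "x : carrier R" "integral_over S x" and b: "b : S" "b**x : S"
 shows "EX m::nat. ALL n::nat. b[^]m**x[^]n : S"
proof -
 note s = subringE[OF S]
 note A = subring_additive_subgroup[OF S]
 have c: "y : carrier R" if "y : S" for y using s(1) that by blast
 have pw: "y[^](k::nat) : S" if "y : S" for y k by (induction k) (use s(3,6) that in auto)
 obtain m :: nat where m: "x[^]m : pspan S x m" using x(2) by (auto simp: integral_over_def)
 have sm: "subring (pspan S x m) R \<or> m = 0" using subring_pspan[OF S x(1) m] by linarith
 \<comment> \<open>The length \<open>Suc m\<close> instead of \<open>m\<close> ensures that the span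
   contains \<open>x\<close> for small \<open>m\<close> too; it is a ring and thus contains all
   powers.\<close>
 have xn: "x[^]n : pspan S x (Suc m)" for n :: nat
 proof -
  have m': "x[^]Suc m : pspan S x (Suc m)" using pspan_shift[OF A x(1) m] m_comm[of x "x[^]m"] x(1) by simp
  have sr: "subring (pspan S x (Suc m)) R" by (rule subring_pspan[OF S x(1) m']) simp
  have x1: "x : pspan S x (Suc m)"
  proof (cases "m = 0")
   case True
   thus ?thesis using m' x(1) by simp
  next
   case False
   thus ?thesis using pspan_monom[OF A x(1) s(3), of 1 "Suc m"] x(1) by simp
  qed
  show ?thesis by (induction n) (use subringE(3,6)[OF sr] x1 in auto)
 qed
 have "b[^]m**z : S" if z: "z : pspan S x (Suc m)" for z
 proof -
  have "b[^]m**z : pspan S x (Suc m)" by (rule pspan_smult[OF A x(1) _ _ z]) (use s(6) pw b c in auto)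
  define E where "E = {z : carrier R. b[^]m**z : S}"
  have bc: "b[^]m : carrier R" using c b by simp
  have E1: "E ~= {}" using bc s(2) zero_closed by (auto simp: E_def)
  have E2: "-- a : E" if "a : E" for a using that bc s(5)[of "b[^]m**a"] by (simp add: E_def r_minus)
  have E3: "a ++ a' : E" if "a : E" "a' : E" for a a' using that bc s(7)[of "b[^]m**a" "b[^]m**a'"] by (simp add: E_def r_distr)
  have E4: "E <= carrier R" by (auto simp: E_def)
  have E: "additive_subgroup E R" unfolding additive_subgroup_def by (rule add.subgroupI) (use E1 E2 E3 E4 in \<open>auto simp: a_inv_def[symmetric]\<close>)
  have "z : E"
  proof (rule pspan_subset[OF E x(1) _ z])
   fix y i assume y: "y : S" "i < Suc m"
   have "b[^]m = b[^](m - i)**b[^]i" using y c b nat_pow_mult[of b "m - i" i] by simp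
   hence "b[^]m**(y**x[^]i) = b[^](m - i)**y**(b**x)[^]i" using y c b x(1) pow_prod[of b x i] by (simp add: m_ac)
   also have "\<dots> : S" using s(6) pw y b by auto
   finally show "y**x[^]i : E" using y c x(1) by (simp add: E_def)
  qed
  thus ?thesis by (simp add: E_def)
 qed
 thus ?thesis using xn by blast
qed

text \<open>For \<open>k = 0\<close> this is the transformation of a monic polynomial, given by its
  coefficients from the leading one on, that multiplies its roots by \<open>c\<close>.\<close>

primrec scl :: "'a => nat => 'a list => 'a list" where
 "scl c k [] = []"
| "scl c k (d # ds) = d**c[^]k # scl c (Suc k) ds"

lemma length_scl [simp]: "length (scl c k ds) = length ds" by (induction ds arbitrary: k) auto

lemma set_scl: "e : set (scl c k ds) ==> EX d:set ds. EX i. e = d**c[^](i::nat)" by (induction ds arbitrary: k) auto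

lemma scl_set: "d : set ds ==> EX i. d**c[^](i::nat) : set (scl c k ds)"
proof (induction ds arbitrary: k)
 case (Cons e ds)
 thus ?case by (cases "d = e") auto
qed simp

lemma scl_closed: "c : carrier R ==> set ds <= carrier R ==> set (scl c k ds) <= carrier R" using set_scl by fastforce

text \<open>The extra factor \<open>c\<close> on the left avoids the truncated exponent
  \<open>length ds - 1\<close> on the right.\<close>

lemma eval_scl:
 assumes c: "c : carrier R" "x : carrier R"
 shows "set ds <= carrier R ==> eval (scl c k ds) (c**x)**c = c[^](k + length ds)**eval ds x"
proof (induction ds arbitrary: k)
 case (Cons d ds)
 have dc: "d : carrier R" "set ds <= carrier R" using Cons.prems by auto
 note e = eval_closed[OF dc(2) c(2)] eval_closed[OF scl_closed[OF c(1) dc(2), of "Suc k"], of "c**x"]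
 define l where "l = length ds"
 define E where "E = eval (scl c (Suc k) ds) (c**x)"
 have Ec: "E : carrier R" using e c by (simp add: E_def)
 have IH: "E**c = c[^](Suc k + l)**eval ds x" using Cons.IH[OF dc(2)] by (simp add: E_def l_def)
 have p: "(c**x)[^]l = c[^]l**x[^]l" using pow_prod c by simp
 have "eval (scl c k (d # ds)) (c**x)**c = (d**c[^]k**(c[^]l**x[^]l))**c ++ E**c" using p dc c Ec by (simp add: E_def l_def l_distr)
 also have "\<dots> = c[^](Suc k + l)**(d**x[^]l) ++ c[^](Suc k + l)**eval ds x" unfolding IH using dc c by (simp add: nat_pow_mult[symmetric] m_ac)
 also have "\<dots> = c[^](Suc k + l)**eval (d # ds) x" using dc c e by (simp add: l_def r_distr)
 finally show ?case by (simp add: l_def)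
qed (use c in simp)

text \<open>The monic polynomial \<open>d\<close> over \<open>K\<close> vanishes at \<open>x\<close>
  exactly if \<open>\<one> # h\<close> vanishes at \<open>c**x\<close>. As \<open>y\<close> is a
  root of \<open>d\<close>, the minimal polynomial of \<open>y\<close> divides \<open>d\<close>, and
  so the conjugate \<open>r\<close> is a root.\<close>

lemma conjugate_root:
 assumes K: "subfield K R" and y: "y : carrier R" "integral_over K y" and r: "r : carrier R" "eval (Irr K y) r = \<zero>"
  and h: "set h <= K" "c : K" "c ~= \<zero>" "eval (\<one> # h) (c**y) = \<zero>"
 shows "eval (\<one> # h) (c**r) = \<zero>"
proof -
 note s = subringE[OF subfieldE(1)[OF K]]
 have Kc: "x : carrier R" if "x : K" for x using s(1) that by blast
 have alg: "(algebraic over K) y" using algebraic_iff_integral[OF K y(1)] y(2) by simp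
 note ic = inv_facts[OF Kc[OF h(2)] h(3)]
 have icK: "inv c : K" using subfield_m_inv(1)[OF K] h by auto
 define d where "d = scl (inv c) 0 (\<one> # h)"
 have icp: "inv c[^]i : K" for i :: nat by (induction i) (use s(3,6) icK in auto)
 have dK: "set d <= K" unfolding d_def using set_scl[of _ "inv c" 0 "\<one> # h"] icp h(1) s(3,6) by fastforce
 have key: "eval d x**inv c = inv c[^]length (\<one> # h)**eval (\<one> # h) (c**x)" if x: "x : carrier R" for x
 proof -
  have "inv c**(c**x) = x" using ic x Kc[OF h(2)] by (simp add: m_assoc[symmetric])
  thus ?thesis using eval_scl[of "inv c" "c**x" "\<one> # h" 0] ic x Kc h by (auto simp: d_def)
 qed
 have dc: "set d <= carrier R" using dK Kc by blast
 have root: "eval d x = \<zero> <-> eval (\<one> # h) (c**x) = \<zero>" if x: "x : carrier R" for x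
 proof -
  have hc: "set (\<one> # h) <= carrier R" using h Kc by auto
  have e: "eval (\<one> # h) (c**x) : carrier R" "eval d x : carrier R" using eval_closed[OF hc] eval_closed[OF dc x] x Kc h by auto
  have "inv c[^]length (\<one> # h) ~= \<zero>" by (rule nonzero_pow) (use ic in auto)
  thus ?thesis using key[OF x] e ic integral_iff[of "eval d x" "inv c"] integral_iff[of "inv c[^]length (\<one> # h)" "eval (\<one> # h) (c**x)"]
   by (metis nat_pow_closed r_null l_null)
 qed
 have hd: "lead_coeff d = \<one>" "d ~= []" using ic by (auto simp: d_def)
 have dp: "d : carrier (K[X])" unfolding univ_poly_carrier[symmetric] polynomial_def using dK hd one_not_zero by auto
 have "(Irr K y) pdivides d" by (rule Irr_minimal[OF K y(1) alg dp]) (use root[OF y(1)] h in simp)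
 moreover have "Irr K y : carrier (poly_ring R)" using IrrE(1)[OF K y(1) alg] carrier_polynomial_shell[OF subfieldE(1)[OF K]] by blast
 ultimately have "eval d r = \<zero>" using pdivides_imp_root_sharing r by blast
 thus ?thesis using root[OF r(1)] by simp
qed

end

text \<open>A prime element for which all orders are finite, so that the localization at it is a
  discrete valuation ring, inside an algebraic closure of the fraction field. Both the power series
  ring and \<open>V\<close> give instances.\<close>

locale prime_element = field R for R (structure) + fixes S q
 assumes S: "subring S R" and q: "q : S" "q ~= \<zero>" "~ (EX z:S. \<one> = q**z)"
  and q_prime: "a : S ==> b : S ==> EX z:S. a**b = q**z ==> (EX z:S. a = q**z) \<or> (EX z:S. b = q**z)"
  and q_decompose: "x : S ==> x ~= \<zero> ==> EX (n::nat) s. s : S & x = q[^]n**s & ~ (EX z:S. s = q**z)"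
  and ac: "algebraically_closed R" and alg: "x : carrier R ==> integral_over (fractions_in R S) x"
begin

abbreviation "Q == fractions_in R S"

lemmas Q_subfield = fractions_in_subfield(1)[OF S] and S_Q = fractions_in_subfield(2)[OF S]

lemma S_c: "x : S ==> x : carrier R" using subringE(1)[OF S] by blast

definition loc where "loc = {a**inv s | a s. a : S & s : {s : S. ~ (EX z:S. s = q**z)}}"

lemma nondiv_nonzero: "~ (EX z:S. s = q**z) ==> s ~= \<zero>" using subringE(2)[OF S] S_c[OF q(1)] by (metis r_null)

lemma loc_subring: "subring loc R" unfolding loc_def
proof (rule localization_subring[OF S])
 show "\<zero> ~: {s : S. ~ (EX z:S. s = q**z)}" using nondiv_nonzero by blast
 show "\<one> : {s : S. ~ (EX z:S. s = q**z)}" using q(3) subringE(3)[OF S] by blast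
 show "x**y : {s : S. ~ (EX z:S. s = q**z)}"
  if "x : {s : S. ~ (EX z:S. s = q**z)}" "y : {s : S. ~ (EX z:S. s = q**z)}" for x y using that q_prime[of x y] subringE(6)[OF S, of x y] by blast
qed blast

lemma S_loc: "S <= loc"
proof
 fix x assume x: "x : S"
 have "x = x**inv \<one>" using S_c[OF x] by simp
 thus "x : loc" unfolding loc_def using x q(3) subringE(3)[OF S] by blast
qed

lemma loc_Q: "loc <= Q" unfolding loc_def fractions_in_def using nondiv_nonzero by blast

lemma loc_decompose:
 assumes "x : loc" "x ~= \<zero>"
 shows "EX n::nat. EX u:loc. u ~= \<zero> & inv u : loc & x = q[^]n**u"
proof -
 obtain a s where a: "a : S" "s : S" "~ (EX z:S. s = q**z)" "x = a**inv s" using assms(1) unfolding loc_def by blast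
 note s0 = nondiv_nonzero[OF a(3)]
 note iss = inv_facts[OF S_c[OF a(2)] s0]
 have "a ~= \<zero>" using assms(2) a(4) iss by auto
 then obtain n :: nat and t where t: "t : S" "a = q[^]n**t" "~ (EX z:S. t = q**z)" using q_decompose a(1) by blast
 note t0 = nondiv_nonzero[OF t(3)]
 note it = inv_facts[OF S_c[OF t(1)] t0]
 have "x = q[^]n**(t**inv s)" unfolding a(4) t(2) using S_c t(1) q(1) iss by (simp add: m_assoc)
 moreover have "t**inv s : loc" unfolding loc_def using t a by blast
 moreover have "inv (t**inv s) = s**inv t" using inv_mult[of t "inv s"] S_c t(1) a(2) t0 iss it m_comm by simp
 hence "inv (t**inv s) : loc" unfolding loc_def using t a by blast
 moreover have "t**inv s ~= \<zero>" using nonzero_mult[of t "inv s"] S_c t(1) t0 iss by blast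
 ultimately show ?thesis by blast
qed

lemma Q_loc: "fractions_in R loc = Q"
proof
 show "Q <= fractions_in R loc" unfolding fractions_in_def using S_loc by blast
 show "fractions_in R loc <= Q"
 proof
  fix x assume "x : fractions_in R loc"
  then obtain a b where ab: "a : loc" "b : loc" "b ~= \<zero>" "x = a**inv b" by (auto simp: fractions_in_def)
  hence "a : Q" "inv b : Q" using loc_Q subfield_m_inv(1)[OF Q_subfield] by auto
  thus "x : Q" unfolding ab(4) by (rule subringE(6)[OF subfieldE(1)[OF Q_subfield]])
 qed
qed

text \<open>With \<open>q[^]m\<close> as common denominator of all powers of \<open>a / q\<close>,
  the quotient of \<open>a[^]Suc m\<close> by \<open>q\<close> lies in the localization. So
  \<open>q\<close> divides \<open>a[^]Suc m\<close> times an element prime to \<open>q\<close>, and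
  by primality it divides \<open>a\<close>.\<close>

lemma divisible_of_integral:
 assumes a: "a : S" and i: "integral_over loc (a**inv q)"
 shows "EX z:S. a = q**z"
proof -
 have c: "a : carrier R" "q : carrier R" using S_c a q by auto
 note iq = inv_facts[OF c(2) q(2)]
 have aq: "q**(a**inv q) = a" using c iq by (simp add: m_lcomm)
 obtain m :: nat where "ALL n::nat. q[^]m**(a**inv q)[^]n : loc" using integral_common_denominator[OF loc_subring _ i, of q] S_loc q a c iq aq by auto
 hence "q[^]m**(a**inv q)[^]Suc m : loc" by blast
 moreover have "q[^]m**(a**inv q)[^]Suc m = a[^]Suc m**inv q"
 proof -
  have "q[^]m**(a**inv q)[^]Suc m = (q[^]m**(a**inv q)[^]m)**(a**inv q)" using c iq by (simp add: m_assoc)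
  also have "q[^]m**(a**inv q)[^]m = a[^]m" using pow_prod[of q "a**inv q" m] aq c iq by simp
  finally show ?thesis using c iq by (simp add: m_assoc)
 qed
 ultimately obtain b s where b: "b : S" "s : S" "~ (EX z:S. s = q**z)" "a[^]Suc m**inv q = b**inv s" unfolding loc_def by auto
 note s0 = nondiv_nonzero[OF b(3)]
 note iss = inv_facts[OF S_c[OF b(2)] s0]
 have bs: "b : carrier R" "s : carrier R" using S_c b by auto
 have qs: "inv q**(q**s) = s" "inv s**(q**s) = q" using c iq iss bs m_assoc[of "inv q" q s] m_lcomm[of "inv s" q s] by simp_all
 have "a[^]Suc m**s = (a[^]Suc m**inv q)**(q**s)" using c iq bs qs(1) by (simp add: m_assoc)
 also have "\<dots> = b**q" unfolding b(4) using c iss bs qs(2) by (simp add: m_assoc)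
 also have "\<dots> = q**b" using c bs m_comm by simp
 finally have e: "a[^]Suc m**s = q**b" .
 have pS: "a[^]k : S" for k :: nat by (induction k) (use subringE(3,6)[OF S] a in auto)
 have "EX z:S. a[^]Suc m = q**z" using q_prime[OF pS[of "Suc m"] b(2)] e b(1,3) by metis
 moreover have "EX z:S. a[^]k = q**z ==> EX z:S. a = q**z" for k :: nat
 proof (induction k)
  case 0
  thus ?case using q(3) by simp
 next
  case (Suc k)
  have "(EX z:S. a[^]k = q**z) \<or> (EX z:S. a = q**z)" using q_prime[OF pS[of k] a] Suc.prems by simp
  thus ?case using Suc.IH by blast
 qed
 ultimately show ?thesis by blast
qed

lemma valuation_integers:
 assumes w: "valued_field R w" "w q = 1" "ALL x:loc. x ~= \<zero> --> w x >= 0" and x: "x : Q" "x ~= \<zero>"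
 shows "w x : \<int>"
proof -
 interpret valued_field R w by (rule w(1))
 have 1: "w y : \<int>" if y: "y : S" "y ~= \<zero>" for y
 proof -
  have "y : loc" using S_loc y by blast
  then obtain n :: nat and u where u: "u : loc" "u ~= \<zero>" "inv u : loc" "y = q[^]n**u" using loc_decompose y(2) by blast
  have uc: "u : carrier R" using u(1) subringE(1)[OF loc_subring] by blast
  have "w (inv u) >= 0" "w u >= 0" using w(3) u inv_facts[OF uc u(2)] by auto
  hence "w u = 0" using w_inv[OF uc u(2)] by simp
  moreover have "w y = n * w q + w u" unfolding u(4)
   using w_mult[of "q[^]n" u] w_pow[OF S_c[OF q(1)] q(2), of n] nonzero_pow[OF S_c[OF q(1)] q(2)] uc u(2) S_c[OF q(1)] by simp
  ultimately show ?thesis using w(2) by simp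
 qed
 obtain a b where ab: "a : S" "b : S" "b ~= \<zero>" "x = a**inv b" using x(1) by (auto simp: fractions_in_def)
 note ib = inv_facts[OF S_c[OF ab(2)] ab(3)]
 have a0: "a ~= \<zero>" using x(2) ab(4) ib by auto
 have "w x = w a - w b" unfolding ab(4) using w_mult[of a "inv b"] w_inv[OF S_c[OF ab(2)] ab(3)] S_c[OF ab(1)] a0 ib by simp
 thus ?thesis using 1 ab a0 by simp
qed

lemma exists_valuation_q:
 assumes "y : carrier R" "~ integral_over loc y"
 shows "EX w. valued_field R w & w q = 1 & (ALL x:loc. x ~= \<zero> --> w x >= 0) & y ~= \<zero> & w y < 0"
proof (rule exists_valuation[OF loc_subring _ q(2) loc_decompose])
 show "q : loc" using S_loc q by blast
qed (use assms Q_loc Q_subfield alg in auto)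

end

text \<open>
  The coefficients of the minimal polynomial of \<open>y\<close> are integral over the localization because the
  conjugates of \<open>y\<close> are, and a power of \<open>q\<close> times each of them is in \<open>S\<close> because the conjugates of
  \<open>q y\<close> are integral over \<open>S\<close>. Hence they are in \<open>S\<close>.
\<close>
lemma (in prime_element) integral_of_localization:
 assumes normal: "!!x. x : Q ==> integral_over S x ==> x : S"
  and y: "y : carrier R" "integral_over loc y" "integral_over S (q**y)"
 shows "integral_over S y"
proof -
 note A = subring_additive_subgroup[OF S] and AL = subring_additive_subgroup[OF loc_subring]
 have c: "q : carrier R" using S_c q by blast
 note iq = inv_facts[OF c q(2)]
 have LQ: "y : carrier R" "integral_over Q y" using y integral_over_mono loc_Q by auto
 have algy: "(algebraic over Q) y" using algebraic_iff_integral[OF Q_subfield y(1)] LQ by simp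
 note I = IrrE[OF Q_subfield y(1) algy]
 have "polynomial Q (Irr Q y)" using I(1) by (simp add: univ_poly_carrier)
 moreover have "Irr Q y ~= []" using I(2) I(3) pirreducibleE(1)[OF subfieldE(1)[OF Q_subfield] I(1,2)] by auto
 ultimately obtain cs where cs: "Irr Q y = \<one> # cs" "set cs <= Q" using I(3) by (cases "Irr Q y") (auto simp: polynomial_def)
 have Qc: "x : carrier R" if "x : Q" for x using subfieldE(3)[OF Q_subfield] that by blast
 have csc: "set cs <= carrier R" using cs(2) Qc by blast
 obtain h where h: "set h <= loc" "eval (\<one> # h) y = \<zero>" using integral_over_eval[OF AL y(1)] y(2) by blast
 obtain g where g: "set g <= S" "eval (\<one> # g) (q**y) = \<zero>" using integral_over_eval[OF A, of "q**y"] y(1,3) c by auto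
 have r1: "integral_over loc r" if r: "r : carrier R" "eval (\<one> # cs) r = \<zero>" for r
 proof -
  have "eval (\<one> # h) (\<one>**r) = \<zero>"
   by (rule conjugate_root[OF Q_subfield LQ r(1)]) (use r cs h loc_Q subringE(3)[OF subfieldE(1)[OF Q_subfield]] y(1) one_not_zero in auto)
  thus ?thesis using integral_over_eval[OF AL r(1)] h(1) r(1) by auto
 qed
 have r2: "integral_over S (q**r)" if r: "r : carrier R" "eval (\<one> # cs) r = \<zero>" for r
 proof -
  have "eval (\<one> # g) (q**r) = \<zero>" by (rule conjugate_root[OF Q_subfield LQ r(1)]) (use r cs g S_Q q in auto)
  thus ?thesis using integral_over_eval[OF A, of "q**r"] g(1) r(1) c by auto
 qed
 obtain rs where rs: "set rs <= carrier R" "ALL r:set rs. eval (\<one> # cs) r = \<zero>"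
  "ALL T. subring T R --> set rs <= T --> set cs <= T" using monic_roots[OF ac csc] by blast
 have c1: "integral_over loc d" if "d : set cs" for d using rs subring_integral_closure[OF loc_subring] r1 that by blast
 \<comment> \<open>The index starts at one because the leading coefficient is left out. These are
   the lower coefficients of the monic polynomial whose roots are \<open>q\<close> times the
   conjugates of \<open>y\<close>.\<close>
 define cs' where "cs' = scl q 1 cs"
 have cs'c: "set cs' <= carrier R" unfolding cs'_def by (rule scl_closed[OF c csc])
 obtain rs' where rs': "set rs' <= carrier R" "ALL r:set rs'. eval (\<one> # cs') r = \<zero>"
  "ALL T. subring T R --> set rs' <= T --> set cs' <= T" using monic_roots[OF ac cs'c] by blast
 have "integral_over S r'" if r': "r' : set rs'" for r'
 proof -
  have rc: "r' : carrier R" using r' rs'(1) by blast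
  define r where "r = inv q**r'"
  have r: "r : carrier R" "q**r = r'" using rc iq c by (simp_all add: r_def m_assoc[symmetric])
  have csc': "set (\<one> # cs) <= carrier R" using csc by auto
  have "scl q 0 (\<one> # cs) = \<one> # cs'" by (simp add: cs'_def)
  hence "eval (\<one> # cs') r'**q = q[^](0 + length (\<one> # cs))**eval (\<one> # cs) r" using eval_scl[OF c r(1) csc', of 0] r(2) by simp
  moreover have "eval (\<one> # cs') r' = \<zero>" using rs'(2) r' by blast
  ultimately have "q[^](0 + length (\<one> # cs))**eval (\<one> # cs) r = \<zero>" using l_null[OF c] by metis
  moreover have "q[^](0 + length (\<one> # cs)) ~= \<zero>" by (rule nonzero_pow[OF c q(2)])
  ultimately have "eval (\<one> # cs) r = \<zero>" using integral_iff[OF nat_pow_closed[OF c] eval_closed[OF csc' r(1)]] by blast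
  thus ?thesis using r2[OF r(1)] r(2) by simp
 qed
 hence c2: "integral_over S d" if "d : set cs'" for d using rs' subring_integral_closure[OF S] that by blast
 have qi: "x**q[^]i : Q" if x: "x : Q" for x and i :: nat
 proof (induction i)
  case (Suc i)
  have "x**q[^]Suc i = (x**q[^]i)**q" using Qc[OF x] c by (simp add: m_assoc)
  thus ?case using subringE(6)[OF subfieldE(1)[OF Q_subfield] Suc] S_Q q(1) by auto
 qed (use x Qc in simp)
 have "d : S" if d: "d : set cs" for d
 proof -
  \<comment> \<open>So far only \<open>d\<close> times a power of \<open>q\<close> is known to be in
    \<open>S\<close>. The power is lowered step by step: \<open>d**q[^]i\<close> is integral over
    the localization, hence \<open>q\<close> divides \<open>d**q[^]Suc i\<close> within
    \<open>S\<close>.\<close>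
  obtain i :: nat where i: "d**q[^]i : set cs'" using scl_set[OF d, of q 1] unfolding cs'_def by blast
  have dQ: "d : Q" using d cs by blast
  have "d**q[^]i : S" using normal[OF qi[OF dQ] c2[OF i]] .
  thus ?thesis
  proof (induction i)
   case 0
   thus ?case using Qc[OF dQ] by simp
  next
   case (Suc i)
   have t: "d**q[^]i : carrier R" using Qc[OF dQ] c by simp
   have e: "d**q[^]Suc i = q**(d**q[^]i)" using Qc[OF dQ] c by (simp add: m_ac)
   have "(d**q[^]Suc i)**inv q = d**q[^]i" using Qc[OF dQ] c iq by (simp add: m_assoc)
   moreover have "integral_over loc (d**q[^]i)"
   proof -
   have "q : {x : carrier R. integral_over loc x}" using c integral_over_subset[OF loc_subring] S_loc q by blast
   moreover have "d : {x : carrier R. integral_over loc x}" using c1[OF d] Qc[OF dQ] by simp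
   moreover have "q[^]k : {x : carrier R. integral_over loc x}" for k :: nat
   by (induction k) (use subringE(3,6)[OF subring_integral_closure[OF loc_subring]] calculation in simp_all)
   ultimately have "d**q[^]i : {x : carrier R. integral_over loc x}" using subringE(6)[OF subring_integral_closure[OF loc_subring]] by blast
   thus ?thesis by simp
   qed
   ultimately obtain z where "z : S" "d**q[^]Suc i = q**z" using divisible_of_integral[OF Suc.prems] by auto
   hence "d**q[^]i : S" using e t m_lcancel[OF q(2) c t] S_c by metis
   thus ?case by (rule Suc.IH)
  qed
 qed
 hence "set cs <= S" by blast
 thus ?thesis using integral_over_eval[OF A y(1)] I(4) cs(1) by auto
qed

text \<open>Integrality of \<open>b / q\<close> over the localization is tested with valuations of
  value one at \<open>q\<close>, each of which has its own field \<open>F\<close>. Normality of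
  \<open>S\<close> then allows the return from the localization to \<open>S\<close>.\<close>

lemma (in prime_element) kaehler_torsion_divisible:
 fixes T :: "('s, 'm) ring_scheme" and u
 defines "B == {x : carrier R. integral_over S x}"
 assumes normal: "!!x. x : Q ==> integral_over S x ==> x : S"
  and p: "p >= 2" "q = natf p" and char: "!!n. n >= 1 ==> natf n ~= \<zero>"
  and bt: "bt : B" "bt[^]p = natf p -- natf p**bt"
  and K: "kaehler_data T u (R\<lparr>carrier := B\<rparr>)" and uS: "u ` carrier T <= S"
  and b: "b : B"
  and rel: "(%s. (b**(\<one> ++ bt[^](p - 1)))**unit_vector R bt s) : kaehler_submodule T u (R\<lparr>carrier := B\<rparr>)"
 shows "EX c:B. b = natf p**c"
proof -
 have B: "subring B R" unfolding B_def by (rule subring_integral_closure[OF S])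
 have bc: "b : carrier R" "integral_over S b" using b by (auto simp: B_def)
 have qc: "q : carrier R" using S_c q by blast
 note iq = inv_facts[OF qc q(2)]
 define y where "y = b**inv q"
 have y: "y : carrier R" "q**y = b" using bc qc iq by (simp_all add: y_def m_lcomm)
 have "integral_over loc y"
 proof (rule ccontr)
  assume "~ ?thesis"
  then obtain w where w: "valued_field R w" "w q = 1" "ALL x:loc. x ~= \<zero> --> w x >= 0" "y ~= \<zero>" "w y < 0" using exists_valuation_q[OF y(1)] by blast
  interpret W: valued_field R w by (rule w(1))
  obtain F where F: "subfield F R" "Q <= F" "ALL x:F. x ~= \<zero> --> w x : \<int>" "ALL x:W.vge 0. EX s:F \<inter> W.vge 0. x -- s : W.vgt 0"
   using W.exists_full_residue_field[OF ac Q_subfield alg valuation_integers[OF w(1-3)]] by blast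
  have "S <= W.vge 0" using w(3) S_loc S_c by (auto simp: W.vge_def)
  hence BW: "B <= W.vge 0" unfolding B_def using valuation_ring_integrally_closed[OF W.vge0_ring] integral_over_mono by blast
  have "b**inv (natf p) : W.vge 0"
  proof (rule W.kaehler_torsion_bound[OF F(1) _ _ _ p(1) _ char bt B BW K _ b rel])
   show "integral_over F x" if "x : carrier R" for x using alg[OF that] F(2) integral_over_mono by blast
   show "u ` carrier T <= F" using uS S_Q F(2) by blast
  next
   show "w (natf p) = 1" using w(2) p(2) by simp
   show "w x : \<int>" if "x : F" "x ~= \<zero>" for x using F(3) that by blast
   show "EX s:F \<inter> W.vge 0. x -- s : W.vgt 0" if "x : W.vge 0" for x using F(4) that by blast
  qed
  hence "y : W.vge 0" using p by (simp add: y_def)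
  thus False using w(4,5) by (simp add: W.vge_def)
 qed
 hence "integral_over S y" using integral_of_localization[OF normal y(1)] y(2) bc by simp
 thus ?thesis using y p by (intro bexI[of _ y]) (auto simp: B_def)
qed

lemma (in power_series_embedding) JR_prime_element:
 assumes "algebraically_closed L" "!!x. x : carrier L ==> L.integral_over (fractions_in L JR) x"
 shows "prime_element L JR pL"
proof (intro prime_element.intro prime_element_axioms.intro L.field_axioms)
 have "~ (EX z:JR. j (indexed_const \<one>) = pL **\<^sub>L z)"
  using divisible_iff[OF power_series_const_closed[OF one_closed]] one_notin_piV by (auto simp: indexed_const_def)
 thus "~ (EX z:JR. \<one>\<^sub>L = pL **\<^sub>L z)" using j_simps(4) by simp
 show "subring JR L" by (rule JR_subring)
 show "pL : JR" "pL ~= \<zero>\<^sub>L" by (rule varpi)+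
qed (rule varpi_prime JR_decompose assms; assumption)+

text \<open>All powers of an integral fraction have a common denominator, so complete integral
  closedness applies.\<close>

lemma (in power_series_embedding) JR_normal:
 assumes x: "x : fractions_in L JR" "L.integral_over JR x"
 shows "x : JR"
proof -
 note s = subringE[OF JR_subring]
 obtain a b where ab: "a : JR" "b : JR" "b ~= \<zero>\<^sub>L" "x = a **\<^sub>L inv\<^bsub>L\<^esub> b" using x(1) by (auto simp: fractions_in_def)
 have c: "a : carrier L" "b : carrier L" using ab s(1) by blast+
 note ib = L.inv_facts[OF c(2) ab(3)]
 have xc: "x : carrier L" "b **\<^sub>L x = a" using c ib by (simp_all add: ab(4) L.m_lcomm)
 obtain m :: nat where m: "ALL n::nat. b [^]\<^sub>L m **\<^sub>L x [^]\<^sub>L n : JR"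
  using L.integral_common_denominator[OF JR_subring xc(1) x(2) ab(2)] xc(2) ab(1) by auto
 have "b [^]\<^sub>L m : JR" by (induction m) (use s(3,6) ab in auto)
 thus ?thesis using JR_completely_integrally_closed[OF xc(1) ab(2,3), of "b [^]\<^sub>L m"] xc(2) ab(1) m L.nonzero_pow[OF c(2) ab(3)] by blast
qed

section \<open>Complete discrete valuation rings\<close>

context cring
begin

lemma binomial_expansion:
 assumes c: "x : carrier R" "y : carrier R"
 shows "(x ++ y)[^](n::nat) = (\<Oplus>k\<in>{..n}. [(n choose k)] \<cdot> (x[^]k**y[^](n - k)))"
proof (induction n)
 case (Suc n)
 define t where "t k = x[^](k::nat)**y[^](Suc n - k)" for k
 have tc: "t k : carrier R" for k using c by (simp add: t_def)
 have S: "(\<Oplus>k\<in>{..n}. [(n choose k)] \<cdot> (x[^]k**y[^](n - k))) = (x ++ y)[^]n" using Suc by simp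
 have gc: "(%k. [(n choose k)] \<cdot> (x[^]k**y[^](n - k))) : {..n} \<rightarrow> carrier R" using c by auto
 have 1: "(\<Oplus>k\<in>{..n}. [(n choose k)] \<cdot> t (Suc k)) = (x ++ y)[^]n**x" unfolding S[symmetric] finsum_ldistr[OF finite_atMost c(1) gc]
 proof (rule finsum_cong')
  fix k
  have "t (Suc k) = (x[^]k**y[^](n - k))**x" using c by (simp add: t_def m_ac)
  thus "[(n choose k)] \<cdot> t (Suc k) = [(n choose k)] \<cdot> (x[^]k**y[^](n - k))**x" using c by (simp add: add_pow_ldistr)
 qed (use c in auto)
 have 2: "(\<Oplus>k\<in>{..n}. [(n choose k)] \<cdot> t k) = (x ++ y)[^]n**y" unfolding S[symmetric] finsum_ldistr[OF finite_atMost c(2) gc]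
 proof (rule finsum_cong')
  show "[(n choose k)] \<cdot> t k = [(n choose k)] \<cdot> (x[^]k**y[^](n - k))**y" if "k : {..n}" for k
   using c that by (simp add: t_def add_pow_ldistr Suc_diff_le m_assoc)
 qed (use c in auto)
 have "(\<Oplus>k\<in>{..Suc n}. [(Suc n choose k)] \<cdot> t k) =
   (\<Oplus>k\<in>{..n}. [(Suc n choose Suc k)] \<cdot> t (Suc k)) ++ [(Suc n choose 0)] \<cdot> t 0" by (rule finsum_Suc2) (use tc in auto)
 also have "(\<Oplus>k\<in>{..n}. [(Suc n choose Suc k)] \<cdot> t (Suc k)) =
   (\<Oplus>k\<in>{..n}. [(n choose k)] \<cdot> t (Suc k) ++ [(n choose Suc k)] \<cdot> t (Suc k))"
  by (rule finsum_cong') (use tc in \<open>auto simp: add.nat_pow_mult\<close>)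
 also have "\<dots> = (\<Oplus>k\<in>{..n}. [(n choose k)] \<cdot> t (Suc k)) ++ (\<Oplus>k\<in>{..n}. [(n choose Suc k)] \<cdot> t (Suc k))"
  by (rule finsum_addf) (use tc in auto)
 finally have "(\<Oplus>k\<in>{..Suc n}. [(Suc n choose k)] \<cdot> t k) =
   (\<Oplus>k\<in>{..n}. [(n choose k)] \<cdot> t (Suc k)) ++ ((\<Oplus>k\<in>{..n}. [(n choose Suc k)] \<cdot> t (Suc k)) ++ [(n choose 0)] \<cdot> t 0)"
  using tc by (simp add: a_assoc)
 also have "(\<Oplus>k\<in>{..n}. [(n choose Suc k)] \<cdot> t (Suc k)) ++ [(n choose 0)] \<cdot> t 0 = (\<Oplus>k\<in>{..Suc n}. [(n choose k)] \<cdot> t k)"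
  by (rule finsum_Suc2[symmetric]) (use tc in auto)
 also have "(\<Oplus>k\<in>{..Suc n}. [(n choose k)] \<cdot> t k) = (\<Oplus>k\<in>{..n}. [(n choose k)] \<cdot> t k)"
  using tc by (subst finsum_Suc) (auto simp: binomial_eq_0)
 also have "(\<Oplus>k\<in>{..n}. [(n choose k)] \<cdot> t (Suc k)) ++ (\<Oplus>k\<in>{..n}. [(n choose k)] \<cdot> t k) = (x ++ y)[^]Suc n"
  unfolding 1 2 using c by (simp add: r_distr)
 finally show ?case by (simp add: t_def)
qed simp

end

section \<open>Frobenius modulo p, linear combinations and additive polynomials\<close>

context field
begin

lemma natf_mult: "x : carrier R ==> [(n::nat)] \<cdot> x = natf n**x" by (simp add: natf_def add_pow_ldistr)

lemma natf_times: "natf (m * n) = natf m**natf n" by (simp add: natf_def add_pow_ldistr add.nat_pow_pow mult.commute)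

lemma frobenius_add:
 assumes S: "subring S R" and c: "x : S" "y : S" and p: "Factorial_Ring.prime (p::nat)"
 shows "EX z:S. (x ++ y)[^]p = (x[^]p ++ y[^]p) ++ natf p**z"
proof -
 note s = subringE[OF S]
 have Sc: "a : carrier R" if "a : S" for a using s(1) that by blast
 have pw: "a[^](k::nat) : S" if "a : S" for a k by (induction k) (use s(3,6) that in auto)
 have p2: "p >= 2" using p prime_ge_2_nat by blast
 define t where "t k = [(p choose k)] \<cdot> (x[^](k::nat)**y[^](p - k))" for k
 have tc: "t k : carrier R" for k using c Sc by (simp add: t_def)
 define T where "T = {natf p**z | z. z : S}"
 have "finsum R t ({..p} - {0} - {p}) : T"
 proof (rule finsum_in)
  show "\<zero> : T" unfolding T_def using s(2) by (intro CollectI exI[of _ \<zero>]) simp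
  show "a ++ b : T" if ab: "a : T" "b : T" for a b
  proof -
   obtain u v where "u : S" "v : S" "a = natf p**u" "b = natf p**v" using ab by (auto simp: T_def)
   hence "a ++ b = natf p**(u ++ v)" "u ++ v : S" using Sc s(7) by (simp_all add: r_distr)
   thus ?thesis unfolding T_def by blast
  qed
  show "T <= carrier R" using Sc by (auto simp: T_def)
  fix k assume k: "k : {..p} - {0} - {p}"
  hence "p dvd (p choose k)" using p by (intro dvd_choose_prime) auto
  then obtain m where m: "p choose k = p * m" by (elim dvdE)
  have "t k = natf p**(natf m**(x[^]k**y[^](p - k)))" using c Sc by (simp add: t_def m natf_mult natf_times m_assoc)
  moreover have "natf m**(x[^]k**y[^](p - k)) : S" using s(6)[OF natf_subring[OF S] s(6)[OF pw[OF c(1)] pw[OF c(2)]]] .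
  ultimately show "t k : T" unfolding T_def by blast
 qed auto
 then obtain z where z: "z : S" "finsum R t ({..p} - {0} - {p}) = natf p**z" by (auto simp: T_def)
 have "(x ++ y)[^]p = finsum R t {..p}" unfolding t_def using binomial_expansion c Sc by simp
 also have "\<dots> = t 0 ++ finsum R t ({..p} - {0})" by (rule finsum_split) (use tc in auto)
 also have "finsum R t ({..p} - {0}) = t p ++ finsum R t ({..p} - {0} - {p})" by (rule finsum_split) (use tc p2 in auto)
 also have "t 0 = y[^]p" using c Sc by (simp add: t_def)
 also have "t p = x[^]p" using c Sc by (simp add: t_def)
 finally have "(x ++ y)[^]p = y[^]p ++ (x[^]p ++ natf p**z)" using z(2) by simp
 also have "\<dots> = (x[^]p ++ y[^]p) ++ natf p**z" using c z(1) Sc by (simp add: a_ac)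
 finally show ?thesis using z(1) by blast
qed

text \<open>Coefficients form a function rather than a list, so that sums and limits of combinations
  can be taken coefficient by coefficient.\<close>

definition lc :: "(nat => 'a) => 'a list => 'a" where "lc f Us = combine (map f [0..<length Us]) Us"

lemma lc_snoc:
 assumes "!!l. f l : carrier R" "set Us <= carrier R" "u : carrier R"
 shows "lc f (Us @ [u]) = lc f Us ++ f (length Us)**u"
 using combine_append[of "map f [0..<length Us]" Us "[f (length Us)]" "[u]"] assms by (auto simp: lc_def image_subset_iff)

lemma lc_nil [simp]: "lc f [] = \<zero>" by (simp add: lc_def)

lemma lc_zero: "set Us <= carrier R ==> lc (%l. \<zero>) Us = \<zero>"
proof (induction Us rule: rev_induct)
 case (snoc u Us)
 thus ?case using lc_snoc[of "%l. \<zero>" Us u] by simp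
qed simp

lemma lc_in:
 assumes E: "additive_subgroup E R" and f: "!!l. f l : carrier R" "set Us <= carrier R" "!!u l. u : set Us ==> f l**u : E"
 shows "lc f Us : E" using f(2,3)
proof (induction Us rule: rev_induct)
 case Nil
 thus ?case using additive_subgroup.zero_closed[OF E] by simp
next
 case (snoc u Us)
 thus ?case using lc_snoc[of f Us u] f(1) additive_subgroup.a_closed[OF E] by simp
qed

lemma lc_closed: "(!!l. f l : carrier R) ==> set Us <= carrier R ==> lc f Us : carrier R" unfolding lc_def by (rule combine_in_carrier) auto

lemma lc_add:
 assumes f: "!!l. f l : carrier R" "!!l. g l : carrier R" and Us: "set Us <= carrier R" and c: "c : carrier R"
 shows "lc (%l. f l ++ c**g l) Us = lc f Us ++ c**lc g Us" using Us
proof (induction Us rule: rev_induct)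
 case Nil
 thus ?case using c by simp
next
 case (snoc u Us)
 hence u: "set Us <= carrier R" "u : carrier R" by auto
 define F where "F = lc f Us"
 define G where "G = lc g Us"
 have FG: "F : carrier R" "G : carrier R" using lc_closed f u(1) by (auto simp: F_def G_def)
 have "lc (%l. f l ++ c**g l) (Us @ [u]) = F ++ c**G ++ (f (length Us) ++ c**g (length Us))**u"
  using lc_snoc[of "%l. f l ++ c**g l" Us u] snoc.IH[OF u(1)] f c u by (simp add: F_def G_def)
 also have "\<dots> = F ++ f (length Us)**u ++ c**(G ++ g (length Us)**u)" using FG f[of "length Us"] c u(2) by (simp add: l_distr r_distr m_assoc a_ac)
 also have "\<dots> = lc f (Us @ [u]) ++ c**lc g (Us @ [u])" using lc_snoc[OF f(1) u] lc_snoc[OF f(2) u] by (simp add: F_def G_def)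
 finally show ?case .
qed

lemma combine_lc: "length Ks = length Us ==> combine Ks Us = lc (%l. if l < length Us then Ks ! l else \<zero>) Us"
proof -
 assume l: "length Ks = length Us"
 have "map (%l. if l < length Us then Ks ! l else \<zero>) [0..<length Us] = Ks" by (rule nth_equalityI) (use l in auto)
 thus ?thesis by (simp add: lc_def)
qed

primrec frob_list :: "nat => nat => 'a => 'a list" where
 "frob_list p 0 x = []"
| "frob_list p (Suc n) x = x # frob_list p n (x[^]p)"

text \<open>An additive polynomial, with terms \<open>c_i T^(p^i)\<close>; modulo p it commutes with
  sums, and a p-th root of it can be taken coefficientwise.\<close>

primrec addpoly :: "nat => 'a list => 'a => 'a" where
 "addpoly p [] x = \<zero>"
| "addpoly p (c # cs) x = c**x ++ addpoly p cs (x[^]p)"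

lemma combine_frob_list: "combine cs (frob_list p (length cs) x) = addpoly p cs x" by (induction cs arbitrary: x) auto

lemma length_frob_list [simp]: "length (frob_list p n x) = n" by (induction n arbitrary: x) auto

lemma frob_list_in: "subring T R ==> x : T ==> set (frob_list p n x) <= T"
proof (induction n arbitrary: x)
 case (Suc n)
 have "x[^]k : T" for k :: nat by (induction k) (use subringE(3,6)[OF Suc.prems(1)] Suc.prems(2) in auto)
 thus ?case using Suc by simp
qed simp

lemma addpoly_in: "subring T R ==> set cs <= T ==> x : T ==> addpoly p cs x : T"
proof (induction cs arbitrary: x)
 case (Cons c cs)
 have "x[^]k : T" for k :: nat by (induction k) (use subringE(3,6)[OF Cons.prems(1)] Cons.prems(3) in auto)
 thus ?case using Cons subringE(6,7)[OF Cons.prems(1)] by simp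
qed (simp add: subringE(2))

end

text \<open>A complete discrete valuation ring with uniformizer p and perfect residue field; the
  residue field appears only through congruences modulo \<open>q\<close>.\<close>

locale complete_prime = prime_element R S q for R (structure) and S q +
 fixes p :: nat
 assumes p: "Factorial_Ring.prime p" "q = natf p" and char: "n >= 1 ==> natf n ~= \<zero>"
  and S_unit: "x : S ==> ~ (EX z:S. x = q**z) ==> inv x : S"
  and S_complete: "(!!k. xs k : S) ==> (!!k. EX z:S. xs (Suc k) -- xs k = q[^](k::nat)**z) ==>
   EX y:S. ALL k. EX z:S. y -- xs k = q[^]k**z"
  and S_perfect: "c : S ==> EX d:S. EX z:S. c -- d[^]p = q**z"
begin

lemma loc_eq: "loc = S"
proof
 show "loc <= S" unfolding loc_def using S_unit subringE(6)[OF S] by blast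
qed (rule S_loc)

end

locale complete_valued = complete_prime R S q p + valued_field R w for R (structure) and S q p w +
 assumes wq: "w q = 1" and S_vge: "S <= vge 0"
begin

lemma qc: "q : carrier R" using S_c q by blast

lemma S_values: "x : S ==> x ~= \<zero> ==> w x >= 0" using S_vge by (auto simp: vge_def)

lemma S_unit': "x : S ==> x ~: vgt 0 ==> inv x : S & x ~= \<zero>"
proof -
 assume x: "x : S" "x ~: vgt 0"
 have "~ (EX z:S. x = q**z)"
 proof
  assume "EX z:S. x = q**z"
  then obtain z where z: "z : S" "x = q**z" by blast
  have "q : vgt 0" using qc wq by (simp add: vgt_def)
  hence "z**q : vgt (0 + 0)" using vgt_mult z(1) S_vge by blast
  thus False using x(2) z m_comm[OF S_c[OF z(1)] qc] by simp
 qed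
 thus ?thesis using S_unit x nondiv_nonzero by blast
qed

lemma values_int: "x : Q ==> x ~= \<zero> ==> w x : \<int>" by (rule valuation_integers[OF valued_field_axioms wq]) (auto simp: loc_eq S_values)

lemma Q_vge: "x : Q ==> x : vge 0 ==> x : S"
proof (cases "x = \<zero>")
 case False
 assume x: "x : Q" "x : vge 0"
 then obtain a b where ab: "a : S" "b : S" "b ~= \<zero>" "x = a**inv b" by (auto simp: fractions_in_def)
 note ib = inv_facts[OF S_c[OF ab(2)] ab(3)]
 have a0: "a ~= \<zero>" using False ab(4) ib by auto
 have dec: "EX n::nat. EX u:S. u ~= \<zero> & inv u : S & y = q[^](n::nat)**u & w y = real n" if y: "y : S" "y ~= \<zero>" for y
 proof -
  obtain n :: nat and u where u: "u : S" "u ~= \<zero>" "inv u : S" "y = q[^]n**u" using loc_decompose y loc_eq by metis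
  have "w (inv u) >= 0" "w u >= 0" using S_values u inv_facts[OF S_c[OF u(1)] u(2)] by auto
  hence "w u = 0" using w_inv[OF S_c[OF u(1)] u(2)] by simp
  hence "w y = real n" unfolding u(4) using w_mult[of "q[^]n" u] w_pow[OF qc q(2), of n] nonzero_pow[OF qc q(2)] u S_c qc wq by simp
  thus ?thesis using u by blast
 qed
 obtain n :: nat and u where u: "u : S" "u ~= \<zero>" "inv u : S" "a = q[^]n**u" "w a = real n" using dec[OF ab(1) a0] by blast
 obtain m :: nat and v where v: "v : S" "v ~= \<zero>" "inv v : S" "b = q[^]m**v" "w b = real m" using dec[OF ab(2,3)] by blast
 have "w x = w a - w b" unfolding ab(4) using w_mult[of a "inv b"] w_inv[OF S_c[OF ab(2)] ab(3)] S_c[OF ab(1)] a0 ib by simp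
 hence mn: "m <= n" using x(2) False u(5) v(5) by (simp add: vge_def)
 note iv = inv_facts[OF S_c[OF v(1)] v(2)]
 have qp: "q[^]k : carrier R" "q[^]k : S" for k :: nat using qc by (simp, induction k) (use subringE(3,6)[OF S] q in auto)
 have "x**b = a" using ab S_c ib by (simp add: m_assoc)
 moreover have "(q[^](n - m)**(u**inv v))**b = a"
 proof -
  define v' where "v' = inv v"
  have "v' : carrier R" using iv by (simp add: v'_def)
  hence "(q[^](n - m)**(u**inv v))**b = (q[^](n - m)**q[^]m)**(u**(inv v**v))"
   unfolding v(4) v'_def[symmetric] using qp(1)[of m] qp(1)[of "n - m"] S_c[OF u(1)] S_c[OF v(1)] by (simp add: m_ac)
  thus ?thesis unfolding u(4) using nat_pow_mult[OF qc, of "n - m" m] mn iv S_c u(1) by simp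
 qed
 ultimately have "x = q[^](n - m)**(u**inv v)" using m_rcancel[OF ab(3) S_c[OF ab(2)], of x "q[^](n - m)**(u**inv v)"] x(2) vge_carrier qp iv S_c[OF u(1)] by simp
 thus "x : S" using subringE(6)[OF S] qp u v by simp
qed (use subringE(2)[OF S] in simp)

lemma vge_vgt_one: "x : Q ==> x : vgt 0 ==> x : vge 1"
proof (cases "x = \<zero>")
 case False
 assume x: "x : Q" "x : vgt 0"
 then obtain k :: int where "w x = k" using values_int[OF x(1) False] by (auto elim: Ints_cases)
 thus ?thesis using x(2) False by (auto simp: vge_def vgt_def)
qed simp

text \<open>A linear dependence over \<open>Q\<close>, divided by a coefficient of least
  value.\<close>

lemma primitive_relation:
 assumes d: "dimension D Q E" and U: "set Us <= E" "length Us > D" "set Us <= carrier R"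
 shows "EX Ks. length Ks = length Us & set Ks <= S & ~ set Ks <= vgt 0 & combine Ks Us = \<zero>"
proof -
 have "~ independent Q Us" using independent_length_le_dimension[OF Q_subfield d, of Us] U by auto
 then obtain Ks where Ks: "length Ks = length Us" "combine Ks Us = \<zero>" "set Ks <= Q" "set Ks ~= {\<zero>}"
  using dependent_imp_non_trivial_combine[OF Q_subfield] U(3) by metis
 have "~ set Ks <= {\<zero>}" using Ks(1,4) U(2) by (cases Ks) auto
 then obtain c where c: "c : set Ks" "c ~= \<zero>" "set (map (%d. d**inv c) Ks) <= Q \<inter> vge 0" "\<one> : set (map (%d. d**inv c) Ks)"
  using normalize_list[OF Q_subfield Ks(3)] by blast
 let ?K = "map (%d. d**inv c) Ks"
 have Qc: "x : carrier R" if "x : Q" for x using subfieldE(3)[OF Q_subfield] that by blast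
 note ic = inv_facts[OF Qc c(2)]
 have icc: "inv c : carrier R" using ic c Ks by blast
 have Kc: "set Ks <= carrier R" using Ks(3) Qc by blast
 have me: "map (%d. d**inv c) Ks = map ((\<otimes>) (inv c)) Ks" using Kc icc m_comm by (intro map_cong) auto
 have "combine ?K Us = inv c**combine Ks Us" unfolding combine_r_distr[OF Kc U(3) icc] by (rule arg_cong[OF me])
 hence "combine ?K Us = \<zero>" using Ks(2) icc by simp
 moreover have "set ?K <= S" using c(3) Q_vge by blast
 moreover have "\<one> ~: vgt 0" by (simp add: vgt_def)
 hence "~ set ?K <= vgt 0" using c(4) by blast
 ultimately show ?thesis using Ks(1) by (intro exI[of _ ?K]) simp
qed

text \<open>
  Lift generators of \<open>O / q O\<close>, where \<open>O\<close> is the valuation ring of \<open>E\<close>; successive approximation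
  converges by completeness.
\<close>
lemma finitely_generated_integers:
 assumes E: "subfield E R" "Q <= E" and d: "dimension D Q E"
 shows "EX Us. set Us <= E \<inter> vge 0 & (ALL y:E \<inter> vge 0. EX f. (ALL l. f l : S) & y = lc f Us)"
proof -
 \<comment> \<open>Linear independence modulo \<open>q\<close> over the residue field of
   \<open>S\<close>. By \<open>primitive_relation\<close> an independent list has at most
   \<open>D\<close> members, so there is a longest one.\<close>
 define ind where "ind Us <-> set Us <= E \<inter> vge 0 &
  (ALL Ks. length Ks = length Us --> set Ks <= S --> combine Ks Us : vge 1 --> set Ks <= vgt 0)" for Us
 have "length Us <= D" if "ind Us" for Us
 proof (rule ccontr)
  assume "~ length Us <= D"
  moreover have "set Us <= E" "set Us <= carrier R" using that vge_carrier unfolding ind_def by blast+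
  ultimately obtain Ks where "length Ks = length Us" "set Ks <= S" "~ set Ks <= vgt 0" "combine Ks Us = \<zero>" using primitive_relation[OF d, of Us] by fastforce
  thus False using that unfolding ind_def by auto
 qed
 hence "ALL Us. ind Us --> length Us < Suc D" by (simp add: le_imp_less_Suc)
 moreover have "ind []" by (simp add: ind_def)
 ultimately obtain Us where Us: "ind Us" "!!Vs. ind Vs ==> length Vs <= length Us" using ex_has_greatest_nat[of ind "[]" length "Suc D"] by blast
 have UE: "set Us <= E \<inter> vge 0" and Uc: "set Us <= carrier R" using Us(1) vge_carrier unfolding ind_def by auto
 note s = subringE[OF S] and e = subringE[OF subfieldE(1)[OF E(1)]]
 have step: "EX f y'. (ALL l. f l : S) & y' : E \<inter> vge 0 & y = lc f Us ++ q**y'" if y: "y : E \<inter> vge 0" for y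
 proof -
  have yc: "y : carrier R" using y vge_carrier by blast
  have "~ ind (y # Us)" using Us(2)[of "y # Us"] by auto
  then obtain Ks' where Ks': "length Ks' = Suc (length Us)" "set Ks' <= S" "combine Ks' (y # Us) : vge 1" "~ set Ks' <= vgt 0" unfolding ind_def using UE y by auto
  then obtain k Ks where K: "Ks' = k # Ks" "length Ks = length Us" by (cases Ks') auto
  have kS: "k : S" "set Ks <= S" using Ks'(2) K by auto
  have kc: "k : carrier R" "set Ks <= carrier R" using kS S_c by auto
  define C where "C = combine Ks Us"
  have Cc: "C : carrier R" using kc(2) Uc by (simp add: C_def)
  have rel: "k**y ++ C : vge 1" using Ks'(3) K by (simp add: C_def)
  \<comment> \<open>Otherwise \<open>k**y\<close> would vanish modulo \<open>q\<close>, leaving a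
    nontrivial relation among the members of \<open>Us\<close>.\<close>
  have "k ~: vgt 0"
  proof
   assume "k : vgt 0"
   hence "k : vge 1" using vge_vgt_one kS(1) S_Q by blast
   hence "k**y : vge 1" using vge0_mult[of y k 1] y m_comm[OF kc(1) yc] by simp
   hence "(k**y ++ C) -- k**y : vge 1" using vge_minus[OF rel] by blast
   hence "C : vge 1" using add_diff_cancel_left[of "k**y" C] kc yc Cc by simp
   hence "set Ks <= vgt 0" using Us(1) K(2) kS(2) unfolding ind_def C_def by blast
   thus False using Ks'(4) K(1) `k : vgt 0` by simp
  qed
  hence iS: "inv k : S" "k ~= \<zero>" using S_unit' kS(1) by auto
  note ik = inv_facts[OF kc(1) iS(2)]
  define g where "g = (%l. if l < length Us then Ks ! l else \<zero>)"
  have gS: "g l : S" for l using kS(2) K(2) s(2) nth_mem[of l Ks] by (auto simp: g_def)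
  have Cg: "C = lc g Us" unfolding C_def g_def by (rule combine_lc[OF K(2)])
  define f where "f l = \<zero> ++ (-- (inv k))**g l" for l
  have fS: "f l : S" for l unfolding f_def using s(2,5,6,7) iS(1) gS by auto
  have l0: "lc (%l. \<zero>) Us = \<zero>" by (rule lc_zero[OF Uc])
  have "lc f Us = lc (%l. \<zero>) Us ++ (-- (inv k))**lc g Us" unfolding f_def by (rule lc_add) (use gS S_c Uc ik in auto)
  hence lf: "lc f Us = (-- (inv k))**C" using l0 Cg Cc ik by simp
  define r where "r = inv k**(k**y ++ C)"
  have rc: "r : carrier R" using kc yc Cc ik by (simp add: r_def)
  have r1: "r : vge 1" unfolding r_def using vge0_mult rel iS(1) S_vge by blast
  have "r = y ++ inv k**C" using kc yc Cc ik by (simp add: r_def r_distr m_assoc[symmetric])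
  hence yr: "y = lc f Us ++ r" unfolding lf using yc Cc ik by (simp add: l_minus a_ac r_neg r_neg1 r_neg2)
  note iq = inv_facts[OF qc q(2)]
  define y' where "y' = inv q**r"
  have y'q: "q**y' = r" using qc iq rc by (simp add: y'_def m_assoc[symmetric])
  have y'v: "y' : vge 0"
  proof (cases "r = \<zero>")
   case True
   thus ?thesis using iq by (simp add: y'_def)
  next
   case False
   thus ?thesis using w_mult[of "inv q" r] w_inv[OF qc q(2)] wq iq rc r1 by (auto simp: y'_def vge_def)
  qed
  have "lc f Us : E" using lc_in[OF subring_additive_subgroup[OF subfieldE(1)[OF E(1)]], of f Us] fS S_c Uc e(6) S_Q E(2) UE by blast
  moreover have "r = y -- lc f Us" using yr yc rc calculation e(1) add_diff_cancel_left[of "lc f Us" r] by auto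
  ultimately have "r : E" using y e(5,7) by (simp add: a_minus_def)
  moreover have "inv q : E" using subfield_m_inv(1)[OF Q_subfield] E(2) S_Q q by blast
  ultimately have "y' : E" using e(6) by (simp add: y'_def)
  thus ?thesis using fS yr y'v y'q by blast
 qed
 have "EX f. (ALL l. f l : S) & y = lc f Us" if y: "y : E \<inter> vge 0" for y
 proof -
  define ok where "ok f x x' <-> (ALL l. f l : S) & x' : E \<inter> vge 0 & x = lc f Us ++ q**x'" for f x x'
  define nx where "nx x = (SOME z. EX f. ok f x z)" for x
  define cf where "cf x = (SOME f. ok f x (nx x))" for x
  define ys where "ys k = (nx ^^ k) y" for k
  have ok: "ok (cf x) x (nx x)" if "x : E \<inter> vge 0" for x
  proof -
   have "EX z. EX f. ok f x z" using step[OF that] unfolding ok_def by blast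
   hence "EX f. ok f x (nx x)" unfolding nx_def by (rule someI_ex)
   thus ?thesis unfolding cf_def by (rule someI_ex)
  qed
  have ysO: "ys k : E \<inter> vge 0" for k by (induction k) (use y ok in \<open>auto simp: ys_def ok_def\<close>)
  have ysS: "ys k = lc (cf (ys k)) Us ++ q**ys (Suc k)" "!!l. cf (ys k) l : S" for k using ok[OF ysO[of k]] by (auto simp: ys_def ok_def)
  \<comment> \<open>The partial sums of the coefficients after \<open>k\<close> approximation steps;
    each entry converges in \<open>S\<close>.\<close>
  define ac where "ac k = rec_nat (%l. \<zero>) (%k a l. a l ++ q[^]k**cf (ys k) l) k" for k :: nat
  have ac0: "ac 0 = (%l. \<zero>)" and acS: "ac (Suc k) = (%l. ac k l ++ q[^]k**cf (ys k) l)" for k by (simp_all add: ac_def)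
  have qp: "q[^]k : S" "q[^]k : carrier R" for k :: nat using qc by (induction k) (use s(3,6) q qc in auto)
  have acc: "ac k l : S" for k l by (induction k) (use ac0 acS s(2,6,7) qp ysS(2) in auto)
  have yc: "ys k : carrier R" for k using ysO vge_carrier by blast
  have sum: "y = lc (ac k) Us ++ q[^]k**ys k" for k
  proof (induction k)
   case 0
   have "lc (%l. \<zero>) Us = \<zero>" by (rule lc_zero[OF Uc])
   thus ?case using yc[of 0] by (simp add: ac0 ys_def)
  next
   case (Suc k)
   have lcc: "lc (ac k) Us : carrier R" "lc (cf (ys k)) Us : carrier R" using lc_closed acc ysS(2) S_c Uc by auto
   have "lc (ac (Suc k)) Us = lc (ac k) Us ++ q[^]k**lc (cf (ys k)) Us" unfolding acS by (rule lc_add) (use acc ysS(2) S_c Uc qp in auto)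
   hence "lc (ac (Suc k)) Us ++ q[^]Suc k**ys (Suc k) = lc (ac k) Us ++ q[^]k**(lc (cf (ys k)) Us ++ q**ys (Suc k))"
   using lcc qp(2)[of k] qc yc[of "Suc k"] by (simp add: r_distr m_assoc a_assoc)
   thus ?case using Suc ysS(1)[of k] by simp
  qed
  have "ALL l. EX t:S. ALL k. EX z:S. t -- ac k l = q[^]k**z"
  proof
   fix l
   show "EX t:S. ALL k. EX z:S. t -- ac k l = q[^]k**z"
   proof (rule S_complete)
   show "EX z:S. ac (Suc k) l -- ac k l = q[^]k**z" for k using add_diff_cancel_left[of "ac k l" "q[^]k**cf (ys k) l"] acc S_c qp ysS(2) by (auto simp: acS)
   qed (rule acc)
  qed
  then obtain t where t: "!!l. t l : S" "!!l k. EX z:S. t l -- ac k l = q[^]k**z" by metis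
  have "ALL k l. EX z. z : S & t l -- ac k l = q[^]k**z" using t(2) by blast
  then obtain z where z: "!!k l. z k l : S" "!!k l. t l -- ac k l = q[^]k**z k l" by metis
  \<comment> \<open>The error of the limit is divisible by every \<open>q[^]k\<close>. Values are
    real numbers, so the error is zero.\<close>
  define \<Delta> where "\<Delta> = y -- lc t Us"
  have tc: "lc t Us : carrier R" using lc_closed t(1) S_c Uc by simp
  have ycc: "y : carrier R" using y vge_carrier by blast
  have \<Delta>k: "\<Delta> : vge (real k)" for k :: nat
  proof -
   have "t = (%l. ac k l ++ q[^]k**z k l)" using z(2)[of _ k] diff_add_cancel acc t(1) S_c by metis
   hence "lc t Us = lc (ac k) Us ++ q[^]k**lc (z k) Us" using lc_add[of "ac k" "z k" Us "q[^]k"] acc z(1) S_c Uc qp by auto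
   moreover have zc: "lc (z k) Us : carrier R" "lc (ac k) Us : carrier R" using lc_closed z(1) acc S_c Uc by auto
   ultimately have "\<Delta> = q[^]k**(ys k -- lc (z k) Us)" unfolding \<Delta>_def using sum[of k] yc[of k] qp(2)[of k]
   by (simp add: a_minus_def r_distr r_minus minus_add a_ac r_neg1 r_neg2)
   moreover have "lc (z k) Us : vge 0" using lc_in[OF vge_additive_subgroup, of "z k" Us 0] z(1) S_c Uc vge0_mult S_vge UE by blast
   hence "ys k -- lc (z k) Us : vge 0" using vge_minus ysO by blast
   moreover have "q[^]k : vge (real k)" using w_pow[OF qc q(2)] qp wq by (simp add: vge_def)
   ultimately show ?thesis using vge_mult[of "q[^]k" "real k" _ 0] by simp
  qed
  obtain n :: nat where "w \<Delta> + 1 <= real n" using real_arch_simple by blast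
  hence "\<Delta> = \<zero>" using \<Delta>k[of n] by (auto simp: vge_def)
  hence "y = lc t Us" unfolding \<Delta>_def using ycc tc by (simp add: r_right_minus_eq)
  thus ?thesis using t(1) by blast
 qed
 thus ?thesis using UE by blast
qed

end

section \<open>Congruences modulo the maximal ideal and perfectness of residue fields of finite
  extensions\<close>

context complete_valued
begin

abbreviation cong_v :: "'a => 'a => bool" (infix "\<doteq>" 50) where "x \<doteq> y == x -- y : vgt 0"

lemma cong_sym: "x : carrier R ==> y : carrier R ==> x \<doteq> y ==> y \<doteq> x"
proof -
 assume c: "x : carrier R" "y : carrier R" "x \<doteq> y"
 have "y -- x = -- (x -- y)" using c by (simp add: a_minus_def minus_add a_comm)
 thus ?thesis using vgt_neg[OF c(3)] by simp
qed

lemma cong_trans: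
 assumes c: "x : carrier R" "y : carrier R" "z : carrier R" and "x \<doteq> y" "y \<doteq> z" shows "x \<doteq> z"
proof -
 have "x -- z = (x -- y) ++ (y -- z)" using c by (simp add: a_minus_def a_assoc r_neg1 r_neg2)
 thus ?thesis using vgt_add assms by simp
qed

lemma cong_add:
 assumes c: "x : carrier R" "y : carrier R" "x' : carrier R" "y' : carrier R" and "x \<doteq> y" "x' \<doteq> y'"
 shows "x ++ x' \<doteq> y ++ y'"
proof -
 have "(x ++ x') -- (y ++ y') = (x -- y) ++ (x' -- y')" using c by (simp add: a_minus_def minus_add a_ac)
 thus ?thesis using vgt_add assms by simp
qed

lemma cong_mult:
 assumes c: "x : vge 0" "y : vge 0" "x' : vge 0" "y' : vge 0" and d: "x \<doteq> y" "x' \<doteq> y'"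
 shows "x**x' \<doteq> y**y'"
proof -
 have cc: "x : carrier R" "y : carrier R" "x' : carrier R" "y' : carrier R" using c vge_carrier by auto
 have "x**x' -- y**y' = x'**(x -- y) ++ y**(x' -- y')" using mult_diff_telescope[OF cc] cc m_comm by simp
 thus ?thesis using vgt_add[of _ 0] vgt_mult[OF c(3) d(1)] vgt_mult[OF c(2) d(2)] by simp
qed

lemma cong_pow: "x : vge 0 ==> y : vge 0 ==> x \<doteq> y ==> x[^](n::nat) \<doteq> y[^]n"
proof (induction n)
 case (Suc n)
 thus ?case using cong_mult[of "x[^]n" "y[^]n" x y] vge0_pow by simp
qed (simp add: a_minus_def r_neg)

lemma q_mult_vgt: "z : vge 0 ==> q**z : vgt 0"
proof -
 assume z: "z : vge 0"
 have "q : vgt 0" using qc wq by (simp add: vgt_def)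
 thus ?thesis using vgt_mult[OF z, of q 0] m_comm[of q z] vge_carrier[OF z] qc by simp
qed

lemma cong_frobenius_add: "x : vge 0 ==> y : vge 0 ==> (x ++ y)[^]p \<doteq> x[^]p ++ y[^]p"
proof -
 assume c: "x : vge 0" "y : vge 0"
 obtain z where z: "z : vge 0" "(x ++ y)[^]p = (x[^]p ++ y[^]p) ++ natf p**z" using frobenius_add[OF vge0_subring c p(1)] by blast
 have "(x[^]p ++ y[^]p) ++ natf p**z -- (x[^]p ++ y[^]p) = natf p**z" by (rule add_diff_cancel_left) (use c z(1) vge_carrier in auto)
 thus ?thesis using z q_mult_vgt p(2) by simp
qed

lemma pow_vgt: "x : vge 0 ==> x[^](n::nat) : vgt 0 ==> x : vgt 0"
proof (cases "x = \<zero>")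
 case False
 assume x: "x : vge 0" "x[^]n : vgt 0"
 have "w x ~= 0" using w_pow[of x n] x False nonzero_pow[of x n] vge_carrier[OF x(1)] by (auto simp: vgt_def)
 thus ?thesis using x(1) False by (auto simp: vge_def vgt_def)
qed simp

text \<open>Coefficients from \<open>S\<close> are p-th powers modulo \<open>q\<close>, and
  Frobenius is additive there. The implication between the two lists preserves nontriviality of a
  relation.\<close>

lemma addpoly_frobenius:
 assumes "set cs <= S" "x : vge 0"
 shows "EX ds. length ds = length cs & set ds <= S & (set ds <= vgt 0 --> set cs <= vgt 0) &
  addpoly p cs (x[^]p) \<doteq> addpoly p ds x[^]p" using assms
proof (induction cs arbitrary: x)
 case Nil
 have "\<zero>[^]p = \<zero>" using p(1) prime_gt_0_nat[of p] by (simp add: nat_pow_zero)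
 thus ?case by (intro exI[of _ "[]"]) (simp add: a_minus_def)
next
 case (Cons c cs)
 have xp: "x[^]p : vge 0" using vge0_pow Cons.prems by blast
 then obtain ds where ds: "length ds = length cs" "set ds <= S" "set ds <= vgt 0 --> set cs <= vgt 0"
  "addpoly p cs ((x[^]p)[^]p) \<doteq> addpoly p ds (x[^]p)[^]p" using Cons.IH[OF _ xp] Cons.prems(1) by auto
 obtain d z where d: "d : S" "z : S" "c -- d[^]p = q**z" using S_perfect[of c] Cons.prems(1) by auto
 have cd: "c \<doteq> d[^]p" using d q_mult_vgt S_vge by auto
 have V: "c : vge 0" "d : vge 0" "x : vge 0" using Cons.prems d S_vge by auto
 have T: "addpoly p ds (x[^]p) : vge 0" "addpoly p cs ((x[^]p)[^]p) : vge 0" using addpoly_in[OF vge0_subring] ds(2) Cons.prems(1) S_vge xp vge0_pow by auto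
 define Y where "Y = addpoly p ds (x[^]p)"
 note m = subringE(6)[OF vge0_subring] and a = subringE(7)[OF vge0_subring] and vc = vge_carrier
 have W: "c**x[^]p : vge 0" "d[^]p**x[^]p : vge 0" "Y[^]p : vge 0" "(d**x)[^]p : vge 0" "d**x : vge 0" "Y : vge 0" using m V vge0_pow T by (auto simp: Y_def)
 have rf: "x[^]p \<doteq> x[^]p" using vc[OF xp] by (simp add: a_minus_def r_neg)
 have 1: "c**x[^]p \<doteq> d[^]p**x[^]p" by (rule cong_mult[OF V(1) vge0_pow[OF V(2)] xp xp cd rf])
 have 2: "addpoly p (c # cs) (x[^]p) \<doteq> d[^]p**x[^]p ++ Y[^]p" using cong_add[OF vc[OF W(1)] vc[OF W(2)] vc[OF T(2)] vc[OF W(3)] 1] ds(4) by (simp add: Y_def)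
 have "d[^]p**x[^]p ++ Y[^]p = (d**x)[^]p ++ Y[^]p" using pow_prod[of d x p] V vc by simp
 moreover have "(d**x)[^]p ++ Y[^]p \<doteq> (d**x ++ Y)[^]p"
  by (rule cong_sym[OF _ _ cong_frobenius_add[OF W(5,6)]]) (use vc W a in \<open>auto intro!: nat_pow_closed\<close>)
 ultimately have 3: "addpoly p (c # cs) (x[^]p) \<doteq> addpoly p (d # ds) x[^]p" using cong_trans[OF _ _ _ 2, of "(d**x ++ Y)[^]p"] vc W T by (simp add: Y_def)
 have "d : vgt 0 --> c : vgt 0"
 proof
  assume "d : vgt 0"
  hence "d[^]p : vgt 0"
  proof -
   have "p = Suc (p - 1)" using p(1) prime_gt_0_nat by simp
   hence "d[^]p = d[^](p - 1)**d" by (metis nat_pow_Suc)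
   thus ?thesis using vgt_mult[OF vge0_pow[OF V(2)] `d : vgt 0`] by simp
  qed
  hence "d[^]p ++ (c -- d[^]p) : vgt 0" using vgt_add cd by blast
  thus "c : vgt 0" using diff_add_cancel[of "d[^]p" c] V vc by simp
 qed
 thus ?case using 3 ds d(1) by (intro exI[of _ "d # ds"]) auto
qed

text \<open>Modulo the maximal ideal a nontrivial additive relation for \<open>x\<close> reads
  \<open>c x + G^p = 0\<close>. If \<open>c\<close> is a unit, \<open>x\<close> is a p-th power,
  since \<open>- 1 / c\<close> is one; otherwise \<open>G = 0\<close> is a shorter nontrivial
  relation.\<close>

lemma residue_pth_root:
 assumes E: "subring E R" "S <= E" and x: "x : E \<inter> vge 0"
 shows "set cs <= S ==> ~ set cs <= vgt 0 ==> addpoly p cs x : vgt 0 ==> EX z:E \<inter> vge 0. x \<doteq> z[^]p"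
proof (induction "length cs" arbitrary: cs)
 case (Suc n)
 then obtain c cs' where cs: "cs = c # cs'" "length cs' = n" by (cases cs) auto
 have xv: "x : vge 0" "x : E" using x by auto
 have cS: "c : S" "set cs' <= S" using Suc.prems cs by auto
 obtain ds where ds: "length ds = length cs'" "set ds <= S" "set ds <= vgt 0 --> set cs' <= vgt 0"
  "addpoly p cs' (x[^]p) \<doteq> addpoly p ds x[^]p" using addpoly_frobenius[OF cS(2) xv(1)] by blast
 define G where "G = addpoly p ds x"
 have GE: "G : E" "G : vge 0" unfolding G_def using addpoly_in[OF E(1)] addpoly_in[OF vge0_subring] ds(2) E(2) S_vge xv by auto
 note vc = vge_carrier
 have cv: "c : vge 0" using cS S_vge by blast
 have A: "addpoly p cs' (x[^]p) : vge 0" using addpoly_in[OF vge0_subring] cS(2) S_vge vge0_pow xv(1) by blast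
 have cx: "c**x : vge 0" using subringE(6)[OF vge0_subring] cv xv by blast
 have Gp: "G[^]p : vge 0" using vge0_pow GE by blast
 have rel: "c**x ++ addpoly p cs' (x[^]p) : vgt 0" using Suc.prems(3) cs by simp
 have "(c**x ++ addpoly p cs' (x[^]p)) -- (addpoly p cs' (x[^]p) -- G[^]p) = c**x ++ G[^]p"
  using vc[OF cx] vc[OF A] vc[OF Gp] by (simp add: a_minus_def minus_add a_ac r_neg1 r_neg2 r_neg)
 hence rel': "c**x ++ G[^]p : vgt 0" using vgt_minus[OF rel ds(4)] by (simp add: G_def)
 show ?case
 proof (cases "c : vgt 0")
  case True
  hence "~ set cs' <= vgt 0" using Suc.prems(2) cs by auto
  hence nd: "~ set ds <= vgt 0" using ds(3) by blast
  have "x**c : vgt 0" using vgt_mult[OF xv(1) True] by simp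
  hence "(c**x ++ G[^]p) -- c**x : vgt 0" using vgt_minus[OF rel'] m_comm[OF vc[OF xv(1)] vc[OF cv]] by simp
  hence "G[^]p : vgt 0" using add_diff_cancel_left[OF vc[OF cx] vc[OF Gp]] by simp
  hence "G : vgt 0" using pow_vgt GE(2) by blast
  thus ?thesis using Suc.hyps(1)[of ds] ds(1,2) cs(2) nd by (simp add: G_def)
 next
  case False
  hence ic: "inv c : S" "c ~= \<zero>" using S_unit' cS(1) by auto
  note icf = inv_facts[OF S_c[OF cS(1)] ic(2)]
  obtain e y where e: "e : S" "y : S" "-- (inv c) -- e[^]p = q**y" using S_perfect subringE(5)[OF S ic(1)] by blast
  have ee: "-- (inv c) \<doteq> e[^]p" using e q_mult_vgt S_vge by auto
  have icv: "inv c : vge 0" "-- (inv c) : vge 0" "e : vge 0" using ic subringE(5)[OF S ic(1)] e S_vge by auto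
  have "inv c**(c**x ++ G[^]p) : vgt 0" using vgt_mult[OF icv(1) rel'] by simp
  moreover have "inv c**(c**x ++ G[^]p) = x -- -- (inv c)**G[^]p" using icf vc[OF cv] vc[OF xv(1)] vc[OF Gp] by (simp add: r_distr m_assoc[symmetric] a_minus_def l_minus)
  ultimately have 1: "x \<doteq> -- (inv c)**G[^]p" by simp
  have rf: "G[^]p \<doteq> G[^]p" using vc[OF Gp] by (simp add: a_minus_def r_neg)
  have 2: "-- (inv c)**G[^]p \<doteq> e[^]p**G[^]p" by (rule cong_mult[OF icv(2) vge0_pow[OF icv(3)] Gp Gp ee rf])
  have "x \<doteq> e[^]p**G[^]p" by (rule cong_trans[OF _ _ _ 1 2]) (use vc icv xv Gp vge0_pow in auto)
  moreover have "e[^]p**G[^]p = (e**G)[^]p" using pow_prod vc icv GE by simp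
  moreover have "e**G : E \<inter> vge 0" using subringE(6)[OF E(1)] subringE(6)[OF vge0_subring] icv GE e E(2) by blast
  ultimately show ?thesis by auto
 qed
qed auto

text \<open>In a finite extension the elements \<open>x, x^p, x^(p^2), ...\<close> are linearly
  dependent, which is the additive relation that yields a p-th root modulo the maximal ideal; this
  is iterated.\<close>

lemma residue_perfect:
 assumes E: "subfield E R" "Q <= E" and d: "dimension D Q E" and x: "x : E \<inter> vge 0"
 shows "EX z:E \<inter> vge 0. x \<doteq> z[^](p ^ n)" using x
proof (induction n arbitrary: x)
 case 0
 thus ?case using vge_carrier by (intro bexI[of _ x]) (auto simp: a_minus_def r_neg)
next
 case (Suc n)
 have Es: "subring E R" using subfieldE(1)[OF E(1)] .
 have SE: "S <= E" using S_Q E(2) by blast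
 have EO: "subring (E \<inter> vge 0) R" by (rule subring_inter[OF Es vge0_subring])
 define Us where "Us = frob_list p (Suc D) x"
 have U: "set Us <= E" "set Us <= carrier R" using frob_list_in[OF EO Suc.prems] vge_carrier unfolding Us_def by blast+
 obtain Ks where K: "length Ks = length Us" "set Ks <= S" "~ set Ks <= vgt 0" "combine Ks Us = \<zero>" using primitive_relation[OF d U(1) _ U(2)] by (auto simp: Us_def)
 have "addpoly p Ks x = \<zero>" using combine_frob_list[of Ks p x] K(1,4) by (simp add: Us_def)
 then obtain z where z: "z : E \<inter> vge 0" "x \<doteq> z[^]p" using residue_pth_root[OF Es SE Suc.prems K(2,3)] by auto
 obtain y where y: "y : E \<inter> vge 0" "z \<doteq> y[^](p ^ n)" using Suc.IH[OF z(1)] by blast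
 have yv: "y[^](p ^ n) : vge 0" using vge0_pow y by blast
 have "z[^]p \<doteq> (y[^](p ^ n))[^]p" using cong_pow y z yv by blast
 hence "x \<doteq> (y[^](p ^ n))[^]p" by (rule cong_trans[OF _ _ _ z(2), rotated 3]) (use Suc.prems z yv vge0_pow vge_carrier in blast)+
 moreover have "y : carrier R" using y(1) vge_carrier by blast
 hence "(y[^](p ^ n))[^]p = y[^](p ^ Suc n)" using nat_pow_pow[of y "p ^ n" p] by (simp add: mult.commute)
 ultimately show ?case using y(1) by auto
qed

text \<open>
  Another valuation that is nonnegative on \<open>S\<close> is bounded below on the integers of a finite
  extension, which are finitely generated, and hence nonnegative on them.
\<close>
lemma vge_integral:
 assumes x: "x : vge 0"
 shows "integral_over S x"
proof (rule ccontr)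
 assume ni: "~ integral_over S x"
 have xc: "x : carrier R" using vge_carrier x .
 obtain w' where w': "valued_field R w'" "w' q = 1" "ALL x:loc. x ~= \<zero> --> w' x >= 0" "x ~= \<zero>" "w' x < 0" using exists_valuation_q[OF xc] ni loc_eq by auto
 interpret W': valued_field R w' by (rule w'(1))
 have algx: "(algebraic over Q) x" using algebraic_iff_integral[OF Q_subfield xc] alg[OF xc] by simp
 define E where "E = finite_extension Q [x]"
 have ax: "!!y. y : set [x] ==> (algebraic over Q) y" and xs: "set [x] <= carrier R" using algx xc by auto
 have E: "subfield E R" using finite_extension_is_subfield[OF Q_subfield xs ax] unfolding E_def by blast
 have QE: "Q <= E" unfolding E_def using finite_extension_incl[OF subfieldE(3)[OF Q_subfield] xs] .
 have xE: "x : E" unfolding E_def using finite_extension_mem[OF subfieldE(1)[OF Q_subfield] xs] by simp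
 obtain D where D: "dimension D Q E" using finite_extension_finite_dimension(1)[OF Q_subfield xs ax] unfolding E_def by (auto simp: finite_dimension_def)
 obtain Us where Us: "set Us <= E \<inter> vge 0" "!!y. y : E \<inter> vge 0 ==> EX f. (ALL l. f l : S) & y = lc f Us"
  using finitely_generated_integers[OF E QE D] by blast
 have Uc: "set Us <= carrier R" using Us(1) vge_carrier by blast
 have SW: "S <= W'.vge 0" using w'(3) loc_eq S_c by (auto simp: W'.vge_def)
 obtain M :: real where M: "!!u. u : set Us ==> u : W'.vge (- M)"
 proof -
  define m where "m = Max (insert 0 ((%u. - w' u) ` set Us))"
  have "u : W'.vge (- m)" if "u : set Us" for u
  proof -
   have "- w' u <= m" unfolding m_def using that by (intro Max_ge) auto
   thus ?thesis using that Uc by (auto simp: W'.vge_def)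
  qed
  thus ?thesis using that by blast
 qed
 have bd: "y : W'.vge (- M)" if y: "y : E \<inter> vge 0" for y
 proof -
  obtain f where f: "ALL l. f l : S" "y = lc f Us" using Us(2)[OF y] by blast
  show ?thesis unfolding f(2) by (rule lc_in[OF W'.vge_additive_subgroup _ Uc]) (use f(1) S_c W'.vge0_mult[OF subsetD[OF SW] M] in auto)
 qed
 \<comment> \<open>The same bound holds for all powers of \<open>x\<close>, which excludes a
   negative value.\<close>
 have "real n * w' x >= - M" for n :: nat
 proof -
  have "x[^]n : E" using pow_in_subfield[OF E xE] .
  hence "x[^]n : W'.vge (- M)" using bd vge0_pow[OF x] by blast
  thus ?thesis using W'.w_pow[OF xc w'(4), of n] nonzero_pow[OF xc w'(4), of n] by (simp add: W'.vge_def)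
 qed
 moreover obtain n :: nat where "M < real n * - w' x" using w'(5) reals_Archimedean3[of "- w' x"] by auto
 ultimately show False by (smt (verit) mult_minus_right)
qed

lemma integral_iff_vge: "x : carrier R ==> integral_over S x <-> x : vge 0"
 using vge_integral valuation_ring_integrally_closed[OF vge0_ring] integral_over_mono S_vge by blast

end

text \<open>Since \<open>inv q\<close> is not integral over the localization, which is
  \<open>S\<close> itself, a normalized valuation exists.\<close>

lemma (in complete_prime) exists_complete_valued: "EX w. complete_valued R S q p w"
proof -
 have qc: "q : carrier R" using S_c q by blast
 note iq = inv_facts[OF qc q(2)]
 have "~ integral_over loc (\<one>**inv q)" using divisible_of_integral[OF subringE(3)[OF S]] q(3) by blast
 hence "~ integral_over loc (inv q)" using iq by simp
 then obtain w where w: "valued_field R w" "w q = 1" "ALL x:loc. x ~= \<zero> --> w x >= 0" using exists_valuation_q iq by blast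
 have "complete_valued R S q p w"
 proof (intro complete_valued.intro complete_valued_axioms.intro complete_prime_axioms w(1,2))
  show "S <= valued_field.vge R w 0" using w(3) loc_eq S_c by (auto simp: valued_field.vge_def[OF w(1)])
 qed
 thus ?thesis by blast
qed

section \<open>Derivations on the integers that vanish on the base ring\<close>

context field
begin

text \<open>The formal derivative of a polynomial; the constant coefficient stands last and is
  dropped.\<close>

primrec dl :: "'a list => 'a list" where
 "dl [] = []"
| "dl (c # cs) = (if cs = [] then [] else natf (length cs)**c # dl cs)"

lemma length_dl: "length (dl cs) = length cs - 1" by (induction cs) auto

lemma dl_in: "subring T R ==> set cs <= T ==> set (dl cs) <= T" by (induction cs) (auto intro: natf_subring subringE(6))

lemma eval_dl_Cons:
 assumes "c : carrier R" "set cs <= carrier R" "x : carrier R"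
 shows "eval (dl (c # cs)) x = c**dpow x (length cs) ++ eval (dl cs) x"
proof (cases cs)
 case Nil
 thus ?thesis using assms by (simp add: dpow_def)
next
 case (Cons d ds)
 have "natf (length cs)**c**x[^](length cs - 1) = c**dpow x (length cs)" using assms by (simp add: dpow_def m_ac)
 thus ?thesis using Cons length_dl[of cs] by simp
qed

end

context complete_valued
begin

context
 fixes M :: "('a, 'x, 'm) module_scheme" and de :: "'a => 'x"
 assumes M: "module (R\<lparr>carrier := vge 0\<rparr>) M" and de: "!!x. x : vge 0 ==> de x : carrier M"
  and de_add: "!!x y. x : vge 0 ==> y : vge 0 ==> de (x ++ y) = de x ++\<^sub>M de y"
  and de_mult: "!!x y. x : vge 0 ==> y : vge 0 ==> de (x**y) = x \<odot>\<^sub>M de y ++\<^sub>M y \<odot>\<^sub>M de x"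
  and de_base: "!!s. s : S ==> de s = \<zero>\<^sub>M"
begin

interpretation M: module "R\<lparr>carrier := vge 0\<rparr>" M by (rule M)

lemma sm_closed: "x : vge 0 ==> m : carrier M ==> x \<odot>\<^sub>M m : carrier M" using M.smult_closed by simp

lemma sm_assoc: "x : vge 0 ==> y : vge 0 ==> m : carrier M ==> (x**y) \<odot>\<^sub>M m = x \<odot>\<^sub>M (y \<odot>\<^sub>M m)" using M.smult_assoc1 by simp

lemma sm_add: "x : vge 0 ==> y : vge 0 ==> m : carrier M ==> (x ++ y) \<odot>\<^sub>M m = x \<odot>\<^sub>M m ++\<^sub>M y \<odot>\<^sub>M m"
 using M.smult_l_distr by simp

lemma sm_zero: "x : vge 0 ==> x \<odot>\<^sub>M \<zero>\<^sub>M = \<zero>\<^sub>M" "m : carrier M ==> \<zero> \<odot>\<^sub>M m = \<zero>\<^sub>M"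
 using M.smult_r_null M.smult_l_null by simp_all

lemma O_mult: "x : vge 0 ==> y : vge 0 ==> x**y : vge 0" by (rule subringE(6)[OF vge0_subring])

lemma O_natf: "natf n : vge 0" by (rule natf_subring[OF vge0_subring])

lemma O_dpow: "x : vge 0 ==> dpow x n : vge 0" unfolding dpow_def using O_mult O_natf vge0_pow by blast

lemma de_scalar: "s : S ==> x : vge 0 ==> de (s**x) = s \<odot>\<^sub>M de x" using de_mult[of s x] de_base[of s] sm_zero de sm_closed[of s "de x"] S_vge by auto

lemma de_pow: "x : vge 0 ==> de (x[^](n::nat)) = dpow x n \<odot>\<^sub>M de x"
proof (induction n)
 case 0
 thus ?case using de_base[OF subringE(3)[OF S]] sm_zero de by (simp add: dpow_def vge_carrier)
next
 case (Suc n)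
 note x = Suc.prems
 have xn: "x[^]n : vge 0" using vge0_pow x .
 have "de (x[^]Suc n) = x[^]n \<odot>\<^sub>M de x ++\<^sub>M x \<odot>\<^sub>M (dpow x n \<odot>\<^sub>M de x)" using de_mult[OF xn x] Suc.IH[OF x] by simp
 also have "\<dots> = (x[^]n ++ x**dpow x n) \<odot>\<^sub>M de x" using sm_assoc[OF x O_dpow[OF x] de[OF x]] sm_add[OF xn O_mult[OF x O_dpow[OF x]] de[OF x]] by simp
 also have "x[^]n ++ x**dpow x n = dpow x (Suc n)" using dpow_Suc[of x n] vge_carrier[OF x] a_comm m_comm by simp
 finally show ?case .
qed

lemma de_eval: "set cs <= S ==> a : vge 0 ==> de (eval cs a) = eval (dl cs) a \<odot>\<^sub>M de a"
proof (induction cs)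
 case Nil
 thus ?case using de_base[OF subringE(2)[OF S]] sm_zero de by simp
next
 case (Cons c cs)
 note a = Cons.prems(2)
 have c: "c : S" "set cs <= S" using Cons.prems(1) by auto
 have cv: "c : vge 0" "set cs <= vge 0" using c S_vge by auto
 have an: "a[^]length cs : vge 0" using vge0_pow a .
 have ev: "eval cs a : vge 0" "eval (dl cs) a : vge 0" using eval_in_subring[OF vge0_subring _ a] dl_in[OF vge0_subring] cv by auto
 have "de (eval (c # cs) a) = c \<odot>\<^sub>M (dpow a (length cs) \<odot>\<^sub>M de a) ++\<^sub>M eval (dl cs) a \<odot>\<^sub>M de a"
  using de_add[OF O_mult[OF cv(1) an] ev(1)] de_scalar[OF c(1) an] de_pow[OF a] Cons.IH[OF c(2) a] by simp
 also have "\<dots> = (c**dpow a (length cs) ++ eval (dl cs) a) \<odot>\<^sub>M de a"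
  using sm_assoc[OF cv(1) O_dpow[OF a] de[OF a]] sm_add[OF O_mult[OF cv(1) O_dpow[OF a]] ev(2) de[OF a]] by simp
 also have "c**dpow a (length cs) ++ eval (dl cs) a = eval (dl (c # cs)) a" by (rule eval_dl_Cons[symmetric]) (use c S_c vge_carrier[OF a] in auto)
 finally show ?case .
qed

lemma qO: "q[^](n::nat) : vge 0" "q[^]n : S" "q[^]n : carrier R"
proof -
 have S: "q[^]n : S" for n :: nat by (induction n) (use subringE(3,6)[OF S] q(1) in auto)
 thus "q[^]n : vge 0" "q[^]n : S" "q[^]n : carrier R" using S_vge qc by auto
qed

text \<open>For a relation \<open>f\<close> of \<open>a\<close> over \<open>S\<close> of least
  length, the derivative of \<open>f\<close> at \<open>a\<close> is nonzero, as the characteristic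
  is zero. It kills \<open>de a\<close>, and some power of \<open>q\<close> is a multiple of
  it.\<close>

lemma derivation_torsion:
 assumes a: "a : vge 0"
 shows "EX N::nat. q[^]N \<odot>\<^sub>M de a = \<zero>\<^sub>M"
proof -
 have ac: "a : carrier R" using vge_carrier a .
 \<comment> \<open>Relations need not be monic here, because the formal derivative has to be
   compared with them and is not monic in general.\<close>
 define P where "P cs <-> set cs <= S & cs ~= [] & hd cs ~= \<zero> & eval cs a = \<zero>" for cs
 obtain cs0 where "set cs0 <= S" "eval (\<one> # cs0) a = \<zero>" using integral_over_eval[OF subring_additive_subgroup[OF S] ac] vge_integral[OF a] by blast
 hence "P (\<one> # cs0)" using subringE(3)[OF S] by (auto simp: P_def)
 then obtain cs where cs: "P cs" "!!ds. P ds ==> length cs <= length ds" using ex_has_least_nat[of P _ length] by blast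
 then obtain c cs' where c: "cs = c # cs'" by (cases cs) (auto simp: P_def)
 have csS: "c : S" "set cs' <= S" "c ~= \<zero>" using cs(1) c by (auto simp: P_def)
 have "cs' ~= []" using cs(1) csS S_c c by (auto simp: P_def)
 hence n: "length cs' >= 1" by (cases cs') auto
 have "hd (dl cs) = natf (length cs')**c" "dl cs ~= []" using `cs' ~= []` c by auto
 moreover have "natf (length cs')**c ~= \<zero>" using nonzero_mult[OF natf_closed S_c[OF csS(1)] char[OF n] csS(3)] .
 moreover have "~ P (dl cs)" using cs(2)[of "dl cs"] length_dl[of cs] c by auto
 ultimately have ev: "eval (dl cs) a ~= \<zero>" using dl_in[OF S, of cs] csS c by (auto simp: P_def)
 define v where "v = eval (dl cs) a"
 have "set cs <= vge 0" using csS c S_vge by auto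
 hence v: "v : vge 0" "v ~= \<zero>" "v : carrier R" using eval_in_subring[OF vge0_subring dl_in[OF vge0_subring] a, of cs] ev vge_carrier by (auto simp: v_def)
 have va: "v \<odot>\<^sub>M de a = \<zero>\<^sub>M" using de_eval[of cs a] cs(1) a de_base[OF subringE(2)[OF S]] by (simp add: P_def v_def)
 obtain N :: nat where N: "w v <= real N" using real_arch_simple by blast
 note iv = inv_facts[OF v(3,2)]
 define d where "d = q[^]N**inv v"
 have "w d = real N - w v" unfolding d_def using w_mult[of "q[^]N" "inv v"] w_pow[OF qc q(2), of N] w_inv[OF v(3,2)] wq nonzero_pow[OF qc q(2)] qc iv by simp
 hence d: "d : vge 0" using N iv qc by (simp add: vge_def d_def)
 have "q[^]N = d**v" using iv qc v by (simp add: d_def m_assoc)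
 hence "q[^]N \<odot>\<^sub>M de a = \<zero>\<^sub>M" using sm_assoc[OF d v(1) de[OF a]] va sm_zero(1)[OF d] by simp
 thus ?thesis by blast
qed

lemma torsion_mono: "m : carrier M ==> q[^]N \<odot>\<^sub>M m = \<zero>\<^sub>M ==> N <= N' ==> q[^](N'::nat) \<odot>\<^sub>M m = \<zero>\<^sub>M"
proof -
 assume a: "m : carrier M" "q[^]N \<odot>\<^sub>M m = \<zero>\<^sub>M" "N <= N'"
 have "q[^]N' = q[^](N' - N)**q[^]N" using nat_pow_mult[OF qc, of "N' - N" N] a(3) by simp
 thus ?thesis using sm_assoc[OF qO(1) qO(1) a(1), of "N' - N" N] a(2) sm_zero(1)[OF qO(1)] by simp
qed

text \<open>The integers of \<open>E\<close> are finitely generated over \<open>S\<close>, and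
  \<open>de\<close> is linear over \<open>S\<close>; the largest exponent of the generators works
  for all.\<close>

lemma derivation_torsion_uniform:
 assumes E: "subfield E R" "Q <= E" and d: "dimension D Q E"
 shows "EX N::nat. ALL y:E \<inter> vge 0. q[^]N \<odot>\<^sub>M de y = \<zero>\<^sub>M"
proof -
 obtain Us where Us: "set Us <= E \<inter> vge 0" "!!y. y : E \<inter> vge 0 ==> EX f. (ALL l. f l : S) & y = lc f Us" using finitely_generated_integers[OF E d] by blast
 have Uv: "set Us <= vge 0" using Us(1) by blast
 hence "EX N::nat. ALL u:set Us. q[^]N \<odot>\<^sub>M de u = \<zero>\<^sub>M"
 proof (induction Us)
  case (Cons u Us)
  then obtain N :: nat where N: "ALL u:set Us. q[^]N \<odot>\<^sub>M de u = \<zero>\<^sub>M" by auto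
  have u: "u : vge 0" using Cons.prems by simp
  obtain N' :: nat where N': "q[^]N' \<odot>\<^sub>M de u = \<zero>\<^sub>M" using derivation_torsion[OF u] by blast
  have "q[^]max N N' \<odot>\<^sub>M de x = \<zero>\<^sub>M" if x: "x : set (u # Us)" for x
  proof -
   have "de x : carrier M" using de x Cons.prems by auto
   moreover have "x = u \<or> x : set Us" using x by simp
   ultimately show ?thesis using torsion_mono[of "de x" N "max N N'"] torsion_mono[of "de x" N' "max N N'"] N N' by auto
  qed
  thus ?case by blast
 qed simp
 then obtain N :: nat where N: "ALL u:set Us. q[^]N \<odot>\<^sub>M de u = \<zero>\<^sub>M" by blast
 define T where "T = {y : vge 0. q[^]N \<odot>\<^sub>M de y = \<zero>\<^sub>M}"
 have Tadd: "x ++ y : T" if "x : T" "y : T" for x y using that de_add[of x y] M.smult_r_distr[of "q[^]N" "de x" "de y"] de qO(1) subringE(7)[OF vge0_subring]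
  by (auto simp: T_def)
 have TS: "s**x : T" if "s : S" "x : T" for s x
 proof -
  have s: "s : vge 0" "x : vge 0" using that S_vge by (auto simp: T_def)
  have "q[^]N \<odot>\<^sub>M de (s**x) = (q[^]N**s) \<odot>\<^sub>M de x" using de_scalar[OF that(1) s(2)] sm_assoc[OF qO(1) s(1) de[OF s(2)]] by simp
  also have "q[^]N**s = s**q[^]N" using m_comm qO(3) vge_carrier[OF s(1)] by simp
  also have "(s**q[^]N) \<odot>\<^sub>M de x = \<zero>\<^sub>M" using sm_assoc[OF s(1) qO(1) de[OF s(2)]] that(2) sm_zero(1)[OF s(1)] by (simp add: T_def)
  finally show ?thesis using O_mult[OF s] by (simp add: T_def)
 qed
 have T0: "\<zero> : T" using de_base[OF subringE(2)[OF S]] sm_zero(1)[OF qO(1)] by (simp add: T_def)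
 have Tc: "T <= carrier R" using vge_carrier by (auto simp: T_def)
 have Tn: "-- x : T" if "x : T" for x using TS[OF subringE(5)[OF S subringE(3)[OF S]] that] Tc that by (auto simp: l_minus)
 have "additive_subgroup T R" unfolding additive_subgroup_def by (rule add.subgroupI) (use Tadd T0 Tc Tn in \<open>auto simp: a_inv_def[symmetric]\<close>)
 hence "lc f Us : T" if "!!l. f l : S" for f using lc_in[of T f Us] that S_c Uv vge_carrier TS N unfolding T_def by blast
 thus ?thesis using Us(2) unfolding T_def by fastforce
qed

text \<open>
  With \<open>un\<close> a uniformizer of \<open>E\<close>, every integer of \<open>E\<close> is a sum of terms \<open>z^(p^N) un^j\<close> modulo \<open>q^N\<close>
  because the residue field is perfect, and \<open>q^N\<close> kills all differentials.
\<close>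
lemma derivation_uniformizer:
 assumes E: "subfield E R" "Q <= E" and d: "dimension D Q E"
 shows "EX un:vge 0. ALL x:E \<inter> vge 0. EX t:vge 0. de x = t \<odot>\<^sub>M de un"
proof -
 have Es: "subring E R" using subfieldE(1)[OF E(1)] .
 have Ec: "x : carrier R" if "x : E" for x using subringE(1)[OF Es] that by blast
 have EO: "subring (E \<inter> vge 0) R" by (rule subring_inter[OF Es vge0_subring])
 obtain N :: nat where N: "!!y. y : E \<inter> vge 0 ==> q[^]N \<odot>\<^sub>M de y = \<zero>\<^sub>M" using derivation_torsion_uniform[OF E d] by blast
 have val: "EX k::int. w x = of_int k * 1" if "x : Q" "x ~= \<zero>" for x using values_int[OF that] by (auto elim: Ints_cases)
 have qE: "q : E" "q[^]n : E" for n :: nat using qO(2) S_Q E(2) q(1) by auto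
 obtain un where pi: "un : E" "un ~= \<zero>" "w un > 0" "!!x. x : E ==> x ~= \<zero> ==> EX k::int. w x = of_int k * w un"
  using exists_uniformizer[OF Q_subfield E(1) d zero_less_one val qE(1) q(2) wq] by blast
 have pic: "un : carrier R" and piv: "un : vge 0" using pi Ec by (auto simp: vge_def)
 note ipi = inv_facts[OF pic pi(2)]
 have ipiE: "inv un : E" using subfield_m_inv(1)[OF E(1)] pi by blast
 have div: "EX y:E \<inter> vge 0. x = un**y" if x: "x : E" "x : vgt 0" for x
 proof -
  have xc: "x : carrier R" using x Ec by blast
  have "inv un**x : vge 0"
  proof (cases "x = \<zero>")
   case False
   then obtain k :: int where k: "w x = of_int k * w un" using pi(4) x by blast
   have "w x > 0" using x(2) False by (simp add: vgt_def)
   hence "k >= 1" using k pi(3) by (simp add: zero_less_mult_iff)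
   hence "of_int k * w un >= 1 * w un" using pi(3) by (intro mult_right_mono) auto
   hence "w (inv un**x) >= 0" using w_mult[of "inv un" x] w_inv[OF pic pi(2)] k False ipi xc by simp
   thus ?thesis using ipi xc by (simp add: vge_def)
  qed (use ipi in simp)
  moreover have "inv un**x : E" using subringE(6)[OF Es ipiE x(1)] .
  moreover have "x = un**(inv un**x)" using ipi pic xc by (simp add: m_assoc[symmetric])
  ultimately show ?thesis by blast
 qed
 define T where "T = {x : E \<inter> vge 0. EX t:vge 0. de x = t \<odot>\<^sub>M de un}"
 have dun: "de un : carrier M" using de piv .
 have Tz: "x : T" if "x : E \<inter> vge 0" "de x = \<zero>\<^sub>M" for x
  using that sm_zero(2)[OF dun] vge_zero[of 0] unfolding T_def by (intro CollectI conjI bexI[of _ \<zero>]) auto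
 have Tadd: "x ++ y : T" if xy: "x : T" "y : T" for x y
 proof -
  obtain s t where st: "s : vge 0" "t : vge 0" "de x = s \<odot>\<^sub>M de un" "de y = t \<odot>\<^sub>M de un" using xy unfolding T_def by blast
  have v: "x : E \<inter> vge 0" "y : E \<inter> vge 0" using xy by (auto simp: T_def)
  have "de (x ++ y) = (s ++ t) \<odot>\<^sub>M de un" using de_add[of x y] v st sm_add[OF st(1,2) dun] by simp
  thus ?thesis unfolding T_def using subringE(7)[OF EO v] subringE(7)[OF vge0_subring st(1,2)] by blast
 qed
 have Tpi: "un**x : T" if x: "x : T" for x
 proof -
  obtain s where s: "s : vge 0" "de x = s \<odot>\<^sub>M de un" using x unfolding T_def by blast
  have v: "x : E \<inter> vge 0" "x : vge 0" using x by (auto simp: T_def)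
  have "de (un**x) = (un**s ++ x) \<odot>\<^sub>M de un" using de_mult[OF piv v(2)] s sm_assoc[OF piv s(1) dun] sm_add[OF O_mult[OF piv s(1)] v(2) dun] by simp
  thus ?thesis unfolding T_def using subringE(6)[OF EO, of un x] pi(1) piv v subringE(7)[OF vge0_subring O_mult[OF piv s(1)] v(2)] by blast
 qed
 have Tpow: "z[^](p ^ N) : T" if z: "z : E \<inter> vge 0" for z
 proof (rule Tz)
  have zv: "z : vge 0" using z by blast
  have zk: "z[^](k::nat) : vge 0" for k using vge0_pow zv by blast
  have "dpow z (p ^ N) = z[^](p ^ N - 1)**q[^]N" using natf_subfield_eq[of p N] m_comm vge_carrier[OF zv] qO(3) p(2) by (simp add: dpow_def)
  thus "de (z[^](p ^ N)) = \<zero>\<^sub>M" using de_pow[OF zv] sm_assoc[OF zk qO(1) de[OF zv]] N[OF z] sm_zero(1)[OF zk] by simp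
  show "z[^](p ^ N) : E \<inter> vge 0" using zk pow_in_subfield[OF E(1)] z by blast
 qed
 have expand: "ALL x:E \<inter> vge 0. EX s:T. EX y:E \<inter> vge 0. x = s ++ un[^](J::nat)**y" for J
 proof (induction J)
  case 0
  have "\<zero> : T" using Tz[of \<zero>] de_base[OF subringE(2)[OF S]] subringE(2)[OF Es] by simp
  moreover have "x = \<zero> ++ un[^](0::nat)**x" if "x : E" for x using Ec[OF that] by simp
  ultimately show ?case by blast
 next
  case (Suc J)
  show ?case
  proof
   fix x assume x: "x : E \<inter> vge 0"
   obtain z where z: "z : E \<inter> vge 0" "x \<doteq> z[^](p ^ N)" using residue_perfect[OF E d x] by blast
   have zN: "z[^](p ^ N) : E" using Tpow[OF z(1)] by (simp add: T_def)
   have "x -- z[^](p ^ N) : E" using x zN subringE(5,7)[OF Es] by (simp add: a_minus_def)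
   then obtain x1 where x1: "x1 : E \<inter> vge 0" "x -- z[^](p ^ N) = un**x1" using div z(2) by blast
   obtain s y where s: "s : T" "y : E \<inter> vge 0" "x1 = s ++ un[^]J**y" using Suc x1(1) by blast
   have c: "x : carrier R" "z[^](p ^ N) : carrier R" "s : carrier R" "y : carrier R" "un[^]J : carrier R" using x zN s Ec pic by (auto simp: T_def)
   have "x = z[^](p ^ N) ++ un**x1" using diff_add_cancel[OF c(2,1)] x1(2) by simp
   also have "\<dots> = (z[^](p ^ N) ++ un**s) ++ un[^]Suc J**y" unfolding s(3) using c pic by (simp add: r_distr a_assoc m_ac)
   finally show "EX s:T. EX y:E \<inter> vge 0. x = s ++ un[^]Suc J**y" using Tadd[OF Tpow[OF z(1)] Tpi[OF s(1)]] s(2) by blast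
  qed
 qed
 \<comment> \<open>This accuracy makes the remainder a multiple of \<open>q[^]N\<close>, with
   cofactor an integer of \<open>E\<close>, so its differential vanishes.\<close>
 obtain J :: nat where J: "real N < real J * w un" using reals_Archimedean3[OF pi(3)] by blast
 have "x : T" if x: "x : E \<inter> vge 0" for x
 proof -
  obtain s y where s: "s : T" "y : E \<inter> vge 0" "x = s ++ un[^]J**y" using expand[of J] x by blast
  have q0: "q[^]N ~= \<zero>" using nonzero_pow[OF qc q(2)] .
  note iq = inv_facts[OF qO(3) q0]
  define e where "e = inv (q[^]N)**un[^]J"
  have pJ: "un[^]J : carrier R" "un[^]J ~= \<zero>" using nonzero_pow[OF pic pi(2)] pic by auto
  have "w e = real J * w un - real N" unfolding e_def
   using w_mult[OF _ pJ(1) _ pJ(2), of "inv (q[^]N)"] w_inv[OF qO(3) q0] w_pow[OF qc q(2), of N] w_pow[OF pic pi(2), of J] wq iq by simp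
  hence ev: "e : vge 0" using J iq pJ by (simp add: vge_def e_def)
  have eE: "e : E" unfolding e_def using subringE(6)[OF Es] subfield_m_inv(1)[OF E(1)] qE(2) q0 pow_in_subfield[OF E(1) pi(1)] by blast
  define y' where "y' = e**y"
  have y': "y' : E \<inter> vge 0" unfolding y'_def using subringE(6)[OF EO, of e y] ev eE s(2) by blast
  have "un[^]J**y = q[^]N**y'" unfolding y'_def e_def using iq pJ qO(3) Ec s(2) by (simp add: m_assoc[symmetric])
  moreover have "q[^]N**y' : T"
  proof (rule Tz)
   show "q[^]N**y' : E \<inter> vge 0" using subringE(6)[OF EO, of "q[^]N" y'] y' qO qE by blast
   show "de (q[^]N**y') = \<zero>\<^sub>M" using de_scalar[OF qO(2), of y' N] y' N[OF y'] by simp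
  qed
  ultimately show ?thesis using s Tadd by simp
 qed
 thus ?thesis using piv unfolding T_def by blast
qed

text \<open>The derivative of \<open>T^p + q T\<close> is \<open>q\<close> times
  \<open>1 + T^(p-1)\<close>; with \<open>g\<close> the factor collected so far, this is one step of
  division by \<open>q\<close>.\<close>

lemma derivation_tower:
 assumes x: "x : vge 0" and g: "g : vge 0"
 shows "q \<odot>\<^sub>M (((\<one> ++ x[^](p - 1))**g) \<odot>\<^sub>M de x) = g \<odot>\<^sub>M de (x[^]p ++ q**x)"
proof -
 have qv: "q : vge 0" using q(1) S_vge by blast
 have xp: "x[^](k::nat) : vge 0" for k using vge0_pow x .
 have v: "\<one> ++ x[^](p - 1) : vge 0" using subringE(3,7)[OF vge0_subring] xp by blast
 note c = vge_carrier[OF x] vge_carrier[OF g] vge_carrier[OF xp]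
 have "de (x[^]p ++ q**x) = dpow x p \<odot>\<^sub>M de x ++\<^sub>M q \<odot>\<^sub>M de x" using de_add[OF xp O_mult[OF qv x]] de_pow[OF x] de_scalar[OF q(1) x] by simp
 also have "\<dots> = (dpow x p ++ q) \<odot>\<^sub>M de x" using sm_add[OF O_dpow[OF x] qv de[OF x]] by simp
 also have "dpow x p ++ q = q**(\<one> ++ x[^](p - 1))" using c qc p(2) by (simp add: dpow_def r_distr a_comm)
 finally have "g \<odot>\<^sub>M de (x[^]p ++ q**x) = (g**(q**(\<one> ++ x[^](p - 1)))) \<odot>\<^sub>M de x" using sm_assoc[OF g O_mult[OF qv v] de[OF x]] by simp
 also have "g**(q**(\<one> ++ x[^](p - 1))) = q**((\<one> ++ x[^](p - 1))**g)" using c qc vge_carrier[OF v] by (simp add: m_ac)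
 also have "\<dots> \<odot>\<^sub>M de x = q \<odot>\<^sub>M (((\<one> ++ x[^](p - 1))**g) \<odot>\<^sub>M de x)" by (rule sm_assoc[OF qv O_mult[OF v g] de[OF x]])
 finally show ?thesis by simp
qed

text \<open>In a finite extension containing \<open>a\<close> and \<open>bt k\<close>, both
  differentials are multiples of that of one uniformizer, and of two coefficients in a valuation
  ring one divides the other. The torsion orders decide which one does.\<close>

lemma derivation_multiple:
 assumes ga: "!!k. ga k : vge 0" "!!k. bt k : vge 0" and om: "!!k. og k = ga k \<odot>\<^sub>M de (bt k)"
  and ws: "!!k. q \<odot>\<^sub>M og (Suc k) = og k" and w1: "og 1 ~= \<zero>\<^sub>M" and a: "a : vge 0"
 shows "EX t:vge 0. EX k. de a = t \<odot>\<^sub>M og k"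
proof -
 obtain N :: nat where N: "q[^]N \<odot>\<^sub>M de a = \<zero>\<^sub>M" using derivation_torsion[OF a] by blast
 have wc: "og k : carrier M" for k unfolding om using sm_closed ga de by blast
 have "q[^]l \<odot>\<^sub>M og (1 + l) = og 1" for l :: nat
  using torsion_pow[where og = og and k = 1 and l = l, OF vge0_subring q(2)[unfolded p(2)] M wc ws[unfolded p(2)]] p(2) by simp
 hence wN: "q[^]N \<odot>\<^sub>M og (1 + N) = og 1" by blast
 \<comment> \<open>For this index \<open>q[^]N\<close> maps \<open>og k\<close> to the nonzero
   \<open>og 1\<close>, whereas it kills \<open>de a\<close>; thus \<open>og k\<close> cannot be a
   multiple of \<open>de a\<close>.\<close>
 define k where "k = 1 + N"
 define xs where "xs = [a, bt k]"
 have xc: "set xs <= carrier R" using a ga vge_carrier by (auto simp: xs_def)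
 have ax: "(algebraic over Q) y" if "y : set xs" for y using algebraic_iff_integral[OF Q_subfield] alg that xc by blast
 define E where "E = finite_extension Q xs"
 have E: "subfield E R" unfolding E_def using finite_extension_is_subfield[OF Q_subfield xc ax] by blast
 have QE: "Q <= E" unfolding E_def using finite_extension_incl[OF subfieldE(3)[OF Q_subfield] xc] .
 have xE: "a : E" "bt k : E" unfolding E_def using finite_extension_mem[OF subfieldE(1)[OF Q_subfield] xc] by (auto simp: xs_def)
 obtain D where D: "dimension D Q E" unfolding E_def using finite_extension_finite_dimension(1)[OF Q_subfield xc ax] by (auto simp: finite_dimension_def)
 obtain un where pi: "un : vge 0" "!!x. x : E \<inter> vge 0 ==> EX t:vge 0. de x = t \<odot>\<^sub>M de un" using derivation_uniformizer[OF E QE D] by blast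
 note dun = de[OF pi(1)]
 obtain t where t: "t : vge 0" "de a = t \<odot>\<^sub>M de un" using pi(2)[of a] xE a by blast
 obtain t' where t': "t' : vge 0" "de (bt k) = t' \<odot>\<^sub>M de un" using pi(2)[of "bt k"] xE ga by blast
 define u where "u = ga k**t'"
 have u: "u : vge 0" "og k = u \<odot>\<^sub>M de un" unfolding om u_def using O_mult[OF ga(1) t'(1)] sm_assoc[OF ga(1) t'(1) dun] t' by auto
 have tc: "t : carrier R" "u : carrier R" using t u vge_carrier by auto
 have u0: "u ~= \<zero>"
 proof
  assume "u = \<zero>"
  hence "og k = \<zero>\<^sub>M" using u(2) sm_zero(2)[OF dun] by simp
  thus False using wN w1 sm_zero(1)[OF qO(1)] by (simp add: k_def)
 qed
 note iu = inv_facts[OF tc(2) u0]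
 show ?thesis
 proof (cases "t = \<zero> \<or> w t >= w u")
  case True
  define s where "s = t**inv u"
  have "s : vge 0"
  proof (cases "t = \<zero>")
   case False
   thus ?thesis using True w_mult[of t "inv u"] w_inv[OF tc(2) u0] tc iu by (simp add: s_def vge_def)
  qed (use iu in \<open>simp add: s_def\<close>)
  moreover have "t = s**u" using tc iu by (simp add: s_def m_assoc)
  ultimately have "de a = s \<odot>\<^sub>M og k" using t(2) u sm_assoc[of s u "de un"] dun by simp
  thus ?thesis using `s : vge 0` by blast
 next
  case False
  note it = inv_facts[OF tc(1)]
  define s where "s = u**inv t"
  have s: "s : vge 0" using False w_mult[of u "inv t"] w_inv[OF tc(1)] tc it u0 by (simp add: s_def vge_def)
  have "u = s**t" using tc it False by (simp add: s_def m_assoc)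
  hence "og k = s \<odot>\<^sub>M de a" using t u(2) sm_assoc[OF s t(1) dun] by simp
  hence "q[^]N \<odot>\<^sub>M og k = (s**q[^]N) \<odot>\<^sub>M de a" using sm_assoc[OF qO(1) s de[OF a], of N] m_comm[OF qO(3) vge_carrier[OF s], of N] by simp
  also have "\<dots> = \<zero>\<^sub>M" using sm_assoc[OF s qO(1) de[OF a]] N sm_zero(1)[OF s] by simp
  finally show ?thesis using wN w1 by (simp add: k_def)
 qed
qed

end

end

section \<open>Monoid algebras and tensor products\<close>

locale mon_alg = cring V + G: Group.monoid G
 for V :: "('v, 'm) ring_scheme" (structure) and G :: "('g, 'n) monoid_scheme"
begin

abbreviation "FM == free_module V (carrier G)"
abbreviation "MA == monoid_algebra V G"

definition mono :: "'v => 'g => 'g => 'v" where "mono c x = (%t. if t = x then c else \<zero>)"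

lemma MA_simps: "carrier MA = carrier FM" "ring.zero MA = (%s. \<zero>)" "\<one>\<^sub>MA = mono \<one> \<one>\<^sub>G"
 "f ++\<^sub>MA g = (%s. f s ++ g s)" by (auto simp: monoid_algebra_def free_module_simps mono_def unit_vector_def)

lemma FM_val: "f : carrier FM ==> f s : carrier V" "f : carrier FM ==> finite {s. f s ~= \<zero>}"
 "f : carrier FM ==> s ~: carrier G ==> f s = \<zero>" by (auto simp: free_module_carrier)

lemma mono_carrier: "c : carrier V ==> x : carrier G ==> mono c x : carrier FM"
proof -
 assume c: "c : carrier V" "x : carrier G"
 have "finite {s. mono c x s ~= \<zero>}" by (rule finite_subset[of _ "{x}"]) (auto simp: mono_def)
 thus ?thesis using c by (auto simp: free_module_carrier mono_def)
qed

lemma FM_add: "f : carrier FM ==> g : carrier FM ==> (%s. f s ++ g s) : carrier FM"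
proof -
 interpret FM: module V FM by (rule free_module_module)
 show "f : carrier FM ==> g : carrier FM ==> (%s. f s ++ g s) : carrier FM" using FM.M.a_closed[of f g] by (simp add: free_module_simps)
qed

lemma FM_induct [consumes 1, case_names mono add]:
 assumes f: "f : carrier FM" and m: "!!c x. c : carrier V ==> x : carrier G ==> P (mono c x)"
  and a: "!!f g. f : carrier FM ==> g : carrier FM ==> P f ==> P g ==> P (%s. f s ++ g s)"
 shows "P f" using f
proof (induction "card {s. f s ~= \<zero>}" arbitrary: f)
 case 0
 hence "f = mono \<zero> \<one>\<^sub>G" using FM_val(2)[of f] by (auto simp: mono_def)
 thus ?case using m[of \<zero> "\<one>\<^sub>G"] by simp
next
 case (Suc n)
 note c = FM_val[OF Suc.prems]
 have "{s. f s ~= \<zero>} ~= {}" using Suc.hyps(2) by (metis card.empty nat.distinct(1))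
 then obtain x where x: "f x ~= \<zero>" by blast
 hence xG: "x : carrier G" using c(3) by blast
 define f' where "f' = (%s. if s = x then \<zero> else f s)"
 have s: "{s. f' s ~= \<zero>} = {s. f s ~= \<zero>} - {x}" by (auto simp: f'_def)
 have f': "f' : carrier FM" using c s by (auto simp: free_module_carrier f'_def)
 have "n = card {s. f' s ~= \<zero>}" unfolding s using Suc.hyps(2) x c(2) by simp
 hence "P f'" using Suc.hyps(1) f' by blast
 moreover have "f = (%s. f' s ++ mono (f x) x s)" using c(1) by (auto simp: f'_def mono_def)
 ultimately show ?case using a[OF f' mono_carrier[OF c(1) xG]] m[OF c(1) xG] by metis
qed

text \<open>The rectangle may exceed the supports, so that products with a sum can be computed over
  one common index set.\<close>

lemma mult_eq:
 assumes f: "f : carrier FM" "g : carrier FM" and X: "finite Xs" "{s. f s ~= \<zero>} <= Xs" "finite Ys" "{s. g s ~= \<zero>} <= Ys"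
 shows "(f **\<^sub>MA g) z = (\<Oplus>w\<in>Xs \<times> Ys. if fst w **\<^sub>G snd w = z then f (fst w)**g (snd w) else \<zero>)"
proof -
 have "(f **\<^sub>MA g) z = (\<Oplus>w\<in>{(x, y). f x ~= \<zero> & g y ~= \<zero> & x **\<^sub>G y = z}. f (fst w)**g (snd w))" by (simp add: monoid_algebra_def)
 also have "\<dots> = (\<Oplus>w\<in>Xs \<times> Ys. if fst w **\<^sub>G snd w = z then f (fst w)**g (snd w) else \<zero>)"
 proof (rule add.finprod_mono_neutral_cong_left)
  show "finite (Xs \<times> Ys)" using X by simp
  show "(if fst i **\<^sub>G snd i = z then f (fst i)**g (snd i) else \<zero>) = \<zero>"
   if "i : Xs \<times> Ys - {(x, y). f x ~= \<zero> & g y ~= \<zero> & x **\<^sub>G y = z}" for i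
  proof (cases "f (fst i) = \<zero> \<or> g (snd i) = \<zero>")
   case True
   thus ?thesis using FM_val(1)[OF f(1)] FM_val(1)[OF f(2)] by auto
  qed (use that in auto)
 qed (use X FM_val(1)[OF f(1)] FM_val(1)[OF f(2)] in auto)
 finally show ?thesis .
qed

lemma supp_add: "f : carrier FM ==> g : carrier FM ==> {s. f s ++ g s ~= \<zero>} <= {s. f s ~= \<zero>} \<union> {s. g s ~= \<zero>}" by auto

lemma mult_add_l:
 assumes f: "f : carrier FM" "f' : carrier FM" "g : carrier FM"
 shows "(%s. f s ++ f' s) **\<^sub>MA g = (%s. (f **\<^sub>MA g) s ++ (f' **\<^sub>MA g) s)"
proof
 fix z
 let ?X = "{s. f s ~= \<zero>} \<union> {s. f' s ~= \<zero>}" and ?Y = "{s. g s ~= \<zero>}"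
 have fin: "finite ?X" "finite ?Y" using FM_val(2) f by auto
 note c = FM_val(1)[OF f(1)] FM_val(1)[OF f(2)] FM_val(1)[OF f(3)]
 let ?t = "%h w. if fst w **\<^sub>G snd w = z then h (fst w)**g (snd w) else \<zero>"
 have "((%s. f s ++ f' s) **\<^sub>MA g) z = (\<Oplus>w\<in>?X \<times> ?Y. ?t (%s. f s ++ f' s) w)"
  by (rule mult_eq[OF FM_add[OF f(1,2)] f(3) fin(1) supp_add[OF f(1,2)] fin(2)]) simp
 also have "\<dots> = (\<Oplus>w\<in>?X \<times> ?Y. ?t f w ++ ?t f' w)" by (rule finsum_cong') (use c in \<open>auto simp: l_distr\<close>)
 also have "\<dots> = (\<Oplus>w\<in>?X \<times> ?Y. ?t f w) ++ (\<Oplus>w\<in>?X \<times> ?Y. ?t f' w)" by (rule finsum_addf) (use c in auto)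
 also have "(\<Oplus>w\<in>?X \<times> ?Y. ?t f w) = (f **\<^sub>MA g) z" by (rule mult_eq[symmetric]) (use f fin in auto)
 also have "(\<Oplus>w\<in>?X \<times> ?Y. ?t f' w) = (f' **\<^sub>MA g) z" by (rule mult_eq[symmetric]) (use f fin in auto)
 finally show "((%s. f s ++ f' s) **\<^sub>MA g) z = (f **\<^sub>MA g) z ++ (f' **\<^sub>MA g) z" .
qed

lemma mult_add_r:
 assumes f: "f : carrier FM" "f' : carrier FM" "g : carrier FM"
 shows "g **\<^sub>MA (%s. f s ++ f' s) = (%s. (g **\<^sub>MA f) s ++ (g **\<^sub>MA f') s)"
proof
 fix z
 let ?X = "{s. f s ~= \<zero>} \<union> {s. f' s ~= \<zero>}" and ?Y = "{s. g s ~= \<zero>}"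
 have fin: "finite ?X" "finite ?Y" using FM_val(2) f by auto
 note c = FM_val(1)[OF f(1)] FM_val(1)[OF f(2)] FM_val(1)[OF f(3)]
 let ?t = "%h w. if fst w **\<^sub>G snd w = z then g (fst w)**h (snd w) else \<zero>"
 have "(g **\<^sub>MA (%s. f s ++ f' s)) z = (\<Oplus>w\<in>?Y \<times> ?X. ?t (%s. f s ++ f' s) w)"
  by (rule mult_eq[OF f(3) FM_add[OF f(1,2)] fin(2) _ fin(1) supp_add[OF f(1,2)]]) simp
 also have "\<dots> = (\<Oplus>w\<in>?Y \<times> ?X. ?t f w ++ ?t f' w)" by (rule finsum_cong') (use c in \<open>auto simp: r_distr\<close>)
 also have "\<dots> = (\<Oplus>w\<in>?Y \<times> ?X. ?t f w) ++ (\<Oplus>w\<in>?Y \<times> ?X. ?t f' w)" by (rule finsum_addf) (use c in auto)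
 also have "(\<Oplus>w\<in>?Y \<times> ?X. ?t f w) = (g **\<^sub>MA f) z" by (rule mult_eq[symmetric]) (use f fin in auto)
 also have "(\<Oplus>w\<in>?Y \<times> ?X. ?t f' w) = (g **\<^sub>MA f') z" by (rule mult_eq[symmetric]) (use f fin in auto)
 finally show "(g **\<^sub>MA (%s. f s ++ f' s)) z = (g **\<^sub>MA f) z ++ (g **\<^sub>MA f') z" .
qed

lemma mult_mono:
 assumes c: "c : carrier V" "d : carrier V" "x : carrier G" "y : carrier G"
 shows "mono c x **\<^sub>MA mono d y = mono (c**d) (x **\<^sub>G y)"
proof
 fix z
 have "(mono c x **\<^sub>MA mono d y) z =
   (\<Oplus>w\<in>{x} \<times> {y}. if fst w **\<^sub>G snd w = z then mono c x (fst w)**mono d y (snd w) else \<zero>)"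
  by (rule mult_eq) (use c mono_carrier in \<open>auto simp: mono_def\<close>)
 also have "\<dots> = mono (c**d) (x **\<^sub>G y) z" using c by (auto simp: mono_def)
 finally show "(mono c x **\<^sub>MA mono d y) z = mono (c**d) (x **\<^sub>G y) z" .
qed

lemma mult_closed: "f : carrier FM ==> g : carrier FM ==> f **\<^sub>MA g : carrier FM"
proof (induction f rule: FM_induct)
 case (mono c x)
 show ?case using mono(3)
 proof (induction g rule: FM_induct)
  case (mono d y)
  thus ?case using mult_mono mono_carrier `c : carrier V` `x : carrier G` by simp
 next
  case (add g g')
  thus ?case using mult_add_r mono_carrier `c : carrier V` `x : carrier G` FM_add by simp
 qed
next
 case (add f f')
 thus ?case using mult_add_l FM_add by simp
qed

lemma mult_assoc: "f : carrier FM ==> g : carrier FM ==> k : carrier FM ==>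
  (f **\<^sub>MA g) **\<^sub>MA k = f **\<^sub>MA (g **\<^sub>MA k)"
proof (induction f rule: FM_induct)
 case (mono c x)
 note cx = mono(1,2) and mc = mono_carrier[OF mono(1,2)]
 show ?case using mono(3,4)
 proof (induction g rule: FM_induct)
  case (mono d y)
  note dy = mono(1,2) and md = mono_carrier[OF mono(1,2)]
  show ?case using mono(3)
  proof (induction k rule: FM_induct)
   case (mono e z)
   thus ?case using cx dy by (simp add: mult_mono m_assoc G.m_assoc)
  next
   case (add k k')
   thus ?case using mult_add_r[OF _ _ md] mult_add_r[OF _ _ mc] mult_add_r[OF _ _ mult_closed[OF mc md]] mult_closed[OF md] by simp
  qed
 next
  case (add g g')
  thus ?case using mult_add_r[OF _ _ mc] mult_add_l mult_closed[OF mc] mult_closed by simp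
 qed
next
 case (add f f')
 thus ?case using mult_add_l mult_closed by simp
qed

lemma mult_one: "f : carrier FM ==> mono \<one> \<one>\<^sub>G **\<^sub>MA f = f & f **\<^sub>MA mono \<one> \<one>\<^sub>G = f"
proof (induction f rule: FM_induct)
 case (mono c x)
 thus ?case using mult_mono by simp
next
 case (add f f')
 have o: "mono \<one> \<one>\<^sub>G : carrier FM" using mono_carrier by simp
 show ?case using add mult_add_r[OF add(1,2) o] mult_add_l[OF add(1,2) o] by simp
qed

lemma MA_ring: "ring MA"
proof (rule ringI)
 interpret FM: module V FM by (rule free_module_module)
 show "abelian_group MA"
 proof (rule abelian_groupI)
  fix x assume x: "x : carrier MA"
  hence "--\<^sub>FM x : carrier MA" "(--\<^sub>FM x) ++\<^sub>MA x = \<zero>\<^sub>MA"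
   using FM.M.a_inv_closed[of x] FM.M.l_neg[of x] by (simp_all add: MA_simps free_module_simps)
  thus "EX y:carrier MA. y ++\<^sub>MA x = \<zero>\<^sub>MA" by blast
 qed (use FM_add FM_val(1) FM.M.zero_closed in \<open>auto simp: MA_simps free_module_simps a_ac\<close>)
 show "Group.monoid MA" by (rule monoidI) (use mult_closed mult_assoc mult_one mono_carrier in \<open>auto simp: MA_simps\<close>)
qed (auto simp: MA_simps mult_add_l mult_add_r)

end

locale mon_alg_hom = mon_alg V G + B: cring B
 for V :: "('v, 'm) ring_scheme" (structure) and G :: "('g, 'n) monoid_scheme" and B :: "('b, 'o) ring_scheme" +
 fixes \<eta> :: "'v => 'b" and \<theta> :: "'g => 'b"
 assumes \<eta>: "\<eta> : ring_hom V B" and \<theta>: "x : carrier G ==> \<theta> x : carrier B"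
  "x : carrier G ==> y : carrier G ==> \<theta> (x **\<^sub>G y) = \<theta> x **\<^sub>B \<theta> y"
begin

definition ev :: "('g => 'v) => 'b" where "ev f = (\<Oplus>\<^bsub>B\<^esub>z\<in>{z. f z ~= \<zero>}. \<eta> (f z) **\<^sub>B \<theta> z)"

lemma \<eta>_simps: "c : carrier V ==> \<eta> c : carrier B" "\<eta> \<zero> = \<zero>\<^sub>B" "\<eta> \<one> = \<one>\<^sub>B"
 "c : carrier V ==> d : carrier V ==> \<eta> (c ++ d) = \<eta> c ++\<^sub>B \<eta> d"
 "c : carrier V ==> d : carrier V ==> \<eta> (c**d) = \<eta> c **\<^sub>B \<eta> d"
 using ring_hom_memE[OF \<eta>] ring_hom_zero[OF \<eta> ring_axioms B.ring_axioms] by auto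

lemma term_closed: "f : carrier FM ==> z : carrier G ==> \<eta> (f z) **\<^sub>B \<theta> z : carrier B" using FM_val(1) \<eta>_simps(1) \<theta>(1) by simp

lemma ev_superset:
 assumes f: "f : carrier FM" and Z: "finite Z" "{z. f z ~= \<zero>} <= Z" "Z <= carrier G"
 shows "ev f = (\<Oplus>\<^bsub>B\<^esub>z\<in>Z. \<eta> (f z) **\<^sub>B \<theta> z)" unfolding ev_def
 by (rule B.add.finprod_mono_neutral_cong_left) (use f Z term_closed \<theta>(1) in \<open>auto simp: \<eta>_simps(2)\<close>)

lemma ev_closed: "f : carrier FM ==> ev f : carrier B"
proof -
 assume f: "f : carrier FM"
 have "z : carrier G" if "f z ~= \<zero>" for z using FM_val(3)[OF f] that by blast
 thus ?thesis unfolding ev_def by (intro B.finsum_closed) (auto intro: term_closed[OF f])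
qed

lemma ev_add: assumes f: "f : carrier FM" "g : carrier FM" shows "ev (%s. f s ++ g s) = ev f ++\<^sub>B ev g"
proof -
 let ?Z = "{s. f s ~= \<zero>} \<union> {s. g s ~= \<zero>}"
 have Z: "finite ?Z" "?Z <= carrier G" using FM_val(2,3) f by blast+
 have "ev (%s. f s ++ g s) = (\<Oplus>\<^bsub>B\<^esub>z\<in>?Z. \<eta> (f z ++ g z) **\<^sub>B \<theta> z)"
  by (rule ev_superset[OF FM_add[OF f] Z(1) supp_add[OF f] Z(2)])
 also have "\<dots> = (\<Oplus>\<^bsub>B\<^esub>z\<in>?Z. \<eta> (f z) **\<^sub>B \<theta> z ++\<^sub>B \<eta> (g z) **\<^sub>B \<theta> z)"
  by (rule B.finsum_cong') (use Z FM_val(1)[OF f(1)] FM_val(1)[OF f(2)] \<theta>(1) in \<open>auto simp: \<eta>_simps B.l_distr subset_iff\<close>)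
 also have "\<dots> = (\<Oplus>\<^bsub>B\<^esub>z\<in>?Z. \<eta> (f z) **\<^sub>B \<theta> z) ++\<^sub>B (\<Oplus>\<^bsub>B\<^esub>z\<in>?Z. \<eta> (g z) **\<^sub>B \<theta> z)"
  by (rule B.finsum_addf) (use Z term_closed[OF f(1)] term_closed[OF f(2)] in \<open>auto simp: subset_iff\<close>)
 also have "\<dots> = ev f ++\<^sub>B ev g" using ev_superset[OF f(1) Z(1) _ Z(2)] ev_superset[OF f(2) Z(1) _ Z(2)] by simp
 finally show ?thesis .
qed

lemma ev_mono: "c : carrier V ==> x : carrier G ==> ev (mono c x) = \<eta> c **\<^sub>B \<theta> x"
proof -
 assume c: "c : carrier V" "x : carrier G"
 have "ev (mono c x) = (\<Oplus>\<^bsub>B\<^esub>z\<in>{x}. \<eta> (mono c x z) **\<^sub>B \<theta> z)"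
  by (rule ev_superset) (use c mono_carrier in \<open>auto simp: mono_def\<close>)
 also have "\<dots> = \<eta> c **\<^sub>B \<theta> x" using c \<eta>_simps(1) \<theta>(1) by (simp add: mono_def)
 finally show ?thesis .
qed

lemma ev_mult: "f : carrier FM ==> g : carrier FM ==> ev (f **\<^sub>MA g) = ev f **\<^sub>B ev g"
proof (induction f rule: FM_induct)
 case (mono c x)
 note cx = mono(1,2) and mc = mono_carrier[OF mono(1,2)]
 show ?case using mono(3)
 proof (induction g rule: FM_induct)
  case (mono d y)
  thus ?case using cx by (simp add: mult_mono ev_mono \<eta>_simps \<theta> B.m_ac)
 next
  case (add g g')
  thus ?case using mult_add_r[OF _ _ mc] mult_closed[OF mc] ev_add ev_closed mc by (simp add: B.r_distr)
 qed
next
 case (add f f')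
 thus ?case using mult_add_l mult_closed ev_add ev_closed by (simp add: B.l_distr)
qed

lemma ev_minus:
 assumes f: "f : carrier FM" "g : carrier FM"
 shows "f --\<^sub>FM g : carrier FM" "ev (f --\<^sub>FM g) = ev f --\<^sub>B ev g"
proof -
 interpret FM: module V FM by (rule free_module_module)
 show m: "f --\<^sub>FM g : carrier FM" using f FM.M.minus_closed by blast
 have "(%s. (f --\<^sub>FM g) s ++ g s) = f" using FM_val(1)[OF f(1)] FM_val(1)[OF f(2)] free_module_minus[OF f] by (auto simp: a_minus_def a_assoc l_neg)
 hence "ev f = ev (f --\<^sub>FM g) ++\<^sub>B ev g" using ev_add[OF m f(2)] by simp
 thus "ev (f --\<^sub>FM g) = ev f --\<^sub>B ev g" using ev_closed m f by (simp add: B.minus_eq B.a_assoc B.r_neg)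
qed

lemma ev_scalar: "v : carrier V ==> c : carrier V ==> x : carrier G ==>
  v \<odot>\<^sub>FM mono c x = mono (v**c) x" by (auto simp: free_module_simps mono_def)

lemma ev_MA: "f : carrier MA ==> ev f : carrier B"
 "f : carrier MA ==> g : carrier MA ==> ev (f ++\<^sub>MA g) = ev f ++\<^sub>B ev g"
 "f : carrier MA ==> g : carrier MA ==> ev (f **\<^sub>MA g) = ev f **\<^sub>B ev g"
 "ev \<zero>\<^sub>MA = \<zero>\<^sub>B" unfolding MA_simps by (simp_all add: ev_closed ev_add ev_mult) (simp add: ev_def)

lemma ev_kernel_ideal: "ideal {f : carrier MA. ev f = \<zero>\<^sub>B} MA"
proof -
 interpret MA: ring MA by (rule MA_ring)
 define N where "N = {f : carrier MA. ev f = \<zero>\<^sub>B}"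
 have N0: "\<zero>\<^sub>MA : N" unfolding N_def using MA.zero_closed ev_MA(4) by blast
 have Na: "a ++\<^sub>MA b : N" if "a : N" "b : N" for a b using that MA.a_closed[of a b] ev_MA(2)[of a b] B.r_zero[OF B.zero_closed] unfolding N_def by force
 have Nn: "--\<^sub>MA a : N" if "a : N" for a
 proof -
  have a: "a : carrier MA" "ev a = \<zero>\<^sub>B" using that by (auto simp: N_def)
  have n: "--\<^sub>MA a : carrier MA" by (rule MA.a_inv_closed[OF a(1)])
  have "ev (--\<^sub>MA a) ++\<^sub>B ev a = \<zero>\<^sub>B" using ev_MA(2)[OF n a(1)] MA.l_neg[OF a(1)] ev_MA(4) by metis
  thus ?thesis using a(2) B.r_zero[OF ev_MA(1)[OF n]] n by (simp add: N_def)
 qed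
 have "subgroup N (add_monoid MA)" by (rule MA.add.subgroupI) (use N0 Na Nn in \<open>auto simp: a_inv_def[symmetric] N_def\<close>)
 moreover have "x **\<^sub>MA a : N" "a **\<^sub>MA x : N" if "a : N" "x : carrier MA" for a x
 proof -
  have a: "a : carrier MA" "ev a = \<zero>\<^sub>B" using that(1) by (auto simp: N_def)
  show "x **\<^sub>MA a : N" "a **\<^sub>MA x : N" using ev_MA(3)[OF that(2) a(1)] ev_MA(3)[OF a(1) that(2)] a(2) ev_MA(1)[OF that(2)]
   MA.m_closed[OF that(2) a(1)] MA.m_closed[OF a(1) that(2)] unfolding N_def by simp_all
 qed
 ultimately show ?thesis unfolding N_def[symmetric] by (intro idealI[OF MA_ring])
qed

text \<open>\<open>ev\<close> kills the relations and thus the ideal they generate, so it is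
  constant on cosets, as \<open>the_elem\<close> in \<open>tensor_lift\<close> requires.\<close>

lemma ev_coset:
 assumes T: "T <= carrier FM" "!!f. f : T ==> ev f = \<zero>\<^sub>B" and f: "f : carrier FM"
 shows "ev ` (Idl\<^bsub>MA\<^esub> T +>\<^bsub>MA\<^esub> f) = {ev f}"
proof -
 interpret MA: ring MA by (rule MA_ring)
 have f': "f : carrier MA" and T': "T <= carrier MA" using f T(1) MA_simps(1) by auto
 have sub: "Idl\<^bsub>MA\<^esub> T <= {f : carrier MA. ev f = \<zero>\<^sub>B}" by (rule MA.genideal_minimal[OF ev_kernel_ideal]) (use T(2) T' in blast)
 have z: "\<zero>\<^sub>MA : Idl\<^bsub>MA\<^esub> T" by (rule additive_subgroup.zero_closed[OF ideal.axioms(1)[OF MA.genideal_ideal[OF T']]])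
 have 1: "ev (x ++\<^sub>MA f) = ev f" if "x : Idl\<^bsub>MA\<^esub> T" for x
 proof -
  have "x : carrier MA" "ev x = \<zero>\<^sub>B" using sub that by blast+
  thus ?thesis using ev_MA(2)[of x f] f' B.l_zero[OF ev_MA(1)[OF f']] by simp
 qed
 have "Idl\<^bsub>MA\<^esub> T +>\<^bsub>MA\<^esub> f = (%x. x ++\<^sub>MA f) ` (Idl\<^bsub>MA\<^esub> T)" by (auto simp: a_r_coset_def')
 hence "ev ` (Idl\<^bsub>MA\<^esub> T +>\<^bsub>MA\<^esub> f) = (%x. ev f) ` (Idl\<^bsub>MA\<^esub> T)" using 1 by (simp add: image_image)
 thus ?thesis using z by auto
qed

end

text \<open>The laws hold in \<open>L\<close> and are pulled back along the injective
  \<open>j\<close>.\<close>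

lemma (in power_series_embedding) PS_monoid: "Group.monoid PS"
proof (rule monoidI)
 show "x **\<^sub>PS y : carrier PS" if "x : carrier PS" "y : carrier PS" for x y using power_series_mult_closed that .
 have o: "\<one>\<^sub>PS : carrier PS" "j \<one>\<^sub>PS = \<one>\<^sub>L"
  using power_series_const_closed[OF one_closed] j_simps(4) by (simp_all add: power_series_simps)
 thus "\<one>\<^sub>PS : carrier PS" by simp
 show "x **\<^sub>PS y **\<^sub>PS z = x **\<^sub>PS (y **\<^sub>PS z)" if c: "x : carrier PS" "y : carrier PS" "z : carrier PS" for x y z
  by (rule j_eq) (use c in \<open>simp_all add: power_series_mult_closed j_simps L.m_assoc\<close>)
 show "\<one>\<^sub>PS **\<^sub>PS x = x" "x **\<^sub>PS \<one>\<^sub>PS = x" if c: "x : carrier PS" for x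
  by (rule j_eq; use c o in \<open>simp add: power_series_mult_closed j_simps(1,2)\<close>)+
qed

section \<open>The exact sequences\<close>

lemma (in field) algebraically_closed_root:
 assumes ac: "algebraically_closed R" and cs: "set cs <= carrier R" "cs ~= []"
 shows "EX r:carrier R. eval (\<one> # cs) r = \<zero>"
proof -
 have Pc: "\<one> # cs : carrier (poly_ring R)" using cs by (auto simp: univ_poly_carrier[symmetric] polynomial_def)
 have "splitted (\<one> # cs)" using algebraically_closed.roots_over_carrier[OF ac Pc] .
 hence "size (roots (\<one> # cs)) ~= 0" using cs(2) by (simp add: splitted_def)
 then obtain r where "r :# roots (\<one> # cs)" by (metis multiset_nonemptyE size_empty)
 thus ?thesis using roots_mem_iff_is_root[OF Pc] by (auto simp: is_root_def)
qed

context complete_valued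
begin

lemma exists_artin_schreier_root:
 assumes b: "b : vge 0"
 shows "EX x:vge 0. x[^]p ++ q**x = b"
proof -
 have bc: "b : carrier R" using vge_carrier b .
 have qv: "q : vge 0" using q(1) S_vge by blast
 define n where "n = p - 2"
 have pn: "p = Suc (Suc n)" using p(1) prime_ge_2_nat[of p] by (simp add: n_def)
 \<comment> \<open>The lower coefficients of \<open>T^p + q T - b\<close>: there are
   \<open>p - 2\<close> zeros before the linear term.\<close>
 define cs where "cs = (replicate n \<zero> @ [q]) @ [-- b]"
 have csv: "set cs <= vge 0" using qv vge_neg[OF b] by (auto simp: cs_def)
 hence csc: "set cs <= carrier R" using vge_carrier by blast
 have ev: "eval (\<one> # cs) x = x[^]p ++ q**x ++ -- b" if x: "x : carrier R" for x
 proof -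
  have "eval (monom \<one> n) x = x[^]n" using eval_monom[of \<one> x n] x by simp
  hence e0: "eval (\<one> # replicate n \<zero>) x = x[^]n" by (simp add: monom_def)
  have s1: "set (\<one> # replicate n \<zero>) <= carrier R" "set ((\<one> # replicate n \<zero>) @ [q]) <= carrier R" using qc by auto
  have "eval (((\<one> # replicate n \<zero>) @ [q]) @ [-- b]) x = (x[^]n**x ++ q)**x ++ -- b"
   unfolding eval_snoc[OF s1(2) a_inv_closed[OF bc] x] eval_snoc[OF s1(1) qc x] e0 ..
  thus ?thesis using x qc bc by (simp add: cs_def pn l_distr)
 qed
 obtain x where x: "x : carrier R" "eval (\<one> # cs) x = \<zero>" using algebraically_closed_root[OF ac csc] by (auto simp: cs_def)
 have "x : vge 0" using valuation_ring_integrally_closed[OF vge0_ring x(1)]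
   integral_over_eval[OF vge_additive_subgroup x(1)] csv x(2) by blast
 moreover have "x[^]p ++ q**x ++ -- b = \<zero>" using ev[OF x(1)] x(2) by simp
 hence "x[^]p ++ q**x = b" using x(1) qc bc by (metis a_closed a_minus_def m_closed nat_pow_closed r_right_minus_eq)
 ultimately show ?thesis by blast
qed

lemma exists_tower:
 "EX bt ga. bt 0 = q & ga 0 = \<one> & (ALL k. bt k : vge 0 & ga k : vge 0 & bt k = bt (Suc k)[^]p ++ q**bt (Suc k) &
  ga (Suc k) = (\<one> ++ bt (Suc k)[^](p - 1))**ga k)"
proof -
 define nx where "nx b = (SOME x. x : vge 0 & x[^]p ++ q**x = b)" for b
 have nx: "nx b : vge 0 & nx b[^]p ++ q**nx b = b" if "b : vge 0" for b unfolding nx_def by (rule someI_ex) (use exists_artin_schreier_root[OF that] in blast)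
 define bt where "bt k = (nx ^^ k) q" for k
 define ga where "ga k = rec_nat \<one> (%k g. (\<one> ++ bt (Suc k)[^](p - 1))**g) k" for k :: nat
 have b: "bt k : vge 0" for k by (induction k) (use q(1) S_vge nx in \<open>auto simp: bt_def\<close>)
 have g: "ga k : vge 0" for k by (induction k) (use subringE(3,6,7)[OF vge0_subring] vge0_pow[OF b] in \<open>auto simp: ga_def\<close>)
 have "bt k = bt (Suc k)[^]p ++ q**bt (Suc k)" for k using nx[OF b[of k]] by (simp add: bt_def)
 moreover have "ga (Suc k) = (\<one> ++ bt (Suc k)[^](p - 1))**ga k" for k by (simp add: ga_def)
 moreover have "bt 0 = q" "ga 0 = \<one>" by (simp_all add: bt_def ga_def)
 ultimately show ?thesis using b g by blast
qed

end

text \<open>The differentials of \<open>B\<close> are to be a module over the integers of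
  \<open>K\<close>, so that the results on derivations apply to the differential composed with
  \<open>h\<close>.\<close>

definition restrict_scalars :: "('a => 'b) => ('b, 'x, 'm) module_scheme => ('a, 'x) module" where
 "restrict_scalars h M = \<lparr>carrier = carrier M, monoid.mult = undefined, one = undefined,
  ring.zero = ring.zero M, ring.add = ring.add M, smult = (%a x. h a \<odot>\<^sub>M x)\<rparr>"

lemma restrict_scalars_simps: "carrier (restrict_scalars h M) = carrier M" "\<zero>\<^bsub>restrict_scalars h M\<^esub> = \<zero>\<^sub>M"
 "x ++\<^bsub>restrict_scalars h M\<^esub> y = x ++\<^sub>M y" "a \<odot>\<^bsub>restrict_scalars h M\<^esub> x = h a \<odot>\<^sub>M x"
 by (simp_all add: restrict_scalars_def)

lemma restrict_scalars_module:
 assumes M: "module B M" and A: "cring A" and h: "h : ring_hom A B"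
 shows "module A (restrict_scalars h M)"
proof -
 interpret M: module B M by (rule M)
 note hm = ring_hom_memE[OF h]
 show ?thesis
 proof (rule moduleI[OF A])
  show "abelian_group (restrict_scalars h M)"
  proof (rule abelian_groupI)
   show "EX y:carrier (restrict_scalars h M). y ++\<^bsub>restrict_scalars h M\<^esub> x = \<zero>\<^bsub>restrict_scalars h M\<^esub>"
   if "x : carrier (restrict_scalars h M)" for x using that M.M.l_neg[of x] M.M.a_inv_closed[of x] unfolding restrict_scalars_simps by blast
  qed (use M.M.a_ac in \<open>auto simp: restrict_scalars_simps\<close>)
 qed (use hm M.smult_l_distr M.smult_r_distr M.smult_assoc1 M.smult_one in \<open>auto simp: restrict_scalars_simps\<close>)
qed

text \<open>
  The classes \<open>og k\<close> generate the differentials coming from the absolute integral closure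
  of the discrete valuation ring.
\<close>
lemma (in prime_element) kaehler_sequence:
 fixes T :: "('s, 'm) ring_scheme" and T' :: "('t, 'o) ring_scheme" and K :: "('k, 'n) ring_scheme"
 defines "B == {x : carrier R. integral_over S x}"
 assumes normal: "!!x. x : Q ==> integral_over S x ==> x : S"
  and qp: "q = natf p" and char: "!!n. n >= 1 ==> natf n ~= \<zero>"
  and W: "complete_valued K SK qK p w"
  and h: "h : ring_hom (K\<lparr>carrier := valued_field.vge K w 0\<rparr>) (R\<lparr>carrier := B\<rparr>)"
  and KT: "kaehler_data T u (R\<lparr>carrier := B\<rparr>)" and KT': "kaehler_data T' u' (R\<lparr>carrier := B\<rparr>)"
  and uS: "u ` carrier T <= S"
  and base: "!!s. s : SK ==> unit_vector (R\<lparr>carrier := B\<rparr>) (h s) : kaehler_submodule T u (R\<lparr>carrier := B\<rparr>)"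
  and le: "kaehler_submodule T u (R\<lparr>carrier := B\<rparr>) <= kaehler_submodule T' u' (R\<lparr>carrier := B\<rparr>)"
  and b0: "!!a. a : valued_field.vge K w 0 ==>
   unit_vector (R\<lparr>carrier := B\<rparr>) (h a) : kaehler_submodule T' u' (R\<lparr>carrier := B\<rparr>)"
  and gen: "!!t D. t : carrier T' ==> D <= B ==> h ` valued_field.vge K w 0 <= D ==>
   (!!b. b : B ==> unit_vector (R\<lparr>carrier := B\<rparr>) b : kaehler_submodule T u (R\<lparr>carrier := B\<rparr>) ==> b : D) ==>
   (!!x y. x : D ==> y : D ==> x ++ y : D) ==> (!!x y. x : D ==> y : D ==> x**y : D) ==> u' t : D"
 shows "EX f. short_exact_modules (R\<lparr>carrier := B\<rparr>) (H1_p p R B) f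
  (H0_p p (kaehler T u (R\<lparr>carrier := B\<rparr>))) (kaehler_proj T' u' (R\<lparr>carrier := B\<rparr>)) (H0_p p (kaehler T' u' (R\<lparr>carrier := B\<rparr>)))"
proof -
 let ?B = "R\<lparr>carrier := B\<rparr>"
 interpret W: complete_valued K SK qK p w by (rule W)
 interpret D: kaehler_data T u ?B by (rule KT)
 interpret O: module ?B D.\<Omega> by (rule D.kaehler_module)
 let ?A = "K\<lparr>carrier := W.vge 0\<rparr>"
 have B: "subring B R" unfolding B_def by (rule subring_integral_closure[OF S])
 have Bc: "x : carrier R" if "x : B" for x using that by (simp add: B_def)
 have A: "cring ?A" using W.subring_is_domain[OF W.vge0_subring] by (simp add: domain_def)
 have p2: "p >= 2" using W.p(1) prime_ge_2_nat by blast
 note hm = ring_hom_memE[OF h]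
 have h1: "h x : B" "h x : carrier R" if "x : W.vge 0" for x using hm(1)[of x] that Bc by auto
 have hmult: "h (x **\<^sub>K y) = h x**h y" if "x : W.vge 0" "y : W.vge 0" for x y using hm(2)[of x y] that by simp
 have hadd: "h (x ++\<^sub>K y) = h x ++ h y" if "x : W.vge 0" "y : W.vge 0" for x y using hm(3)[of x y] that by simp
 have hone: "h \<one>\<^sub>K = \<one>" using hm(4) by simp
 have hzero: "h \<zero>\<^sub>K = \<zero>" using ring_hom_zero[OF h] A D.B.ring_axioms by (simp add: cring_def)
 note WA = subringE[OF W.vge0_subring]
 have hnat: "h (W.natf n) = natf n" for n by (induction n) (use hzero hadd hone WA(3) natf_subring W.natf_subring[OF W.vge0_subring] in auto)
 have hpow: "h (x [^]\<^sub>K (n::nat)) = h x[^]n" if x: "x : W.vge 0" for x n by (induction n) (use hone hmult W.vge0_pow[OF x] x in auto)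
 have hq: "h qK = natf p" using hnat[of p] W.p(2) by simp
 obtain bt ga where t0: "bt 0 = qK" "ga 0 = \<one>\<^sub>K" and bv: "!!k. bt k : W.vge 0" and gv: "!!k. ga k : W.vge 0"
  and bs: "!!k. bt k = bt (Suc k) [^]\<^sub>K p ++\<^sub>K qK **\<^sub>K bt (Suc k)"
  and gs: "!!k. ga (Suc k) = (\<one>\<^sub>K ++\<^sub>K bt (Suc k) [^]\<^sub>K (p - 1)) **\<^sub>K ga k" using W.exists_tower by blast
 define M where "M = restrict_scalars h D.\<Omega>"
 define de where "de x = D.diff (h x)" for x
 have Ms: "carrier M = carrier D.\<Omega>" "ring.zero M = ring.zero D.\<Omega>" "x ++\<^sub>M y = x ++\<^sub>D.\<Omega> y" "a \<odot>\<^sub>M x = h a \<odot>\<^sub>D.\<Omega> x" for x y a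
  by (simp_all add: M_def restrict_scalars_simps)
 have M: "module ?A M" unfolding M_def by (rule restrict_scalars_module[OF D.kaehler_module A h])
 have d1: "!!x. x : W.vge 0 ==> de x : carrier M" unfolding de_def Ms using D.diff_closed h1 by simp
 have d2: "!!x y. x : W.vge 0 ==> y : W.vge 0 ==> de (x ++\<^sub>K y) = de x ++\<^sub>M de y" unfolding de_def Ms using D.diff_add h1 hadd by simp
 have d3: "!!x y. x : W.vge 0 ==> y : W.vge 0 ==> de (x **\<^sub>K y) = x \<odot>\<^sub>M de y ++\<^sub>M y \<odot>\<^sub>M de x"
  unfolding de_def Ms using D.diff_mult h1 hmult by simp
 have null: "D.diff b = \<zero>\<^sub>D.\<Omega>" if "b : B" "D.unitv b : D.N" for b unfolding D.diff_def using D.cls_eq_zero[OF D.unitv_closed] that by simp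
 have d4: "!!s. s : SK ==> de s = \<zero>\<^sub>M" unfolding de_def Ms using null base h1 W.S_vge by blast
 define og where "og k = h (ga k) \<odot>\<^sub>D.\<Omega> D.diff (h (bt k))" for k
 have om: "og k = ga k \<odot>\<^sub>M de (bt k)" for k by (simp add: og_def de_def Ms)
 have wc: "og k : carrier D.\<Omega>" for k unfolding og_def using O.smult_closed D.diff_closed h1 bv gv by simp
 have qv: "qK : W.vge 0" using W.q(1) W.S_vge by blast
 have wsM: "qK \<odot>\<^sub>M og (Suc k) = og k" for k unfolding om gs using W.derivation_tower[OF M d1 d2 d3 d4 bv[of "Suc k"] gv[of k]] bs[of k] by simp
 hence ws: "natf p \<odot>\<^sub>D.\<Omega> og (Suc k) = og k" for k by (simp add: Ms hq)
 have w0: "og 0 = \<zero>\<^sub>D.\<Omega>" unfolding og_def t0 using d4[OF W.q(1)] O.smult_one by (simp add: de_def Ms hone)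
 have g1: "h (ga 1) = \<one> ++ h (bt 1)[^](p - 1)"
 proof -
  have x: "bt 1 [^]\<^sub>K (p - 1) : W.vge 0" using W.vge0_pow bv .
  have "ga 1 = \<one>\<^sub>K ++\<^sub>K bt 1 [^]\<^sub>K (p - 1)" using gs[of 0] t0 W.vge_carrier[OF x] by simp
  thus ?thesis using hadd[OF WA(3) x] hone hpow[OF bv] by simp
 qed
 have b1: "h (bt 1)[^]p = natf p -- natf p**h (bt 1)"
 proof -
  have x: "bt 1 [^]\<^sub>K p : W.vge 0" using W.vge0_pow bv .
  have "qK = bt 1 [^]\<^sub>K p ++\<^sub>K qK **\<^sub>K bt 1" using bs[of 0] t0 by simp
  hence "natf p = h (bt 1)[^]p ++ natf p**h (bt 1)" using hadd[OF x WA(6)[OF qv bv]] hmult[OF qv bv] hpow[OF bv] hq by metis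
  moreover have "h (bt 1)[^]p = (h (bt 1)[^]p ++ natf p**h (bt 1)) -- natf p**h (bt 1)" using h1(2)[OF bv] by (simp add: a_minus_def a_assoc r_neg)
  ultimately show ?thesis by metis
 qed
 have inj1: "EX c:B. b = natf p**c" if b: "b : B" "b \<odot>\<^sub>D.\<Omega> og 1 = \<zero>\<^sub>D.\<Omega>" for b
 proof -
  have hb: "h (bt 1) : B" "h (ga 1) : B" using h1 bv gv by auto
  have uF: "D.unitv (h (bt 1)) : carrier D.F" using D.unitv_closed hb by simp
  have bg: "b**h (ga 1) : B" using subringE(6)[OF B] b(1) hb by blast
  have "D.cls ((b**h (ga 1)) \<odot>\<^sub>D.F D.unitv (h (bt 1))) = (b**h (ga 1)) \<odot>\<^sub>D.\<Omega> D.diff (h (bt 1))"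
   unfolding D.diff_def by (rule D.cls_smult[OF _ uF]) (use bg in simp)
  also have "\<dots> = b \<odot>\<^sub>D.\<Omega> og 1" unfolding og_def using O.smult_assoc1[of b "h (ga 1)" "D.diff (h (bt 1))"] b hb D.diff_closed by simp
  finally have "(b**h (ga 1)) \<odot>\<^sub>D.F D.unitv (h (bt 1)) : D.N"
   using D.cls_eq_zero[of "(b**h (ga 1)) \<odot>\<^sub>D.F D.unitv (h (bt 1))"] D.F.smult_closed[OF _ uF] bg b(2) by simp
  moreover have "D.unitv (h (bt 1)) = unit_vector R (h (bt 1))" by (auto simp: unit_vector_def)
  ultimately have "(%s. (b**(\<one> ++ h (bt 1)[^](p - 1)))**unit_vector R (h (bt 1)) s) : D.N" using g1 by (simp add: free_module_def)
  from kaehler_torsion_divisible[OF normal p2 qp char hb(1)[unfolded B_def] b1 KT[unfolded B_def] uS b(1)[unfolded B_def]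
   this[unfolded B_def]]
  show ?thesis unfolding B_def .
 qed
 \<comment> \<open>If \<open>og 1\<close> vanished, \<open>inj1\<close> would make
   \<open>natf p\<close> invertible in \<open>B\<close>. The inverse lies in \<open>Q\<close>, hence
   by normality in \<open>S\<close>, where \<open>q\<close> is not a unit.\<close>
 have w1: "og 1 ~= \<zero>\<^sub>D.\<Omega>"
 proof
  assume e: "og 1 = \<zero>\<^sub>D.\<Omega>"
  have "\<one> \<odot>\<^sub>D.\<Omega> og 1 = og 1" using O.smult_one[OF wc[of 1]] by simp
  hence "\<one> \<odot>\<^sub>D.\<Omega> og 1 = \<zero>\<^sub>D.\<Omega>" unfolding e .
  then obtain c where c: "c : B" "\<one> = natf p**c" using inj1[OF subringE(3)[OF B]] by blast
  have qc: "q : carrier R" using S_c q(1) .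
  have "c = inv q" using comm_inv_char[OF qc Bc[OF c(1)]] c(2) qp by simp
  hence "c : Q" using subfield_m_inv(1)[OF Q_subfield] S_Q q by auto
  hence "c : S" using normal c(1) by (simp add: B_def)
  thus False using q(3) c(2) qp by blast
 qed
 have p0: "natf p ~= \<zero>" using q(2) qp by simp
 \<comment> \<open>These elements are closed under sums and products. They include the image of the
   integers of \<open>K\<close> by \<open>derivation_multiple\<close> and all elements of
   differential zero, so \<open>gen\<close> shows that the image of \<open>T'\<close> is among
   them.\<close>
 define E where "E = {b : B. EX c:B. EX k. D.diff b = c \<odot>\<^sub>D.\<Omega> og k}"
 have sp: "u' t : E" if t: "t : carrier T'" for t
 proof (rule gen[OF t])
  show "E <= B" by (auto simp: E_def)
  show "h ` W.vge 0 <= E"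
  proof
   fix y assume "y : h ` W.vge 0"
   then obtain a where a: "a : W.vge 0" "y = h a" by blast
   have "og 1 ~= \<zero>\<^sub>M" using w1 by (simp add: Ms)
   then obtain s k where "s : W.vge 0" "de a = s \<odot>\<^sub>M og k"
   using W.derivation_multiple[where M = M and de = de and ga = ga and bt = bt and og = og, OF M d1 d2 d3 d4 gv bv om wsM _ a(1)] by blast
   thus "y : E" unfolding E_def a(2) using h1 a(1) by (auto simp: de_def Ms)
  qed
  show "b : E" if "b : B" "D.unitv b : D.N" for b
  proof -
   have "D.diff b = \<zero> \<odot>\<^sub>D.\<Omega> og 0" using null[OF that] O.smult_l_null[OF wc] by simp
   thus ?thesis unfolding E_def using that(1) subringE(2)[OF B] by blast
  qed
  have Eadd: "EX e:B. EX m. c \<odot>\<^sub>D.\<Omega> og k ++\<^sub>D.\<Omega> d \<odot>\<^sub>D.\<Omega> og l = e \<odot>\<^sub>D.\<Omega> og m" if cd: "c : B" "d : B" for c d k l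
  proof -
   note tr = torsion_raise[where og = og, OF B p0 D.kaehler_module wc ws]
   have n: "natf p[^](i::nat) : B" for i by (induction i) (use subringE(3,6)[OF B] natf_subring[OF B] in auto)
   have e: "c**natf p[^]l : B" "d**natf p[^]k : B" using n cd subringE(6)[OF B] by auto
   have "c \<odot>\<^sub>D.\<Omega> og k ++\<^sub>D.\<Omega> d \<odot>\<^sub>D.\<Omega> og l = (c**natf p[^]l ++ d**natf p[^]k) \<odot>\<^sub>D.\<Omega> og (k + l)"
   using tr[OF cd(1), of k l] tr[OF cd(2), of l k] O.smult_l_distr[of "c**natf p[^]l" "d**natf p[^]k" "og (k + l)"] e wc by (simp add: add.commute)
   thus ?thesis using subringE(7)[OF B e] by blast
  qed
  fix x y assume xy: "x : E" "y : E"
  then obtain c k d l where cd: "x : B" "y : B" "c : B" "d : B" "D.diff x = c \<odot>\<^sub>D.\<Omega> og k" "D.diff y = d \<odot>\<^sub>D.\<Omega> og l"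
   unfolding E_def by blast
  show "x ++ y : E" unfolding E_def using D.diff_add[of x y] Eadd[OF cd(3,4), of k l] cd subringE(7)[OF B cd(1,2)] by simp
  have m: "x**d : B" "y**c : B" using cd subringE(6)[OF B] by auto
  have "D.diff (x**y) = (x**d) \<odot>\<^sub>D.\<Omega> og l ++\<^sub>D.\<Omega> (y**c) \<odot>\<^sub>D.\<Omega> og k"
   using D.diff_mult[of x y] O.smult_assoc1[of x d "og l"] O.smult_assoc1[of y c "og k"] cd wc by simp
  thus "x**y : E" unfolding E_def using Eadd[OF m, of l k] subringE(6)[OF B cd(1,2)] by simp
 qed
 show ?thesis
 proof (rule kaehler_short_exact[where ga = "%k. h (ga k)" and bt = "%k. h (bt k)" and og = og, OF B p0 KT KT' le])
  show "EX b:B. EX k. D.diff (u' t) = b \<odot>\<^sub>D.\<Omega> og k" if "t : carrier T'" for t using sp[OF that] unfolding E_def by blast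
 qed (use h1 gv bv og_def w0 ws inj1 b0 in auto)
qed

section \<open>Translation of the hypotheses on the base ring and of the tensor product\<close>

lemma (in cring) ideals_set_power:
 assumes a: "a : carrier R"
 shows "PIdl a [^]\<^bsub>ideals_set R\<^esub> (k::nat) = {a[^]k**c | c. c : carrier R}"
proof (induction k)
 case 0
 have "carrier R = {\<one>**c | c. c : carrier R}" by force
 thus ?case by (simp add: nat_pow_def ideals_set_def)
next
 case (Suc k)
 let ?I = "{a[^]k**c | c. c : carrier R}" and ?J = "{a[^]Suc k**c | c. c : carrier R}"
 have "PIdl a [^]\<^bsub>ideals_set R\<^esub> Suc k = ideal_prod R ?I (PIdl a)" using Suc by (simp add: nat_pow_def ideals_set_def)
 also have "\<dots> = ?J"
 proof
  show "ideal_prod R ?I (PIdl a) <= ?J"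
  proof
   fix x assume "x : ideal_prod R ?I (PIdl a)"
   thus "x : ?J"
   proof (induction rule: ideal_prod.induct)
   case (prod i j)
   then obtain c d where "c : carrier R" "d : carrier R" "i = a[^]k**c" "j = d**a" by (auto simp: cgenideal_def)
   hence "i**j = a[^]Suc k**(c**d)" "c**d : carrier R" using a by (simp_all add: m_ac)
   thus ?case by blast
   next
   case (sum s t)
   then obtain c d where "c : carrier R" "d : carrier R" "s = a[^]Suc k**c" "t = a[^]Suc k**d" by blast
   hence "s ++ t = a[^]Suc k**(c ++ d)" "c ++ d : carrier R" using a by (simp_all add: r_distr)
   thus ?case by blast
   qed
  qed
  show "?J <= ideal_prod R ?I (PIdl a)"
  proof
   fix x assume "x : ?J"
   then obtain c where c: "c : carrier R" "x = a[^]Suc k**c" by blast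
   have "x = (a[^]k**c)**(\<one>**a)" using c a by (simp add: m_ac)
   moreover have "a[^]k**c : ?I" "\<one>**a : PIdl a" using c by (auto simp: cgenideal_def)
   hence "(a[^]k**c)**(\<one>**a) : ideal_prod R ?I (PIdl a)" by (rule ideal_prod.prod)
   ultimately show "x : ideal_prod R ?I (PIdl a)" by simp
  qed
 qed
 finally show ?case .
qed

text \<open>Completeness includes separatedness, so a nonzero element is divisible by only finitely
  many powers of \<open>un\<close>. The last cofactor lies outside the only maximal ideal and is a
  unit.\<close>

lemma uniformized_of_dvr:
 assumes V: "principal_domain V" "EX! I. maximalideal I V" and pi: "un : carrier V" "un ~= \<zero>\<^sub>V"
  and m: "maximalideal (PIdl\<^bsub>V\<^esub> un) V" and c: "adically_complete V (PIdl\<^bsub>V\<^esub> un)"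
 shows "uniformized V un"
proof -
 interpret principal_domain V by (rule V(1))
 have pid: "x : PIdl\<^bsub>V\<^esub> un <-> (EX v:carrier V. x = v **\<^sub>V un)" for x by (auto simp: cgenideal_def)
 have unit: "u : Units V" if u: "u : carrier V" "u ~: PIdl\<^bsub>V\<^esub> un" for u
 proof (rule ccontr)
  assume n: "u ~: Units V"
  have "\<zero>\<^sub>V = \<zero>\<^sub>V **\<^sub>V un" using pi by simp
  hence "u ~= \<zero>\<^sub>V" using u(2) pid zero_closed by blast
  then obtain b where b: "b : carrier V" "ring_irreducible\<^bsub>V\<^esub> b" "b divides\<^bsub>V\<^esub> u" using exists_irreducible_divisor u(1) n by blast
  have "PIdl\<^bsub>V\<^esub> b = PIdl\<^bsub>V\<^esub> un" using V(2) m irreducible_imp_maximalideal[OF b(1,2)] by blast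
  moreover obtain d where "d : carrier V" "u = b **\<^sub>V d" using b(3) by (auto simp: factor_def)
  hence "u : PIdl\<^bsub>V\<^esub> b" using m_comm b(1) by (auto simp: cgenideal_def)
  ultimately show False using u(2) by blast
 qed
 show ?thesis
 proof (intro uniformized.intro uniformized_axioms.intro domain_axioms pi)
  show "un ~: Units V"
  proof
   assume "un : Units V"
   hence "\<one>\<^sub>V : PIdl\<^bsub>V\<^esub> un" using Units_l_inv[of un] Units_inv_closed[of un] pid by metis
   hence "PIdl\<^bsub>V\<^esub> un = carrier V" using ideal.one_imp_carrier[OF maximalideal.axioms(1)[OF m]] by blast
   thus False using maximalideal.I_notcarr[OF m] by simp
  qed
  fix v assume v: "v : carrier V" "v ~= \<zero>\<^sub>V"
  have "EX k::nat. ALL d:carrier V. v ~= un [^]\<^sub>V k **\<^sub>V d"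
  proof (rule ccontr)
   assume "~ ?thesis"
   hence all: "v : PIdl\<^bsub>V\<^esub> un [^]\<^bsub>ideals_set V\<^esub> k" for k :: nat unfolding ideals_set_power[OF pi(1)] by blast
   have z: "\<zero>\<^sub>V : PIdl\<^bsub>V\<^esub> un [^]\<^bsub>ideals_set V\<^esub> k" for k :: nat
   unfolding ideals_set_power[OF pi(1)] using pi(1) by (intro CollectI exI[of _ "\<zero>\<^sub>V"]) simp
   have m0: "x --\<^sub>V \<zero>\<^sub>V = x" if "x : carrier V" for x using that by (simp add: a_minus_def)
   \<comment> \<open>For the zero sequence, uniqueness of the limit says that only zero lies in all
     powers of the ideal.\<close>
   have "EX! y. y : carrier V & (ALL k. y --\<^sub>V \<zero>\<^sub>V : PIdl\<^bsub>V\<^esub> un [^]\<^bsub>ideals_set V\<^esub> (k::nat))"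
   using c[unfolded adically_complete_def, THEN spec[of _ "%k. \<zero>\<^sub>V"]] z m0[OF zero_closed] by simp
   hence "v = \<zero>\<^sub>V" using v(1) all z m0 zero_closed by metis
   thus False using v(2) by simp
  qed
  define k where "k = (LEAST k::nat. ALL d:carrier V. v ~= un [^]\<^sub>V k **\<^sub>V d)"
  have k: "ALL d:carrier V. v ~= un [^]\<^sub>V k **\<^sub>V d" unfolding k_def by (rule LeastI_ex) fact
  have min: "EX d:carrier V. v = un [^]\<^sub>V l **\<^sub>V d" if "l < k" for l using not_less_Least that unfolding k_def by blast
  have "v = un [^]\<^sub>V (0::nat) **\<^sub>V v" using v(1) by simp
  hence "k ~= 0" using k v(1) by (cases "k = 0") auto
  then obtain l where l: "k = Suc l" by (cases k) auto
  obtain d where d: "d : carrier V" "v = un [^]\<^sub>V l **\<^sub>V d" using min[of l] l by blast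
  have "d ~: PIdl\<^bsub>V\<^esub> un"
  proof
   assume "d : PIdl\<^bsub>V\<^esub> un"
   then obtain e where "e : carrier V" "d = e **\<^sub>V un" using pid by blast
   hence "v = un [^]\<^sub>V k **\<^sub>V e" "e : carrier V" using d(2) l pi(1) by (simp_all add: m_ac)
   thus False using k by blast
  qed
  hence "d : Units V" using unit d(1) by blast
  thus "EX u:Units V. EX n::nat. v = u **\<^sub>V un [^]\<^sub>V n" using d m_comm[of "un [^]\<^sub>V l" d] pi(1) by auto
 qed
qed

lemma (in uniformized) complete_prime_image:
 fixes K :: "('k, 'n) ring_scheme" and i :: "'v => 'k"
 assumes K: "field K" and i: "i : ring_hom V K" "inj_on i (carrier V)" and ac: "algebraically_closed K"
  and alg: "!!x. x : carrier K ==> cring.integral_over K (fractions_in K (i ` carrier V)) x"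
  and p: "Factorial_Ring.prime p" "un = [p] \<cdot> \<one>" and char: "!!n::nat. n >= 1 ==> [n] \<cdot> \<one> ~= \<zero>"
  and complete: "!!xs. (!!k. xs k : carrier V) ==> (!!k. EX z:carrier V. xs (Suc k) -- xs k = un[^](k::nat)**z) ==>
   EX y:carrier V. ALL k. EX z:carrier V. y -- xs k = un[^]k**z"
  and perfect: "!!c. c : carrier V ==> EX d:carrier V. EX z:carrier V. c -- d[^]p = un**z"
 shows "complete_prime K (i ` carrier V) (i un) p"
proof -
 interpret K: field K by (rule K)
 interpret H: ring_hom_ring V K i by (rule ring_hom_ringI2[OF ring_axioms K.ring_axioms i(1)])
 let ?S = "i ` carrier V"
 have inj: "a = b" if "a : carrier V" "b : carrier V" "i a = i b" for a b using i(2) that by (auto dest: inj_onD)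
 have hpow: "i (a[^](n::nat)) = i a [^]\<^sub>K n" if "a : carrier V" for a n using H.hom_nat_pow[OF that] .
 have hmin: "i (a -- b) = i a --\<^sub>K i b" if "a : carrier V" "b : carrier V" for a b using that by (simp add: a_minus_def)
 have hnat: "i ([n] \<cdot> \<one>) = K.natf n" for n :: nat by (induction n) simp_all
 have div: "(EX z:?S. i a = i un **\<^sub>K z) <-> a : piV" if a: "a : carrier V" for a
 proof
  assume "EX z:?S. i a = i un **\<^sub>K z"
  then obtain v where v: "v : carrier V" "i a = i un **\<^sub>K i v" by blast
  hence "a = un**v" using inj[OF a, of "un**v"] pi_closed by simp
  thus "a : piV" using v(1) by blast
 next
  assume "a : piV"
  then obtain v where "v : carrier V" "a = un**v" by blast
  thus "EX z:?S. i a = i un **\<^sub>K z" using pi_closed by auto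
 qed
 show ?thesis
 proof (intro complete_prime.intro prime_element.intro prime_element_axioms.intro complete_prime_axioms.intro K)
  show "subring ?S K" by (rule H.img_is_subring[OF carrier_is_subring])
  show "i un : ?S" using pi_closed by blast
  show "i un ~= \<zero>\<^sub>K" using inj[OF pi_closed zero_closed] pi_nonzero by auto
  show "~ (EX z:?S. \<one>\<^sub>K = i un **\<^sub>K z)" using div[OF one_closed] one_notin_piV by simp
  show "(EX z:?S. a = i un **\<^sub>K z) \<or> (EX z:?S. b = i un **\<^sub>K z)"
   if ab: "a : ?S" "b : ?S" "EX z:?S. a **\<^sub>K b = i un **\<^sub>K z" for a b
  proof -
   obtain a' b' where a': "a' : carrier V" "a = i a'" and b': "b' : carrier V" "b = i b'" using ab by blast
   have "a'**b' : piV" using div[of "a'**b'"] ab(3) a' b' by simp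
   thus ?thesis using piV_prime[OF a'(1) b'(1)] div[OF a'(1)] div[OF b'(1)] a'(2) b'(2) by blast
  qed
  show "EX (n::nat) s. s : ?S & x = i un [^]\<^sub>K n **\<^sub>K s & ~ (EX z:?S. s = i un **\<^sub>K z)"
   if x: "x : ?S" "x ~= \<zero>\<^sub>K" for x
  proof -
   obtain v where v: "v : carrier V" "x = i v" using x by blast
   have "v ~= \<zero>" using x(2) v(2) by auto
   then obtain u and n :: nat where u: "u : Units V" "v = u**un[^]n" using decompose v(1) by blast
   have uc: "u : carrier V" using Units_closed u(1) .
   have "x = i un [^]\<^sub>K n **\<^sub>K i u" unfolding v(2) u(2) using uc pi_closed hpow[OF pi_closed] K.m_comm by simp
   moreover have "~ (EX z:?S. i u = i un **\<^sub>K z)" using div[OF uc] unit_notin_piV[OF u(1)] by blast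
   ultimately show ?thesis using uc by blast
  qed
  show "inv\<^bsub>K\<^esub> x : ?S" if x: "x : ?S" "~ (EX z:?S. x = i un **\<^sub>K z)" for x
  proof -
   obtain v where v: "v : carrier V" "x = i v" using x by blast
   have u: "v : Units V" using unit_iff[OF v(1)] div[OF v(1)] x(2) v(2) by blast
   have "i v **\<^sub>K i (inv v) = \<one>\<^sub>K" using H.hom_mult[of v "inv v"] u v(1) by simp
   hence "inv\<^bsub>K\<^esub> x = i (inv v)" unfolding v(2) using v(1) u by (intro K.comm_inv_char) auto
   thus ?thesis using u by blast
  qed
  show "EX y:?S. ALL k. EX z:?S. y --\<^sub>K xs k = i un [^]\<^sub>K k **\<^sub>K z"
   if xs: "!!k. xs k : ?S" "!!k. EX z:?S. xs (Suc k) --\<^sub>K xs k = i un [^]\<^sub>K (k::nat) **\<^sub>K z" for xs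
  proof -
   have "ALL k. EX v. v : carrier V & xs k = i v" using xs(1) by blast
   then obtain ys where ys: "!!k. ys k : carrier V" "!!k. xs k = i (ys k)" by metis
   have st: "EX z:carrier V. ys (Suc k) -- ys k = un[^]k**z" for k
   proof -
   obtain z where z: "z : carrier V" "xs (Suc k) --\<^sub>K xs k = i un [^]\<^sub>K k **\<^sub>K i z" using xs(2)[of k] by blast
   have "i (ys (Suc k) -- ys k) = i (un[^]k**z)" using z ys(2) pi_closed hmin[OF ys(1) ys(1), of "Suc k" k] hpow[OF pi_closed] by simp
   thus ?thesis using inj[of "ys (Suc k) -- ys k" "un[^]k**z"] ys(1) z(1) pi_closed by auto
   qed
   obtain y where y: "y : carrier V" "ALL k. EX z:carrier V. y -- ys k = un[^]k**z" using complete[of ys, OF ys(1) st] by blast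
   have "EX z:?S. i y --\<^sub>K xs k = i un [^]\<^sub>K k **\<^sub>K z" for k
   proof -
   obtain z where z: "z : carrier V" "y -- ys k = un[^]k**z" using y(2) by blast
   have "i y --\<^sub>K xs k = i (un[^]k**z)" using hmin[OF y(1) ys(1), of k] unfolding z(2) ys(2) by (rule sym)
   also have "\<dots> = i un [^]\<^sub>K k **\<^sub>K i z" using z(1) pi_closed hpow[OF pi_closed] by simp
   finally show ?thesis using z(1) by blast
   qed
   thus ?thesis using y(1) by blast
  qed
  show "EX d:?S. EX z:?S. c --\<^sub>K d [^]\<^sub>K p = i un **\<^sub>K z" if c: "c : ?S" for c
  proof -
   obtain v where v: "v : carrier V" "c = i v" using c by blast
   obtain d z where d: "d : carrier V" "z : carrier V" "v -- d[^]p = un**z" using perfect[OF v(1)] by blast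
   have "i (v -- d[^]p) = i v --\<^sub>K i (d[^]p)" by (rule hmin) (use v(1) d(1) in auto)
   hence "c --\<^sub>K i d [^]\<^sub>K p = i (v -- d[^]p)" unfolding hpow[OF d(1)] v(2) by (rule sym)
   also have "\<dots> = i un **\<^sub>K i z" unfolding d(3) using d(2) pi_closed by simp
   finally show ?thesis using d(1,2) by blast
  qed
  show "i un = K.natf p" using hnat p(2) by simp
  show "K.natf n ~= \<zero>\<^sub>K" if n: "n >= 1" for n
  proof
   assume "K.natf n = \<zero>\<^sub>K"
   hence "i ([n] \<cdot> \<one>) = i \<zero>" using hnat[of n] by simp
   thus False using inj[OF _ zero_closed] char[OF n] by auto
  qed
 qed (use ac alg p in auto)
qed

lemma (in power_series_embedding) j_natf: "j (indexed_const ([(n::nat)] \<cdot> \<one>)) = L.natf n"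
proof (induction n)
 case 0
 have "indexed_const \<zero> = (%m :: 'i multiset. \<zero>)" by (auto simp: indexed_const_def)
 thus ?case using j_zero by simp
next
 case (Suc n)
 have "indexed_const ([Suc n] \<cdot> \<one>) = (%m :: 'i multiset. indexed_const ([n] \<cdot> \<one>) m ++ indexed_const \<one> m)" by (auto simp: indexed_const_def)
 moreover have "indexed_const ([n] \<cdot> \<one>) : carrier PS" "indexed_const \<one> : carrier PS" by (rule power_series_const_closed; simp)+
 ultimately show ?case using j_simps(3)[of "indexed_const ([n] \<cdot> \<one>)" "indexed_const \<one>"] j_simps(4) Suc by simp
qed

lemma (in kaehler_data) unitv_base_N: "s : carrier S ==> unitv (u s) : N" using relations_N unfolding kaehler_relations_def Let_def by blast

text \<open>\<open>tensor_lift\<close> evaluates formal sums of pairs, and evaluation kills the four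
  kinds of relations. Its image is thus accessible through products of \<open>h a\<close> and
  \<open>j r\<close>, and differentials over the tensor product depend only on that image.\<close>

lemma tensor_lift_values:
 fixes A :: "('a, 'x) ring_scheme"
 assumes V: "cring V" and A: "cring A" and R: "Group.monoid R" and B: "cring B"
  and i: "i : ring_hom V A" and h: "h : ring_hom A B" and j: "j : ring_hom R B"
  and c_hyp: "ALL v:carrier V. c v : carrier R & h (i v) = j (c v)"
  and add_hyp: "ALL r:carrier R. ALL s:carrier R. r ++\<^sub>R s : carrier R"
 shows "!!t. t : carrier (tensor_algebra V A i R c) ==> EX f. f : carrier (free_module V (carrier A \<times> carrier R)) &
   tensor_lift V i h j B t = (\<Oplus>\<^bsub>B\<^esub>z\<in>{z. f z ~= \<zero>\<^sub>V}. h (i (f z)) **\<^sub>B (h (fst z) **\<^sub>B j (snd z)))"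
  and "!!a r. a : carrier A ==> r : carrier R ==>
   EX t:carrier (tensor_algebra V A i R c). tensor_lift V i h j B t = h a **\<^sub>B j r"
proof -
 interpret A: cring A by (rule A)
 interpret B: cring B by (rule B)
 interpret R: Group.monoid R by (rule R)
 have c: "!!v. v : carrier V ==> c v : carrier R" "!!v. v : carrier V ==> h (i v) = j (c v)"
  and R_add: "!!r s. r : carrier R ==> s : carrier R ==> r ++\<^sub>R s : carrier R" using c_hyp add_hyp by auto
 let ?G = "A \<times>\<times> R" and ?\<eta> = "%v. h (i v)" and ?\<theta> = "%z. h (fst z) **\<^sub>B j (snd z)"
 note im = ring_hom_memE[OF i] and hm = ring_hom_memE[OF h] and jm = ring_hom_memE[OF j]
 have G: "Group.monoid ?G" by (rule DirProd_monoid[OF A.monoid_axioms R])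
 have Gc: "carrier ?G = carrier A \<times> carrier R" and Gm: "(a, r) **\<^sub>?G (b, s) = (a **\<^sub>A b, r **\<^sub>R s)" for a b r s by (simp_all add: DirProd_def)
 interpret M: mon_alg_hom V ?G B ?\<eta> ?\<theta>
 proof (intro mon_alg_hom.intro mon_alg.intro mon_alg_hom_axioms.intro V G B)
  show "?\<eta> : ring_hom V B" using ring_hom_trans[OF i h] by (simp add: comp_def)
  show "?\<theta> x : carrier B" if "x : carrier ?G" for x using that hm jm by (auto simp: Gc)
  show "?\<theta> (x **\<^sub>?G y) = ?\<theta> x **\<^sub>B ?\<theta> y" if xy: "x : carrier ?G" "y : carrier ?G" for x y
  proof -
   obtain a r b s where "x = (a, r)" "y = (b, s)" "a : carrier A" "b : carrier A" "r : carrier R" "s : carrier R" using xy by (auto simp: Gc)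
   thus ?thesis using hm jm by (simp add: Gm B.m_ac)
  qed
 qed
 have FM: "free_module V (carrier A \<times> carrier R) = M.FM" by (simp add: Gc)
 have e: "unit_vector V z = M.mono \<one>\<^sub>V z" for z by (auto simp: unit_vector_def M.mono_def)
 have eF: "M.mono x (a, r) : carrier M.FM" if "x : carrier V" "a : carrier A" "r : carrier R" for x a r using M.mono_carrier that by (simp add: Gc)
 have ee: "M.ev (M.mono x (a, r)) = ?\<eta> x **\<^sub>B (h a **\<^sub>B j r)" if "x : carrier V" "a : carrier A" "r : carrier R" for x a r
  using M.ev_mono[OF that(1), of "(a, r)"] that by (simp add: Gc)
 have o: "\<one>\<^sub>V : carrier V" "?\<eta> \<one>\<^sub>V = \<one>\<^sub>B" using im(4) hm(4) by auto
 have e1: "M.ev (M.mono \<one>\<^sub>V (a, r)) = h a **\<^sub>B j r" if "a : carrier A" "r : carrier R" for a r using ee[OF o(1) that] o(2) hm(1) jm(1) that by simp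
 let ?T = "tensor_relations V A i R c"
 have FMadd: "f ++\<^sub>M.FM g = (%s. f s ++\<^sub>V g s)" for f g by (simp add: M.free_module_simps)
 have sum: "f ++\<^sub>M.FM g : carrier M.FM & M.ev (f ++\<^sub>M.FM g) = M.ev f ++\<^sub>B M.ev g"
  if "f : carrier M.FM" "g : carrier M.FM" for f g unfolding FMadd using M.FM_add that M.ev_add by blast
 have key: "f --\<^sub>M.FM g : carrier M.FM & M.ev (f --\<^sub>M.FM g) = \<zero>\<^sub>B"
  if "f : carrier M.FM" "g : carrier M.FM" "M.ev f = M.ev g" for f g using M.ev_minus[OF that(1,2)] that(3) M.ev_closed[OF that(2)] by (simp add: B.minus_eq B.r_neg)
 define good where "good f <-> f : carrier M.FM & M.ev f = \<zero>\<^sub>B" for f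
 have P1: "good (M.mono \<one>\<^sub>V (a ++\<^sub>A a', r) --\<^sub>M.FM (M.mono \<one>\<^sub>V (a, r) ++\<^sub>M.FM M.mono \<one>\<^sub>V (a', r)))"
  if 1: "a : carrier A" "a' : carrier A" "r : carrier R" for a a' r
 proof -
  have 2: "a ++\<^sub>A a' : carrier A" using 1 by simp
  note s = sum[OF eF[OF o(1) 1(1,3)] eF[OF o(1) 1(2,3)]]
  have "M.ev (M.mono \<one>\<^sub>V (a ++\<^sub>A a', r)) = M.ev (M.mono \<one>\<^sub>V (a, r) ++\<^sub>M.FM M.mono \<one>\<^sub>V (a', r))"
   unfolding conjunct2[OF s] e1[OF 2 1(3)] e1[OF 1(1,3)] e1[OF 1(2,3)] using 1 hm jm by (simp add: B.l_distr)
  from key[OF eF[OF o(1) 2 1(3)] conjunct1[OF s] this] show ?thesis unfolding good_def .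
 qed
 have P2: "good (M.mono \<one>\<^sub>V (a, r ++\<^sub>R r') --\<^sub>M.FM (M.mono \<one>\<^sub>V (a, r) ++\<^sub>M.FM M.mono \<one>\<^sub>V (a, r')))"
  if 2: "a : carrier A" "r : carrier R" "r' : carrier R" for a r r'
 proof -
  note s = sum[OF eF[OF o(1) 2(1,2)] eF[OF o(1) 2(1,3)]]
  have "M.ev (M.mono \<one>\<^sub>V (a, r ++\<^sub>R r')) = M.ev (M.mono \<one>\<^sub>V (a, r) ++\<^sub>M.FM M.mono \<one>\<^sub>V (a, r'))"
   unfolding conjunct2[OF s] e1[OF 2(1) R_add[OF 2(2,3)]] e1[OF 2(1,2)] e1[OF 2(1,3)] using 2 hm jm by (simp add: B.r_distr)
  from key[OF eF[OF o(1) 2(1) R_add[OF 2(2,3)]] conjunct1[OF s] this] show ?thesis unfolding good_def .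
 qed
 have sc: "v \<odot>\<^sub>M.FM M.mono \<one>\<^sub>V (a, r) = M.mono v (a, r)"
  if "v : carrier V" "a : carrier A" "r : carrier R" for v a r using M.ev_scalar[OF that(1) o(1), of "(a, r)"] that M.r_one by (simp add: Gc)
 have P3: "good (M.mono \<one>\<^sub>V (i v **\<^sub>A a, r) --\<^sub>M.FM v \<odot>\<^sub>M.FM M.mono \<one>\<^sub>V (a, r))"
  if 3: "v : carrier V" "a : carrier A" "r : carrier R" for v a r
 proof -
  have c3: "i v **\<^sub>A a : carrier A" using 3 im by simp
  have "M.ev (M.mono \<one>\<^sub>V (i v **\<^sub>A a, r)) = M.ev (M.mono v (a, r))" unfolding e1[OF c3 3(3)] ee[OF 3] using 3 im hm jm by (simp add: B.m_assoc)
  from key[OF eF[OF o(1) c3 3(3)] eF[OF 3] this] show ?thesis unfolding good_def sc[OF 3] .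
 qed
 have P4: "good (M.mono \<one>\<^sub>V (a, c v **\<^sub>R r) --\<^sub>M.FM v \<odot>\<^sub>M.FM M.mono \<one>\<^sub>V (a, r))"
  if 4: "v : carrier V" "a : carrier A" "r : carrier R" for v a r
 proof -
  have c4: "c v **\<^sub>R r : carrier R" using 4 c by simp
  have "M.ev (M.mono \<one>\<^sub>V (a, c v **\<^sub>R r)) = M.ev (M.mono v (a, r))" unfolding e1[OF 4(2) c4] ee[OF 4] using 4 c hm(1) jm by (simp add: B.m_lcomm)
  from key[OF eF[OF o(1) 4(2) c4] eF[OF 4] this] show ?thesis unfolding good_def sc[OF 4] .
 qed
 have T: "f : carrier M.FM & M.ev f = \<zero>\<^sub>B" if f: "f : ?T" for f unfolding good_def[symmetric] using f unfolding tensor_relations_def Let_def FM e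
  by (elim UnE CollectE exE conjE) (hypsubst, rule P1 P2 P3 P4; assumption)+
 let ?I = "Idl\<^bsub>M.MA\<^esub> ?T"
 have lift: "tensor_lift V i h j B (?I +>\<^bsub>M.MA\<^esub> f) = M.ev f" if f: "f : carrier M.FM" for f
 proof -
  have "M.ev ` (?I +>\<^bsub>M.MA\<^esub> f) = {M.ev f}" by (rule M.ev_coset) (use T f in auto)
  hence "the_elem (M.ev ` (?I +>\<^bsub>M.MA\<^esub> f)) = M.ev f" by simp
  thus ?thesis unfolding tensor_lift_def M.ev_def .
 qed
 have car: "carrier (tensor_algebra V A i R c) = {?I +>\<^bsub>M.MA\<^esub> f | f. f : carrier M.FM}"
  by (auto simp: tensor_algebra_def Let_def FactRing_def A_RCOSETS_def' M.MA_simps)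
 show "EX f. f : carrier (free_module V (carrier A \<times> carrier R)) &
   tensor_lift V i h j B t = (\<Oplus>\<^bsub>B\<^esub>z\<in>{z. f z ~= \<zero>\<^sub>V}. h (i (f z)) **\<^sub>B (h (fst z) **\<^sub>B j (snd z)))"
  if t: "t : carrier (tensor_algebra V A i R c)" for t
 proof -
  obtain f where f: "f : carrier M.FM" "t = ?I +>\<^bsub>M.MA\<^esub> f" using t unfolding car by blast
  thus ?thesis using lift[OF f(1)] unfolding FM M.ev_def by blast
 qed
 show "EX t:carrier (tensor_algebra V A i R c). tensor_lift V i h j B t = h a **\<^sub>B j r"
  if ar: "a : carrier A" "r : carrier R" for a r
  using lift[OF eF[OF o(1) ar]] e1[OF ar] eF[OF o(1) ar] unfolding car by (intro bexI[of _ "?I +>\<^bsub>M.MA\<^esub> M.mono \<one>\<^sub>V (a, r)"]) auto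
qed

text \<open>Both sequences come from \<open>kaehler_sequence\<close>: the base is \<open>V\<close>
  or \<open>R\<close>, the larger base \<open>A\<close> or \<open>AR\<close>, and the tower lies in
  \<open>A\<close> in either case.\<close>

theorem corollary2:
  fixes V :: "'v ring" and K :: "'k ring" and L :: "'l ring"
    and p n :: nat
    and i :: "'v \<Rightarrow> 'k" and j :: "(nat multiset \<Rightarrow> 'v) \<Rightarrow> 'l" and h :: "'k \<Rightarrow> 'l"
  defines "pV \<equiv> PIdl\<^bsub>V\<^esub> ([p] \<cdot>\<^bsub>V\<^esub> \<one>\<^bsub>V\<^esub>)"
    and "R \<equiv> power_series_ring V {..<n - 1}"
    and "const \<equiv> ring.indexed_const V"
  defines "A \<equiv> absolute_integral_closure V K i"
    and "B \<equiv> absolute_integral_closure R L j"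
  defines "AR \<equiv> tensor_algebra V A i R const"
  assumes "n \<ge> 1"
    and "discrete_valuation_ring V"
    and "mixed_characteristic V p"
    and "maximalideal pV V"
    and "adically_complete V pV"
    and "perfect_char p (V Quot pV)"
    and "algebraic_closure_of_fractions V K i"
    and "finite_over_padics p K (fractions_in K (i ` carrier V))"
    and "algebraic_closure_of_fractions R L j"
    and "h \<in> ring_hom A B" and "inj_on h (carrier A)"
    and "\<forall>v\<in>carrier V. h (i v) = j (const v)"
  shows "(\<exists>f. short_exact_modules B
            (H1_p p L (carrier B)) f
            (H0_p p (kaehler V (j \<circ> const) B)) (kaehler_proj A h B)
            (H0_p p (kaehler A h B))) \<and>
         (\<exists>f. short_exact_modules B
            (H1_p p L (carrier B)) f
            (H0_p p (kaehler R j B)) (kaehler_proj AR (tensor_lift V i h j B) B)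
            (H0_p p (kaehler AR (tensor_lift V i h j B) B)))"
proof -
 note asm = assms
 have pd: "principal_domain V" and loc: "EX! I. maximalideal I V" using asm(8) by (auto simp: discrete_valuation_ring_def)
 interpret V: principal_domain V by (rule pd)
 define un where "un = [p] \<cdot>\<^bsub>V\<^esub> \<one>\<^sub>V"
 have pc: "un : carrier V" by (simp add: un_def)
 have pV: "pV = PIdl\<^bsub>V\<^esub> un" by (simp add: asm(1) un_def)
 have pr: "Factorial_Ring.prime p" using asm(9) by (simp add: mixed_characteristic_def)
 have char: "[n] \<cdot>\<^bsub>V\<^esub> \<one>\<^sub>V ~= \<zero>\<^sub>V" if "n >= 1" for n :: nat
 proof
  assume n: "[n] \<cdot>\<^bsub>V\<^esub> \<one>\<^sub>V = \<zero>\<^sub>V"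
  let ?P = "%k::nat. 0 < k & [k] \<cdot>\<^bsub>V\<^esub> \<one>\<^sub>V = \<zero>\<^sub>V"
  have ex: "EX k. ?P k" using n that by (intro exI[of _ n]) simp
  hence "ring_characteristic V = (LEAST k. ?P k)" by (simp add: ring_characteristic_def)
  moreover have "0 < (LEAST k. ?P k)" using LeastI_ex[OF ex] by simp
  ultimately show False using asm(9) by (simp add: mixed_characteristic_def)
 qed
 have p0: "un ~= \<zero>\<^sub>V" unfolding un_def using char prime_ge_1_nat[OF pr] by blast
 interpret U: uniformized V un by (rule uniformized_of_dvr[OF pd loc pc p0 asm(10,11)[unfolded pV]])
 have pow: "x : pV [^]\<^bsub>ideals_set V\<^esub> k <-> (EX z:carrier V. x = un [^]\<^sub>V k **\<^sub>V z)" for x and k :: nat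
  unfolding pV V.ideals_set_power[OF pc] by blast
 have complete: "EX y:carrier V. ALL k. EX z:carrier V. y --\<^sub>V xs k = un [^]\<^sub>V (k::nat) **\<^sub>V z"
  if xs: "!!k. xs k : carrier V" "!!k. EX z:carrier V. xs (Suc k) --\<^sub>V xs k = un [^]\<^sub>V (k::nat) **\<^sub>V z" for xs
 proof -
  have "EX! y. y : carrier V & (ALL k. y --\<^sub>V xs k : pV [^]\<^bsub>ideals_set V\<^esub> (k::nat))"
   using asm(11)[unfolded adically_complete_def, THEN spec[of _ xs]] xs unfolding pow by blast
  thus ?thesis unfolding pow by blast
 qed
 interpret I: ideal pV V using maximalideal.axioms(1)[OF asm(10)] .
 \<comment> \<open>Surjectivity of Frobenius on the quotient, restated with representatives.\<close>
 have perfect: "EX d:carrier V. EX z:carrier V. c --\<^sub>V d [^]\<^sub>V p = un **\<^sub>V z" if c: "c : carrier V" for c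
 proof -
  interpret H: ring_hom_ring V "V Quot pV" "(+>\<^bsub>V\<^esub>) pV" by (rule I.rcos_ring_hom_ring)
  have "bij_betw (%x. x [^]\<^bsub>V Quot pV\<^esub> p) (carrier (V Quot pV)) (carrier (V Quot pV))" using asm(12) by (simp add: perfect_char_def)
  hence "pV +>\<^bsub>V\<^esub> c : (%x. x [^]\<^bsub>V Quot pV\<^esub> p) ` carrier (V Quot pV)" using H.hom_closed[OF c] bij_betw_imp_surj_on by metis
  then obtain Y where Y: "Y : carrier (V Quot pV)" "Y [^]\<^bsub>V Quot pV\<^esub> p = pV +>\<^bsub>V\<^esub> c" by (elim imageE) simp
  have "carrier (V Quot pV) = (\<Union>a\<in>carrier V. {pV +>\<^bsub>V\<^esub> a})" unfolding FactRing_simps by simp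
  then obtain d where d: "d : carrier V" "Y = pV +>\<^bsub>V\<^esub> d" using Y(1) by blast
  have "pV +>\<^bsub>V\<^esub> (d [^]\<^sub>V p) = pV +>\<^bsub>V\<^esub> c" using H.hom_nat_pow[OF d(1), of p] Y(2) d(2) by simp
  moreover have "c : pV +>\<^bsub>V\<^esub> c" using I.a_rcos_self[OF c] .
  ultimately have "c : (\<Union>x\<in>pV. {x ++\<^sub>V d [^]\<^sub>V p})" by (simp only: a_r_coset_def')
  then obtain x where x: "x : pV" "c = x ++\<^sub>V d [^]\<^sub>V p" by blast
  obtain z where z: "z : carrier V" "x = z **\<^sub>V un" using x(1) unfolding pV cgenideal_def by blast
  have "c --\<^sub>V d [^]\<^sub>V p = un **\<^sub>V z" unfolding x(2) z(2) using z(1) d(1) pc by (simp add: a_minus_def V.a_assoc V.r_neg V.m_comm)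
  thus ?thesis using d(1) z(1) by blast
 qed
 have iK: "i : ring_hom V K" "inj_on i (carrier V)" "algebraic_closure K (fractions_in K (i ` carrier V))"
  using asm(13) by (auto simp: algebraic_closure_of_fractions_def)
 interpret K: algebraic_closure K "fractions_in K (i ` carrier V)" by (rule iK(3))
 have algK: "K.integral_over (fractions_in K (i ` carrier V)) x" if "x : carrier K" for x
  using K.algebraic_extension[OF that] K.algebraic_iff_integral[OF K.subfield_axioms that] by simp
 have CP: "complete_prime K (i ` carrier V) (i un) p"
  by (rule U.complete_prime_image[OF K.field_axioms iK(1,2) K.algebraically_closed_axioms algK pr un_def char complete perfect])
 obtain w where W: "complete_valued K (i ` carrier V) (i un) p w" using complete_prime.exists_complete_valued[OF CP] by blast
 interpret W: complete_valued K "i ` carrier V" "i un" p w by (rule W)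
 \<comment> \<open>Integrality over the image of \<open>V\<close> means nonnegative value, so
   \<open>A\<close> is the valuation ring of \<open>K\<close>.\<close>
 have Aeq: "A = K\<lparr>carrier := W.vge 0\<rparr>" using K.integral_closure_in_eq[OF W.S] W.integral_iff_vge W.vge_carrier
  by (auto simp: asm(4) absolute_integral_closure_def intro!: arg_cong[where f = "%c. K\<lparr>carrier := c\<rparr>"])
 have jL: "j : ring_hom R L" "inj_on j (carrier R)" "algebraic_closure L (fractions_in L (j ` carrier R))"
  using asm(15) by (auto simp: algebraic_closure_of_fractions_def)
 interpret L: algebraic_closure L "fractions_in L (j ` carrier R)" by (rule jL(3))
 interpret E: power_series_embedding V un L "{..<n - 1}" j by (intro power_series_embedding.intro power_series_embedding_axioms.intro U.uniformized_axioms L.field_axioms)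
   (use jL in \<open>simp_all add: asm(2)\<close>)
 have Req: "R = E.PS" by (simp add: asm(2))
 have algL: "L.integral_over (fractions_in L E.JR) x" if "x : carrier L" for x
  using L.algebraic_extension[OF that] L.algebraic_iff_integral[OF L.subfield_axioms that] by (simp add: Req)
 interpret P: prime_element L E.JR "E.pL" by (rule E.JR_prime_element[OF L.algebraically_closed_axioms algL])
 have qp: "E.pL = L.natf p" using E.j_natf[of p] by (simp add: un_def)
 have charL: "L.natf m ~= \<zero>\<^sub>L" if m: "m >= 1" for m
 proof
  assume "L.natf m = \<zero>\<^sub>L"
  hence "j (V.indexed_const ([m] \<cdot>\<^bsub>V\<^esub> \<one>\<^sub>V)) = j (%m. \<zero>\<^sub>V)" using E.j_natf[of m] E.j_zero by simp
  hence "V.indexed_const ([m] \<cdot>\<^bsub>V\<^esub> \<one>\<^sub>V) = (%m :: nat multiset. \<zero>\<^sub>V)"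
   by (intro E.j_eq V.power_series_const_closed) (auto simp: V.power_series_carrier)
  from fun_cong[OF this, of "{#}"] show False using char[OF m] by (simp add: V.indexed_const_def)
 qed
 define BB where "BB = {x : carrier L. L.integral_over E.JR x}"
 have Beq: "B = L\<lparr>carrier := BB\<rparr>" using L.integral_closure_in_eq[OF E.JR_subring] by (simp add: asm(5) absolute_integral_closure_def BB_def Req)
 have BBs: "subring BB L" unfolding BB_def by (rule L.subring_integral_closure[OF E.JR_subring])
 have Bc: "cring B" unfolding Beq using L.subring_is_domain[OF BBs] by (simp add: domain_def)
 have Ac: "cring A" unfolding Aeq using K.subring_is_domain[OF W.vge0_subring] by (simp add: domain_def)
 have iA: "i : ring_hom V A" using ring_hom_memE[OF iK(1)] W.S_vge unfolding Aeq by (intro ring_hom_memI) auto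
 have JB: "E.JR <= BB" using L.integral_over_subset[OF E.JR_subring] subringE(1)[OF E.JR_subring] by (auto simp: BB_def)
 have jB: "j : ring_hom R B" using ring_hom_memE[OF jL(1)] JB unfolding Beq Req by (intro ring_hom_memI) auto
 have cR: "const v : carrier R" if "v : carrier V" for v using V.power_series_const_closed[OF that] by (simp add: Req asm(3))
 have Rm: "Group.monoid R" unfolding Req by (rule E.PS_monoid)
 have Radd: "ALL r:carrier R. ALL s:carrier R. r ++\<^sub>R s : carrier R" unfolding Req by (auto simp: V.power_series_simps V.power_series_carrier)
 note hj = asm(18)[rule_format]
 have chyp: "ALL v:carrier V. const v : carrier R & h (i v) = j (const v)" using cR hj by blast
 note TL = tensor_lift_values[OF V.is_cring Ac Rm Bc iA asm(16) jB chyp Radd, folded asm(6)]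
 have hB: "h a : carrier B" if "a : carrier A" for a using ring_hom_memE(1)[OF asm(16) that] .
 have jRB: "j r : carrier B" if "r : carrier R" for r using ring_hom_memE(1)[OF jB that] .
 interpret B: cring B by (rule Bc)
 have one: "h \<one>\<^sub>A = \<one>\<^sub>B" "j \<one>\<^sub>R = \<one>\<^sub>B" "\<one>\<^sub>A : carrier A" "\<one>\<^sub>R : carrier R"
  using ring_hom_memE(4)[OF asm(16)] ring_hom_memE(4)[OF jB] cring.cring_simprules(6)[OF Ac] monoid.one_closed[OF Rm] by auto
 have th: "EX t:carrier AR. tensor_lift V i h j B t = h a" if "a : carrier A" for a using TL(2)[OF that one(4)] one(2) hB[OF that] by simp
 have tj: "EX t:carrier AR. tensor_lift V i h j B t = j r" if "r : carrier R" for r using TL(2)[OF one(3) that] one(1) jRB[OF that] by simp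
 have terms: "h (i (f z)) **\<^sub>B (h (fst z) **\<^sub>B j (snd z)) : D"
  if f: "f : carrier (free_module V (carrier A \<times> carrier R))" "f z ~= \<zero>\<^sub>V" and D: "h ` carrier A <= D" "j ` carrier R <= D"
   "!!x y. x : D ==> y : D ==> x **\<^sub>B y : D" for f z D
 proof -
  have "f z : carrier V" "z : carrier A \<times> carrier R" using f(1)[unfolded V.free_module_carrier] f(2) by blast+
  hence "h (i (f z)) : D" "h (fst z) : D" "j (snd z) : D" using D(1,2) ring_hom_memE(1)[OF iA] by auto
  thus ?thesis using D(3) by blast
 qed
 have lift_in: "tensor_lift V i h j B t : D"
  if t: "t : carrier AR" and D: "D <= carrier B" "h ` carrier A <= D" "j ` carrier R <= D"
   "!!x y. x : D ==> y : D ==> x ++\<^sub>B y : D" "!!x y. x : D ==> y : D ==> x **\<^sub>B y : D" for t D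
 proof -
  obtain f where f: "f : carrier (free_module V (carrier A \<times> carrier R))"
   "tensor_lift V i h j B t = (\<Oplus>\<^bsub>B\<^esub>z\<in>{z. f z ~= \<zero>\<^sub>V}. h (i (f z)) **\<^sub>B (h (fst z) **\<^sub>B j (snd z)))"
   using TL(1)[OF t] by blast
  have "h \<zero>\<^sub>A = \<zero>\<^sub>B" using ring_hom_zero[OF asm(16)] Ac B.ring_axioms by (simp add: cring_def)
  hence z: "\<zero>\<^sub>B : D" using D(2) cring.cring_simprules(2)[OF Ac] by (metis imageI subsetD)
  show ?thesis unfolding f(2)
  proof (rule B.finsum_in[OF _ z D(4,1)])
   show "finite {z. f z ~= \<zero>\<^sub>V}" using f(1) by (simp add: V.free_module_carrier)
   show "h (i (f z)) **\<^sub>B (h (fst z) **\<^sub>B j (snd z)) : D" if "z : {z. f z ~= \<zero>\<^sub>V}" for z using terms[OF f(1) _ D(2,3,5)] that by blast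
  qed
 qed
 have liftB: "tensor_lift V i h j B t : carrier B" if "t : carrier AR" for t by (rule lift_in[OF that order.refl]) (use hB jRB in auto)
 have KV: "kaehler_data V (j \<circ> const) B" and KA: "kaehler_data A h B" and KR: "kaehler_data R j B"
  and KAR: "kaehler_data AR (tensor_lift V i h j B) B" by (intro kaehler_data.intro kaehler_data_axioms.intro Bc; use hB jRB cR liftB in simp)+
 note uV = kaehler_data.unitv_base_N[OF KV] and uA = kaehler_data.unitv_base_N[OF KA]
  and uR = kaehler_data.unitv_base_N[OF KR] and uAR = kaehler_data.unitv_base_N[OF KAR]
 have leVA: "kaehler_submodule V (j \<circ> const) B <= kaehler_submodule A h B"
  by (rule kaehler_data.N_base_mono[OF KA KV]) (use uA ring_hom_memE(1)[OF iA] hj in \<open>auto simp: o_def simp flip: hj\<close>)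
 have leRAR: "kaehler_submodule R j B <= kaehler_submodule AR (tensor_lift V i h j B) B" by (rule kaehler_data.N_base_mono[OF KAR KR]) (use uAR tj in metis)
 have carA: "carrier A = W.vge 0" and carB: "carrier B = BB" by (simp_all add: Aeq Beq)
 have ops: "x ++\<^sub>B y = x ++\<^sub>L y" "x **\<^sub>B y = x **\<^sub>L y" for x y by (simp_all add: Beq)
 note seq = P.kaehler_sequence[where p = p, folded BB_def, folded Beq, OF E.JR_normal qp charL W asm(16)[unfolded Aeq]]
 have "EX f. short_exact_modules B (H1_p p L BB) f (H0_p p (kaehler V (j \<circ> const) B)) (kaehler_proj A h B) (H0_p p (kaehler A h B))"
 proof (rule seq[OF _ _ _ KV KA])
  show "(j \<circ> const) ` carrier V <= E.JR" using cR by (auto simp: Req)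
  show "unit_vector B (h s) : kaehler_submodule V (j \<circ> const) B" if s: "s : i ` carrier V" for s using s uV hj by auto
  show "unit_vector B (h a) : kaehler_submodule A h B" if "a : W.vge 0" for a using uA[of a] that carA by simp
  show "h t : D" if "t : carrier A" "h ` W.vge 0 <= D" for t D using that carA by blast
 qed (assumption | rule leVA)+
 moreover have "EX f. short_exact_modules B (H1_p p L BB) f (H0_p p (kaehler R j B))
   (kaehler_proj AR (tensor_lift V i h j B) B) (H0_p p (kaehler AR (tensor_lift V i h j B) B))"
 proof (rule seq[OF _ _ _ KR KAR])
  show "j ` carrier R <= E.JR" by (simp add: Req)
  show "unit_vector B (h s) : kaehler_submodule R j B" if s: "s : i ` carrier V" for s
  proof -
   obtain v where v: "v : carrier V" "s = i v" using s by blast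
   show ?thesis unfolding v(2) hj[OF v(1)] using uR[OF cR[OF v(1)]] .
  qed
  show "unit_vector B (h a) : kaehler_submodule AR (tensor_lift V i h j B) B" if "a : W.vge 0" for a using th[of a] uAR that carA by metis
  fix t D assume t: "t : carrier AR" and D: "D <= BB" "h ` W.vge 0 <= D"
   "!!b. b : BB ==> unit_vector B b : kaehler_submodule R j B ==> b : D"
   "!!x y. x : D ==> y : D ==> x ++\<^sub>L y : D" "!!x y. x : D ==> y : D ==> x **\<^sub>L y : D"
  \<comment> \<open>The image of \<open>AR\<close> is built from those of \<open>A\<close> and
    \<open>R\<close> by sums and products, and elements of \<open>R\<close> have zero differential
    over the base \<open>R\<close>.\<close>
  show "tensor_lift V i h j B t : D"
  proof (rule lift_in[OF t])
   show "j ` carrier R <= D" using D(3) uR jRB carB by blast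
  qed (use D carA carB ops in auto)
 qed (assumption | rule leRAR)+
 ultimately show ?thesis unfolding carB by blast
qed

end
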